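(* For every $\mathbf f^2\in L^2(\Omega_2)^N$ and $h^1\in L^2(\Omega_1)$ problem $(P_0)$ has a unique solution $[\mathbf v,p]\in\mathbf X^0\times\mathbf Y^0$, and there is a constant $c>0$ independent of the data with $\|\mathbf v\|_{\mathbf X^0}+\|p\|_{L^2(\Omega_1)\times L^2(\Omega_2)}\le c(\|\mathbf f^2\|_{L^2(\Omega_2)}+\|h^1\|_{L^2(\Omega_1)})$.
   Context: Let $N\ge2$; write $x=(\tilde x,x_N)$, $\tilde x\in\mathbb R^{N-1}$, identifying $\mathbb R^{N-1}$ with $\mathbb R^{N-1}\times\{0\}$. Let $\Gamma\subset\mathbb R^{N-1}$ be a bounded Lipschitz domain, $\Omega_2:=\Gamma\times(0,1)$ with coordinates $(\tilde x,z)$, and $\Omega_1\subset\mathbb R^N$ a bounded Lipschitz domain disjoint from $\Omega_2$ with $\partial\Omega_1\cap\partial\Omega_2=\Gamma$, $\partial\Omega_1-\Gamma$ smooth of positive surface measure. $\mathbf n$ is the unit outward normal of $\Omega_1$ (so $\mathbf n=e_N$ on $\Gamma$); for $\mathbf w\in\mathbf H_{\rm div}(\Omega_1)$, $\mathbf w\cdot\mathbf n$ is its normal trace. For a vector field $\mathbf w$ on $\Omega_2$, $\mathbf w_T$ are its first $N-1$ components and $\mathbf w_N$ its last; $\nabla_T,\nabla_T\cdot$ are gradient/divergence in $\tilde x$, $\partial_z$ the $z$-derivative; integrals over $\Gamma$ use traces. $H(\partial_z,\Omega_2):=\{u\in L^2(\Omega_2):\partial_zu\in L^2(\Omega_2)\}$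 with inner product $\int_{\Omega_2}(uv+\partial_zu\,\partial_zv)$; its elements have $L^2$ traces on $z=0$ and $z=1$. Coefficients: $\mu>0$ constant; $\alpha,\beta\ge0$ bounded measurable on $\Gamma$; $\mathcal Q$ bounded measurable symmetric $N\times N$ matrix-valued on $\Omega_1\cup\Gamma$ with $(\mathcal Qy)\cdot y\ge C_{\mathcal Q}|y|^2$, $C_{\mathcal Q}>0$; $\sqrt{\mathcal Q}$ its positive root; for $u,w\in\mathbb R^{N-1}$, $\sqrt{\mathcal Q}u\cdot w:=\sqrt{\mathcal Q}(u,0)\cdot(w,0)$. Spaces: $\mathbf X_2^0:=\{\mathbf w^2=[\mathbf w^2_T,\mathbf w^2_N]:\mathbf w^2_T\in H^1(\Omega_2)^{N-1}\text{ independent of }z,\ \mathbf w^2_T=0\text{ on }\partial\Gamma\times(0,1),\ \mathbf w^2_N\in H(\partial_z,\Omega_2),\ \partial_z\mathbf w^2_N\text{ independent of }z,\ \mathbf w^2_N(\tilde x,1)=0\}$ with norm $(\|\mathbf w^2_T\|^2_{H^1(\Omega_2)}+\|\mathbf w^2_N\|^2_{H(\partial_z,\Omega_2)})^{1/2}$; $\mathbf X^0:=\{(\mathbf w^1,\mathbf w^2)\in\mathbf H_{\rm div}(\Omega_1)\times\mathbf X_2^0:\mathbf w^1\cdot\mathbf n=\mathbf w^2_N\text{ on }\Gamma\}$ with the product norm; $\mathbf Y^0:=\{(\varphi^1,\varphi^2)\in L^2(\Omega_1)\times L^2(\Omega_2):\varphi^2\text{ independent of }z\}$. Problem $(P_0)$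 with data $\mathbf f^2,h^1$: find $[\mathbf v,p]\in\mathbf X^0\times\mathbf Y^0$, $\mathbf v=[\mathbf v^1,[\mathbf v^2_T,\mathbf v^2_N]]$, $p=[p^1,p^2]$, such that for all $[\mathbf w,\varphi]\in\mathbf X^0\times\mathbf Y^0$: $\int_{\Omega_1}\mathcal Q\mathbf v^1\cdot\mathbf w^1-\int_{\Omega_1}p^1\nabla\cdot\mathbf w^1-\int_{\Omega_2}p^2(\nabla_T\cdot\mathbf w^2_T+\partial_z\mathbf w^2_N)+\int_{\Omega_2}\mu\nabla_T\mathbf v^2_T:\nabla_T\mathbf w^2_T+\int_{\Omega_2}\mu\,\partial_z\mathbf v^2_N\,\partial_z\mathbf w^2_N+\int_\Gamma\alpha(\mathbf v^1\cdot\mathbf n)(\mathbf w^1\cdot\mathbf n)+\int_\Gamma\beta\sqrt{\mathcal Q}\mathbf v^2_T\cdot\mathbf w^2_T=\int_{\Omega_2}\mathbf f^2_T\cdot\mathbf w^2_T$, $\int_{\Omega_1}(\nabla\cdot\mathbf v^1)\varphi^1+\int_{\Omega_2}(\nabla_T\cdot\mathbf v^2_T+\partial_z\mathbf v^2_N)\varphi^2=\int_{\Omega_1}h^1\varphi^1$. *)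

theory Defs
  imports "HOL-Analysis.Analysis"
begin

(* Conventions.
   R^(N-1) is an arbitrary euclidean space 'a (so N - 1 = DIM('a) >= 1, i.e. N >= 2);
   R^N is 'a \<times> real, a point being (x~, x_N).  The unit vector e_N is (0,1). *)

definition pd :: "'e::euclidean_space \<Rightarrow> ('e \<Rightarrow> 'b::real_normed_vector) \<Rightarrow> 'e \<Rightarrow> 'b" where
  "pd e f x = frechet_derivative f (at x) e"

definition grad :: "('e::euclidean_space \<Rightarrow> real) \<Rightarrow> 'e \<Rightarrow> 'e" where
  "grad f x = (\<Sum>b\<in>Basis. pd b f x *\<^sub>R b)"

fun Ck :: "nat \<Rightarrow> 'e::euclidean_space set \<Rightarrow> ('e \<Rightarrow> 'b::real_normed_vector) \<Rightarrow> bool" where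
  "Ck 0 S f = continuous_on S f"
| "Ck (Suc k) S f = ((\<forall>x\<in>S. f differentiable (at x)) \<and> (\<forall>e\<in>Basis. Ck k S (pd e f)))"

definition smooth_on :: "'e::euclidean_space set \<Rightarrow> ('e \<Rightarrow> 'b::real_normed_vector) \<Rightarrow> bool" where
  "smooth_on S f \<longleftrightarrow> (\<forall>k. Ck k S f)"

text \<open>C_c^infinity(U), functions extended by zero to the whole space.\<close>
definition test_fun :: "'e::euclidean_space set \<Rightarrow> ('e \<Rightarrow> real) \<Rightarrow> bool" where
  "test_fun U \<phi> \<longleftrightarrow> smooth_on UNIV \<phi> \<and> (\<exists>K. compact K \<and> K \<subseteq> U \<and> (\<forall>x. x \<notin> K \<longrightarrow> \<phi> x = 0))"

definition L2 :: "'e::euclidean_space set \<Rightarrow> ('e \<Rightarrow> 'b::euclidean_space) \<Rightarrow> bool" where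
  "L2 U u \<longleftrightarrow> u \<in> borel_measurable (lebesgue_on U) \<and> integrable (lebesgue_on U) (\<lambda>x. (norm (u x))\<^sup>2)"

definition l2norm :: "'e::euclidean_space set \<Rightarrow> ('e \<Rightarrow> 'b::euclidean_space) \<Rightarrow> real" where
  "l2norm U u = sqrt (\<integral>x. (norm (u x))\<^sup>2 \<partial>lebesgue_on U)"

definition has_wpd :: "'e::euclidean_space set \<Rightarrow> ('e \<Rightarrow> 'b::euclidean_space) \<Rightarrow> 'e \<Rightarrow> ('e \<Rightarrow> 'b) \<Rightarrow> bool" where
  "has_wpd U u e g \<longleftrightarrow> L2 U u \<and> L2 U g \<and>
     (\<forall>\<phi>. test_fun U \<phi> \<longrightarrow>
        (\<integral>x. pd e \<phi> x *\<^sub>R u x \<partial>lebesgue_on U) = - (\<integral>x. \<phi> x *\<^sub>R g x \<partial>lebesgue_on U))"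

definition wpd :: "'e::euclidean_space set \<Rightarrow> ('e \<Rightarrow> 'b::euclidean_space) \<Rightarrow> 'e \<Rightarrow> 'e \<Rightarrow> 'b" where
  "wpd U u e = (SOME g. has_wpd U u e g)"

definition has_wdiv :: "'e::euclidean_space set \<Rightarrow> ('e \<Rightarrow> 'e) \<Rightarrow> ('e \<Rightarrow> real) \<Rightarrow> bool" where
  "has_wdiv U w d \<longleftrightarrow> L2 U w \<and> L2 U d \<and>
     (\<forall>\<phi>. test_fun U \<phi> \<longrightarrow>
        (\<integral>x. w x \<bullet> grad \<phi> x \<partial>lebesgue_on U) = - (\<integral>x. \<phi> x * d x \<partial>lebesgue_on U))"

definition wdiv :: "'e::euclidean_space set \<Rightarrow> ('e \<Rightarrow> 'e) \<Rightarrow> 'e \<Rightarrow> real" where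
  "wdiv U w = (SOME d. has_wdiv U w d)"

definition Hdiv :: "'e::euclidean_space set \<Rightarrow> ('e \<Rightarrow> 'e) \<Rightarrow> bool" where
  "Hdiv U w \<longleftrightarrow> (\<exists>d. has_wdiv U w d)"

definition hdiv_norm :: "'e::euclidean_space set \<Rightarrow> ('e \<Rightarrow> 'e) \<Rightarrow> real" where
  "hdiv_norm U w = sqrt ((l2norm U w)\<^sup>2 + (l2norm U (wdiv U w))\<^sup>2)"

definition H1 :: "'e::euclidean_space set \<Rightarrow> ('e \<Rightarrow> 'b::euclidean_space) \<Rightarrow> bool" where
  "H1 U u \<longleftrightarrow> L2 U u \<and> (\<forall>e\<in>Basis. \<exists>g. has_wpd U u e g)"

definition h1_norm :: "'e::euclidean_space set \<Rightarrow> ('e \<Rightarrow> 'b::euclidean_space) \<Rightarrow> real" where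
  "h1_norm U u = sqrt ((l2norm U u)\<^sup>2 + (\<Sum>e\<in>Basis. (l2norm U (wpd U u e))\<^sup>2))"

definition Omega2 :: "'a::euclidean_space set \<Rightarrow> ('a \<times> real) set" where
  "Omega2 \<Gamma> = \<Gamma> \<times> {0<..<1}"

definition ez :: "'a::euclidean_space \<times> real" where
  "ez = (0, 1)"

definition Hz :: "'a::euclidean_space set \<Rightarrow> ('a \<times> real \<Rightarrow> real) \<Rightarrow> bool" where
  "Hz \<Gamma> u \<longleftrightarrow> L2 (Omega2 \<Gamma>) u \<and> (\<exists>g. has_wpd (Omega2 \<Gamma>) u ez g)"

definition hz_norm :: "'a::euclidean_space set \<Rightarrow> ('a \<times> real \<Rightarrow> real) \<Rightarrow> real" where
  "hz_norm \<Gamma> u = sqrt ((l2norm (Omega2 \<Gamma>) u)\<^sup>2 + (l2norm (Omega2 \<Gamma>) (wpd (Omega2 \<Gamma>) u ez))\<^sup>2)"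

definition zindep :: "'a::euclidean_space set \<Rightarrow> ('a \<times> real \<Rightarrow> 'b) \<Rightarrow> bool" where
  "zindep \<Gamma> u \<longleftrightarrow> (\<exists>f. AE x in lebesgue_on (Omega2 \<Gamma>). u x = f (fst x))"

text \<open>Traces on z = 0 and z = 1 of functions with an L2 z-derivative, characterized
  by the integration-by-parts formula in z.\<close>
definition ztrace0 :: "'a::euclidean_space set \<Rightarrow> ('a \<times> real \<Rightarrow> 'b::euclidean_space) \<Rightarrow> ('a \<Rightarrow> 'b) \<Rightarrow> bool" where
  "ztrace0 \<Gamma> u g \<longleftrightarrow> L2 \<Gamma> g \<and> (\<exists>du. has_wpd (Omega2 \<Gamma>) u ez du \<and>
     (\<forall>\<phi>. test_fun (\<Gamma> \<times> {..<1}) \<phi> \<longrightarrow>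
        (\<integral>x. pd ez \<phi> x *\<^sub>R u x + \<phi> x *\<^sub>R du x \<partial>lebesgue_on (Omega2 \<Gamma>))
          = - (\<integral>y. \<phi> (y, 0) *\<^sub>R g y \<partial>lebesgue_on \<Gamma>)))"

definition ztrace1 :: "'a::euclidean_space set \<Rightarrow> ('a \<times> real \<Rightarrow> 'b::euclidean_space) \<Rightarrow> ('a \<Rightarrow> 'b) \<Rightarrow> bool" where
  "ztrace1 \<Gamma> u g \<longleftrightarrow> L2 \<Gamma> g \<and> (\<exists>du. has_wpd (Omega2 \<Gamma>) u ez du \<and>
     (\<forall>\<phi>. test_fun (\<Gamma> \<times> {0<..}) \<phi> \<longrightarrow>
        (\<integral>x. pd ez \<phi> x *\<^sub>R u x + \<phi> x *\<^sub>R du x \<partial>lebesgue_on (Omega2 \<Gamma>))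
          = (\<integral>y. \<phi> (y, 1) *\<^sub>R g y \<partial>lebesgue_on \<Gamma>)))"

text \<open>The trace on Gamma = {z = 0} (a.e. unique).\<close>
definition tr0 :: "'a::euclidean_space set \<Rightarrow> ('a \<times> real \<Rightarrow> 'b::euclidean_space) \<Rightarrow> 'a \<Rightarrow> 'b" where
  "tr0 \<Gamma> u = (SOME g. ztrace0 \<Gamma> u g)"

text \<open>Vanishing trace of an H^1 function on the lateral boundary (boundary of Gamma) x (0,1),
  via the Green formula with test functions vanishing near the top and bottom faces.\<close>
definition lateral_zero :: "'a::euclidean_space set \<Rightarrow> ('a \<times> real \<Rightarrow> 'b::euclidean_space) \<Rightarrow> bool" where
  "lateral_zero \<Gamma> u \<longleftrightarrow> H1 (Omega2 \<Gamma>) u \<and>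
     (\<forall>e\<in>Basis. \<forall>\<phi>. test_fun (- (closure \<Gamma> \<times> {0, 1})) \<phi> \<longrightarrow>
        (\<integral>x. pd e \<phi> x *\<^sub>R u x + \<phi> x *\<^sub>R wpd (Omega2 \<Gamma>) u e x \<partial>lebesgue_on (Omega2 \<Gamma>)) = 0)"

text \<open>Normal trace (outward normal of Omega_1) of w in H_div(Omega_1) on Gamma x {0} equals g
  (as distributions on Gamma), via Green's formula.\<close>
definition normal_trace_on :: "('a::euclidean_space \<times> real) set \<Rightarrow> 'a set \<Rightarrow> ('a \<times> real \<Rightarrow> 'a \<times> real) \<Rightarrow> ('a \<Rightarrow> real) \<Rightarrow> bool" where
  "normal_trace_on \<Omega>1 \<Gamma> w g \<longleftrightarrow> Hdiv \<Omega>1 w \<and> L2 \<Gamma> g \<and>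
     (\<forall>\<phi>. test_fun (- closure (frontier \<Omega>1 - \<Gamma> \<times> {0})) \<phi> \<longrightarrow>
        (\<integral>x. w x \<bullet> grad \<phi> x + \<phi> x * wdiv \<Omega>1 w x \<partial>lebesgue_on \<Omega>1)
          = (\<integral>y. g y * \<phi> (y, 0) \<partial>lebesgue_on \<Gamma>))"

definition X20 :: "'a::euclidean_space set \<Rightarrow> ('a \<times> real \<Rightarrow> 'a) \<Rightarrow> ('a \<times> real \<Rightarrow> real) \<Rightarrow> bool" where
  "X20 \<Gamma> wT wN \<longleftrightarrow>
     H1 (Omega2 \<Gamma>) wT \<and> zindep \<Gamma> wT \<and> lateral_zero \<Gamma> wT \<and>
     Hz \<Gamma> wN \<and> zindep \<Gamma> (wpd (Omega2 \<Gamma>) wN ez) \<and> ztrace1 \<Gamma> wN (\<lambda>_. 0)"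

definition X20_norm :: "'a::euclidean_space set \<Rightarrow> ('a \<times> real \<Rightarrow> 'a) \<Rightarrow> ('a \<times> real \<Rightarrow> real) \<Rightarrow> real" where
  "X20_norm \<Gamma> wT wN = sqrt ((h1_norm (Omega2 \<Gamma>) wT)\<^sup>2 + (hz_norm \<Gamma> wN)\<^sup>2)"

definition X0 :: "('a::euclidean_space \<times> real) set \<Rightarrow> 'a set \<Rightarrow> ('a \<times> real \<Rightarrow> 'a \<times> real) \<Rightarrow> ('a \<times> real \<Rightarrow> 'a) \<Rightarrow> ('a \<times> real \<Rightarrow> real) \<Rightarrow> bool" where
  "X0 \<Omega>1 \<Gamma> w1 wT wN \<longleftrightarrow> Hdiv \<Omega>1 w1 \<and> X20 \<Gamma> wT wN \<and>
     (\<exists>g. ztrace0 \<Gamma> wN g \<and> normal_trace_on \<Omega>1 \<Gamma> w1 g)"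

definition X0_norm :: "('a::euclidean_space \<times> real) set \<Rightarrow> 'a set \<Rightarrow> ('a \<times> real \<Rightarrow> 'a \<times> real) \<Rightarrow> ('a \<times> real \<Rightarrow> 'a) \<Rightarrow> ('a \<times> real \<Rightarrow> real) \<Rightarrow> real" where
  "X0_norm \<Omega>1 \<Gamma> w1 wT wN = sqrt ((hdiv_norm \<Omega>1 w1)\<^sup>2 + (X20_norm \<Gamma> wT wN)\<^sup>2)"

definition Y0 :: "('a::euclidean_space \<times> real) set \<Rightarrow> 'a set \<Rightarrow> ('a \<times> real \<Rightarrow> real) \<Rightarrow> ('a \<times> real \<Rightarrow> real) \<Rightarrow> bool" where
  "Y0 \<Omega>1 \<Gamma> \<phi>1 \<phi>2 \<longleftrightarrow> L2 \<Omega>1 \<phi>1 \<and> L2 (Omega2 \<Gamma>) \<phi>2 \<and> zindep \<Gamma> \<phi>2"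

definition Y0_norm :: "('a::euclidean_space \<times> real) set \<Rightarrow> 'a set \<Rightarrow> ('a \<times> real \<Rightarrow> real) \<Rightarrow> ('a \<times> real \<Rightarrow> real) \<Rightarrow> real" where
  "Y0_norm \<Omega>1 \<Gamma> \<phi>1 \<phi>2 = sqrt ((l2norm \<Omega>1 \<phi>1)\<^sup>2 + (l2norm (Omega2 \<Gamma>) \<phi>2)\<^sup>2)"

definition divT :: "'a::euclidean_space set \<Rightarrow> ('a \<times> real \<Rightarrow> 'a) \<Rightarrow> 'a \<times> real \<Rightarrow> real" where
  "divT \<Gamma> wT x = (\<Sum>b\<in>Basis. wpd (Omega2 \<Gamma>) wT (b, 0) x \<bullet> b)"

definition gradT_inner :: "'a::euclidean_space set \<Rightarrow> ('a \<times> real \<Rightarrow> 'a) \<Rightarrow> ('a \<times> real \<Rightarrow> 'a) \<Rightarrow> 'a \<times> real \<Rightarrow> real" where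
  "gradT_inner \<Gamma> vT wT x = (\<Sum>b\<in>Basis. wpd (Omega2 \<Gamma>) vT (b, 0) x \<bullet> wpd (Omega2 \<Gamma>) wT (b, 0) x)"

definition dz :: "'a::euclidean_space set \<Rightarrow> ('a \<times> real \<Rightarrow> real) \<Rightarrow> 'a \<times> real \<Rightarrow> real" where
  "dz \<Gamma> w = wpd (Omega2 \<Gamma>) w ez"

definition sym_op :: "('e::euclidean_space \<Rightarrow>\<^sub>L 'e) \<Rightarrow> bool" where
  "sym_op A \<longleftrightarrow> (\<forall>y z. A y \<bullet> z = y \<bullet> A z)"

definition psqrt :: "('e::euclidean_space \<Rightarrow>\<^sub>L 'e) \<Rightarrow> ('e \<Rightarrow>\<^sub>L 'e)" where
  "psqrt A = (THE S. sym_op S \<and> (\<forall>y. 0 \<le> S y \<bullet> y) \<and> S o\<^sub>L S = A)"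

definition local_graph :: "'e::euclidean_space set \<Rightarrow> 'e \<Rightarrow> 'e \<Rightarrow> real \<Rightarrow> real \<Rightarrow> ('e \<Rightarrow> real) \<Rightarrow> bool" where
  "local_graph U x0 \<nu> r h \<gamma> \<longleftrightarrow> norm \<nu> = 1 \<and> r > 0 \<and> h > 0 \<and> \<gamma> 0 = 0 \<and>
     (\<forall>y t. y \<bullet> \<nu> = 0 \<and> norm y < r \<and> \<bar>t\<bar> < h \<longrightarrow> (x0 + y + t *\<^sub>R \<nu> \<in> U \<longleftrightarrow> t < \<gamma> y))"

definition lipschitz_domain :: "'e::euclidean_space set \<Rightarrow> bool" where
  "lipschitz_domain U \<longleftrightarrow> open U \<and> connected U \<and> U \<noteq> {} \<and>
     (\<forall>x0\<in>frontier U. \<exists>\<nu> r h \<gamma> L. local_graph U x0 \<nu> r h \<gamma> \<and> L-lipschitz_on {y. y \<bullet> \<nu> = 0} \<gamma>)"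

definition smooth_boundary_part :: "'e::euclidean_space set \<Rightarrow> 'e set \<Rightarrow> bool" where
  "smooth_boundary_part U S \<longleftrightarrow> S \<subseteq> frontier U \<and>
     (\<forall>x0\<in>S - closure (frontier U - S). \<exists>\<nu> r h \<gamma>. local_graph U x0 \<nu> r h \<gamma> \<and> smooth_on (ball 0 r) \<gamma>)"

definition hausdorff_measure :: "real \<Rightarrow> 'e::euclidean_space set \<Rightarrow> ennreal" where
  "hausdorff_measure s A =
     (SUP \<delta>\<in>{0<..}. INF C \<in> {C :: nat \<Rightarrow> 'e set. A \<subseteq> (\<Union>i. C i) \<and> (\<forall>i. bounded (C i) \<and> diameter (C i) \<le> \<delta>)}.
        (\<Sum>i. ennreal (pi powr (s / 2) / Gamma (s / 2 + 1) * (diameter (C i) / 2) powr s)))"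

definition P0_solution ::
  "('a::euclidean_space \<times> real) set \<Rightarrow> 'a set \<Rightarrow> real \<Rightarrow> ('a \<Rightarrow> real) \<Rightarrow> ('a \<Rightarrow> real)
   \<Rightarrow> ('a \<times> real \<Rightarrow> ('a \<times> real) \<Rightarrow>\<^sub>L ('a \<times> real))
   \<Rightarrow> ('a \<times> real \<Rightarrow> 'a \<times> real) \<Rightarrow> ('a \<times> real \<Rightarrow> real)
   \<Rightarrow> ('a \<times> real \<Rightarrow> 'a \<times> real) \<Rightarrow> ('a \<times> real \<Rightarrow> 'a) \<Rightarrow> ('a \<times> real \<Rightarrow> real)
   \<Rightarrow> ('a \<times> real \<Rightarrow> real) \<Rightarrow> ('a \<times> real \<Rightarrow> real) \<Rightarrow> bool" where
  "P0_solution \<Omega>1 \<Gamma> \<mu> \<alpha> \<beta> Q f2 h1 v1 vT vN p1 p2 \<longleftrightarrow>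
     X0 \<Omega>1 \<Gamma> v1 vT vN \<and> Y0 \<Omega>1 \<Gamma> p1 p2 \<and>
     (\<forall>w1 wT wN \<phi>1 \<phi>2. X0 \<Omega>1 \<Gamma> w1 wT wN \<and> Y0 \<Omega>1 \<Gamma> \<phi>1 \<phi>2 \<longrightarrow>
        (\<integral>x. Q x (v1 x) \<bullet> w1 x \<partial>lebesgue_on \<Omega>1)
        - (\<integral>x. p1 x * wdiv \<Omega>1 w1 x \<partial>lebesgue_on \<Omega>1)
        - (\<integral>x. p2 x * (divT \<Gamma> wT x + dz \<Gamma> wN x) \<partial>lebesgue_on (Omega2 \<Gamma>))
        + (\<integral>x. \<mu> * gradT_inner \<Gamma> vT wT x \<partial>lebesgue_on (Omega2 \<Gamma>))
        + (\<integral>x. \<mu> * dz \<Gamma> vN x * dz \<Gamma> wN x \<partial>lebesgue_on (Omega2 \<Gamma>))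
        + (\<integral>y. \<alpha> y * tr0 \<Gamma> vN y * tr0 \<Gamma> wN y \<partial>lebesgue_on \<Gamma>)
        + (\<integral>y. \<beta> y * (psqrt (Q (y, 0)) (tr0 \<Gamma> vT y, 0) \<bullet> (tr0 \<Gamma> wT y, 0)) \<partial>lebesgue_on \<Gamma>)
        = (\<integral>x. fst (f2 x) \<bullet> wT x \<partial>lebesgue_on (Omega2 \<Gamma>))
      \<and>
        (\<integral>x. wdiv \<Omega>1 v1 x * \<phi>1 x \<partial>lebesgue_on \<Omega>1)
        + (\<integral>x. (divT \<Gamma> vT x + dz \<Gamma> vN x) * \<phi>2 x \<partial>lebesgue_on (Omega2 \<Gamma>))
        = (\<integral>x. h1 x * \<phi>1 x \<partial>lebesgue_on \<Omega>1))"

end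

(* A field in X^0 is determined by its part w1 on Omega_1 and by functions on Gamma: w_T is tau o fst with
   tau in H^1_0(Gamma), and w_N = (z - 1) f with f = d_z w_N. Its membership condition becomes a family of
   integral identities for test functions, so no trace operators are needed. In these variables (P_0) is a
   saddle point problem. The form a is nonnegative and, by the Poincare inequality on Gamma, it controls the
   whole norm up to the divergence, which the constraint prescribes; the divergence has a bounded right
   inverse: take tau = 0, let f be the datum on Omega_2, and solve for w1 among vertical fields (0, W),
   which works because Omega_1 lies locally below Gamma and the remaining boundary imposes no condition.
   Everything is done with semi-inner products on honest functions instead of
   equivalence classes, with completeness up to null vectors. *)
theory Submission
  imports Defs "HOL-Library.Function_Algebras"
begin

text \<open>Membership in X^0 is defined by testing against smooth functions, and the estimates stay
  at that level: they are obtained by duality. A bounded functional on test functions is represented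
  by an L2 function, and the fundamental lemma identifies that function. The Poincare inequality on
  \<Gamma> comes from translating a test function until its support has left \<Gamma>, with no
  approximation of the unknown. For the divergence, a test function on \<Omega>1 must be bounded by
  its own z-derivative along vertical lines. The danger is a line ending on \<Gamma>, where test
  functions need not vanish. Going down from points of height at most 0 and up from all others, the
  end point never has height 0. The pressure needs no closed range theorem: the residual of the
  momentum equation vanishes on the kernel of the divergence, hence is a functional of the
  divergence alone, and a bounded one because divergences have preimages of comparable norm. The
  form a alone does not control the divergence, so the Riesz theorem is applied to a plus the
  divergence term, which is complete on the whole velocity space.\<close>

instantiation "fun" :: (type, real_vector) real_vector
begin
definition scaleR_fun :: "real \<Rightarrow> ('a \<Rightarrow> 'b) \<Rightarrow> 'a \<Rightarrow> 'b" where
  "scaleR_fun r f = (\<lambda>x. r *\<^sub>R f x)"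
instance
  by standard (auto simp: scaleR_fun_def fun_eq_iff algebra_simps)
end

lemma scaleR_fun_apply [simp]: "(r *\<^sub>R f) x = r *\<^sub>R f x"
  by (simp add: scaleR_fun_def)

section \<open>Semi-inner products\<close>

text \<open>Bilinearity is required on \<open>S\<close> only. For the L2 form it would fail outside:
  the Bochner integral of a non-integrable function is 0 by convention, which breaks
  additivity.\<close>

locale semi_inner =
  fixes S :: "'v::real_vector set" and B :: "'v \<Rightarrow> 'v \<Rightarrow> real"
  assumes subspace: "subspace S"
    and add_left: "x \<in> S \<Longrightarrow> y \<in> S \<Longrightarrow> z \<in> S \<Longrightarrow> B (x + y) z = B x z + B y z"
    and scale_left: "x \<in> S \<Longrightarrow> z \<in> S \<Longrightarrow> B (r *\<^sub>R x) z = r * B x z"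
    and commute: "x \<in> S \<Longrightarrow> y \<in> S \<Longrightarrow> B x y = B y x"
    and nonneg: "x \<in> S \<Longrightarrow> 0 \<le> B x x"
begin

definition nrm :: "'v \<Rightarrow> real" where
  "nrm x = sqrt (B x x)"

lemma memI:
  shows "x \<in> S \<Longrightarrow> y \<in> S \<Longrightarrow> x + y \<in> S" "x \<in> S \<Longrightarrow> r *\<^sub>R x \<in> S"
    "x \<in> S \<Longrightarrow> y \<in> S \<Longrightarrow> x - y \<in> S" "0 \<in> S"
  using subspace by (auto simp: subspace_add subspace_scale subspace_diff subspace_0)

lemma add_right: "x \<in> S \<Longrightarrow> y \<in> S \<Longrightarrow> z \<in> S \<Longrightarrow> B z (x + y) = B z x + B z y"
  by (metis add_left commute memI(1))

lemma scale_right: "x \<in> S \<Longrightarrow> z \<in> S \<Longrightarrow> B z (r *\<^sub>R x) = r * B z x"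
  by (metis scale_left commute memI(2))

lemma diff_left: "x \<in> S \<Longrightarrow> y \<in> S \<Longrightarrow> z \<in> S \<Longrightarrow> B (x - y) z = B x z - B y z"
  using add_left[of x "(-1) *\<^sub>R y" z] scale_left[of y z "-1"] memI(2)[of y "-1"] by simp

lemma diff_right: "x \<in> S \<Longrightarrow> y \<in> S \<Longrightarrow> z \<in> S \<Longrightarrow> B z (x - y) = B z x - B z y"
  by (metis diff_left commute memI(3))

lemma nrm_nonneg [simp]: "x \<in> S \<Longrightarrow> 0 \<le> nrm x"
  by (simp add: nrm_def nonneg)

lemma nrm_sq: "x \<in> S \<Longrightarrow> (nrm x)\<^sup>2 = B x x"
  by (simp add: nrm_def nonneg)

lemma nrm_scale: "x \<in> S \<Longrightarrow> nrm (r *\<^sub>R x) = \<bar>r\<bar> * nrm x"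
proof -
  assume x: "x \<in> S"
  then have "B (r *\<^sub>R x) (r *\<^sub>R x) = r\<^sup>2 * B x x"
    by (simp add: scale_left scale_right memI power2_eq_square)
  then show ?thesis by (simp add: nrm_def real_sqrt_mult)
qed

lemma expand:
  assumes "x \<in> S" "y \<in> S"
  shows "B (x + t *\<^sub>R y) (x + t *\<^sub>R y) = B x x + 2 * t * B x y + t\<^sup>2 * B y y"
  using assms by (simp add: add_left add_right scale_left scale_right memI commute[of y x]
      power2_eq_square algebra_simps)

text \<open>Stated for arbitrary reals because it serves twice: for the Cauchy-Schwarz inequality,
  and in the Riesz theorem, where near-minimality yields such a quadratic with a small constant term
  \<open>p\<close>.\<close>

lemma nonneg_quadratic_discriminant:
  fixes p q r :: real
  assumes "\<And>t. 0 \<le> p + 2 * t * q + t\<^sup>2 * r" "0 \<le> r"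
  shows "q\<^sup>2 \<le> p * r"
proof (cases "r = 0")
  case True
  have "q = 0"
  proof (rule ccontr)
    assume "q \<noteq> 0"
    \<comment> \<open>For r = 0 the polynomial is affine in t; at this t it equals -1.\<close>
    then show False using assms(1)[of "- (p + 1) / (2 * q)"] True by (simp add: field_simps)
  qed
  then show ?thesis using True by simp
next
  case False
  then have r: "r > 0" using assms(2) by simp
  \<comment> \<open>Evaluation at the minimiser t = - q / r.\<close>
  have "0 \<le> p + 2 * (- q / r) * q + (- q / r)\<^sup>2 * r" by (rule assms(1))
  also have "\<dots> = p - q\<^sup>2 / r" using r by (simp add: power2_eq_square field_simps)
  finally show ?thesis using r by (simp add: field_simps)
qed

lemma Cauchy_Schwarz_sq:
  assumes "x \<in> S" "y \<in> S"
  shows "(B x y)\<^sup>2 \<le> B x x * B y y"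
  by (rule nonneg_quadratic_discriminant)
    (use assms in \<open>simp_all add: expand[symmetric] nonneg memI\<close>)

lemma Cauchy_Schwarz:
  assumes "x \<in> S" "y \<in> S"
  shows "\<bar>B x y\<bar> \<le> nrm x * nrm y"
  using real_sqrt_le_mono[OF Cauchy_Schwarz_sq[OF assms]] by (simp add: nrm_def real_sqrt_mult)

lemma nrm_triangle:
  assumes "x \<in> S" "y \<in> S"
  shows "nrm (x + y) \<le> nrm x + nrm y"
proof -
  have "(nrm (x + y))\<^sup>2 = B x x + 2 * B x y + B y y"
    using expand[OF assms, of 1] assms by (simp add: nrm_sq memI)
  also have "\<dots> \<le> (nrm x + nrm y)\<^sup>2"
    using Cauchy_Schwarz[OF assms] assms by (simp add: power2_sum nrm_sq)
  finally show ?thesis by (rule power2_le_imp_le) (simp add: assms)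
qed

lemma nrm_minus_commute: "x \<in> S \<Longrightarrow> y \<in> S \<Longrightarrow> nrm (x - y) = nrm (y - x)"
  using nrm_scale[of "x - y" "-1"] memI by simp

lemma nrm_diff_triangle:
  assumes "x \<in> S" "y \<in> S"
  shows "nrm x \<le> nrm y + nrm (x - y)"
  using nrm_triangle[of y "x - y"] assms memI by simp

text \<open>By Cauchy-Schwarz the form does not see null vectors. This is what makes choices and
  limits that are fixed only up to null vectors harmless.\<close>

lemma B_null:
  assumes "x \<in> S" "y \<in> S" "nrm x = 0"
  shows "B x y = 0" "B y x = 0"
  using Cauchy_Schwarz[OF assms(1,2)] commute[OF assms(1,2)] assms(3) by auto

lemma tendsto_B:
  assumes "\<And>n. s n \<in> S" "u \<in> S" "(\<lambda>n. nrm (s n - u)) \<longlonglongrightarrow> 0" "d \<in> S"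
  shows "(\<lambda>n. B (s n) d) \<longlonglongrightarrow> B u d"
proof -
  have "(\<lambda>n. B (s n - u) d) \<longlonglongrightarrow> 0"
  proof (rule Lim_null_comparison)
    show "\<forall>\<^sub>F n in sequentially. norm (B (s n - u) d) \<le> nrm (s n - u) * nrm d"
      using Cauchy_Schwarz assms memI by simp
    show "(\<lambda>n. nrm (s n - u) * nrm d) \<longlonglongrightarrow> 0"
      using tendsto_mult_left_zero[OF assms(3)] by simp
  qed
  then show ?thesis
    using assms by (simp add: diff_left LIM_zero_iff)
qed

end

text \<open>Completeness in the sense of the quotient by null vectors, but expressed on
  representatives: a Cauchy sequence has some limit in \<open>S\<close>, not a unique one.\<close>

locale semi_hilbert = semi_inner +
  assumes complete: "(\<And>n. s n \<in> S) \<Longrightarrow> (\<And>e. e > 0 \<Longrightarrow> \<exists>N. \<forall>m\<ge>N. \<forall>n\<ge>N. B (s m - s n) (s m - s n) < e) \<Longrightarrow>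
    \<exists>u\<in>S. (\<lambda>n. B (s n - u) (s n - u)) \<longlonglongrightarrow> 0"
begin

(* Minimise the quadratic functional B (T d) (T d) - 2 l d: the parallelogram law makes minimising
   sequences Cauchy, although neither T ` D is closed nor B definite. *)
lemma riesz:
  fixes D :: "'d::real_vector set"
  assumes D: "subspace D"
    and T: "\<And>d. d \<in> D \<Longrightarrow> T d \<in> S" "\<And>c d. c \<in> D \<Longrightarrow> d \<in> D \<Longrightarrow> T (c + d) = T c + T d"
      "\<And>r d. d \<in> D \<Longrightarrow> T (r *\<^sub>R d) = r *\<^sub>R T d"
    and l: "\<And>c d. c \<in> D \<Longrightarrow> d \<in> D \<Longrightarrow> l (c + d) = l c + l d" "\<And>r d. d \<in> D \<Longrightarrow> l (r *\<^sub>R d) = r * l d"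
    and bound: "\<And>d. d \<in> D \<Longrightarrow> \<bar>l d\<bar> \<le> C * nrm (T d)" and C: "0 \<le> C"
  shows "\<exists>u\<in>S. (\<forall>d\<in>D. B u (T d) = l d) \<and> nrm u \<le> C \<and>
    (\<exists>s. (\<forall>n. s n \<in> D) \<and> (\<lambda>n. nrm (T (s n) - u)) \<longlonglongrightarrow> 0)"
proof -
  define J where "J d = B (T d) (T d) - 2 * l d" for d
  have Dm: "c \<in> D \<Longrightarrow> d \<in> D \<Longrightarrow> c + d \<in> D" "c \<in> D \<Longrightarrow> r *\<^sub>R c \<in> D" for c d r
    using D by (auto simp: subspace_add subspace_scale)
  have D0: "0 \<in> D" using D by (simp add: subspace_0)
  \<comment> \<open>Completing the square with the bound on \<open>l\<close> keeps the functional
    above - C^2, so the infimum \<open>m\<close> is finite.\<close>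
  have Jlow: "- C\<^sup>2 \<le> J d" if "d \<in> D" for d
  proof -
    have "0 \<le> (nrm (T d) - C)\<^sup>2" by simp
    also have "\<dots> = B (T d) (T d) - 2 * (C * nrm (T d)) + C\<^sup>2"
      using that by (simp add: power2_diff nrm_sq T)
    also have "\<dots> \<le> J d + C\<^sup>2" using bound[OF that] by (simp add: J_def)
    finally show ?thesis by simp
  qed
  define m where "m = Inf (J ` D)"
  have bdd: "bdd_below (J ` D)" using Jlow by (auto intro!: bdd_belowI2)
  have mle: "m \<le> J d" if "d \<in> D" for d
    unfolding m_def using that by (intro cInf_lower bdd) auto
  have "\<exists>d\<in>D. J d < m + 1 / Suc n" for n
    using cInf_lessD[of "J ` D" "m + 1 / Suc n"] D0 by (auto simp: m_def)
  then obtain s where sD: "s n \<in> D" and sJ: "J (s n) < m + 1 / Suc n" for n by metis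
  \<comment> \<open>The midpoint of two members of the sequence lies in \<open>D\<close>, so its
    value is at least \<open>m\<close>; the parallelogram law turns this into closeness of the two
    images.\<close>
  have par: "B (T (s i) - T (s j)) (T (s i) - T (s j)) \<le> 2 / Suc i + 2 / Suc j" for i j
  proof -
    define x y where "x = T (s i)" and "y = T (s j)"
    have xy: "x \<in> S" "y \<in> S" by (simp_all add: x_def y_def T sD)
    define d where "d = (1/2::real) *\<^sub>R (s i + s j)"
    have dD: "d \<in> D" by (simp add: d_def Dm sD)
    have Td: "T d = (1/2::real) *\<^sub>R (x + y)" by (simp add: d_def x_def y_def T sD Dm)
    have ld: "l d = (l (s i) + l (s j)) / 2" by (simp add: d_def l sD Dm)
    have 1: "4 * B (T d) (T d) = B x x + 2 * B x y + B y y"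
      using xy by (simp add: Td scale_left scale_right add_left add_right memI commute[of y x] field_simps)
    have 2: "B (x - y) (x - y) = B x x - 2 * B x y + B y y"
      using xy by (simp add: diff_left diff_right memI commute[of y x])
    have "m \<le> B (T d) (T d) - 2 * l d" using mle[OF dD] by (simp add: J_def)
    then have "4 * m \<le> B x x + 2 * B x y + B y y - 4 * (l (s i) + l (s j))"
      using 1 ld by linarith
    moreover have "B x x - 2 * l (s i) < m + 1 / Suc i" "B y y - 2 * l (s j) < m + 1 / Suc j"
      using sJ[of i] sJ[of j] by (simp_all add: J_def x_def y_def)
    ultimately have "B (x - y) (x - y) \<le> 2 * (1 / Suc i) + 2 * (1 / Suc j)"
      unfolding 2 distrib_left by linarith
    then show ?thesis by (simp add: x_def y_def)
  qed
  have "\<exists>N. \<forall>i\<ge>N. \<forall>j\<ge>N. B (T (s i) - T (s j)) (T (s i) - T (s j)) < e" if e: "e > 0" for e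
  proof -
    obtain N where N: "1 / Suc N < e / 4" using e nat_approx_posE[of "e/4"] by auto
    have "B (T (s i) - T (s j)) (T (s i) - T (s j)) < e" if "i \<ge> N" "j \<ge> N" for i j
    proof -
      have "1 / Suc i \<le> 1 / Suc N" "1 / Suc j \<le> 1 / Suc N" using that by (simp_all add: field_simps)
      then show ?thesis using par[of i j] N by simp
    qed
    then show ?thesis by blast
  qed
  then obtain u where u: "u \<in> S" and lim: "(\<lambda>n. B (T (s n) - u) (T (s n) - u)) \<longlonglongrightarrow> 0"
    using complete[of "\<lambda>n. T (s n)"] T sD by blast
  have limn: "(\<lambda>n. nrm (T (s n) - u)) \<longlonglongrightarrow> 0"
    using tendsto_real_sqrt[OF lim] by (simp add: nrm_def)
  have rep: "B u (T d) = l d" if d: "d \<in> D" for d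
  proof -
    \<comment> \<open>Moving from \<open>s n\<close> in direction \<open>d\<close> cannot go below
      \<open>m\<close>, and \<open>J (s n)\<close> exceeds \<open>m\<close> by less than 1 / (n +
      1). The discriminant of the resulting quadratic in t bounds the residual at
      \<open>d\<close>.\<close>
    have est: "(B (T (s n)) (T d) - l d)\<^sup>2 \<le> 1 / Suc n * B (T d) (T d)" for n
    proof (rule nonneg_quadratic_discriminant)
      fix t :: real
      have "m \<le> J (s n + t *\<^sub>R d)" by (rule mle) (simp add: Dm sD d)
      also have "\<dots> = J (s n) + 2 * t * (B (T (s n)) (T d) - l d) + t\<^sup>2 * B (T d) (T d)"
        using d sD by (simp add: J_def T l Dm expand algebra_simps)
      finally show "0 \<le> 1 / Suc n + 2 * t * (B (T (s n)) (T d) - l d) + t\<^sup>2 * B (T d) (T d)"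
        using sJ[of n] by simp
    qed (simp add: nonneg T d)
    have "(\<lambda>n. 1 / Suc n * B (T d) (T d)) \<longlonglongrightarrow> 0"
      using tendsto_mult_left_zero[OF LIMSEQ_inverse_real_of_nat, of "B (T d) (T d)"]
      by (simp add: inverse_eq_divide)
    then have "(\<lambda>n. (B (T (s n)) (T d) - l d)\<^sup>2) \<longlonglongrightarrow> 0"
      by (rule Lim_null_comparison[rotated]) (use est in simp)
    then have "(\<lambda>n. \<bar>B (T (s n)) (T d) - l d\<bar>) \<longlonglongrightarrow> 0"
      using tendsto_real_sqrt by fastforce
    then have "(\<lambda>n. B (T (s n)) (T d)) \<longlonglongrightarrow> l d"
      by (simp add: LIM_zero_iff tendsto_rabs_zero_iff)
    moreover have "(\<lambda>n. B (T (s n)) (T d)) \<longlonglongrightarrow> B u (T d)"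
      by (rule tendsto_B) (simp_all add: u limn T sD d)
    ultimately show ?thesis by (rule LIMSEQ_unique[symmetric])
  qed
  \<comment> \<open>\<open>u\<close> need not lie in the image of \<open>D\<close>, so
    \<open>l\<close> cannot be evaluated at it; the bound is taken along the minimising sequence and
    passed to the limit.\<close>
  have "nrm u \<le> C"
  proof (cases "nrm u = 0")
    case False
    have lim1: "(\<lambda>n. B u (T (s n))) \<longlonglongrightarrow> B u u"
      using tendsto_B[of "\<lambda>n. T (s n)" u u] u sD T limn commute by simp
    have lim2: "(\<lambda>n. C * (nrm u + nrm (T (s n) - u))) \<longlonglongrightarrow> C * (nrm u + 0)"
      by (intro tendsto_intros limn)
    have "B u (T (s n)) \<le> C * (nrm u + nrm (T (s n) - u))" for n
    proof -
      have "B u (T (s n)) \<le> C * nrm (T (s n))" using bound[OF sD] rep[OF sD] by (metis abs_le_D1)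
      also have "\<dots> \<le> C * (nrm u + nrm (T (s n) - u))"
        using nrm_diff_triangle[of "T (s n)" u] sD T u C by (intro mult_left_mono) auto
      finally show ?thesis .
    qed
    then have "B u u \<le> C * nrm u" using LIMSEQ_le[OF lim1 lim2] by auto
    then have "nrm u * nrm u \<le> C * nrm u" using nrm_sq[OF u] by (simp add: power2_eq_square)
    then show ?thesis using False u nrm_nonneg[OF u] by (simp add: mult_le_cancel_right)
  qed (simp add: C)
  then show ?thesis using u rep sD limn by blast
qed

end

section \<open>Abstract saddle point problems\<close>

text \<open>Coercivity is asked of a together with the divergence term, on all of \<open>X\<close>;
  on the kernel of \<open>b\<close> it is the usual coercivity of a. \<open>b_surj\<close> plays the
  part of the inf-sup condition: a right inverse of \<open>b\<close>, bounded, and correct up to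
  null vectors.\<close>

locale mixed_problem = X: semi_hilbert X ipX + Y: semi_hilbert Y ipY + a: semi_inner X a
  for X :: "'v::real_vector set" and ipX and Y :: "'y::real_vector set" and ipY and a +
  fixes b :: "'v \<Rightarrow> 'y" and k M C :: real
  assumes a_bdd: "v \<in> X \<Longrightarrow> a v v \<le> M * ipX v v"
    and b_mem: "v \<in> X \<Longrightarrow> b v \<in> Y"
    and b_add: "v \<in> X \<Longrightarrow> w \<in> X \<Longrightarrow> b (v + w) = b v + b w"
    and b_scale: "v \<in> X \<Longrightarrow> b (r *\<^sub>R v) = r *\<^sub>R b v"
    and b_bdd: "v \<in> X \<Longrightarrow> ipY (b v) (b v) \<le> M * ipX v v"
    and coercive: "v \<in> X \<Longrightarrow> k * ipX v v \<le> a v v + ipY (b v) (b v)"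
    and k_pos: "k > 0"
    and b_surj: "y \<in> Y \<Longrightarrow> \<exists>w\<in>X. Y.nrm (b w - y) = 0 \<and> X.nrm w \<le> C * Y.nrm y"
    and pos: "M \<ge> 0" "C \<ge> 0"
begin

definition solves :: "('v \<Rightarrow> real) \<Rightarrow> 'y \<Rightarrow> 'v \<Rightarrow> 'y \<Rightarrow> bool" where
  "solves F h v p \<longleftrightarrow> v \<in> X \<and> p \<in> Y \<and> (\<forall>w\<in>X. a v w - ipY p (b w) = F w) \<and>
     (\<forall>y\<in>Y. ipY (b v) y = ipY h y)"

lemma b_diff: "v \<in> X \<Longrightarrow> w \<in> X \<Longrightarrow> b (v - w) = b v - b w"
  using b_add[of v "(-1) *\<^sub>R w"] b_scale[of w "-1"] X.memI(2)[of w "-1"] by simp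

lemma a_nrm: "v \<in> X \<Longrightarrow> a.nrm v \<le> sqrt M * X.nrm v"
  using real_sqrt_le_mono[OF a_bdd] by (simp add: a.nrm_def X.nrm_def real_sqrt_mult)

text \<open>The diagonal bound \<open>a_bdd\<close> extends to all pairs by the Cauchy-Schwarz
  inequality of the semi-inner product \<open>a\<close> itself.\<close>

lemma a_le:
  assumes "v \<in> X" "w \<in> X"
  shows "\<bar>a v w\<bar> \<le> M * X.nrm v * X.nrm w"
proof -
  have "\<bar>a v w\<bar> \<le> a.nrm v * a.nrm w" using assms by (rule a.Cauchy_Schwarz)
  also have "\<dots> \<le> (sqrt M * X.nrm v) * (sqrt M * X.nrm w)"
    using assms pos by (intro mult_mono a_nrm) auto
  also have "\<dots> = (sqrt M * sqrt M) * X.nrm v * X.nrm w" by (simp only: ac_simps)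
  finally show ?thesis using pos by simp
qed

text \<open>The augmented form is equivalent to \<open>ipX\<close>: \<open>coercive\<close> bounds
  it from below, and \<open>a_bdd\<close> and \<open>b_bdd\<close> from above, whence the factor 2 *
  M. Completeness is carried over along this equivalence.\<close>

sublocale E: semi_hilbert X "\<lambda>v w. a v w + ipY (b v) (b w)"
proof
  show "subspace X" by (rule X.subspace)
  let ?E = "\<lambda>v w. a v w + ipY (b v) (b w)"
  fix s :: "nat \<Rightarrow> 'v" assume s: "\<And>n. s n \<in> X"
    and cau: "\<And>e. e > 0 \<Longrightarrow> \<exists>N. \<forall>m\<ge>N. \<forall>n\<ge>N. ?E (s m - s n) (s m - s n) < e"
  have "\<exists>N. \<forall>m\<ge>N. \<forall>n\<ge>N. ipX (s m - s n) (s m - s n) < e" if e: "e > 0" for e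
  proof -
    obtain N where N: "\<forall>m\<ge>N. \<forall>n\<ge>N. ?E (s m - s n) (s m - s n) < k * e"
      using cau[OF mult_pos_pos[OF k_pos e]] by (rule exE)
    have "ipX (s m - s n) (s m - s n) < e" if "m \<ge> N" "n \<ge> N" for m n
    proof -
      have "k * ipX (s m - s n) (s m - s n) < k * e"
        by (rule le_less_trans[OF coercive N[rule_format, OF that]]) (simp add: s X.memI)
      then show ?thesis using k_pos by simp
    qed
    then show ?thesis by blast
  qed
  then obtain u where u: "u \<in> X" and lim: "(\<lambda>n. ipX (s n - u) (s n - u)) \<longlonglongrightarrow> 0"
    using X.complete[of s, OF s] by metis
  have "(\<lambda>n. 2 * M * ipX (s n - u) (s n - u)) \<longlonglongrightarrow> 0"
    using tendsto_mult_right_zero[OF lim] by blast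
  then have "(\<lambda>n. ?E (s n - u) (s n - u)) \<longlonglongrightarrow> 0"
  proof (rule Lim_null_comparison[rotated])
    have "norm (?E (s n - u) (s n - u)) \<le> 2 * M * ipX (s n - u) (s n - u)" for n
      using a_bdd[of "s n - u"] b_bdd[of "s n - u"] a.nonneg[of "s n - u"] Y.nonneg[OF b_mem, of "s n - u"]
        s u X.memI(3)[of "s n" u] by simp
    then show "\<forall>\<^sub>F n in sequentially. norm (?E (s n - u) (s n - u)) \<le> 2 * M * ipX (s n - u) (s n - u)"
      by simp
  qed
  with u show "\<exists>u\<in>X. (\<lambda>n. ?E (s n - u) (s n - u)) \<longlonglongrightarrow> 0" by blast
next
  fix x y assume xy: "x \<in> X" "y \<in> X"
  show "a x y + ipY (b x) (b y) = a y x + ipY (b y) (b x)"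
    using a.commute[OF xy] Y.commute[of "b x" "b y"] b_mem xy by simp
qed (simp_all add: b_add b_scale X.memI b_mem a.add_left Y.add_left a.scale_left Y.scale_left
    distrib_left a.nonneg Y.nonneg)

text \<open>The kernel modulo null vectors. Exact vanishing of \<open>b v\<close> would be too
  strict, because two preimages of the same datum provided by \<open>b_surj\<close> differ by a
  field whose image is merely null.\<close>

definition K :: "'v set" where
  "K = {v \<in> X. Y.nrm (b v) = 0}"

lemma K_subspace: "subspace K"
proof (rule subspaceI)
  have "b 0 = 0" using b_scale[of 0 0] X.memI(4) by simp
  then show "0 \<in> K" using X.memI(4) Y.nrm_scale[OF Y.memI(4), of 0] by (simp add: K_def)
next
  fix v w assume vw: "v \<in> K" "w \<in> K"
  then have "Y.nrm (b v + b w) \<le> 0"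
    using Y.nrm_triangle[of "b v" "b w"] by (simp add: K_def b_mem)
  then show "v + w \<in> K"
    using vw Y.nrm_nonneg[OF b_mem, of "v + w"] by (simp add: K_def X.memI b_add)
next
  fix c v assume "v \<in> K"
  then show "c *\<^sub>R v \<in> K" by (simp add: K_def X.memI b_scale Y.nrm_scale b_mem)
qed

text \<open>A preimage \<open>v0\<close> of the constraint datum is split off and the rest is found
  in the kernel by the Riesz theorem for the augmented form. The residual a v - F then vanishes on
  the kernel, so it factors through \<open>b\<close>; a second Riesz representation, now in
  \<open>Y\<close>, gives the pressure.\<close>

lemma solves_exists:
  assumes F: "\<And>v w. v \<in> X \<Longrightarrow> w \<in> X \<Longrightarrow> F (v + w) = F v + F w"
      "\<And>r v. v \<in> X \<Longrightarrow> F (r *\<^sub>R v) = r * F v"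
    and Fb: "\<And>v. v \<in> X \<Longrightarrow> \<bar>F v\<bar> \<le> c * X.nrm v" and c: "0 \<le> c" and h: "h \<in> Y"
  shows "\<exists>v p. solves F h v p"
proof -
  obtain v0 where v0: "v0 \<in> X" "Y.nrm (b v0 - h) = 0" using b_surj[OF h] by blast
  have KX: "v \<in> X" if "v \<in> K" for v using that by (simp add: K_def)
  \<comment> \<open>Bound for F - a v0 on the kernel relative to \<open>E.nrm\<close>; the division
    by sqrt k is the cost of replacing \<open>X.nrm\<close> by \<open>E.nrm\<close>.\<close>
  define L where "L = (c + M * X.nrm v0) / sqrt k"
  have Enrm: "X.nrm v \<le> E.nrm v / sqrt k" if "v \<in> X" for v
  proof -
    have "sqrt k * X.nrm v \<le> E.nrm v"
      using real_sqrt_le_mono[OF coercive[OF that]] by (simp add: X.nrm_def E.nrm_def real_sqrt_mult)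
    then show ?thesis using k_pos by (simp add: field_simps)
  qed
  have "\<exists>u\<in>X. (\<forall>d\<in>K. a u d + ipY (b u) (b d) = F d - a v0 d) \<and> E.nrm u \<le> L \<and>
    (\<exists>s. (\<forall>n. s n \<in> K) \<and> (\<lambda>n. E.nrm (s n - u)) \<longlonglongrightarrow> 0)"
  proof (rule E.riesz)
    show "subspace K" by (rule K_subspace)
    show "0 \<le> L" using c k_pos pos v0 by (simp add: L_def)
    fix d assume d: "d \<in> K"
    have "\<bar>F d - a v0 d\<bar> \<le> c * X.nrm d + M * X.nrm v0 * X.nrm d"
      using Fb[of d] a_le[of v0 d] KX[OF d] v0 by linarith
    also have "\<dots> = (c + M * X.nrm v0) * X.nrm d" by (simp add: algebra_simps)
    also have "\<dots> \<le> (c + M * X.nrm v0) * (E.nrm d / sqrt k)"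
      using c pos v0 Enrm[OF KX[OF d]] by (intro mult_left_mono) auto
    finally show "\<bar>F d - a v0 d\<bar> \<le> L * E.nrm d" by (simp add: L_def)
  qed (simp_all add: KX F a.add_right a.scale_right v0 right_diff_distrib)
  then obtain u s where u: "u \<in> X" and uK: "\<And>d. d \<in> K \<Longrightarrow> a u d + ipY (b u) (b d) = F d - a v0 d"
    and s: "\<And>n. s n \<in> K" and lim: "(\<lambda>n. E.nrm (s n - u)) \<longlonglongrightarrow> 0"
    by blast
  \<comment> \<open>The Riesz vector is only a limit of elements of \<open>K\<close>. As
    \<open>b (s n)\<close> is null and the augmented norm dominates the norm of \<open>b\<close>,
    the image \<open>b u\<close> is null too.\<close>
  have "Y.nrm (b u) \<le> E.nrm (s n - u)" for n
  proof -
    have su: "s n - u \<in> X" using s u KX X.memI by blast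
    have "Y.nrm (b u) = Y.nrm (b (s n - u))"
    proof -
      have "Y.nrm (b u) \<le> Y.nrm (b (s n)) + Y.nrm (b u - b (s n))"
        using Y.nrm_diff_triangle[of "b u" "b (s n)"] s u KX b_mem by auto
      moreover have "Y.nrm (b (s n - u)) \<le> Y.nrm (b (s n)) + Y.nrm (b u)"
        using Y.nrm_triangle[of "b (s n)" "(-1) *\<^sub>R b u"] Y.nrm_scale[of "b u" "-1"] s u KX b_mem
          Y.memI(2)[of "b u" "-1"] by (simp add: b_diff)
      ultimately show ?thesis
        using s[of n] u KX[OF s] Y.nrm_minus_commute[of "b u" "b (s n)"] b_mem
        by (simp add: K_def b_diff)
    qed
    also have "\<dots> \<le> E.nrm (s n - u)"
      unfolding Y.nrm_def E.nrm_def using a.nonneg[OF su] by simp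
    finally show ?thesis .
  qed
  then have "Y.nrm (b u) \<le> 0"
    using LIMSEQ_le_const[OF lim] by blast
  then have bu: "Y.nrm (b u) = 0" using Y.nrm_nonneg[OF b_mem[OF u]] by linarith
  define v where "v = u + v0"
  have v: "v \<in> X" by (simp add: v_def u v0 X.memI)
  have vK: "a v d = F d" if d: "d \<in> K" for d
    using uK[OF d] Y.B_null(1)[OF b_mem[OF u] b_mem[OF KX[OF d]] bu] KX[OF d] u v0
    by (simp add: v_def a.add_left)
  \<comment> \<open>A pointwise choice of preimages, in general not linear. Its composition with the
    residual \<open>G\<close> below is linear nevertheless, since \<open>G\<close> takes equal
    values on fields whose images differ by a null vector.\<close>
  define E' where "E' y = (SOME w. w \<in> X \<and> Y.nrm (b w - y) = 0 \<and> X.nrm w \<le> C * Y.nrm y)" for y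
  have E': "E' y \<in> X" "Y.nrm (b (E' y) - y) = 0" "X.nrm (E' y) \<le> C * Y.nrm y" if "y \<in> Y" for y
    using someI_ex[of "\<lambda>w. w \<in> X \<and> Y.nrm (b w - y) = 0 \<and> X.nrm w \<le> C * Y.nrm y"] b_surj[OF that]
    unfolding E'_def[symmetric] by blast+
  define G where "G w = a v w - F w" for w
  have Gadd: "G (x + y) = G x + G y" if "x \<in> X" "y \<in> X" for x y
    using that v by (simp add: G_def a.add_right F)
  have Gscale: "G (r *\<^sub>R x) = r * G x" if "x \<in> X" for x r
    using that v by (simp add: G_def a.scale_right F algebra_simps)
  have Gnull: "G x = G y" if "x \<in> X" "y \<in> X" "Y.nrm (b x - b y) = 0" for x y
  proof -
    have "x - y \<in> K" using that by (simp add: K_def X.memI b_diff)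
    then have "G (x - y) = 0" using vK by (simp add: G_def)
    then show ?thesis using Gadd[of "x - y" y] that X.memI by simp
  qed
  have null_close: "Y.nrm (x - z) = 0" if "x \<in> Y" "y \<in> Y" "z \<in> Y" "Y.nrm (x - y) = 0" "Y.nrm (z - y) = 0" for x y z
  proof -
    have "Y.nrm ((x - y) + (y - z)) \<le> Y.nrm (x - y) + Y.nrm (y - z)"
      using that by (intro Y.nrm_triangle Y.memI)
    then show ?thesis using that Y.nrm_minus_commute[of z y] Y.nrm_nonneg[OF Y.memI(3), of x z] by simp
  qed
  have GE_eq: "G (E' y) = G w" if "y \<in> Y" "w \<in> X" "Y.nrm (b w - y) = 0" for y w
    by (rule Gnull[OF E'(1)[OF that(1)] that(2)], rule null_close[of _ y])
      (simp_all add: that E' b_mem)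
  define N where "N = (M * X.nrm v + c) * C"
  have GE: "\<bar>G (E' y)\<bar> \<le> N * Y.nrm y" if y: "y \<in> Y" for y
  proof -
    have "\<bar>G (E' y)\<bar> \<le> M * X.nrm v * X.nrm (E' y) + c * X.nrm (E' y)"
      using a_le[of v "E' y"] Fb[of "E' y"] E'(1)[OF y] v unfolding G_def by linarith
    also have "\<dots> = (M * X.nrm v + c) * X.nrm (E' y)" by (simp add: algebra_simps)
    also have "\<dots> \<le> (M * X.nrm v + c) * (C * Y.nrm y)"
      using E'(3)[OF y] pos c v by (intro mult_left_mono) auto
    finally show ?thesis by (simp add: N_def)
  qed
  \<comment> \<open>The representing vector of the residual, seen as a functional of the divergence,
    is the pressure.\<close>
  have "\<exists>p\<in>Y. (\<forall>y\<in>Y. ipY p y = G (E' y)) \<and> Y.nrm p \<le> N \<and>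
    (\<exists>s. (\<forall>n. s n \<in> Y) \<and> (\<lambda>n. Y.nrm (s n - p)) \<longlonglongrightarrow> 0)"
  proof (rule Y.riesz)
    show "0 \<le> N" using pos c v by (simp add: N_def)
    fix y z assume yz: "y \<in> Y" "z \<in> Y"
    have "Y.nrm (b (E' y) + b (E' z) - (y + z)) \<le> Y.nrm (b (E' y) - y) + Y.nrm (b (E' z) - z)"
      using Y.nrm_triangle[of "b (E' y) - y" "b (E' z) - z"] yz E' b_mem Y.memI by (simp add: algebra_simps)
    also have "\<dots> = 0" using E'(2) yz by simp
    finally have "Y.nrm (b (E' y) + b (E' z) - (y + z)) \<le> 0" .
    moreover have "b (E' y) + b (E' z) - (y + z) \<in> Y" by (intro Y.memI b_mem E' yz)
    ultimately have "Y.nrm (b (E' y) + b (E' z) - (y + z)) = 0"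
      using Y.nrm_nonneg order_antisym by blast
    then have "G (E' (y + z)) = G (E' y + E' z)"
      using yz E' by (intro GE_eq) (simp_all add: X.memI Y.memI b_add)
    then show "G (E' (y + z)) = G (E' y) + G (E' z)" using yz E' Gadd by simp
  next
    fix r y assume y: "y \<in> Y"
    have "Y.nrm (r *\<^sub>R b (E' y) - r *\<^sub>R y) = 0"
      using y E' Y.nrm_scale[of "b (E' y) - y" r] b_mem Y.memI by (simp add: scaleR_diff_right)
    then have "G (E' (r *\<^sub>R y)) = G (r *\<^sub>R E' y)"
      using y E' by (intro GE_eq) (simp_all add: X.memI Y.memI b_scale)
    then show "G (E' (r *\<^sub>R y)) = r * G (E' y)" using y E' Gscale by simp
  qed (simp_all add: Y.subspace GE)
  then obtain p where p: "p \<in> Y" and pr: "\<And>y. y \<in> Y \<Longrightarrow> ipY p y = G (E' y)" by blast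
  have "solves F h v p"
    unfolding solves_def
  proof (intro conjI ballI v p)
    fix w assume w: "w \<in> X"
    have "G (E' (b w)) = G w" using E' w b_mem by (intro Gnull) auto
    then show "a v w - ipY p (b w) = F w" using pr[OF b_mem[OF w]] by (simp add: G_def)
  next
    fix y assume y: "y \<in> Y"
    have "ipY (b v) y = ipY (b u) y + (ipY (b v0 - h) y + ipY h y)"
      using u v0 y h b_mem by (simp add: v_def b_add Y.add_left Y.diff_left)
    then show "ipY (b v) y = ipY h y"
      using Y.B_null(1)[OF _ y] bu v0 b_mem u h Y.memI(3) by simp
  qed
  then show ?thesis by blast
qed

text \<open>Subtracting a bounded preimage of \<open>h\<close> leaves a field in the kernel; testing
  with it removes the pressure, and coercivity bounds it. The pressure is then tested with a field
  whose divergence it is. With F and h zero this is also the uniqueness statement.\<close>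

lemma solves_bound:
  assumes sol: "solves F h v p" and Fb: "\<And>v. v \<in> X \<Longrightarrow> \<bar>F v\<bar> \<le> c * X.nrm v"
    and c: "0 \<le> c" and h: "h \<in> Y"
  shows "X.nrm v \<le> (c + (M + k) * C * Y.nrm h) / k" "Y.nrm p \<le> C * (M * X.nrm v + c)"
proof -
  have v: "v \<in> X" and p: "p \<in> Y" and eq1: "\<And>w. w \<in> X \<Longrightarrow> a v w - ipY p (b w) = F w"
    and eq2: "\<And>y. y \<in> Y \<Longrightarrow> ipY (b v) y = ipY h y"
    using sol by (auto simp: solves_def)
  obtain v0 where v0: "v0 \<in> X" "Y.nrm (b v0 - h) = 0" "X.nrm v0 \<le> C * Y.nrm h" using b_surj[OF h] by blast
  define u where "u = v - v0"
  have u: "u \<in> X" by (simp add: u_def v v0 X.memI)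
  have z: "ipY (b u) y = 0" if y: "y \<in> Y" for y
  proof -
    have "ipY (b u) y = ipY (b v) y - (ipY (b v0 - h) y + ipY h y)"
      using v v0 y h b_mem by (simp add: u_def b_diff Y.diff_left)
    then show ?thesis using Y.B_null(1)[OF _ y, of "b v0 - h"] eq2[OF y] v0 b_mem h Y.memI(3) by simp
  qed
  \<comment> \<open>\<open>b u\<close> is orthogonal to all of \<open>Y\<close>, in particular to
    itself, so the divergence term of the augmented form drops out.\<close>
  have "k * ipX u u \<le> a u u" using coercive[OF u] z[OF b_mem[OF u]] by simp
  also have "\<dots> = F u + ipY p (b u) - a v0 u"
    using eq1[OF u] u v v0 a.diff_left[of v v0 u] by (simp add: u_def)
  also have "\<dots> = F u - a v0 u" using z[OF p] Y.commute[OF p b_mem[OF u]] by simp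
  also have "\<dots> \<le> c * X.nrm u + M * X.nrm v0 * X.nrm u"
    using Fb[OF u] a_le[OF v0(1) u] by linarith
  finally have "(k * X.nrm u) * X.nrm u \<le> (c + M * X.nrm v0) * X.nrm u"
    using X.nrm_sq[OF u] by (simp add: algebra_simps power2_eq_square)
  then have "k * X.nrm u \<le> c + M * X.nrm v0"
    using X.nrm_nonneg[OF u] X.nrm_nonneg[OF v0(1)] c pos k_pos
    by (cases "X.nrm u = 0") (auto simp: mult_le_cancel_right)
  moreover have "X.nrm v \<le> X.nrm v0 + X.nrm u"
    using X.nrm_diff_triangle[OF v v0(1)] by (simp add: u_def)
  then have "k * X.nrm v \<le> k * (X.nrm v0 + X.nrm u)" using k_pos by (intro mult_left_mono) auto
  moreover have "(M + k) * X.nrm v0 \<le> (M + k) * (C * Y.nrm h)"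
    using v0(3) pos k_pos by (intro mult_left_mono) auto
  ultimately have "k * X.nrm v \<le> c + (M + k) * C * Y.nrm h" by (simp add: algebra_simps)
  then show "X.nrm v \<le> (c + (M + k) * C * Y.nrm h) / k" using k_pos by (simp add: field_simps)
  \<comment> \<open>A velocity field whose divergence is the pressure itself, up to a null
    vector.\<close>
  obtain w where w: "w \<in> X" "Y.nrm (b w - p) = 0" "X.nrm w \<le> C * Y.nrm p" using b_surj[OF p] by blast
  have "ipY p p = ipY p (b w) - ipY p (b w - p)" using p b_mem[OF w(1)] by (simp add: Y.diff_right)
  also have "\<dots> = a v w - F w"
    using eq1[OF w(1)] Y.B_null(2)[OF _ p w(2)] p b_mem[OF w(1)] Y.memI(3) by simp
  also have "\<dots> \<le> (M * X.nrm v + c) * X.nrm w"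
    using a_le[OF v w(1)] Fb[OF w(1)] by (simp add: algebra_simps)
  also have "\<dots> \<le> (M * X.nrm v + c) * (C * Y.nrm p)"
    using w(3) pos c v by (intro mult_left_mono) auto
  finally have "Y.nrm p * Y.nrm p \<le> (C * (M * X.nrm v + c)) * Y.nrm p"
    using Y.nrm_sq[OF p] by (simp add: power2_eq_square algebra_simps)
  then show "Y.nrm p \<le> C * (M * X.nrm v + c)"
    using Y.nrm_nonneg[OF p] X.nrm_nonneg[OF v] c pos
    by (cases "Y.nrm p = 0") (auto simp: mult_le_cancel_right)
qed

end

section \<open>The space of square-integrable functions\<close>

definition l2ip :: "'e::euclidean_space set \<Rightarrow> ('e \<Rightarrow> 'b::euclidean_space) \<Rightarrow> ('e \<Rightarrow> 'b) \<Rightarrow> real" where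
  "l2ip U u v = (\<integral>x. u x \<bullet> v x \<partial>lebesgue_on U)"

lemma L2_measurable: "L2 U u \<Longrightarrow> u \<in> borel_measurable (lebesgue_on U)"
  by (simp add: L2_def)

lemma L2_integrable_inner:
  assumes "L2 U u" "L2 U v"
  shows "integrable (lebesgue_on U) (\<lambda>x. u x \<bullet> v x)"
proof (rule Bochner_Integration.integrable_bound)
  show "integrable (lebesgue_on U) (\<lambda>x. (norm (u x))\<^sup>2 + (norm (v x))\<^sup>2)"
    using assms by (auto simp: L2_def)
  show "(\<lambda>x. u x \<bullet> v x) \<in> borel_measurable (lebesgue_on U)"
    using assms by (intro borel_measurable_inner) (simp_all add: L2_def)
  have "\<bar>u x \<bullet> v x\<bar> \<le> (norm (u x))\<^sup>2 + (norm (v x))\<^sup>2" for x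
    using Cauchy_Schwarz_ineq2[of "u x" "v x"] sum_squares_bound[of "norm (u x)" "norm (v x)"]
      mult_nonneg_nonneg[OF norm_ge_zero[of "u x"] norm_ge_zero[of "v x"]] by linarith
  then show "AE x in lebesgue_on U. norm (u x \<bullet> v x) \<le> norm ((norm (u x))\<^sup>2 + (norm (v x))\<^sup>2)"
    by simp
qed

lemma L2_real_integrable_mult:
  fixes u v :: "'e::euclidean_space \<Rightarrow> real"
  shows "L2 U u \<Longrightarrow> L2 U v \<Longrightarrow> integrable (lebesgue_on U) (\<lambda>x. u x * v x)"
  using L2_integrable_inner[of U u v] by simp

lemma L2_scaleR:
  assumes "L2 U u"
  shows "L2 U (\<lambda>x. r *\<^sub>R u x)"
proof -
  have "(\<lambda>x. (norm (r *\<^sub>R u x))\<^sup>2) = (\<lambda>x. r\<^sup>2 * (norm (u x))\<^sup>2)" by (simp add: power_mult_distrib)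
  then show ?thesis using assms unfolding L2_def by (auto intro!: borel_measurable_scaleR)
qed

lemma L2_add:
  assumes "L2 U u" "L2 U v"
  shows "L2 U (\<lambda>x. u x + v x)"
proof -
  have "(\<lambda>x. (norm (u x + v x))\<^sup>2) = (\<lambda>x. (norm (u x))\<^sup>2 + 2 * (u x \<bullet> v x) + (norm (v x))\<^sup>2)"
    by (simp add: power2_norm_eq_inner inner_add inner_commute fun_eq_iff)
  then show ?thesis using assms L2_integrable_inner[OF assms] unfolding L2_def
    by (auto intro!: borel_measurable_add)
qed

lemma L2_zero: "L2 U (\<lambda>x. 0)"
  by (simp add: L2_def)

lemma L2_minus: "L2 U u \<Longrightarrow> L2 U (\<lambda>x. - u x)"
  using L2_scaleR[of U u "-1"] by simp

lemma L2_diff: "L2 U u \<Longrightarrow> L2 U v \<Longrightarrow> L2 U (\<lambda>x. u x - v x)"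
  using L2_add[OF _ L2_minus, of U u v] by simp

lemma L2_sum: "(\<And>i. i \<in> I \<Longrightarrow> L2 U (u i)) \<Longrightarrow> L2 U (\<lambda>x. \<Sum>i\<in>I. u i x)"
  by (induction I rule: infinite_finite_induct) (auto simp: L2_zero L2_add)

lemma L2_cong_AE:
  assumes "L2 U u" "v \<in> borel_measurable (lebesgue_on U)" "AE x in lebesgue_on U. u x = v x"
  shows "L2 U v"
proof -
  have "integrable (lebesgue_on U) (\<lambda>x. (norm (v x))\<^sup>2)"
    by (rule integrable_cong_AE_imp[of _ "\<lambda>x. (norm (u x))\<^sup>2"]) (use assms in \<open>auto simp: L2_def\<close>)
  then show ?thesis using assms by (simp add: L2_def)
qed

lemma L2_bounded:
  fixes u :: "'e::euclidean_space \<Rightarrow> 'b::euclidean_space" and v :: "'e \<Rightarrow> 'c::euclidean_space"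
  assumes "L2 U u" "v \<in> borel_measurable (lebesgue_on U)"
    "AE x in lebesgue_on U. norm (v x) \<le> C * norm (u x)"
  shows "L2 U v"
proof -
  have "integrable (lebesgue_on U) (\<lambda>x. (norm (v x))\<^sup>2)"
  proof (rule Bochner_Integration.integrable_bound)
    show "integrable (lebesgue_on U) (\<lambda>x. C\<^sup>2 * (norm (u x))\<^sup>2)" using assms by (simp add: L2_def)
    show "AE x in lebesgue_on U. norm ((norm (v x))\<^sup>2) \<le> norm (C\<^sup>2 * (norm (u x))\<^sup>2)"
      using assms(3)
    proof eventually_elim
      case (elim x)
      then have "(norm (v x))\<^sup>2 \<le> (C * norm (u x))\<^sup>2" by (intro power_mono) auto
      then show ?case by (simp add: power_mult_distrib)
    qed
  qed (use assms(2) in measurable)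
  then show ?thesis using assms by (simp add: L2_def)
qed

lemma L2_inner_const: "L2 U u \<Longrightarrow> L2 U (\<lambda>x. u x \<bullet> b)"
  by (rule L2_bounded[of U u _ "norm b"])
    (auto simp: L2_def mult.commute[of "norm b"] intro!: Cauchy_Schwarz_ineq2)

lemma L2_scaleR_const: "L2 U u \<Longrightarrow> L2 U (\<lambda>x. u x *\<^sub>R b)"
  by (rule L2_bounded[of U u _ "norm b"]) (auto simp: L2_def)

lemma l2norm_l2ip: "l2norm U u = sqrt (l2ip U u u)"
  by (simp add: l2norm_def l2ip_def power2_norm_eq_inner)

lemma l2norm_cong_AE:
  "u \<in> borel_measurable (lebesgue_on U) \<Longrightarrow> v \<in> borel_measurable (lebesgue_on U) \<Longrightarrow>
   AE x in lebesgue_on U. u x = v x \<Longrightarrow> l2norm U u = l2norm U v"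
  unfolding l2norm_def by (intro arg_cong[where f = sqrt] integral_cong_AE) auto

lemma l2norm_nonneg [simp]: "0 \<le> l2norm U u"
  by (simp add: l2norm_def)

lemma l2norm_zero [simp]: "l2norm U (\<lambda>x. 0) = 0"
  by (simp add: l2norm_def)

lemma l2norm_eq_0_AE:
  assumes "L2 U u" "l2norm U u = 0"
  shows "AE x in lebesgue_on U. u x = 0"
proof -
  have "AE x in lebesgue_on U. (norm (u x))\<^sup>2 = 0"
    by (rule integral_nonneg_eq_0_iff_AE[THEN iffD1]) (use assms in \<open>auto simp: L2_def l2norm_def\<close>)
  then show ?thesis by eventually_elim simp
qed

lemma l2norm_mono:
  fixes u :: "'e::euclidean_space \<Rightarrow> 'b::euclidean_space" and v :: "'e \<Rightarrow> 'c::euclidean_space"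
  assumes "L2 U u" "L2 U v" "AE x in lebesgue_on U. norm (v x) \<le> C * norm (u x)" "0 \<le> C"
  shows "l2norm U v \<le> C * l2norm U u"
proof -
  have "(\<integral>x. (norm (v x))\<^sup>2 \<partial>lebesgue_on U) \<le> (\<integral>x. C\<^sup>2 * (norm (u x))\<^sup>2 \<partial>lebesgue_on U)"
  proof (rule integral_mono_AE)
    show "AE x in lebesgue_on U. (norm (v x))\<^sup>2 \<le> C\<^sup>2 * (norm (u x))\<^sup>2"
      using assms(3)
    proof eventually_elim
      case (elim x)
      then have "(norm (v x))\<^sup>2 \<le> (C * norm (u x))\<^sup>2" by (intro power_mono) auto
      then show ?case by (simp add: power_mult_distrib)
    qed
  qed (use assms in \<open>auto simp: L2_def\<close>)
  then have "sqrt (\<integral>x. (norm (v x))\<^sup>2 \<partial>lebesgue_on U) \<le> sqrt (C\<^sup>2 * (\<integral>x. (norm (u x))\<^sup>2 \<partial>lebesgue_on U))"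
    by simp
  then show ?thesis using assms(4) by (simp add: l2norm_def real_sqrt_mult)
qed

section \<open>The semi-Hilbert structure of square-integrable functions\<close>

lemma L2_semi_inner: "semi_inner {u. L2 U u} (l2ip U)"
proof
  show "subspace {u. L2 U u}"
    by (rule subspaceI) (auto simp: plus_fun_def zero_fun_def scaleR_fun_def L2_zero L2_add L2_scaleR)
next
  fix x y z :: "'a \<Rightarrow> 'b" assume "x \<in> {u. L2 U u}" "y \<in> {u. L2 U u}" "z \<in> {u. L2 U u}"
  then show "l2ip U (x + y) z = l2ip U x z + l2ip U y z"
    by (simp add: l2ip_def inner_add_left L2_integrable_inner)
qed (simp_all add: l2ip_def inner_commute)

interpretation L2: semi_inner "{u. L2 U u}" "l2ip U" for U :: "'e::euclidean_space set"
  by (rule L2_semi_inner)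

lemma l2norm_nrm: "L2.nrm U = l2norm U"
  by (rule ext) (simp add: L2.nrm_def l2norm_l2ip)

lemma l2ip_bound:
  assumes "L2 U u" "L2 U v"
  shows "\<bar>\<integral>x. u x \<bullet> v x \<partial>lebesgue_on U\<bar> \<le> l2norm U u * l2norm U v"
  using L2.Cauchy_Schwarz[of u U v] assms by (simp add: l2norm_nrm l2ip_def)

(* Along a rapidly convergent subsequence, sum_n 4^n |s (r (n+1)) - s (r n)|^2 is integrable,
   which forces geometric convergence a.e.; Fatou then identifies the limit. *)
lemma L2_complete:
  fixes s :: "nat \<Rightarrow> 'e::euclidean_space \<Rightarrow> 'b::euclidean_space"
  assumes s: "\<And>n. L2 U (s n)"
    and cau: "\<And>e. e > 0 \<Longrightarrow> \<exists>N. \<forall>m\<ge>N. \<forall>n\<ge>N. l2ip U (s m - s n) (s m - s n) < e"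
  shows "\<exists>u. L2 U u \<and> (\<lambda>n. l2ip U (s n - u) (s n - u)) \<longlonglongrightarrow> 0"
proof -
  let ?M = "lebesgue_on U"
  define q where "q m n x = (norm (s m x - s n x))\<^sup>2" for m n x
  have meas [measurable]: "s n \<in> borel_measurable ?M" for n using s by (simp add: L2_def)
  have q_int: "integrable ?M (q m n)" for m n
    using L2_diff[OF s s, of m n] by (simp add: L2_def q_def[abs_def])
  have q_meas [measurable]: "q m n \<in> borel_measurable ?M" for m n
    by (rule borel_measurable_integrable[OF q_int])
  have ip: "l2ip U (s m - s n) (s m - s n) = (\<integral>x. q m n x \<partial>?M)" for m n
    by (simp add: l2ip_def q_def power2_norm_eq_inner)
  have nn: "(\<integral>\<^sup>+x. ennreal (q m n x) \<partial>?M) = ennreal (l2ip U (s m - s n) (s m - s n))" for m n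
    unfolding ip by (rule nn_integral_eq_integral[OF q_int]) (simp add: q_def)
  define N where "N e = (SOME N. \<forall>m\<ge>N. \<forall>n\<ge>N. l2ip U (s m - s n) (s m - s n) < e)" for e
  have N: "l2ip U (s m - s n) (s m - s n) < e" if "e > 0" "m \<ge> N e" "n \<ge> N e" for e m n
    using someI_ex[OF cau[OF that(1)]] that(2,3) unfolding N_def[symmetric] by blast
  \<comment> \<open>Summing the thresholds makes \<open>r\<close> monotone and at least the
    threshold for (1/8)^n; the summand n makes \<open>r n\<close> tend to infinity. Squared
    increments of size 8^-n, weighted with 4^n, leave the convergent series of 2^-n.\<close>
  define r where "r n = (\<Sum>k\<le>n. N ((1/8)^k)) + n" for n
  have r_ge: "N ((1/8)^n) \<le> r n" "n \<le> r n" for n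
    unfolding r_def by (auto intro!: trans_le_add1 member_le_sum)
  have r_Suc: "r n \<le> r (Suc n)" for n by (simp add: r_def)
  have small: "l2ip U (s (r (Suc n)) - s (r n)) (s (r (Suc n)) - s (r n)) \<le> (1/8)^n" for n
    using N[of "(1/8)^n" "r (Suc n)" "r n"] r_ge[of n] r_Suc[of n] by simp
  have "(\<integral>\<^sup>+x. (\<Sum>n. ennreal (4^n * q (r (Suc n)) (r n) x)) \<partial>?M)
      = (\<Sum>n. \<integral>\<^sup>+x. ennreal (4^n * q (r (Suc n)) (r n) x) \<partial>?M)"
    by (rule nn_integral_suminf) measurable
  also have "\<dots> \<le> (\<Sum>n. ennreal ((1/2)^n))"
  proof (rule suminf_le)
    fix n
    have "(\<integral>\<^sup>+x. ennreal (4^n * q (r (Suc n)) (r n) x) \<partial>?M) =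
        (\<integral>\<^sup>+x. ennreal (4^n) * ennreal (q (r (Suc n)) (r n) x) \<partial>?M)"
      by (simp add: ennreal_mult q_def)
    also have "\<dots> = ennreal (4^n) * ennreal (l2ip U (s (r (Suc n)) - s (r n)) (s (r (Suc n)) - s (r n)))"
      by (subst nn_integral_cmult) (simp_all add: nn)
    also have "\<dots> \<le> ennreal (4^n) * ennreal ((1/8)^n)"
      using small by (intro mult_left_mono ennreal_leI) auto
    also have "\<dots> = ennreal ((1/2)^n)"
      by (simp add: ennreal_mult'[symmetric] power_mult_distrib[symmetric])
    finally show "(\<integral>\<^sup>+x. ennreal (4^n * q (r (Suc n)) (r n) x) \<partial>?M) \<le> ennreal ((1/2)^n)" .
  qed auto
  also have "\<dots> < \<infinity>"
    by (subst suminf_ennreal2) (auto simp: summable_geometric)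
  finally have "AE x in ?M. (\<Sum>n. ennreal (4^n * q (r (Suc n)) (r n) x)) \<noteq> \<infinity>"
    by (intro nn_integral_PInf_AE) auto
  then have conv: "AE x in ?M. convergent (\<lambda>n. s (r n) x)"
  proof eventually_elim
    case (elim x)
    have summ: "summable (\<lambda>n. 4^n * q (r (Suc n)) (r n) x)"
      using elim by (intro summable_suminf_not_top) (auto simp: q_def)
    then have "(\<lambda>n. 4^n * q (r (Suc n)) (r n) x) \<longlonglongrightarrow> 0" by (rule summable_LIMSEQ_zero)
    then have "Bseq (\<lambda>n. 4^n * q (r (Suc n)) (r n) x)" using convergent_imp_Bseq convergentI by blast
    then obtain K where K: "K > 0" "\<And>n. norm (4^n * q (r (Suc n)) (r n) x) \<le> K"
      by (auto simp: Bseq_def)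
    have d: "norm (s (r (Suc n)) x - s (r n) x) \<le> sqrt K * (1/2)^n" for n
    proof -
      have "4^n * q (r (Suc n)) (r n) x \<le> K" using K(2)[of n] by simp
      then have "sqrt (4^n * q (r (Suc n)) (r n) x) \<le> sqrt K" by simp
      moreover have "sqrt (4^n * q (r (Suc n)) (r n) x) = 2^n * norm (s (r (Suc n)) x - s (r n) x)"
        by (simp add: q_def real_sqrt_mult real_sqrt_power)
      ultimately show ?thesis by (simp add: field_simps power_one_over)
    qed
    have "summable (\<lambda>n. s (r (Suc n)) x - s (r n) x)"
      by (rule summable_comparison_test'[where g = "\<lambda>n. sqrt K * (1/2)^n"])
        (use d in \<open>auto intro: summable_mult summable_geometric\<close>)
    then have "convergent (\<lambda>n. \<Sum>i<n. s (r (Suc i)) x - s (r i) x)"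
      by (simp add: summable_iff_convergent)
    then have "convergent (\<lambda>n. s (r n) x - s (r 0) x)"
      by (simp add: sum_lessThan_telescope[of "\<lambda>i. s (r i) x"])
    then show ?case by (simp add: convergent_diff_const_right_iff)
  qed
  define u where "u x = lim (\<lambda>n. s (r n) x)" for x
  have u_meas [measurable]: "u \<in> borel_measurable ?M"
    unfolding u_def by measurable
  have conv_u: "AE x in ?M. (\<lambda>n. s (r n) x) \<longlonglongrightarrow> u x"
    using conv by eventually_elim (simp add: u_def convergent_LIMSEQ_iff)
  \<comment> \<open>With m fixed, the Cauchy bound holds for \<open>s (r n)\<close> with all large
    n; Fatou's lemma passes it on to the pointwise limit.\<close>
  have fatou: "(\<integral>\<^sup>+x. ennreal ((norm (s m x - u x))\<^sup>2) \<partial>?M) \<le> ennreal e"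
    if e: "e > 0" and m: "m \<ge> N e" for e m
  proof -
    have "(\<integral>\<^sup>+x. ennreal ((norm (s m x - u x))\<^sup>2) \<partial>?M) = (\<integral>\<^sup>+x. liminf (\<lambda>n. ennreal (q m (r n) x)) \<partial>?M)"
    proof (rule nn_integral_cong_AE)
      show "AE x in ?M. ennreal ((norm (s m x - u x))\<^sup>2) = liminf (\<lambda>n. ennreal (q m (r n) x))"
        using conv_u
      proof eventually_elim
        case (elim x)
        then have "(\<lambda>n. ennreal (q m (r n) x)) \<longlonglongrightarrow> ennreal ((norm (s m x - u x))\<^sup>2)"
          unfolding q_def by (intro tendsto_intros)
        then show ?case using lim_imp_Liminf[OF trivial_limit_sequentially] by metis
      qed
    qed
    also have "\<dots> \<le> liminf (\<lambda>n. \<integral>\<^sup>+x. ennreal (q m (r n) x) \<partial>?M)"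
      by (rule nn_integral_liminf) measurable
    also have "\<dots> \<le> liminf (\<lambda>n. ennreal e)"
    proof (rule Liminf_mono)
      have "\<forall>n\<ge>N e. (\<integral>\<^sup>+x. ennreal (q m (r n) x) \<partial>?M) \<le> ennreal e"
      proof (intro allI impI)
        fix n assume "n \<ge> N e"
        then have "r n \<ge> N e" using r_ge(2)[of n] by linarith
        then show "(\<integral>\<^sup>+x. ennreal (q m (r n) x) \<partial>?M) \<le> ennreal e"
          unfolding nn using N[OF e m, of "r n"] by (intro ennreal_leI) simp
      qed
      then show "\<forall>\<^sub>F n in sequentially. (\<integral>\<^sup>+x. ennreal (q m (r n) x) \<partial>?M) \<le> ennreal e"
        unfolding eventually_sequentially by blast
    qed
    also have "\<dots> = ennreal e" by (simp add: Liminf_const)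
    finally show ?thesis .
  qed
  \<comment> \<open>One member of the sequence at finite distance from \<open>u\<close> is enough to
    place \<open>u\<close> in L2.\<close>
  have diff: "L2 U (\<lambda>x. s (N 1) x - u x)"
    unfolding L2_def
  proof
    show "integrable ?M (\<lambda>x. (norm (s (N 1) x - u x))\<^sup>2)"
    proof (rule integrableI_bounded)
      show "(\<integral>\<^sup>+x. ennreal (norm ((norm (s (N 1) x - u x))\<^sup>2)) \<partial>?M) < \<infinity>"
        using fatou[of 1 "N 1"] by (auto intro: le_less_trans)
    qed measurable
  qed measurable
  have u: "L2 U u" using L2_diff[OF s diff, of "N 1"] by simp
  have "(\<lambda>n. l2ip U (s n - u) (s n - u)) \<longlonglongrightarrow> 0"
  proof (rule LIMSEQ_I)
    fix e :: real assume e: "e > 0"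
    have "norm (l2ip U (s m - u) (s m - u) - 0) < e" if m: "m \<ge> N (e/2)" for m
    proof -
      have int: "integrable ?M (\<lambda>x. (norm (s m x - u x))\<^sup>2)"
        using L2_diff[OF s u, of m] by (simp add: L2_def)
      have "ennreal (\<integral>x. (norm (s m x - u x))\<^sup>2 \<partial>?M) \<le> ennreal (e/2)"
        using fatou[of "e/2" m] nn_integral_eq_integral[OF int] e m by simp
      then have "(\<integral>x. (norm (s m x - u x))\<^sup>2 \<partial>?M) \<le> e / 2" using e by (simp add: ennreal_le_iff)
      moreover have "l2ip U (s m - u) (s m - u) = (\<integral>x. (norm (s m x - u x))\<^sup>2 \<partial>?M)"
        by (simp add: l2ip_def power2_norm_eq_inner)
      moreover have "(\<integral>x. (norm (s m x - u x))\<^sup>2 \<partial>?M) \<ge> 0" by simp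
      ultimately show ?thesis using e by simp
    qed
    then show "\<exists>no. \<forall>n\<ge>no. norm (l2ip U (s n - u) (s n - u) - 0) < e" by blast
  qed
  with u show ?thesis by blast
qed

lemma L2_semi_hilbert: "semi_hilbert {u::'e::euclidean_space \<Rightarrow> 'b::euclidean_space. L2 U u} (l2ip U)"
proof (intro semi_hilbert.intro L2_semi_inner semi_hilbert_axioms.intro)
  fix s :: "nat \<Rightarrow> 'e \<Rightarrow> 'b"
  assume "\<And>n. s n \<in> {u. L2 U u}"
    and "\<And>e. e > 0 \<Longrightarrow> \<exists>N. \<forall>m\<ge>N. \<forall>n\<ge>N. l2ip U (s m - s n) (s m - s n) < e"
  then show "\<exists>u\<in>{u. L2 U u}. (\<lambda>n. l2ip U (s n - u) (s n - u)) \<longlonglongrightarrow> 0"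
    using L2_complete[of U s] by simp
qed

interpretation L2: semi_hilbert "{u. L2 U u}" "l2ip U" for U :: "'e::euclidean_space set"
  by (rule L2_semi_hilbert)

section \<open>Smooth functions and test functions\<close>

lemma pd_eq:
  assumes "(f has_derivative f') (at x)"
  shows "pd e f x = f' e"
  using frechet_derivative_at[OF assms] by (simp add: pd_def)

lemma has_derivative_pd:
  fixes f :: "'e::euclidean_space \<Rightarrow> 'b::real_normed_vector"
  assumes "f differentiable (at x)"
  shows "(f has_derivative (\<lambda>v. \<Sum>b\<in>Basis. (v \<bullet> b) *\<^sub>R pd b f x)) (at x)"
proof -
  obtain f' where f': "(f has_derivative f') (at x)" using assms by (auto simp: differentiable_def)
  have "f' v = (\<Sum>b\<in>Basis. (v \<bullet> b) *\<^sub>R pd b f x)" for v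
  proof -
    have "f' v = f' (\<Sum>b\<in>Basis. (v \<bullet> b) *\<^sub>R b)" by (simp add: euclidean_representation)
    also have "\<dots> = (\<Sum>b\<in>Basis. (v \<bullet> b) *\<^sub>R f' b)"
      using has_derivative_linear[OF f'] by (simp add: linear_sum linear_scale)
    finally show ?thesis by (simp add: pd_eq[OF f'])
  qed
  then have "f' = (\<lambda>v. \<Sum>b\<in>Basis. (v \<bullet> b) *\<^sub>R pd b f x)" by (rule ext)
  then show ?thesis using f' by simp
qed

text \<open>Each positive level of \<open>Ck\<close> asks for full differentiability, not merely for
  partial derivatives; this supplies the continuity at the bottom of the induction.\<close>

lemma Ck_Suc_imp_Ck:
  fixes f :: "'e::euclidean_space \<Rightarrow> 'b::real_normed_vector"
  shows "Ck (Suc k) UNIV f \<Longrightarrow> Ck k UNIV f"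
proof (induction k arbitrary: f)
  case 0
  then have "f differentiable (at x)" for x by simp
  then show ?case
    by (simp add: continuous_at_imp_continuous_on differentiable_imp_continuous_within)
next
  case (Suc k)
  then show ?case by (simp only: Ck.simps) blast
qed

lemma Ck_continuous:
  fixes f :: "'e::euclidean_space \<Rightarrow> 'b::real_normed_vector"
  shows "Ck k UNIV f \<Longrightarrow> continuous_on UNIV f"
  by (induction k) (simp, metis Ck_Suc_imp_Ck)

lemma Ck_const: "Ck k UNIV (\<lambda>x::'e::euclidean_space. c::'b::real_normed_vector)"
proof (induction k arbitrary: c)
  case (Suc k)
  have "pd e (\<lambda>x::'e. c) = (\<lambda>x. 0)" for e
    by (rule ext) (simp add: pd_eq[OF has_derivative_const])
  then show ?case using Suc.IH by simp
qed simp

lemma pd_add: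
  assumes "f differentiable (at x)" "g differentiable (at x)"
  shows "pd e (\<lambda>x. f x + g x) x = pd e f x + pd e g x"
proof -
  obtain f' g' where d: "(f has_derivative f') (at x)" "(g has_derivative g') (at x)"
    using assms by (auto simp: differentiable_def)
  show ?thesis by (simp only: pd_eq[OF has_derivative_add[OF d]] d[THEN pd_eq])
qed

lemma pd_scaleR:
  assumes "f differentiable (at x)"
  shows "pd e (\<lambda>x. r *\<^sub>R f x) x = r *\<^sub>R pd e f x"
proof -
  obtain f' where d: "(f has_derivative f') (at x)" using assms by (auto simp: differentiable_def)
  show ?thesis by (simp only: pd_eq[OF has_derivative_scaleR_right[OF d]] pd_eq[OF d])
qed

lemma pd_mult:
  fixes f g :: "'e::euclidean_space \<Rightarrow> real"
  assumes "f differentiable (at x)" "g differentiable (at x)"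
  shows "pd e (\<lambda>x. f x * g x) x = f x * pd e g x + pd e f x * g x"
proof -
  obtain f' g' where d: "(f has_derivative f') (at x)" "(g has_derivative g') (at x)"
    using assms by (auto simp: differentiable_def)
  show ?thesis by (simp only: pd_eq[OF has_derivative_mult[OF d]] d[THEN pd_eq])
qed

lemma Ck_add:
  fixes f g :: "'e::euclidean_space \<Rightarrow> 'b::real_normed_vector"
  shows "Ck k UNIV f \<Longrightarrow> Ck k UNIV g \<Longrightarrow> Ck k UNIV (\<lambda>x. f x + g x)"
proof (induction k arbitrary: f g)
  case (Suc k)
  then have "pd e (\<lambda>x. f x + g x) = (\<lambda>x. pd e f x + pd e g x)" for e
    by (intro ext pd_add) auto
  then show ?case using Suc by auto
qed (simp add: continuous_on_add)

lemma Ck_scaleR: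
  fixes f :: "'e::euclidean_space \<Rightarrow> 'b::real_normed_vector"
  shows "Ck k UNIV f \<Longrightarrow> Ck k UNIV (\<lambda>x. r *\<^sub>R f x)"
proof (induction k arbitrary: f)
  case (Suc k)
  then have "pd e (\<lambda>x. r *\<^sub>R f x) = (\<lambda>x. r *\<^sub>R pd e f x)" for e
    by (intro ext pd_scaleR) auto
  then show ?case using Suc by auto
qed (simp add: continuous_on_scaleR)

lemma Ck_sum:
  fixes f :: "'i \<Rightarrow> 'e::euclidean_space \<Rightarrow> 'b::real_normed_vector"
  shows "(\<And>i. i \<in> I \<Longrightarrow> Ck k UNIV (f i)) \<Longrightarrow> Ck k UNIV (\<lambda>x. \<Sum>i\<in>I. f i x)"
  by (induction I rule: infinite_finite_induct) (auto simp: Ck_const Ck_add)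

lemma Ck_mult:
  fixes f g :: "'e::euclidean_space \<Rightarrow> real"
  shows "Ck k UNIV f \<Longrightarrow> Ck k UNIV g \<Longrightarrow> Ck k UNIV (\<lambda>x. f x * g x)"
proof (induction k arbitrary: f g)
  case (Suc k)
  then have "pd e (\<lambda>x. f x * g x) = (\<lambda>x. f x * pd e g x + pd e f x * g x)" for e
    by (intro ext pd_mult) auto
  then show ?case using Suc Ck_Suc_imp_Ck[OF Suc.prems(1)] Ck_Suc_imp_Ck[OF Suc.prems(2)]
    by (auto intro!: Ck_add differentiable_mult)
qed (simp add: continuous_on_mult)

lemma pd_affine:
  fixes f :: "'f::euclidean_space \<Rightarrow> 'b::real_normed_vector" and A :: "'e::euclidean_space \<Rightarrow> 'f"
  assumes "f differentiable (at (A x + c))" "linear A"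
  shows "pd e (\<lambda>x. f (A x + c)) x = (\<Sum>b\<in>Basis. (A e \<bullet> b) *\<^sub>R pd b f (A x + c))"
    "(\<lambda>x. f (A x + c)) differentiable (at x)"
proof -
  have A: "((\<lambda>x. A x + c) has_derivative A) (at x)"
    using linear_imp_has_derivative[OF assms(2)] by (auto intro!: derivative_eq_intros)
  have "((\<lambda>x. f (A x + c)) has_derivative (\<lambda>v. \<Sum>b\<in>Basis. (A v \<bullet> b) *\<^sub>R pd b f (A x + c))) (at x)"
    by (rule has_derivative_compose[OF A has_derivative_pd[OF assms(1)]])
  then show "pd e (\<lambda>x. f (A x + c)) x = (\<Sum>b\<in>Basis. (A e \<bullet> b) *\<^sub>R pd b f (A x + c))"
    "(\<lambda>x. f (A x + c)) differentiable (at x)"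
    by (rule pd_eq, auto simp: differentiable_def)
qed

text \<open>By the chain rule the partial derivatives of the composition are linear combinations of
  compositions of the same kind, so the induction closes. Translations, slices and coordinate
  projections are all instances.\<close>

lemma Ck_affine:
  fixes f :: "'f::euclidean_space \<Rightarrow> 'b::real_normed_vector" and A :: "'e::euclidean_space \<Rightarrow> 'f"
  assumes A: "linear A"
  shows "Ck k UNIV f \<Longrightarrow> Ck k UNIV (\<lambda>x. f (A x + c))"
proof (induction k arbitrary: f)
  case 0
  then have "continuous_on UNIV f" by simp
  moreover have "continuous_on UNIV (\<lambda>x. A x + c)"
    using A by (intro continuous_intros linear_continuous_on linear_conv_bounded_linear[THEN iffD1])
  ultimately show ?case using continuous_on_compose2[of UNIV f UNIV "\<lambda>x. A x + c"] by simp
next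
  case (Suc k)
  then have d: "f differentiable (at y)" for y by simp
  have "pd e (\<lambda>x. f (A x + c)) = (\<lambda>x. \<Sum>b\<in>Basis. (A e \<bullet> b) *\<^sub>R pd b f (A x + c))" for e
    by (intro ext pd_affine(1) d A)
  then show ?case using Suc pd_affine(2)[OF d A] by (auto intro!: Ck_sum Ck_scaleR)
qed

lemma smooth_affine:
  fixes f :: "'f::euclidean_space \<Rightarrow> 'b::real_normed_vector" and A :: "'e::euclidean_space \<Rightarrow> 'f"
  shows "linear A \<Longrightarrow> smooth_on UNIV f \<Longrightarrow> smooth_on UNIV (\<lambda>x. f (A x + c))"
  by (simp add: smooth_on_def Ck_affine)

lemma smooth_mult:
  fixes f g :: "'e::euclidean_space \<Rightarrow> real"
  shows "smooth_on UNIV f \<Longrightarrow> smooth_on UNIV g \<Longrightarrow> smooth_on UNIV (\<lambda>x. f x * g x)"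
  by (simp add: smooth_on_def Ck_mult)

lemma smooth_const: "smooth_on UNIV (\<lambda>x::'e::euclidean_space. c::'b::real_normed_vector)"
  by (simp add: smooth_on_def Ck_const)

lemma smooth_prod:
  fixes f :: "'i \<Rightarrow> 'e::euclidean_space \<Rightarrow> real"
  shows "(\<And>i. i \<in> I \<Longrightarrow> smooth_on UNIV (f i)) \<Longrightarrow> smooth_on UNIV (\<lambda>x. \<Prod>i\<in>I. f i x)"
  by (induction I rule: infinite_finite_induct) (auto simp: smooth_const smooth_mult)

lemma smooth_differentiable:
  fixes f :: "'e::euclidean_space \<Rightarrow> 'b::real_normed_vector"
  shows "smooth_on UNIV f \<Longrightarrow> f differentiable (at x)"
  unfolding smooth_on_def using Ck.simps(2)[of 0 UNIV f] by blast

lemma smooth_pd: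
  fixes f :: "'e::euclidean_space \<Rightarrow> 'b::real_normed_vector"
  shows "smooth_on UNIV f \<Longrightarrow> e \<in> Basis \<Longrightarrow> smooth_on UNIV (pd e f)"
  unfolding smooth_on_def
proof
  fix k assume "\<forall>k. Ck k UNIV f" "e \<in> Basis"
  then have "Ck (Suc k) UNIV f" by blast
  then show "Ck k UNIV (pd e f)" using \<open>e \<in> Basis\<close> by simp
qed

lemma smooth_continuous:
  fixes f :: "'e::euclidean_space \<Rightarrow> 'b::real_normed_vector"
  shows "smooth_on UNIV f \<Longrightarrow> continuous_on UNIV f"
  unfolding smooth_on_def by (rule Ck_continuous[of 0]) (rule spec)

section \<open>Smooth bumps on boxes\<close>

text \<open>The standard flat function exp(-1/t) together with its quotients by powers of t.
  Admitting all powers closes the family under differentiation up to linear combinations, which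
  makes smoothness a plain induction.\<close>

definition flat_exp :: "nat \<Rightarrow> real \<Rightarrow> real" where
  "flat_exp k t = (if t > 0 then exp (- 1 / t) / t ^ k else 0)"

text \<open>From the right, the substitution of 1/t for t turns the claim into the decay of powers
  over the exponential at infinity; on the left the function is 0.\<close>

lemma flat_exp_tendsto_0: "(flat_exp k \<longlongrightarrow> 0) (at 0)"
proof -
  have "((\<lambda>t. exp (- 1 / t) / t ^ k) \<longlongrightarrow> 0) (at_right (0::real))"
  proof -
    have "((\<lambda>t. inverse t ^ k / exp (inverse t)) \<longlongrightarrow> 0) (at_right (0::real))"
      by (rule filterlim_compose[OF tendsto_power_div_exp_0 filterlim_inverse_at_top_right])
    moreover have "inverse t ^ k / exp (inverse t) = exp (- 1 / t) / t ^ k" for t :: real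
    proof -
      have "exp (- 1 / t) = inverse (exp (inverse t))"
        by (simp add: exp_minus[symmetric] divide_inverse)
      then show ?thesis by (simp add: divide_inverse power_inverse mult.commute)
    qed
    ultimately show ?thesis by simp
  qed
  then have "(flat_exp k \<longlongrightarrow> 0) (at_right 0)"
    by (rule tendsto_cong[THEN iffD1, rotated])
      (auto simp: flat_exp_def eventually_at_filter)
  moreover have "(flat_exp k \<longlongrightarrow> 0) (at_left 0)"
    by (rule tendsto_eventually) (auto simp: flat_exp_def eventually_at_filter)
  ultimately show ?thesis by (simp add: filterlim_split_at)
qed

lemma flat_exp_deriv:
  "(flat_exp k has_real_derivative (flat_exp (k + 2) t - k * flat_exp (k + 1) t)) (at t)"
proof -
  consider "t > 0" | "t < 0" | "t = 0" by linarith
  then show ?thesis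
  proof cases
    case 1
    have "((\<lambda>t. exp (- 1 / t) / t ^ k) has_real_derivative (flat_exp (k + 2) t - k * flat_exp (k + 1) t)) (at t)"
    proof (rule DERIV_cong)
      show "((\<lambda>t. exp (- 1 / t) / t ^ k) has_real_derivative
          (exp (- 1 / t) * (1 / (t * t)) * t ^ k - exp (- 1 / t) * (real k * t ^ (k - Suc 0))) / (t ^ k * t ^ k)) (at t)"
        using 1 by (auto intro!: derivative_eq_intros)
      \<comment> \<open>The truncated exponent for k = 0 is harmless, since the factor k vanishes
        there.\<close>
      have "real k * t ^ (k - Suc 0) = real k * t ^ k / t" using 1 by (cases k) auto
      then show "(exp (- 1 / t) * (1 / (t * t)) * t ^ k - exp (- 1 / t) * (real k * t ^ (k - Suc 0))) / (t ^ k * t ^ k)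
          = flat_exp (k + 2) t - k * flat_exp (k + 1) t"
        using 1 by (auto simp: flat_exp_def field_simps)
    qed
    then show ?thesis
      by (rule has_field_derivative_transform_within_open[of _ _ _ "{0<..}"])
        (use 1 in \<open>auto simp: flat_exp_def\<close>)
  next
    case 2
    have "((\<lambda>t. 0) has_real_derivative (flat_exp (k + 2) t - k * flat_exp (k + 1) t)) (at t)"
      using 2 by (simp add: flat_exp_def)
    then show ?thesis
      by (rule has_field_derivative_transform_within_open[of _ _ _ "{..<0}"])
        (use 2 in \<open>auto simp: flat_exp_def\<close>)
  next
    case 3
    \<comment> \<open>Away from h = 0 the difference quotient at 0 is
      \<open>flat_exp (k + 1) h\<close>, whose limit is known.\<close>
    have "((\<lambda>h. (flat_exp k (0 + h) - flat_exp k 0) / h) \<longlongrightarrow> 0) (at 0)"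
      by (rule tendsto_cong[THEN iffD1, OF _ flat_exp_tendsto_0[of "k + 1"]])
        (auto simp: flat_exp_def eventually_at_filter)
    then show ?thesis using 3 by (simp add: DERIV_def flat_exp_def)
  qed
qed

lemma smooth_flat_exp: "smooth_on UNIV (flat_exp k)"
proof -
  have "Ck n UNIV (flat_exp k)" for n
  proof (induction n arbitrary: k)
    case 0
    then show ?case using flat_exp_deriv by (auto intro!: continuous_at_imp_continuous_on DERIV_isCont)
  next
    case (Suc n)
    have "pd 1 (flat_exp k) = (\<lambda>t. flat_exp (k + 2) t + (- real k) *\<^sub>R flat_exp (k + 1) t)"
      by (rule ext) (use pd_eq[OF flat_exp_deriv[unfolded has_field_derivative_def]] in \<open>simp add: fun_eq_iff\<close>)
    moreover have "flat_exp k differentiable (at t)" for t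
      unfolding real_differentiable_def by (rule exI, rule flat_exp_deriv)
    ultimately show ?case
      using Ck_add[OF Suc.IH[of "k + 2"] Ck_scaleR[OF Suc.IH[of "k + 1"], of "- real k"]] by simp
  qed
  then show ?thesis by (simp add: smooth_on_def)
qed

lemma flat_exp_bounds: "0 \<le> flat_exp 0 t" "flat_exp 0 t \<le> 1" "flat_exp 0 t \<noteq> 0 \<longleftrightarrow> t > 0"
  by (auto simp: flat_exp_def)

text \<open>The parameter \<open>n\<close> is a steepness: for every positive \<open>n\<close> the
  bump is nonzero exactly on the open box, and as \<open>n\<close> grows it tends pointwise to the
  indicator of that box.\<close>

definition box_bump :: "real \<Rightarrow> 'e::euclidean_space \<Rightarrow> 'e \<Rightarrow> 'e \<Rightarrow> real" where
  "box_bump n a b x = (\<Prod>i\<in>Basis. flat_exp 0 (n * (x \<bullet> i - a \<bullet> i)) * flat_exp 0 (n * (b \<bullet> i - x \<bullet> i)))"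

lemma smooth_box_bump: "smooth_on UNIV (box_bump n a b)"
proof -
  have "smooth_on UNIV (\<lambda>x. flat_exp 0 (n * (x \<bullet> i - a \<bullet> i)))" for i
    using smooth_affine[OF _ smooth_flat_exp, of "\<lambda>x. n * (x \<bullet> i)" 0 "- n * (a \<bullet> i)"]
    by (simp add: right_diff_distrib linear_iff inner_add_left algebra_simps)
  moreover have "smooth_on UNIV (\<lambda>x. flat_exp 0 (n * (b \<bullet> i - x \<bullet> i)))" for i
    using smooth_affine[OF _ smooth_flat_exp, of "\<lambda>x. - n * (x \<bullet> i)" 0 "n * (b \<bullet> i)"]
    by (simp add: right_diff_distrib linear_iff inner_add_left algebra_simps)
  ultimately show ?thesis unfolding box_bump_def[abs_def] by (intro smooth_prod smooth_mult)
qed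

lemma box_bump_bounds: "0 \<le> box_bump n a b x" "box_bump n a b x \<le> 1"
  unfolding box_bump_def by (auto intro!: prod_nonneg prod_le_1 mult_le_one simp: flat_exp_bounds)

lemma box_bump_nonzero_iff: "n > 0 \<Longrightarrow> box_bump n a b x \<noteq> 0 \<longleftrightarrow> x \<in> box a b"
  by (auto simp: box_bump_def flat_exp_bounds mem_box zero_less_mult_iff)

lemma box_bump_tendsto: "(\<lambda>n. box_bump (real (Suc n)) a b x) \<longlonglongrightarrow> indicator (box a b) x"
proof (cases "x \<in> box a b")
  case True
  have *: "(\<lambda>n. flat_exp 0 (real (Suc n) * d)) \<longlonglongrightarrow> 1" if "d > 0" for d
  proof -
    have "(\<lambda>n. exp (- (inverse (real (Suc n)) * inverse d))) \<longlonglongrightarrow> exp (- (0 * inverse d))"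
      by (intro tendsto_intros LIMSEQ_inverse_real_of_nat)
    then show ?thesis using that by (simp add: flat_exp_def divide_inverse inverse_mult_distrib)
  qed
  have "(\<lambda>n. box_bump (real (Suc n)) a b x) \<longlonglongrightarrow> (\<Prod>i\<in>(Basis::'a set). 1 * 1)"
    unfolding box_bump_def using True by (intro tendsto_prod tendsto_mult *) (auto simp: mem_box)
  then show ?thesis using True by simp
next
  case False
  then have "box_bump (real (Suc n)) a b x = 0" for n using box_bump_nonzero_iff[of "real (Suc n)" a b x] by simp
  then show ?thesis using False by simp
qed

lemma test_fun_box_bump:
  assumes "n > 0" "cbox a b \<subseteq> U"
  shows "test_fun U (box_bump n a b)"
  unfolding test_fun_def
proof (intro conjI smooth_box_bump exI[of _ "cbox a b"] allI impI assms(2) compact_cbox)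
  fix x assume "x \<notin> cbox a b"
  then have "x \<notin> box a b" using box_subset_cbox by blast
  then show "box_bump n a b x = 0" using box_bump_nonzero_iff[OF assms(1)] by metis
qed

section \<open>Test functions under sums, translations, products and slicing\<close>

lemma test_funE:
  assumes "test_fun U \<phi>"
  obtains K where "compact K" "K \<subseteq> U" "\<And>x. x \<notin> K \<Longrightarrow> \<phi> x = 0" "smooth_on UNIV \<phi>"
  using assms by (auto simp: test_fun_def)

lemma test_fun_mono: "test_fun U \<phi> \<Longrightarrow> U \<subseteq> V \<Longrightarrow> test_fun V \<phi>"
  unfolding test_fun_def by blast

lemma test_fun_eq_0: "test_fun U \<phi> \<Longrightarrow> x \<notin> U \<Longrightarrow> \<phi> x = 0"
  unfolding test_fun_def by blast

lemma test_fun_differentiable: "test_fun U \<phi> \<Longrightarrow> \<phi> differentiable (at x)"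
  by (simp add: test_fun_def smooth_differentiable)

lemma test_fun_continuous: "test_fun U \<phi> \<Longrightarrow> continuous_on UNIV \<phi>"
  by (simp add: test_fun_def smooth_continuous)

lemma test_fun_pd:
  assumes "test_fun U \<phi>" "e \<in> Basis"
  shows "test_fun U (pd e \<phi>)"
proof -
  obtain K where K: "compact K" "K \<subseteq> U" "\<And>x. x \<notin> K \<Longrightarrow> \<phi> x = 0" "smooth_on UNIV \<phi>"
    by (rule test_funE[OF assms(1)]) (rule that)
  have "pd e \<phi> x = 0" if "x \<notin> K" for x
  proof -
    have "((\<lambda>x. 0) has_derivative (\<lambda>v. 0)) (at x)" by simp
    then have "(\<phi> has_derivative (\<lambda>v. 0)) (at x)"
      by (rule has_derivative_transform_within_open[of _ _ _ _ "- K"])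
        (use K that compact_imp_closed in auto)
    then show ?thesis by (rule pd_eq)
  qed
  then show ?thesis using K smooth_pd[OF K(4) assms(2)] by (auto simp: test_fun_def)
qed

lemma test_fun_add:
  assumes "test_fun U f" "test_fun U g"
  shows "test_fun U (\<lambda>x. f x + g x)"
proof -
  obtain K L where "compact K" "K \<subseteq> U" "\<And>x. x \<notin> K \<Longrightarrow> f x = 0"
     "compact L" "L \<subseteq> U" "\<And>x. x \<notin> L \<Longrightarrow> g x = 0"
    using assms by (auto simp: test_fun_def)
  then have "compact (K \<union> L) \<and> K \<union> L \<subseteq> U \<and> (\<forall>x. x \<notin> K \<union> L \<longrightarrow> f x + g x = 0)" by auto
  moreover have "smooth_on UNIV (\<lambda>x. f x + g x)"
    using assms by (simp add: test_fun_def smooth_on_def Ck_add)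
  ultimately show ?thesis unfolding test_fun_def by blast
qed

lemma test_fun_scale: "test_fun U f \<Longrightarrow> test_fun U (\<lambda>x. r * f x)"
  unfolding test_fun_def using Ck_scaleR[where 'b = real, of _ f r] by (auto simp: smooth_on_def)

lemma test_fun_subspace: "subspace {\<phi>. test_fun U \<phi>}"
proof (rule subspaceI)
  show "0 \<in> {\<phi>. test_fun U \<phi>}"
    unfolding zero_fun_def test_fun_def by (auto simp: smooth_const intro!: exI[of _ "{}"])
qed (auto simp: plus_fun_def scaleR_fun_def test_fun_add test_fun_scale)

lemma test_fun_translate:
  assumes "test_fun U \<phi>" "\<And>x. x \<in> U \<Longrightarrow> x + c \<in> V"
  shows "test_fun V (\<lambda>x. \<phi> (x - c))"
proof -
  obtain K where K: "compact K" "K \<subseteq> U" "\<And>x. x \<notin> K \<Longrightarrow> \<phi> x = 0" "smooth_on UNIV \<phi>"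
    by (rule test_funE[OF assms(1)]) (rule that)
  have "smooth_on UNIV (\<lambda>x. \<phi> (x - c))"
    using smooth_affine[OF linear_ident K(4), of "- c"] by simp
  moreover have "compact ((+) c ` K)" using K(1) by (rule compact_translation)
  moreover have "(+) c ` K \<subseteq> V" using K(2) assms(2) by (auto simp: add.commute)
  moreover have "\<phi> (x - c) = 0" if "x \<notin> (+) c ` K" for x
  proof -
    have "x - c \<notin> K" using that imageI[of "x - c" K "(+) c"] by auto
    then show ?thesis by (rule K(3))
  qed
  ultimately show ?thesis unfolding test_fun_def by blast
qed

lemma pd_translate: "\<phi> differentiable (at (x - c)) \<Longrightarrow> pd e (\<lambda>x. \<phi> (x - c)) x = pd e \<phi> (x - c)"
proof -
  assume "\<phi> differentiable (at (x - c))"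
  then obtain f' where "(\<phi> has_derivative f') (at (x - c))" by (auto simp: differentiable_def)
  note d = this
  have D: "((\<lambda>x. \<phi> (x - c)) has_derivative f') (at x)"
    by (rule has_derivative_compose[where g = \<phi> and f = "\<lambda>x. x - c" and f' = "\<lambda>v. v", OF _ d])
      (auto intro!: derivative_eq_intros)
  show ?thesis by (simp only: pd_eq[OF D] pd_eq[OF d])
qed

lemma linear_fst': "linear fst" and linear_snd': "linear snd"
  by (simp_all add: linear_fst linear_snd)

lemma test_fun_tensor:
  fixes \<phi> :: "'a::euclidean_space \<Rightarrow> real" and \<eta> :: "'c::euclidean_space \<Rightarrow> real"
  assumes "test_fun U \<phi>" "test_fun V \<eta>"
  shows "test_fun (U \<times> V) (\<lambda>x. \<phi> (fst x) * \<eta> (snd x))"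
proof -
  obtain K L where K: "compact K" "K \<subseteq> U" "\<And>x. x \<notin> K \<Longrightarrow> \<phi> x = 0" "smooth_on UNIV \<phi>"
     "compact L" "L \<subseteq> V" "\<And>x. x \<notin> L \<Longrightarrow> \<eta> x = 0" "smooth_on UNIV \<eta>"
    using assms by (auto simp: test_fun_def)
  have "smooth_on UNIV (\<lambda>x. \<phi> (fst (x :: 'a \<times> 'c) + 0) * \<eta> (snd x + 0))"
    by (intro smooth_mult smooth_affine linear_fst' linear_snd' K)
  then have "smooth_on UNIV (\<lambda>x. \<phi> (fst x) * \<eta> (snd x))" by simp
  moreover have "compact (K \<times> L)" "K \<times> L \<subseteq> U \<times> V" using K by (auto simp: compact_Times)
  moreover have "\<phi> (fst x) * \<eta> (snd x) = 0" if "x \<notin> K \<times> L" for x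
    using that K(3,7) by (cases x) auto
  ultimately show ?thesis unfolding test_fun_def by blast
qed

lemma pd_tensor:
  fixes \<phi> :: "'a::euclidean_space \<Rightarrow> real" and \<eta> :: "'c::euclidean_space \<Rightarrow> real"
  assumes "\<phi> differentiable (at (fst x))" "\<eta> differentiable (at (snd x))"
  shows "pd (b, 0) (\<lambda>x. \<phi> (fst x) * \<eta> (snd x)) x = pd b \<phi> (fst x) * \<eta> (snd x)"
    "pd (0, c) (\<lambda>x. \<phi> (fst x) * \<eta> (snd x)) x = \<phi> (fst x) * pd c \<eta> (snd x)"
proof -
  obtain f' g' where d: "(\<phi> has_derivative f') (at (fst x))" "(\<eta> has_derivative g') (at (snd x))"
    using assms by (auto simp: differentiable_def)
  have "((\<lambda>x. \<phi> (fst x) * \<eta> (snd x)) has_derivative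
      (\<lambda>v. \<phi> (fst x) * g' (snd v) + f' (fst v) * \<eta> (snd x))) (at x)"
    by (intro has_derivative_mult has_derivative_compose[where g = \<phi> and f = fst, OF _ d(1)]
        has_derivative_compose[where g = \<eta> and f = snd, OF _ d(2)]
        has_derivative_fst has_derivative_snd has_derivative_ident)
  note D = this
  have "f' 0 = 0" "g' 0 = 0"
    using d[THEN has_derivative_linear] by (simp_all add: linear_0)
  then show "pd (b, 0) (\<lambda>x. \<phi> (fst x) * \<eta> (snd x)) x = pd b \<phi> (fst x) * \<eta> (snd x)"
    "pd (0, c) (\<lambda>x. \<phi> (fst x) * \<eta> (snd x)) x = \<phi> (fst x) * pd c \<eta> (snd x)"
    by (simp_all add: pd_eq[OF D] pd_eq[OF d(1)] pd_eq[OF d(2)])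
qed

text \<open>The support of a slice lies in the projection of the corresponding slice of the compact
  support. In particular the restriction of a test function to height 0 is again a test
  function.\<close>

lemma test_fun_slice:
  fixes \<Phi> :: "'a::euclidean_space \<times> 'c::euclidean_space \<Rightarrow> real"
  assumes "test_fun W \<Phi>"
  shows "test_fun {x. (x, z) \<in> W} (\<lambda>x. \<Phi> (x, z))"
proof -
  obtain K where K: "compact K" "K \<subseteq> W" "\<And>x. x \<notin> K \<Longrightarrow> \<Phi> x = 0" "smooth_on UNIV \<Phi>"
    by (rule test_funE[OF assms(1)]) (rule that)
  have "linear (\<lambda>x::'a. (x, 0::'c))" by (simp add: linear_iff)
  from smooth_affine[OF this K(4), of "(0, z)"] have "smooth_on UNIV (\<lambda>x. \<Phi> (x, z))" by simp
  moreover have "compact (fst ` (K \<inter> UNIV \<times> {z}))"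
    by (intro compact_continuous_image compact_Int_closed closed_Times K(1) continuous_on_fst
        continuous_on_id closed_UNIV closed_singleton)
  moreover have "fst ` (K \<inter> UNIV \<times> {z}) \<subseteq> {x. (x, z) \<in> W}" using K(2) by auto
  moreover have "\<Phi> (x, z) = 0" if "x \<notin> fst ` (K \<inter> UNIV \<times> {z})" for x
    using that K(3)[of "(x, z)"] by force
  ultimately show ?thesis unfolding test_fun_def by blast
qed

lemma pd_slice1:
  fixes \<Phi> :: "'a::euclidean_space \<times> 'c::euclidean_space \<Rightarrow> real"
  assumes "\<Phi> differentiable (at (x, z))"
  shows "pd b (\<lambda>x. \<Phi> (x, z)) x = pd (b, 0) \<Phi> (x, z)"
proof -
  obtain f' where d: "(\<Phi> has_derivative f') (at (x, z))" using assms by (auto simp: differentiable_def)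
  have D: "((\<lambda>x. \<Phi> (x, z)) has_derivative (\<lambda>v. f' (v, 0))) (at x)"
    by (rule has_derivative_compose[where g = \<Phi> and f = "\<lambda>x. (x, z)", OF _ d])
      (auto intro!: has_derivative_Pair has_derivative_ident has_derivative_const)
  show ?thesis by (simp only: pd_eq[OF D] pd_eq[OF d])
qed

lemma slice2_deriv:
  fixes \<Phi> :: "'a::euclidean_space \<times> real \<Rightarrow> real"
  assumes "\<Phi> differentiable (at (x, z))"
  shows "((\<lambda>z. \<Phi> (x, z)) has_real_derivative pd ez \<Phi> (x, z)) (at z)"
proof -
  obtain f' where d: "(\<Phi> has_derivative f') (at (x, z))" using assms by (auto simp: differentiable_def)
  have *: "((\<lambda>z. \<Phi> (x, z)) has_derivative (\<lambda>v. f' (0, v))) (at z)"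
    by (rule has_derivative_compose[where g = \<Phi> and f = "\<lambda>z. (x, z)", OF _ d])
      (auto intro!: has_derivative_Pair has_derivative_ident has_derivative_const)
  have "f' (0, v) = pd ez \<Phi> (x, z) * v" for v
  proof -
    have "f' (v *\<^sub>R (0, 1)) = v *\<^sub>R f' (0, 1)" using has_derivative_linear[OF d] by (rule linear_scale)
    then show ?thesis by (simp add: pd_eq[OF d] ez_def)
  qed
  then show ?thesis using * by (simp add: has_field_derivative_def)
qed

lemma ez_Basis: "ez \<in> Basis"
  by (auto simp: ez_def Basis_prod_def)

lemma Basis_prod_real: "(Basis :: ('a::euclidean_space \<times> real) set) = insert ez ((\<lambda>b. (b, 0)) ` Basis)"
  by (auto simp: Basis_prod_def ez_def)

lemma test_fun_bounded:
  assumes "test_fun U \<phi>"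
  obtains C where "C > 0" "\<And>x. \<bar>\<phi> x\<bar> \<le> C"
proof -
  obtain K where K: "compact K" "K \<subseteq> U" "\<And>x. x \<notin> K \<Longrightarrow> \<phi> x = 0"
    by (rule test_funE[OF assms]) (rule that)
  have "bounded (\<phi> ` K)"
    by (intro compact_imp_bounded compact_continuous_image K(1)
        continuous_on_subset[OF test_fun_continuous[OF assms]]) simp
  then obtain C where C: "C > 0" "\<forall>y\<in>\<phi> ` K. norm y \<le> C"
    unfolding bounded_pos by (elim exE conjE)
  have "\<bar>\<phi> x\<bar> \<le> C" for x using K(3)[of x] C by (cases "x \<in> K") auto
  then show thesis by (rule that[OF C(1)])
qed

lemma test_fun_borel: "test_fun U \<phi> \<Longrightarrow> \<phi> \<in> borel_measurable borel"
  by (rule borel_measurable_continuous_onI[OF test_fun_continuous])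

lemma borel_lebesgue_on: "f \<in> borel_measurable borel \<Longrightarrow> f \<in> borel_measurable (lebesgue_on U)"
  by (intro measurable_restrict_space1 measurable_completion) simp

lemma test_fun_measurable: "test_fun U \<phi> \<Longrightarrow> \<phi> \<in> borel_measurable (lebesgue_on V)"
  by (intro borel_lebesgue_on test_fun_borel)

lemma test_fun_L2:
  assumes "test_fun U \<phi>" "V \<in> sets lebesgue"
  shows "L2 V \<phi>"
proof -
  obtain K where K: "compact K" "K \<subseteq> U" "\<And>x. x \<notin> K \<Longrightarrow> \<phi> x = 0"
    by (rule test_funE[OF assms(1)]) (rule that)
  obtain C where C: "C > 0" "\<And>x. \<bar>\<phi> x\<bar> \<le> C" by (rule test_fun_bounded[OF assms(1)]) (rule that)
  have "integrable (lebesgue_on V) (\<lambda>x. (norm (\<phi> x))\<^sup>2)"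
  proof (rule Bochner_Integration.integrable_bound)
    have "integrable lebesgue (\<lambda>x. C\<^sup>2 * indicator (K \<inter> V) x :: real)"
      using fmeasurable_Int_fmeasurable[OF lmeasurable_compact[OF K(1)] assms(2)]
      by (intro integrable_mult_right integrable_real_indicator) (auto simp: fmeasurable_def)
    then show "integrable (lebesgue_on V) (\<lambda>x. C\<^sup>2 * indicator K x :: real)"
      using assms(2) by (subst integrable_restrict_space)
        (auto simp: indicator_inter_arith ac_simps)
    show "AE x in lebesgue_on V. norm ((norm (\<phi> x))\<^sup>2) \<le> norm (C\<^sup>2 * indicator K x :: real)"
      using K(3) C by (intro AE_I2) (auto simp: indicator_def abs_le_square_iff[symmetric])
  qed (use test_fun_measurable[OF assms(1)] in measurable)
  then show ?thesis using test_fun_measurable[OF assms(1)] by (simp add: L2_def)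
qed

section \<open>Fubini for Lebesgue measurable factors\<close>

lemma integrable_lebesgue_on_iff:
  fixes f :: "'e::euclidean_space \<Rightarrow> 'b::euclidean_space"
  shows "U \<in> sets lebesgue \<Longrightarrow> integrable (lebesgue_on U) f \<longleftrightarrow> integrable lebesgue (\<lambda>x. indicator U x *\<^sub>R f x)"
  by (simp add: integrable_restrict_space)

lemma integral_lebesgue_on:
  fixes f :: "'e::euclidean_space \<Rightarrow> 'b::euclidean_space"
  shows "U \<in> sets lebesgue \<Longrightarrow> integral\<^sup>L (lebesgue_on U) f = integral\<^sup>L lebesgue (\<lambda>x. indicator U x *\<^sub>R f x)"
  by (simp add: integral_restrict_space)

lemma AE_lebesgue_on:
  "U \<in> sets lebesgue \<Longrightarrow> (AE x in lebesgue_on U. P x) \<longleftrightarrow> (AE x in lborel. x \<in> U \<longrightarrow> P x)"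
  by (simp add: AE_restrict_space_iff AE_completion_iff)

text \<open>Fubini's theorem is available for products of Borel measures, and Lebesgue measure on a
  product is the completion of such a product. Lebesgue measurable integrands are therefore first
  replaced by Borel ones.\<close>

lemma lebesgue_ex_borel:
  fixes h :: "'e::euclidean_space \<Rightarrow> 'b::euclidean_space"
  assumes "h \<in> borel_measurable lebesgue"
  obtains h' where "h' \<in> borel_measurable borel" "AE x in lborel. h x = h' x"
proof -
  have "(\<lambda>x. h x \<bullet> b) \<in> borel_measurable lebesgue" for b
    by (intro borel_measurable_inner assms borel_measurable_const)
  then have "\<forall>b. \<exists>g. g \<in> borel_measurable lborel \<and> (AE x in lborel. h x \<bullet> b = g x)"
    using completion_ex_borel_measurable_real unfolding Bex_def by blast
  from choice[OF this] obtain g where "\<forall>b. g b \<in> borel_measurable lborel \<and> (AE x in lborel. h x \<bullet> b = g b x)"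
    by (rule exE)
  then have g: "g b \<in> borel_measurable borel" "AE x in lborel. h x \<bullet> b = g b x" for b
    by simp_all
  have "AE x in lborel. \<forall>b\<in>Basis. h x \<bullet> b = g b x"
    by (rule AE_finite_allI) (auto simp: g)
  then have "AE x in lborel. h x = (\<Sum>b\<in>Basis. g b x *\<^sub>R b)"
  proof eventually_elim
    case (elim x)
    have "h x = (\<Sum>b\<in>Basis. (h x \<bullet> b) *\<^sub>R b)" by (simp add: euclidean_representation)
    then show ?case using elim by simp
  qed
  moreover have "(\<lambda>x. \<Sum>b\<in>Basis. g b x *\<^sub>R b) \<in> borel_measurable borel"
    by (intro borel_measurable_sum borel_measurable_scaleR g borel_measurable_const)
  ultimately show thesis by (rule that[rotated])
qed

lemma fst_null_sets:
  assumes "N \<in> null_sets (lborel :: 'a::euclidean_space measure)"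
  shows "N \<times> UNIV \<in> null_sets (lborel :: ('a \<times> 'c::euclidean_space) measure)"
proof -
  have "emeasure (lborel \<Otimes>\<^sub>M lborel) (N \<times> (UNIV :: 'c set)) = 0"
    using null_setsD1[OF assms] null_setsD2[OF assms] by (simp add: lborel.emeasure_pair_measure_Times)
  moreover have "N \<times> UNIV \<in> sets (lborel \<Otimes>\<^sub>M (lborel :: 'c measure))"
    by (rule pair_measureI[OF null_setsD2[OF assms]]) simp
  then have "N \<times> (UNIV :: 'c set) \<in> sets lborel" by (simp only: lborel_prod)
  ultimately show ?thesis by (simp add: lborel_prod null_sets_def)
qed

lemma AE_fst:
  assumes "AE x in (lborel :: 'a::euclidean_space measure). P x"
  shows "AE x in (lborel :: ('a \<times> 'c::euclidean_space) measure). P (fst x)"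
proof -
  obtain N where N: "\<And>x. x \<in> space lborel - N \<Longrightarrow> P x" "N \<in> null_sets lborel"
    by (rule AE_E3[OF assms]) (rule that)
  show ?thesis
  proof (rule AE_I'[OF fst_null_sets[OF N(2)]], rule subsetI)
    fix x :: "'a \<times> 'c" assume "x \<in> {x \<in> space lborel. \<not> P (fst x)}"
    then have "fst x \<in> N" using N(1)[of "fst x"] by auto
    then show "x \<in> N \<times> UNIV" by (cases x) simp
  qed
qed

text \<open>A Lebesgue set is a Borel set together with part of a null set. The cylinder over a null
  set is null, so the decomposition survives the preimage under the projection.\<close>

lemma fst_measurable_lebesgue: "fst \<in> measurable (lebesgue :: ('a::euclidean_space \<times> 'c::euclidean_space) measure) lebesgue"
proof (rule measurableI)
  fix A :: "'a set" assume "A \<in> sets lebesgue"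
  then obtain S N N' where A: "A = S \<union> N" "N \<subseteq> N'" "N' \<in> null_sets lborel" "S \<in> sets lborel"
    by (rule sets_completionE)
  have "S \<times> UNIV \<in> sets (lborel \<Otimes>\<^sub>M (lborel :: 'c measure))"
    by (rule pair_measureI[OF A(4)]) simp
  then have S: "S \<times> (UNIV :: 'c set) \<in> sets lborel" by (simp only: lborel_prod)
  show "fst -` A \<inter> space lebesgue \<in> sets (lebesgue :: ('a \<times> 'c) measure)"
  proof (rule sets_completionI[OF _ _ fst_null_sets[OF A(3)] S])
    show "fst -` A \<inter> space lebesgue = S \<times> UNIV \<union> N \<times> UNIV" unfolding A(1) by auto
    show "N \<times> UNIV \<subseteq> N' \<times> UNIV" using A(2) by (intro Sigma_mono) simp_all
  qed
qed simp

text \<open>Completeness of Lebesgue measure: altering a function on a null set keeps it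
  measurable.\<close>

lemma measurable_lebesgue_AE:
  assumes "g \<in> borel_measurable lebesgue" "AE x in lebesgue. f x = g x"
  shows "f \<in> borel_measurable lebesgue"
proof (rule measurableI)
  fix B :: "'b set" assume "B \<in> sets borel"
  then have a: "g -` B \<inter> space lebesgue \<in> sets lebesgue" by (rule measurable_sets[OF assms(1)])
  have b: "AE x in lebesgue. x \<in> g -` B \<inter> space lebesgue \<longleftrightarrow> x \<in> f -` B \<inter> space lebesgue"
    using assms(2) by eventually_elim simp
  show "f -` B \<inter> space lebesgue \<in> sets lebesgue"
    by (rule completion.in_sets_AE[OF b a]) simp
qed simp

text \<open>Only the factor \<open>h\<close> is rough, and it depends on one variable; the weight
  \<open>c\<close> is Borel, bounded and supported over a set \<open>S\<close> of finite measure.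
  That is enough for integrability, and both orders of integration are recorded because later
  arguments freeze either variable.\<close>

lemma Fubini_lebesgue:
  fixes h :: "'a::euclidean_space \<Rightarrow> 'b::euclidean_space" and c :: "'a \<times> 'c::euclidean_space \<Rightarrow> real"
  assumes h: "integrable lebesgue h" and c: "c \<in> borel_measurable borel"
    and bound: "\<And>x z. \<bar>c (x, z)\<bar> \<le> C * indicator S z" and S: "S \<in> sets borel" "emeasure lborel S < \<infinity>"
  shows "integrable lebesgue (\<lambda>x. c x *\<^sub>R h (fst x))"
    "(\<integral>x. c x *\<^sub>R h (fst x) \<partial>lebesgue) = (\<integral>x. (\<integral>z. c (x, z) \<partial>lborel) *\<^sub>R h x \<partial>lebesgue)"
    "(\<integral>x. c x *\<^sub>R h (fst x) \<partial>lebesgue) = (\<integral>z. (\<integral>x. c (x, z) *\<^sub>R h x \<partial>lebesgue) \<partial>lborel)"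
proof -
  obtain h' where h': "h' \<in> borel_measurable borel" "AE x in lborel. h x = h' x"
    by (rule lebesgue_ex_borel[OF borel_measurable_integrable[OF h]])
  have c': "c \<in> borel_measurable (borel \<Otimes>\<^sub>M borel)" using c by (simp add: borel_prod)
  note h'(1)[measurable] c'[measurable] S(1)[measurable]
  have h'L: "h' \<in> borel_measurable lebesgue"
    by (rule measurable_completion) (simp add: h'(1))
  have ih': "integrable lborel h'"
  proof -
    have "integrable lebesgue h'"
      by (rule integrable_cong_AE_imp[OF h]) (use h' in \<open>auto simp: AE_completion_iff measurable_completion\<close>)
    then show ?thesis using h'(1) by (simp add: integrable_completion)
  qed
  let ?H = "\<lambda>x. c x *\<^sub>R h' (fst x)"
  have "?H \<in> borel_measurable (borel \<Otimes>\<^sub>M borel)" by measurable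
  then have Hmeas: "?H \<in> borel_measurable borel" by (simp add: borel_prod)
  then have Hm: "?H \<in> borel_measurable (lborel \<Otimes>\<^sub>M lborel)" by (simp add: lborel_prod)
  have bnd: "norm (c (x, z) *\<^sub>R v) \<le> indicator S z * (C * norm v)" for x z and v :: 'b
    using mult_right_mono[OF bound[of x z] norm_ge_zero[of v]] by (simp add: mult_ac)
  have Sint: "integrable lborel (\<lambda>z. indicator S z * r :: real)" for r
    using S by (intro integrable_mult_left integrable_real_indicator) auto
  have slice: "integrable lborel (\<lambda>z. ?H (x, z))" for x
    by (rule Bochner_Integration.integrable_bound[OF Sint[of "C * norm (h' x)"]])
      (use bnd[of x _ "h' x"] in \<open>auto intro: order_trans[OF _ abs_ge_self]\<close>)
  have cint: "integrable lborel (\<lambda>z. c (x, z))" for x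
    by (rule Bochner_Integration.integrable_bound[OF Sint[of C]])
      (use bound[of x] in \<open>auto simp: mult.commute intro: order_trans[OF _ abs_ge_self]\<close>)
  \<comment> \<open>Each slice integral is at most C times the measure of \<open>S\<close> times the
    norm of \<open>h'\<close>, which is integrable.\<close>
  have Hint: "integrable (lborel \<Otimes>\<^sub>M lborel) ?H"
  proof (rule lborel_pair.Fubini_integrable[OF Hm])
    show "integrable lborel (\<lambda>x. \<integral>z. norm (?H (x, z)) \<partial>lborel)"
    proof (rule Bochner_Integration.integrable_bound)
      show "integrable lborel (\<lambda>x. measure lborel S * C * norm (h' x))" using ih' by simp
      show "AE x in lborel. norm (\<integral>z. norm (?H (x, z)) \<partial>lborel) \<le> norm (measure lborel S * C * norm (h' x))"
      proof (rule AE_I2)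
        fix x
        have "(\<integral>z. norm (?H (x, z)) \<partial>lborel) \<le> (\<integral>z. indicator S z * (C * norm (h' x)) \<partial>lborel)"
          by (intro integral_mono integrable_norm slice Sint) (use bnd[of x _ "h' x"] in simp)
        also have "\<dots> = measure lborel S * C * norm (h' x)" using S by simp
        finally show "norm (\<integral>z. norm (?H (x, z)) \<partial>lborel) \<le> norm (measure lborel S * C * norm (h' x))"
          by (simp add: order_trans[OF _ abs_ge_self])
      qed
    qed measurable
    show "AE x in lborel. integrable lborel (\<lambda>z. ?H (x, z))" using slice by simp
  qed
  then have Hint': "integrable lborel ?H" by (simp add: lborel_prod)
  have ae: "AE x in lborel. c x *\<^sub>R h (fst x) = ?H x" using AE_fst[OF h'(2)] by eventually_elim simp
  then have aeL: "AE x in lebesgue. c x *\<^sub>R h (fst x) = ?H x" by (simp only: AE_completion_iff)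
  have HmB: "?H \<in> borel_measurable lborel" using Hmeas by simp
  then have HmL: "?H \<in> borel_measurable lebesgue" by (rule measurable_completion)
  have meas: "(\<lambda>x. c x *\<^sub>R h (fst x)) \<in> borel_measurable lebesgue"
    by (rule measurable_lebesgue_AE[OF HmL aeL])
  have "integrable lebesgue ?H" using Hint' by (simp only: integrable_completion[OF HmB])
  then show "integrable lebesgue (\<lambda>x. c x *\<^sub>R h (fst x))"
    by (rule integrable_cong_AE[THEN iffD2, OF meas HmL aeL])
  have "(\<integral>x. c x *\<^sub>R h (fst x) \<partial>lebesgue) = (\<integral>x. ?H x \<partial>lebesgue)"
    by (rule integral_cong_AE[OF meas HmL aeL])
  also have "\<dots> = (\<integral>x. ?H x \<partial>(lborel \<Otimes>\<^sub>M lborel))" by (simp only: integral_completion[OF HmB] lborel_prod)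
  finally have eq: "(\<integral>x. c x *\<^sub>R h (fst x) \<partial>lebesgue) = (\<integral>x. ?H x \<partial>(lborel \<Otimes>\<^sub>M lborel))" .
  have "(\<lambda>x. \<integral>z. c (x, z) \<partial>lborel) \<in> borel_measurable lborel" by measurable
  then have lm: "(\<lambda>x. \<integral>z. c (x, z) \<partial>lborel) \<in> borel_measurable lebesgue" by (rule measurable_completion)
  have "(\<integral>x. ?H x \<partial>(lborel \<Otimes>\<^sub>M lborel)) = (\<integral>x. (\<integral>z. ?H (x, z) \<partial>lborel) \<partial>lborel)"
    by (rule lborel_pair.integral_fst'[OF Hint, symmetric])
  also have "\<dots> = (\<integral>x. (\<integral>z. c (x, z) \<partial>lborel) *\<^sub>R h' x \<partial>lborel)" using cint by simp
  also have "\<dots> = (\<integral>x. (\<integral>z. c (x, z) \<partial>lborel) *\<^sub>R h' x \<partial>lebesgue)"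
    by (rule integral_completion[symmetric]) measurable
  also have "\<dots> = (\<integral>x. (\<integral>z. c (x, z) \<partial>lborel) *\<^sub>R h x \<partial>lebesgue)"
  proof (rule integral_cong_AE)
    show "AE x in lebesgue. (\<integral>z. c (x, z) \<partial>lborel) *\<^sub>R h' x = (\<integral>z. c (x, z) \<partial>lborel) *\<^sub>R h x"
      unfolding AE_completion_iff using h'(2) by eventually_elim simp
  qed (intro borel_measurable_scaleR lm h'L borel_measurable_integrable[OF h])+
  finally show "(\<integral>x. c x *\<^sub>R h (fst x) \<partial>lebesgue) = (\<integral>x. (\<integral>z. c (x, z) \<partial>lborel) *\<^sub>R h x \<partial>lebesgue)"
    using eq by simp
  have "(\<integral>x. ?H x \<partial>(lborel \<Otimes>\<^sub>M lborel)) = (\<integral>z. (\<integral>x. ?H (x, z) \<partial>lborel) \<partial>lborel)"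
  proof -
    have "(\<lambda>(x, z). ?H (x, z)) = ?H" by (simp add: fun_eq_iff)
    then show ?thesis using lborel_pair.integral_snd[of "\<lambda>x z. ?H (x, z)"] Hint by simp
  qed
  also have "\<dots> = (\<integral>z. (\<integral>x. c (x, z) *\<^sub>R h x \<partial>lebesgue) \<partial>lborel)"
  proof (rule Bochner_Integration.integral_cong)
    fix z
    have "(\<lambda>x. c (x, z)) \<in> borel_measurable lborel" by measurable
    then have cm: "(\<lambda>x. c (x, z)) \<in> borel_measurable lebesgue" by (rule measurable_completion)
    have "(\<integral>x. ?H (x, z) \<partial>lborel) = (\<integral>x. c (x, z) *\<^sub>R h' x \<partial>lebesgue)"
      unfolding fst_conv by (rule integral_completion[symmetric]) measurable
    also have "\<dots> = (\<integral>x. c (x, z) *\<^sub>R h x \<partial>lebesgue)"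
    proof (rule integral_cong_AE)
      show "AE x in lebesgue. c (x, z) *\<^sub>R h' x = c (x, z) *\<^sub>R h x"
        unfolding AE_completion_iff using h'(2) by eventually_elim simp
    qed (intro borel_measurable_scaleR cm h'L borel_measurable_integrable[OF h])+
    finally show "(\<integral>x. ?H (x, z) \<partial>lborel) = (\<integral>x. c (x, z) *\<^sub>R h x \<partial>lebesgue)" .
  qed simp
  finally show "(\<integral>x. c x *\<^sub>R h (fst x) \<partial>lebesgue) = (\<integral>z. (\<integral>x. c (x, z) *\<^sub>R h x \<partial>lebesgue) \<partial>lborel)"
    using eq by simp
qed

section \<open>The fundamental lemma of the calculus of variations\<close>

lemma sigma_finite_lebesgue: "sigma_finite_measure (lebesgue :: 'e::euclidean_space measure)"
proof
  obtain A :: "'e set set" where A: "countable A" "A \<subseteq> sets lborel" "\<Union>A = space lborel"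
    "\<forall>a\<in>A. emeasure lborel a \<noteq> \<infinity>"
    using lborel.sigma_finite_countable by blast
  have "emeasure lebesgue a = emeasure lborel a" if "a \<in> A" for a
    using A(2) that by (auto simp: emeasure_completion)
  then show "\<exists>A::'e set set. countable A \<and> A \<subseteq> sets lebesgue \<and> \<Union>A = space lebesgue \<and> (\<forall>a\<in>A. emeasure lebesgue a \<noteq> \<infinity>)"
    using A by (intro exI[of _ A]) auto
qed

text \<open>Boxes form an intersection-stable generator of the Borel sets, so vanishing integrals
  spread from boxes to Borel sets; complements are where the total integral enters. A function with
  zero integral over every measurable set vanishes almost everywhere.\<close>

lemma AE_zero_if_box_integrals_zero:
  fixes v :: "'e::euclidean_space \<Rightarrow> 'b::euclidean_space"
  assumes v: "integrable lebesgue v" and tot: "(\<integral>x. v x \<partial>lebesgue) = 0"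
    and box: "\<And>c d. (\<integral>x. indicator (box c d) x *\<^sub>R v x \<partial>lebesgue) = 0"
  shows "AE x in lebesgue. v x = 0"
proof (rule sigma_finite_measure.density_zero[OF sigma_finite_lebesgue v])
  let ?P = "\<lambda>A. (\<integral>x. indicator A x *\<^sub>R v x \<partial>lebesgue) = 0"
  let ?E = "range (\<lambda>(a, b). box a b :: 'e set)"
  have si: "set_integrable lebesgue A v" if "A \<in> sets borel" for A
    unfolding set_integrable_def using that by (intro integrable_mult_indicator v) auto
  have "Int_stable ?E" by (auto simp: Int_stable_def box_Int_box)
  have E_sub: "?E \<subseteq> Pow UNIV" by simp
  have bor: "sets (borel :: 'e measure) = sigma_sets UNIV ?E"
    by (subst borel_eq_box) simp
  have P: "?P A" if "A \<in> sigma_sets UNIV ?E" for A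
    using \<open>Int_stable ?E\<close> E_sub that
  proof (induct rule: sigma_sets_induct_disjoint)
    case (compl A)
    have "A \<in> sets borel" using compl bor by simp
    have "(\<integral>x. indicator (UNIV - A) x *\<^sub>R v x \<partial>lebesgue) = (\<integral>x. v x - indicator A x *\<^sub>R v x \<partial>lebesgue)"
      by (intro Bochner_Integration.integral_cong) (auto simp: indicator_def)
    also have "\<dots> = 0"
      using compl tot v si[OF \<open>A \<in> sets borel\<close>] by (simp add: set_integrable_def)
    finally show ?case .
  next
    case (union A)
    then have Ab: "A i \<in> sets borel" for i using bor by auto
    have "set_lebesgue_integral lebesgue (\<Union>i. A i) v = (\<Sum>i. set_lebesgue_integral lebesgue (A i) v)"
    proof (rule lebesgue_integral_countable_add)
      show "set_integrable lebesgue (\<Union>i. A i) v" using Ab by (intro si) auto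
      show "A i \<inter> A j = {}" if "i \<noteq> j" for i j using union that by (auto simp: disjoint_family_on_def)
    qed (use Ab in auto)
    then show ?case using union by (simp add: set_lebesgue_integral_def)
  qed (use box in auto)
  \<comment> \<open>A Lebesgue set differs from its Borel main part by a null set, which reduces the
    claim to the Borel case.\<close>
  fix A assume A: "A \<in> sets (lebesgue :: 'e measure)"
  then have m: "main_part lborel A \<in> sets borel" using main_part_sets[OF A] by simp
  have "AE x in lebesgue. x \<notin> null_part lborel A"
    unfolding AE_completion_iff by (rule AE_notin_null_part) (use A in simp)
  then have "AE x in lebesgue. indicator A x *\<^sub>R v x = indicator (main_part lborel A) x *\<^sub>R v x"
  proof eventually_elim
    case (elim x)
    then have "x \<in> A \<longleftrightarrow> x \<in> main_part lborel A" using main_part_null_part_Un[OF A] by blast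
    then show ?case by (simp add: indicator_def)
  qed
  then have "(\<integral>x. indicator A x *\<^sub>R v x \<partial>lebesgue) = (\<integral>x. indicator (main_part lborel A) x *\<^sub>R v x \<partial>lebesgue)"
    by (intro integral_cong_AE borel_measurable_scaleR borel_measurable_indicator)
      (use A m v in auto)
  also have "\<dots> = 0" using P m bor by simp
  finally show "set_lebesgue_integral lebesgue A v = 0" by (simp add: set_lebesgue_integral_def)
qed

lemma L2_indicator:
  assumes "U \<in> sets lebesgue" "B \<in> lmeasurable"
  shows "L2 U (indicator B :: 'e::euclidean_space \<Rightarrow> real)"
proof -
  have "integrable lebesgue (indicator (B \<inter> U) :: 'e \<Rightarrow> real)"
    using fmeasurable_Int_fmeasurable[OF assms(2,1)] by (intro integrable_real_indicator) (auto simp: fmeasurable_def)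
  then have "integrable (lebesgue_on U) (indicator B :: 'e \<Rightarrow> real)"
  proof -
    have "(\<lambda>x. indicator U x *\<^sub>R indicator B x :: real) = indicator (B \<inter> U)"
      by (auto simp: indicator_def fun_eq_iff)
    then show "integrable lebesgue (indicator (B \<inter> U) :: 'e \<Rightarrow> real) \<Longrightarrow> integrable (lebesgue_on U) (indicator B :: 'e \<Rightarrow> real)"
      using assms(1) by (simp only: integrable_lebesgue_on_iff)
  qed
  moreover have "(\<lambda>x. (norm (indicator B x :: real))\<^sup>2) = indicator B" by (auto simp: indicator_def)
  ultimately show ?thesis unfolding L2_def by auto
qed

lemma L2_integrable_scaleR:
  fixes f :: "'e::euclidean_space \<Rightarrow> real" and u :: "'e \<Rightarrow> 'b::euclidean_space"
  assumes "L2 U f" "L2 U u"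
  shows "integrable (lebesgue_on U) (\<lambda>x. f x *\<^sub>R u x)"
proof (rule Bochner_Integration.integrable_bound)
  have n: "L2 U (\<lambda>x. norm (f x))" "L2 U (\<lambda>x. norm (u x))" using assms by (auto simp: L2_def)
  show "integrable (lebesgue_on U) (\<lambda>x. norm (f x) * norm (u x))"
    by (rule L2_real_integrable_mult[OF n])
  show "(\<lambda>x. f x *\<^sub>R u x) \<in> borel_measurable (lebesgue_on U)"
    by (intro borel_measurable_scaleR L2_measurable assms)
qed simp

lemma L2_integrable:
  fixes u :: "'e::euclidean_space \<Rightarrow> 'b::euclidean_space"
  assumes "U \<in> lmeasurable" "L2 U u"
  shows "integrable (lebesgue_on U) u"
proof -
  have "U \<in> sets lebesgue" using assms(1) by (rule fmeasurableD)
  then have "integrable (lebesgue_on U) (\<lambda>x. indicator U x *\<^sub>R u x)"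
    by (intro L2_integrable_scaleR L2_indicator assms)
  moreover have "integrable (lebesgue_on U) (\<lambda>x. indicator U x *\<^sub>R u x) \<longleftrightarrow> integrable (lebesgue_on U) u"
    by (rule Bochner_Integration.integrable_cong) (auto simp: indicator_def)
  ultimately show ?thesis by simp
qed

text \<open>Bumps approximate the indicator of a box inside U and are dominated by it, so the
  integrals of \<open>u\<close> over such boxes vanish. This settles one closed box at a time, and
  countably many closed boxes exhaust U.\<close>

lemma test_fun_integral_zero_AE:
  fixes u :: "'e::euclidean_space \<Rightarrow> 'b::euclidean_space"
  assumes U: "open U" and u: "L2 U u"
    and zero: "\<And>\<phi>. test_fun U \<phi> \<Longrightarrow> (\<integral>x. \<phi> x *\<^sub>R u x \<partial>lebesgue_on U) = 0"
  shows "AE x in lebesgue_on U. u x = 0"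
proof -
  have Ul: "U \<in> sets lebesgue" using U by simp
  have boxint: "integrable (lebesgue_on U) (\<lambda>x. indicator (box a b) x *\<^sub>R u x)" for a b
    by (intro L2_integrable_scaleR L2_indicator Ul u) simp
  have box0: "(\<integral>x. indicator (box a b) x *\<^sub>R u x \<partial>lebesgue_on U) = 0" if "cbox a b \<subseteq> U" for a b
  proof -
    have "(\<lambda>n. \<integral>x. box_bump (real (Suc n)) a b x *\<^sub>R u x \<partial>lebesgue_on U) \<longlonglongrightarrow>
        (\<integral>x. indicator (box a b) x *\<^sub>R u x \<partial>lebesgue_on U)"
    proof (rule integral_dominated_convergence)
      show "integrable (lebesgue_on U) (\<lambda>x. norm (indicator (box a b) x *\<^sub>R u x))"
        by (intro integrable_norm boxint)
      show "AE x in lebesgue_on U. (\<lambda>n. box_bump (real (Suc n)) a b x *\<^sub>R u x) \<longlonglongrightarrow> indicator (box a b) x *\<^sub>R u x"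
        by (intro AE_I2 tendsto_intros box_bump_tendsto)
      show "AE x in lebesgue_on U. norm (box_bump (real (Suc n)) a b x *\<^sub>R u x) \<le> norm (indicator (box a b) x *\<^sub>R u x)" for n
      proof (rule AE_I2)
        fix x
        show "norm (box_bump (real (Suc n)) a b x *\<^sub>R u x) \<le> norm (indicator (box a b) x *\<^sub>R u x)"
        proof (cases "x \<in> box a b")
          case True
          then show ?thesis
            using box_bump_bounds[of "real (Suc n)" a b x] by (simp add: mult_left_le_one_le)
        next
          case False
          then have "box_bump (real (Suc n)) a b x = 0" using box_bump_nonzero_iff[of "real (Suc n)" a b x] by simp
          then show ?thesis by simp
        qed
      qed
      show "(\<lambda>x. box_bump (real (Suc n)) a b x *\<^sub>R u x) \<in> borel_measurable (lebesgue_on U)" for n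
        by (intro borel_measurable_scaleR L2_measurable[OF u] test_fun_measurable[OF test_fun_box_bump[OF _ that]]) simp
    qed (rule borel_measurable_integrable[OF boxint])
    moreover have "(\<integral>x. box_bump (real (Suc n)) a b x *\<^sub>R u x \<partial>lebesgue_on U) = 0" for n
      by (rule zero[OF test_fun_box_bump[OF _ that]]) simp
    ultimately have "(\<lambda>n::nat. 0) \<longlonglongrightarrow> (\<integral>x. indicator (box a b) x *\<^sub>R u x \<partial>lebesgue_on U)"
      by simp
    then show ?thesis by (simp add: LIMSEQ_const_iff)
  qed
  \<comment> \<open>Cutting \<open>u\<close> off to a single box yields a function integrable on the
    whole space, whose integral over any other box is one over an intersection of boxes.\<close>
  have AEbox: "AE x in lebesgue. x \<in> cbox a b \<longrightarrow> u x = 0" if ab: "cbox a b \<subseteq> U" for a b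
  proof -
    let ?v = "\<lambda>x. indicator (box a b) x *\<^sub>R u x"
    have sub: "box a b \<subseteq> U" using ab box_subset_cbox by blast
    have vU: "indicator U x *\<^sub>R ?v x = ?v x" for x using sub by (auto simp: indicator_def)
    have "AE x in lebesgue. ?v x = 0"
    proof (rule AE_zero_if_box_integrals_zero)
      show "integrable lebesgue ?v" using boxint[of a b] Ul by (simp only: integrable_lebesgue_on_iff vU)
      show "(\<integral>x. ?v x \<partial>lebesgue) = 0" using box0[OF ab] Ul by (simp only: integral_lebesgue_on vU)
      fix c d
      obtain p q where pq: "box a b \<inter> box c d = box p q" using box_Int_box[of a b c d] that by auto
      show "(\<integral>x. indicator (box c d) x *\<^sub>R ?v x \<partial>lebesgue) = 0"
      \<comment> \<open>The corners of an empty box may lie anywhere, so containment of its closed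
        hull in U can be argued only when the intersection is nonempty.\<close>
      proof (cases "box p q = {}")
        case True
        then have "(\<lambda>x. indicator (box c d) x *\<^sub>R ?v x) = (\<lambda>x. 0)"
          using pq by (auto simp: indicator_def fun_eq_iff)
        then show ?thesis by (simp only: Bochner_Integration.integral_zero)
      next
        case False
        have "closure (box p q) \<subseteq> closure (box a b)" using pq by (intro closure_mono) auto
        moreover have "box a b \<noteq> {}" using False pq by auto
        ultimately have "cbox p q \<subseteq> cbox a b" by (metis closure_box False)
        then have "(\<integral>x. indicator (box p q) x *\<^sub>R u x \<partial>lebesgue_on U) = 0" using ab by (intro box0) auto
        moreover have "indicator (box c d) x *\<^sub>R ?v x = indicator U x *\<^sub>R (indicator (box p q) x *\<^sub>R u x)" for x
          using sub by (auto simp: indicator_def pq[symmetric])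
        ultimately show ?thesis using Ul by (simp only: integral_lebesgue_on)
      qed
    qed
    moreover have "AE x in lebesgue. x \<notin> cbox a b - box a b"
      by (rule AE_not_in) (use negligible_frontier_interval[of a b] in \<open>simp add: negligible_iff_null_sets\<close>)
    ultimately show ?thesis
    proof eventually_elim
      case (elim x)
      then show ?case by (cases "x \<in> box a b") simp_all
    qed
  qed
  obtain D where D: "countable D" "D \<subseteq> Pow U" "\<And>X. X \<in> D \<Longrightarrow> \<exists>a b. X = cbox a b" "\<Union>D = U"
    by (rule open_countable_Union_open_cbox[OF U]) (rule that)
  have "AE x in lebesgue. \<forall>X\<in>D. x \<in> X \<longrightarrow> u x = 0"
  proof (subst AE_ball_countable[OF D(1)], rule ballI)
    fix X assume X: "X \<in> D"
    then obtain a b where ab: "X = cbox a b" using D(3) by blast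
    then have "cbox a b \<subseteq> U" using X D(2) by auto
    then show "AE x in lebesgue. x \<in> X \<longrightarrow> u x = 0" using AEbox ab by simp
  qed
  then have "AE x in lebesgue. x \<in> U \<longrightarrow> u x = 0"
  proof eventually_elim
    case (elim x)
    show ?case
    proof
      assume "x \<in> U"
      then obtain X where "X \<in> D" "x \<in> X" using D(4) by (metis UnionE)
      then show "u x = 0" using elim by (metis (no_types))
    qed
  qed
  then show ?thesis using Ul by (simp add: AE_restrict_space_iff)
qed

section \<open>Duality between L2 functions and test functions\<close>

text \<open>The Riesz theorem with the test functions as subspace of L2 of U. The set
  \<open>V\<close> carrying the test functions may be larger than U; with the whole space as
  \<open>V\<close> the representing function obeys identities that also register the boundary of
  U.\<close>

lemma test_fun_riesz:
  fixes l :: "('e::euclidean_space \<Rightarrow> real) \<Rightarrow> real"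
  assumes U: "U \<in> sets lebesgue"
    and add: "\<And>f g. test_fun V f \<Longrightarrow> test_fun V g \<Longrightarrow> l (\<lambda>x. f x + g x) = l f + l g"
    and scale: "\<And>r f. test_fun V f \<Longrightarrow> l (\<lambda>x. r * f x) = r * l f"
    and bound: "\<And>f. test_fun V f \<Longrightarrow> \<bar>l f\<bar> \<le> C * l2norm U f" and C: "0 \<le> C"
  shows "\<exists>u. L2 U u \<and> l2norm U u \<le> C \<and> (\<forall>f. test_fun V f \<longrightarrow> (\<integral>x. f x * u x \<partial>lebesgue_on U) = l f)"
proof -
  have "\<exists>u\<in>{u. L2 U u}. (\<forall>f\<in>{f. test_fun V f}. l2ip U u f = l f) \<and> L2.nrm U u \<le> C \<and>
      (\<exists>s. (\<forall>n. s n \<in> {f. test_fun V f}) \<and> (\<lambda>n. L2.nrm U (s n - u)) \<longlonglongrightarrow> 0)"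
    by (rule L2.riesz)
      (use add scale in \<open>simp_all add: test_fun_subspace test_fun_L2[OF _ U] C l2norm_nrm bound
        plus_fun_def scaleR_fun_def\<close>)
  then obtain u where u: "L2 U u" "\<And>f. test_fun V f \<Longrightarrow> l2ip U u f = l f" "l2norm U u \<le> C"
    by (auto simp: l2norm_nrm)
  show ?thesis
    by (rule exI[of _ u]) (use u in \<open>simp add: l2ip_def mult.commute\<close>)
qed

text \<open>The converse of Cauchy-Schwarz. Riesz supplies some function of norm at most
  \<open>C\<close> with the same pairings, and the fundamental lemma says that this function is
  \<open>u\<close>.\<close>

lemma l2norm_le_if_test_fun_bound:
  fixes u :: "'e::euclidean_space \<Rightarrow> real"
  assumes U: "open U" and u: "L2 U u" and C: "0 \<le> C"
    and bound: "\<And>\<phi>. test_fun U \<phi> \<Longrightarrow> \<bar>\<integral>x. \<phi> x * u x \<partial>lebesgue_on U\<bar> \<le> C * l2norm U \<phi>"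
  shows "l2norm U u \<le> C"
proof -
  have Ul: "U \<in> sets lebesgue" using U by simp
  have int: "integrable (lebesgue_on U) (\<lambda>x. f x * v x)" if "test_fun U f" "L2 U v" for f v
    using L2_real_integrable_mult[OF test_fun_L2[OF that(1) Ul] that(2)] .
  have "\<exists>v. L2 U v \<and> l2norm U v \<le> C \<and>
      (\<forall>f. test_fun U f \<longrightarrow> (\<integral>x. f x * v x \<partial>lebesgue_on U) = (\<integral>x. f x * u x \<partial>lebesgue_on U))"
  proof (rule test_fun_riesz[OF Ul])
    show "(\<integral>x. (f x + g x) * u x \<partial>lebesgue_on U) = (\<integral>x. f x * u x \<partial>lebesgue_on U) + (\<integral>x. g x * u x \<partial>lebesgue_on U)"
      if "test_fun U f" "test_fun U g" for f g
      using int[OF that(1) u] int[OF that(2) u] by (simp add: distrib_right)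
    show "(\<integral>x. (r * f x) * u x \<partial>lebesgue_on U) = r * (\<integral>x. f x * u x \<partial>lebesgue_on U)" for r f
      by (simp add: mult.assoc)
  qed (rule bound C, assumption?)+
  then obtain v where v: "L2 U v" "l2norm U v \<le> C"
    "\<And>f. test_fun U f \<Longrightarrow> (\<integral>x. f x * v x \<partial>lebesgue_on U) = (\<integral>x. f x * u x \<partial>lebesgue_on U)"
    by auto
  have "AE x in lebesgue_on U. u x - v x = 0"
  proof (rule test_fun_integral_zero_AE[OF U L2_diff[OF u v(1)]])
    fix \<phi> assume p: "test_fun U \<phi>"
    show "(\<integral>x. \<phi> x *\<^sub>R (u x - v x) \<partial>lebesgue_on U) = 0"
      using v(3)[OF p] int[OF p u] int[OF p v(1)] by (simp add: right_diff_distrib)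
  qed
  then have "AE x in lebesgue_on U. u x = v x" by eventually_elim simp
  then have "l2norm U u = l2norm U v" by (rule l2norm_cong_AE[OF L2_measurable[OF u] L2_measurable[OF v(1)]])
  with v(2) show ?thesis by simp
qed

section \<open>Uniqueness of weak derivatives\<close>

lemma test_fun_scaleR_integrable:
  assumes "test_fun V \<phi>" "U \<in> sets lebesgue" "L2 U u"
  shows "integrable (lebesgue_on U) (\<lambda>x. \<phi> x *\<^sub>R u x)"
  by (rule L2_integrable_scaleR[OF test_fun_L2[OF assms(1,2)] assms(3)])

lemma AE_eq_if_test_fun_integrals_eq:
  fixes u v :: "'e::euclidean_space \<Rightarrow> 'b::euclidean_space"
  assumes U: "open U" and u: "L2 U u" and v: "L2 U v"
    and eq: "\<And>\<phi>. test_fun U \<phi> \<Longrightarrow> (\<integral>x. \<phi> x *\<^sub>R u x \<partial>lebesgue_on U) = (\<integral>x. \<phi> x *\<^sub>R v x \<partial>lebesgue_on U)"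
  shows "AE x in lebesgue_on U. u x = v x"
proof -
  have Ul: "U \<in> sets lebesgue" using U by simp
  have "AE x in lebesgue_on U. u x - v x = 0"
  proof (rule test_fun_integral_zero_AE[OF U L2_diff[OF u v]])
    fix \<phi> assume p: "test_fun U \<phi>"
    show "(\<integral>x. \<phi> x *\<^sub>R (u x - v x) \<partial>lebesgue_on U) = 0"
      using eq[OF p] test_fun_scaleR_integrable[OF p Ul u] test_fun_scaleR_integrable[OF p Ul v]
      by (simp add: scaleR_diff_right)
  qed
  then show ?thesis by eventually_elim simp
qed

lemma has_wpd_unique:
  assumes "open U" "has_wpd U u e g" "has_wpd U u e g'"
  shows "AE x in lebesgue_on U. g x = g' x"
  by (rule AE_eq_if_test_fun_integrals_eq[OF assms(1)]) (use assms(2,3) in \<open>simp_all add: has_wpd_def\<close>)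

lemma has_wpd_wpd: "has_wpd U u e g \<Longrightarrow> has_wpd U u e (wpd U u e)"
  using someI[of "has_wpd U u e" g] by (simp add: wpd_def)

text \<open>\<open>wpd\<close> selects an arbitrary weak derivative. The link to explicit
  derivatives is this agreement almost everywhere.\<close>

lemma wpd_AE: "open U \<Longrightarrow> has_wpd U u e g \<Longrightarrow> AE x in lebesgue_on U. wpd U u e x = g x"
  by (rule has_wpd_unique[OF _ has_wpd_wpd])

lemma has_wdiv_wdiv: "has_wdiv U u d \<Longrightarrow> has_wdiv U u (wdiv U u)"
  using someI[of "has_wdiv U u" d] by (simp add: wdiv_def)

lemma wdiv_AE:
  assumes "open U" "has_wdiv U u d"
  shows "AE x in lebesgue_on U. wdiv U u x = d x"
  by (rule AE_eq_if_test_fun_integrals_eq[OF assms(1)])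
    (use assms(2) has_wdiv_wdiv[OF assms(2)] in \<open>simp_all add: has_wdiv_def\<close>)

lemma L2_scaleR_measurable:
  "test_fun V \<phi> \<Longrightarrow> u \<in> borel_measurable (lebesgue_on U) \<Longrightarrow> (\<lambda>x. \<phi> x *\<^sub>R u x :: 'b::euclidean_space) \<in> borel_measurable (lebesgue_on U)"
  by (intro borel_measurable_scaleR test_fun_measurable)

lemma test_fun_integral_cong_AE:
  fixes u v :: "'e::euclidean_space \<Rightarrow> 'b::euclidean_space"
  assumes "test_fun V \<phi>" "u \<in> borel_measurable (lebesgue_on U)" "v \<in> borel_measurable (lebesgue_on U)"
    "AE x in lebesgue_on U. u x = v x"
  shows "(\<integral>x. \<phi> x *\<^sub>R u x \<partial>lebesgue_on U) = (\<integral>x. \<phi> x *\<^sub>R v x \<partial>lebesgue_on U)"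
proof (rule integral_cong_AE)
  show "AE x in lebesgue_on U. \<phi> x *\<^sub>R u x = \<phi> x *\<^sub>R v x" using assms(4) by eventually_elim simp
qed (rule L2_scaleR_measurable[OF assms(1) assms(2)] L2_scaleR_measurable[OF assms(1) assms(3)])+

lemma has_wpd_cong_AE:
  assumes w: "has_wpd U u e g" and e: "e \<in> Basis"
    and u': "u' \<in> borel_measurable (lebesgue_on U)" "AE x in lebesgue_on U. u x = u' x"
    and g': "g' \<in> borel_measurable (lebesgue_on U)" "AE x in lebesgue_on U. g x = g' x"
  shows "has_wpd U u' e g'"
proof -
  have L: "L2 U u" "L2 U g" using w by (simp_all add: has_wpd_def)
  have "(\<integral>x. pd e \<phi> x *\<^sub>R u' x \<partial>lebesgue_on U) = - (\<integral>x. \<phi> x *\<^sub>R g' x \<partial>lebesgue_on U)"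
    if p: "test_fun U \<phi>" for \<phi>
    using w p test_fun_integral_cong_AE[OF test_fun_pd[OF p e] L2_measurable[OF L(1)] u']
      test_fun_integral_cong_AE[OF p L2_measurable[OF L(2)] g'] by (simp add: has_wpd_def)
  then show ?thesis using L2_cong_AE[OF L(1) u'] L2_cong_AE[OF L(2) g'] by (simp add: has_wpd_def)
qed

section \<open>Functions independent of the last variable\<close>

lemma open_Omega2: "open \<Gamma> \<Longrightarrow> open (Omega2 \<Gamma>)"
  by (simp add: Omega2_def open_Times)

lemma lift_measurable:
  fixes h :: "'a::euclidean_space \<Rightarrow> 'b::euclidean_space"
  assumes \<Gamma>: "open \<Gamma>" and h: "h \<in> borel_measurable (lebesgue_on \<Gamma>)"
  shows "(\<lambda>x. h (fst x)) \<in> borel_measurable (lebesgue_on (Omega2 \<Gamma>))"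
proof -
  have "(\<lambda>x. indicator \<Gamma> x *\<^sub>R h x) \<in> borel_measurable lebesgue"
    using h \<Gamma> by (simp add: borel_measurable_restrict_space_iff)
  then have "(\<lambda>x::'a \<times> real. indicator \<Gamma> (fst x) *\<^sub>R h (fst x)) \<in> borel_measurable lebesgue"
    by (rule measurable_compose[OF fst_measurable_lebesgue])
  then have "(\<lambda>x::'a \<times> real. indicator \<Gamma> (fst x) *\<^sub>R h (fst x)) \<in> borel_measurable (lebesgue_on (Omega2 \<Gamma>))"
    by (rule measurable_restrict_space1)
  then show ?thesis
    by (rule measurable_cong[THEN iffD1, rotated]) (auto simp: Omega2_def)
qed

lemma lift_AE:
  assumes \<Gamma>: "open \<Gamma>" and P: "AE y in lebesgue_on \<Gamma>. P y"
  shows "AE x in lebesgue_on (Omega2 \<Gamma>). P (fst x)"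
proof -
  have "AE y in lborel. y \<in> \<Gamma> \<longrightarrow> P y" using P \<Gamma> by (simp only: AE_lebesgue_on lborelD sets_completionI_sets borel_open sets_lborel)
  then have "AE x in (lborel :: ('a \<times> real) measure). fst x \<in> \<Gamma> \<longrightarrow> P (fst x)" by (rule AE_fst)
  then have "AE x in (lborel :: ('a \<times> real) measure). x \<in> Omega2 \<Gamma> \<longrightarrow> P (fst x)"
    by eventually_elim (auto simp: Omega2_def)
  then show ?thesis using open_Omega2[OF \<Gamma>] by (simp only: AE_lebesgue_on lborelD sets_completionI_sets borel_open sets_lborel)
qed

text \<open>The two iterated forms have different uses: integrating out z first handles
  z-derivatives, while freezing z handles tangential derivatives.\<close>

lemma Fubini_Omega2:
  fixes h :: "'a::euclidean_space \<Rightarrow> 'b::euclidean_space" and c :: "'a \<times> real \<Rightarrow> real"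
  assumes \<Gamma>: "open \<Gamma>" and h: "integrable (lebesgue_on \<Gamma>) h" and c: "c \<in> borel_measurable borel"
    and bound: "\<And>x. \<bar>c x\<bar> \<le> C"
  shows "integrable (lebesgue_on (Omega2 \<Gamma>)) (\<lambda>x. c x *\<^sub>R h (fst x))"
    "(\<integral>x. c x *\<^sub>R h (fst x) \<partial>lebesgue_on (Omega2 \<Gamma>)) =
      (\<integral>y. (\<integral>z. indicator {0<..<1} z * c (y, z) \<partial>lborel) *\<^sub>R h y \<partial>lebesgue_on \<Gamma>)"
    "(\<integral>x. c x *\<^sub>R h (fst x) \<partial>lebesgue_on (Omega2 \<Gamma>)) =
      (\<integral>z. indicator {0<..<1} z *\<^sub>R (\<integral>y. c (y, z) *\<^sub>R h y \<partial>lebesgue_on \<Gamma>) \<partial>lborel)"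
proof -
  let ?h = "\<lambda>y. indicator \<Gamma> y *\<^sub>R h y" and ?c = "\<lambda>x::'a \<times> real. indicator {0<..<1} (snd x) * c x"
  have Gl: "\<Gamma> \<in> sets lebesgue" and Ol: "Omega2 \<Gamma> \<in> sets lebesgue"
    using \<Gamma> open_Omega2[OF \<Gamma>] by simp_all
  have h': "integrable lebesgue ?h" using h Gl by (simp only: integrable_lebesgue_on_iff)
  have "snd \<in> borel_measurable (borel :: ('a \<times> real) measure)"
    by (intro borel_measurable_continuous_onI continuous_on_snd continuous_on_id)
  then have "(\<lambda>x. indicator {0<..<1} (snd x) :: real) \<in> borel_measurable (borel :: ('a \<times> real) measure)"
    by (rule measurable_compose) simp
  then have c': "?c \<in> borel_measurable borel" using c by (rule borel_measurable_times)
  have b': "\<bar>?c (x, z)\<bar> \<le> C * indicator {0<..<1} z" for x z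
    using bound[of "(x, z)"] by (simp add: indicator_def)
  have S: "{0<..<1::real} \<in> sets borel" "emeasure lborel {0<..<1::real} < \<infinity>" by simp_all
  note F = Fubini_lebesgue[OF h' c' b' S]
  have eq: "?c x *\<^sub>R ?h (fst x) = indicator (Omega2 \<Gamma>) x *\<^sub>R (c x *\<^sub>R h (fst x))" for x
    by (cases x) (auto simp: Omega2_def indicator_def)
  show "integrable (lebesgue_on (Omega2 \<Gamma>)) (\<lambda>x. c x *\<^sub>R h (fst x))"
    using F(1) by (simp only: integrable_lebesgue_on_iff[OF Ol] eq)
  have i1: "(\<integral>x. c x *\<^sub>R h (fst x) \<partial>lebesgue_on (Omega2 \<Gamma>)) = (\<integral>x. ?c x *\<^sub>R ?h (fst x) \<partial>lebesgue)"
    by (simp only: integral_lebesgue_on[OF Ol] eq)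
  show "(\<integral>x. c x *\<^sub>R h (fst x) \<partial>lebesgue_on (Omega2 \<Gamma>)) =
      (\<integral>y. (\<integral>z. indicator {0<..<1} z * c (y, z) \<partial>lborel) *\<^sub>R h y \<partial>lebesgue_on \<Gamma>)"
    unfolding i1 F(2) integral_lebesgue_on[OF Gl] by (simp add: mult.commute)
  have "indicator {0<..<1} z *\<^sub>R (\<integral>y. c (y, z) *\<^sub>R h y \<partial>lebesgue_on \<Gamma>) = (\<integral>x. ?c (x, z) *\<^sub>R ?h x \<partial>lebesgue)" for z
  proof -
    have "?c (x, z) *\<^sub>R ?h x = indicator {0<..<1} z *\<^sub>R (indicator \<Gamma> x *\<^sub>R (c (x, z) *\<^sub>R h x))" for x
      by (simp add: mult_ac)
    then show ?thesis unfolding integral_lebesgue_on[OF Gl] by (simp only: integral_scaleR_right)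
  qed
  then show "(\<integral>x. c x *\<^sub>R h (fst x) \<partial>lebesgue_on (Omega2 \<Gamma>)) =
      (\<integral>z. indicator {0<..<1} z *\<^sub>R (\<integral>y. c (y, z) *\<^sub>R h y \<partial>lebesgue_on \<Gamma>) \<partial>lborel)"
    unfolding i1 F(3) by simp
qed

lemma integral_lift:
  fixes h :: "'a::euclidean_space \<Rightarrow> 'b::euclidean_space"
  assumes \<Gamma>: "open \<Gamma>" and h: "integrable (lebesgue_on \<Gamma>) h"
  shows "integrable (lebesgue_on (Omega2 \<Gamma>)) (\<lambda>x. h (fst x))"
    "(\<integral>x. h (fst x) \<partial>lebesgue_on (Omega2 \<Gamma>)) = (\<integral>y. h y \<partial>lebesgue_on \<Gamma>)"
  using Fubini_Omega2[OF \<Gamma> h, of "\<lambda>_. 1" 1] by simp_all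

lemma L2_lift:
  fixes h :: "'a::euclidean_space \<Rightarrow> 'b::euclidean_space"
  assumes \<Gamma>: "open \<Gamma>" and h: "L2 \<Gamma> h"
  shows "L2 (Omega2 \<Gamma>) (\<lambda>x. h (fst x))" "l2norm (Omega2 \<Gamma>) (\<lambda>x. h (fst x)) = l2norm \<Gamma> h"
proof -
  have i: "integrable (lebesgue_on \<Gamma>) (\<lambda>y. (norm (h y))\<^sup>2)" using h by (simp add: L2_def)
  show "L2 (Omega2 \<Gamma>) (\<lambda>x. h (fst x))"
    unfolding L2_def using lift_measurable[OF \<Gamma> L2_measurable[OF h]] integral_lift(1)[OF \<Gamma> i] by simp
  show "l2norm (Omega2 \<Gamma>) (\<lambda>x. h (fst x)) = l2norm \<Gamma> h"
    unfolding l2norm_def using integral_lift(2)[OF \<Gamma> i] by simp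
qed

text \<open>Nothing is known about \<open>f\<close> except that it describes \<open>u\<close> almost
  everywhere, so its measurability must be earned: by Fubini the identity holds at almost every
  point of some horizontal slice, and there \<open>f\<close> agrees with a Borel function. The
  cylinder has height one, so the square integrals of \<open>u\<close> and \<open>f\<close>
  coincide.\<close>

lemma zindep_L2:
  fixes f :: "'a::euclidean_space \<Rightarrow> 'b::euclidean_space"
  assumes \<Gamma>: "open \<Gamma>" and u: "L2 (Omega2 \<Gamma>) u" and f: "AE x in lebesgue_on (Omega2 \<Gamma>). u x = f (fst x)"
  shows "L2 \<Gamma> f"
proof -
  have Gl: "\<Gamma> \<in> sets lebesgue" and Ol: "Omega2 \<Gamma> \<in> sets lebesgue"
    using \<Gamma> open_Omega2[OF \<Gamma>] by simp_all
  have "(\<lambda>x. indicator (Omega2 \<Gamma>) x *\<^sub>R u x) \<in> borel_measurable lebesgue"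
    using L2_measurable[OF u] Ol by (simp add: borel_measurable_restrict_space_iff)
  then obtain u' where u': "u' \<in> borel_measurable borel" "AE x in lborel. indicator (Omega2 \<Gamma>) x *\<^sub>R u x = u' x"
    by (rule lebesgue_ex_borel) (rule that)
  have "AE x in lborel. x \<in> Omega2 \<Gamma> \<longrightarrow> u x = f (fst x)" using f by (simp only: AE_lebesgue_on[OF Ol])
  with u'(2) have ae: "AE x in lborel. x \<in> Omega2 \<Gamma> \<longrightarrow> u' x = f (fst x)"
  proof eventually_elim
    case (elim x)
    show ?case
    proof
      assume "x \<in> Omega2 \<Gamma>"
      then show "u' x = f (fst x)" using elim by simp
    qed
  qed
  obtain N where N: "\<And>x. x \<in> space lborel - N \<Longrightarrow> x \<in> Omega2 \<Gamma> \<longrightarrow> u' x = f (fst x)" "N \<in> null_sets lborel"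
    by (rule AE_E3[OF ae]) (rule that)
  have Nn: "N \<in> null_sets (lborel \<Otimes>\<^sub>M (lborel :: real measure))" using N(2) by (simp add: lborel_prod)
  then have Ns[measurable]: "N \<in> sets (borel \<Otimes>\<^sub>M (borel :: real measure))" using null_setsD2[OF Nn] by (simp cong: sets_pair_measure_cong)
  have "AE x in lborel \<Otimes>\<^sub>M lborel. x \<notin> N" using Nn by (rule AE_not_in)
  then have "AE x in lborel. AE z in lborel. (x, z) \<notin> N" by (rule lborel_pair.AE_pair)
  then have "AE z in lborel. AE x in lborel. (x, z) \<notin> N"
    by (subst lborel_pair.AE_commute) measurable
  then obtain Z where Z: "\<And>z. z \<in> space lborel - Z \<Longrightarrow> AE x in lborel. (x, z) \<notin> N" "Z \<in> null_sets lborel"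
    by (rule AE_E3) (rule that)
  \<comment> \<open>Almost every height is good and the unit interval is not null, so a good height
    inside it exists.\<close>
  have "\<not> {0<..<1::real} \<subseteq> Z"
  proof
    assume "{0<..<1::real} \<subseteq> Z"
    then have "emeasure lborel {0<..<1::real} \<le> emeasure lborel Z" using null_setsD2[OF Z(2)] by (rule emeasure_mono)
    then show False using null_setsD1[OF Z(2)] by simp
  qed
  then obtain z0 where z0: "0 < z0" "z0 < 1" "z0 \<notin> Z" by (auto simp: subset_iff)
  then have ae0: "AE x in lborel. (x, z0) \<notin> N" using Z(1)[of z0] by simp
  have u'm[measurable]: "u' \<in> borel_measurable (borel \<Otimes>\<^sub>M borel)" using u'(1) by (simp add: borel_prod)
  have Gb[measurable]: "\<Gamma> \<in> sets borel" using \<Gamma> by simp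
  have "(\<lambda>x. indicator \<Gamma> x *\<^sub>R u' (x, z0)) \<in> borel_measurable borel"
    by measurable
  then have m: "(\<lambda>x. indicator \<Gamma> x *\<^sub>R u' (x, z0)) \<in> borel_measurable lebesgue"
    by (intro measurable_completion) simp
  define f0 where "f0 x = indicator \<Gamma> x *\<^sub>R f x" for x
  have "AE x in lebesgue. f0 x = indicator \<Gamma> x *\<^sub>R u' (x, z0)"
    unfolding AE_completion_iff using ae0
  proof eventually_elim
    case (elim x)
    show ?case
      using N(1)[of "(x, z0)"] elim z0 by (cases "x \<in> \<Gamma>") (simp_all add: f0_def Omega2_def)
  qed
  with m have f0: "f0 \<in> borel_measurable lebesgue" by (rule measurable_lebesgue_AE)
  then have fm: "f \<in> borel_measurable (lebesgue_on \<Gamma>)"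
    using Gl by (simp add: f0_def[abs_def] borel_measurable_restrict_space_iff)
  obtain f' where f': "f' \<in> borel_measurable borel" "AE x in lborel. f0 x = f' x"
    by (rule lebesgue_ex_borel[OF f0]) (rule that)
  note f'(1)[measurable]
  have "(\<integral>\<^sup>+x. ennreal ((norm (f0 x))\<^sup>2) \<partial>lebesgue) = (\<integral>\<^sup>+x. ennreal ((norm (f0 x))\<^sup>2) \<partial>lborel)"
    by (rule nn_integral_completion)
  also have "\<dots> = (\<integral>\<^sup>+x. ennreal ((norm (f' x))\<^sup>2) \<partial>lborel)"
    by (rule nn_integral_cong_AE) (use f'(2) in \<open>eventually_elim, simp\<close>)
  \<comment> \<open>A factor of integral one over the heights is inserted in order to pass to the
    product.\<close>
  also have "\<dots> = (\<integral>\<^sup>+x. (\<integral>\<^sup>+z. ennreal ((norm (f' x))\<^sup>2) * indicator {0<..<1::real} z \<partial>lborel) \<partial>lborel)"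
    by (simp add: nn_integral_cmult_indicator)
  also have "\<dots> = (\<integral>\<^sup>+x. ennreal ((norm (f' (fst x)))\<^sup>2) * indicator {0<..<1::real} (snd x) \<partial>(lborel \<Otimes>\<^sub>M lborel))"
  proof -
    have "(\<lambda>x. ennreal ((norm (f' (fst x)))\<^sup>2) * indicator {0<..<1::real} (snd x)) \<in> borel_measurable (borel \<Otimes>\<^sub>M borel)"
      by measurable
    then have "(\<lambda>x. ennreal ((norm (f' (fst x)))\<^sup>2) * indicator {0<..<1::real} (snd x)) \<in> borel_measurable (lborel \<Otimes>\<^sub>M lborel)"
      by (subst measurable_cong_sets[OF sets_pair_measure_cong[OF sets_lborel sets_lborel] refl])
    from lborel.nn_integral_fst[OF this] show ?thesis by simp
  qed
  also have "\<dots> = (\<integral>\<^sup>+x. ennreal ((norm (f' (fst x)))\<^sup>2) * indicator {0<..<1::real} (snd x) \<partial>lborel)"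
    by (simp only: lborel_prod)
  also have "\<dots> = (\<integral>\<^sup>+x. ennreal ((norm (indicator (Omega2 \<Gamma>) x *\<^sub>R u x))\<^sup>2) \<partial>lborel)"
  proof (rule nn_integral_cong_AE)
    have "AE x in (lborel :: ('a \<times> real) measure). f0 (fst x) = f' (fst x)" by (rule AE_fst[OF f'(2)])
    then show "AE x in lborel. ennreal ((norm (f' (fst x)))\<^sup>2) * indicator {0<..<1::real} (snd x) =
        ennreal ((norm (indicator (Omega2 \<Gamma>) x *\<^sub>R u x))\<^sup>2)"
      using u'(2) ae
    proof eventually_elim
      case (elim x)
      show ?case
      proof (cases "x \<in> Omega2 \<Gamma>")
        case True
        then have "f' (fst x) = u x" "snd x \<in> {0<..<1}" using elim by (auto simp: f0_def Omega2_def)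
        then show ?thesis using True by simp
      next
        case False
        then have "f' (fst x) = 0 \<or> snd x \<notin> {0<..<1}"
          using elim by (cases x) (auto simp: f0_def Omega2_def)
        then show ?thesis using False by auto
      qed
    qed
  qed
  also have "\<dots> = (\<integral>\<^sup>+x. ennreal ((norm (indicator (Omega2 \<Gamma>) x *\<^sub>R u x))\<^sup>2) \<partial>lebesgue)"
    by (rule nn_integral_completion[symmetric])
  also have "\<dots> < \<infinity>"
  proof -
    have "integrable lebesgue (\<lambda>x. indicator (Omega2 \<Gamma>) x *\<^sub>R (norm (u x))\<^sup>2)"
      using u Ol by (simp add: L2_def integrable_lebesgue_on_iff)
    moreover have "(\<lambda>x. indicator (Omega2 \<Gamma>) x *\<^sub>R (norm (u x))\<^sup>2) = (\<lambda>x. (norm (indicator (Omega2 \<Gamma>) x *\<^sub>R u x))\<^sup>2)"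
      by (auto simp: indicator_def fun_eq_iff)
    ultimately have "integrable lebesgue (\<lambda>x. (norm (indicator (Omega2 \<Gamma>) x *\<^sub>R u x))\<^sup>2)" by simp
    from integrableD(2)[OF this] show ?thesis by (simp add: less_top[symmetric])
  qed
  finally have fin: "(\<integral>\<^sup>+x. ennreal ((norm (f0 x))\<^sup>2) \<partial>lebesgue) < \<infinity>" .
  have "integrable lebesgue (\<lambda>x. (norm (f0 x))\<^sup>2)"
    by (rule integrableI_bounded) (use f0 fin in simp_all)
  moreover have "(\<lambda>x. (norm (f0 x))\<^sup>2) = (\<lambda>x. indicator \<Gamma> x *\<^sub>R (norm (f x))\<^sup>2)"
    by (auto simp: f0_def indicator_def fun_eq_iff)
  ultimately show ?thesis using fm Gl by (simp add: L2_def integrable_lebesgue_on_iff)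
qed

section \<open>The translation estimate\<close>

(* Integrating the weak derivative identity for the translates psi(. - s e) over 0 <= s <= T. *)
lemma shift_estimate:
  fixes d :: "'e::euclidean_space \<Rightarrow> real"
  assumes U: "U \<in> lmeasurable" and d: "L2 U d" and e: "e \<in> Basis" and T: "0 \<le> T"
    and psi: "test_fun V \<psi>"
    and M: "\<And>s. 0 \<le> s \<Longrightarrow> s \<le> T \<Longrightarrow> \<bar>\<integral>x. pd e \<psi> (x - s *\<^sub>R e) * d x \<partial>lebesgue_on U\<bar> \<le> M"
  shows "\<bar>\<integral>x. (\<psi> x - \<psi> (x - T *\<^sub>R e)) * d x \<partial>lebesgue_on U\<bar> \<le> T * M"
proof -
  have Ul: "U \<in> sets lebesgue" using U by (rule fmeasurableD)
  let ?c = "\<lambda>x::'e \<times> real. indicator {0..T} (snd x) * pd e \<psi> (fst x - snd x *\<^sub>R e)"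
  let ?h = "\<lambda>x. indicator U x *\<^sub>R d x"
  obtain C where C: "C > 0" "\<And>x. \<bar>pd e \<psi> x\<bar> \<le> C" by (rule test_fun_bounded[OF test_fun_pd[OF psi e]]) (rule that)
  have h: "integrable lebesgue ?h" using L2_integrable[OF U d] by (simp only: integrable_lebesgue_on_iff[OF Ul])
  have cont: "continuous_on UNIV (pd e \<psi>)" by (rule test_fun_continuous[OF test_fun_pd[OF psi e]])
  have "snd \<in> borel_measurable (borel :: ('e \<times> real) measure)"
    by (intro borel_measurable_continuous_onI continuous_on_snd continuous_on_id)
  then have m1: "(\<lambda>x. indicator {0..T} (snd x) :: real) \<in> borel_measurable (borel :: ('e \<times> real) measure)"
    by (rule measurable_compose) simp
  have m2: "(\<lambda>x::'e \<times> real. pd e \<psi> (fst x - snd x *\<^sub>R e)) \<in> borel_measurable borel"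
    by (intro borel_measurable_continuous_onI continuous_on_compose2[OF cont] continuous_intros) simp
  have c: "?c \<in> borel_measurable borel" using m1 m2 by (rule borel_measurable_times)
  have b: "\<bar>?c (x, s)\<bar> \<le> C * indicator {0..T} s" for x s
    using C(2)[of "x - s *\<^sub>R e"] by (simp add: indicator_def)
  have S: "{0..T} \<in> sets borel" "emeasure lborel {0..T} < \<infinity>" using T by simp_all
  note F = Fubini_lebesgue[OF h c b S]
  have ftc: "(\<integral>s. ?c (x, s) \<partial>lborel) = \<psi> x - \<psi> (x - T *\<^sub>R e)" for x
  proof -
    have D: "((\<lambda>s. - \<psi> (x - s *\<^sub>R e)) has_real_derivative pd e \<psi> (x - s *\<^sub>R e)) (at s)" for s
    proof -
      have A: "((\<lambda>s. x - s *\<^sub>R e) has_derivative (\<lambda>v. - (v *\<^sub>R e))) (at s)"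
        by (auto intro!: derivative_eq_intros)
      have "((\<lambda>s. \<psi> (x - s *\<^sub>R e)) has_derivative
          (\<lambda>v. \<Sum>b\<in>Basis. (- (v *\<^sub>R e) \<bullet> b) *\<^sub>R pd b \<psi> (x - s *\<^sub>R e))) (at s)"
        by (rule has_derivative_compose[where g = \<psi>, OF A has_derivative_pd[OF test_fun_differentiable[OF psi]]])
      moreover have "(\<Sum>b\<in>Basis. (- (v *\<^sub>R e) \<bullet> b) *\<^sub>R pd b \<psi> (x - s *\<^sub>R e)) = - (pd e \<psi> (x - s *\<^sub>R e) * v)" for v
      proof -
        have "(\<Sum>b\<in>Basis. (- (v *\<^sub>R e) \<bullet> b) *\<^sub>R pd b \<psi> (x - s *\<^sub>R e))
            = (\<Sum>b\<in>Basis. if b = e then - (pd e \<psi> (x - s *\<^sub>R e) * v) else 0)"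
          by (rule sum.cong) (use e in \<open>auto simp: inner_Basis\<close>)
        also have "\<dots> = - (pd e \<psi> (x - s *\<^sub>R e) * v)" using e by simp
        finally show ?thesis .
      qed
      ultimately have "((\<lambda>s. \<psi> (x - s *\<^sub>R e)) has_derivative (\<lambda>v. - (pd e \<psi> (x - s *\<^sub>R e) * v))) (at s)" by simp
      from has_derivative_minus[OF this] show ?thesis by (simp add: has_field_derivative_def)
    qed
    have "(\<integral>s. pd e \<psi> (x - s *\<^sub>R e) * indicator {0..T} s \<partial>lborel) = - \<psi> (x - T *\<^sub>R e) - - \<psi> (x - 0 *\<^sub>R e)"
    proof (rule integral_FTC_Icc_real[OF T D])
      have "continuous_on UNIV (\<lambda>s. pd e \<psi> (x - s *\<^sub>R e))"
        by (intro continuous_on_compose2[OF cont] continuous_intros) simp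
      then show "isCont (\<lambda>s. pd e \<psi> (x - s *\<^sub>R e)) s" for s by (simp add: continuous_on_eq_continuous_at)
    qed
    then show ?thesis by (simp add: mult.commute)
  qed
  have int: "(\<integral>x. ?c (x, s) *\<^sub>R ?h x \<partial>lebesgue) = indicator {0..T} s * (\<integral>x. pd e \<psi> (x - s *\<^sub>R e) * d x \<partial>lebesgue_on U)" for s
  proof -
    have "?c (x, s) *\<^sub>R ?h x = indicator {0..T} s *\<^sub>R (indicator U x *\<^sub>R (pd e \<psi> (x - s *\<^sub>R e) * d x))" for x
      by (simp add: mult_ac)
    then show ?thesis unfolding integral_lebesgue_on[OF Ul] by (simp only: integral_mult_right_zero real_scaleR_def)
  qed
  have "(\<integral>x. (\<psi> x - \<psi> (x - T *\<^sub>R e)) * d x \<partial>lebesgue_on U) = (\<integral>x. (\<integral>s. ?c (x, s) \<partial>lborel) *\<^sub>R ?h x \<partial>lebesgue)"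
    unfolding integral_lebesgue_on[OF Ul] ftc by (simp add: mult_ac)
  also have "\<dots> = (\<integral>s. indicator {0..T} s * (\<integral>x. pd e \<psi> (x - s *\<^sub>R e) * d x \<partial>lebesgue_on U) \<partial>lborel)"
    using F(2,3) int by simp
  also have "\<bar>\<dots>\<bar> \<le> (\<integral>s. indicator {0..T} s * M \<partial>lborel)"
  \<comment> \<open>Without integrability the integral in s is 0 by convention, and \<open>M\<close>
    is nonnegative by the hypothesis at s = 0.\<close>
  proof (cases "integrable lborel (\<lambda>s. indicator {0..T} s * (\<integral>x. pd e \<psi> (x - s *\<^sub>R e) * d x \<partial>lebesgue_on U))")
    case True
    have "norm (\<integral>s. indicator {0..T} s * (\<integral>x. pd e \<psi> (x - s *\<^sub>R e) * d x \<partial>lebesgue_on U) \<partial>lborel) \<le>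
        (\<integral>s. indicator {0..T} s * M \<partial>lborel)"
    proof (rule Bochner_Integration.integral_norm_bound_integral[OF True])
      show "integrable lborel (\<lambda>s. indicator {0..T} s * M)"
        by (rule integrable_mult_left, rule integrable_real_indicator) (use S in simp_all)
      show "norm (indicator {0..T} s * (\<integral>x. pd e \<psi> (x - s *\<^sub>R e) * d x \<partial>lebesgue_on U)) \<le> indicator {0..T} s * M" for s
        using M[of s] by (simp add: indicator_def)
    qed
    then show ?thesis by simp
  next
    case False
    have "0 \<le> M" using M[of 0] T by simp
    then show ?thesis using T by (simp only: not_integrable_integral_eq[OF False]) simp
  qed
  also have "\<dots> = T * M" using T by simp
  finally show ?thesis .
qed

section \<open>Traces and weak derivatives of lifted functions\<close>

lemma integral_open_unit:
  fixes k :: "real \<Rightarrow> real"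
  assumes "continuous_on UNIV k"
  shows "(\<integral>z. indicator {0<..<1} z * k z \<partial>lborel) = (\<integral>z. k z * indicator {0..1} z \<partial>lborel)"
proof (rule integral_cong_AE)
  have k: "k \<in> borel_measurable lborel" using borel_measurable_continuous_onI[OF assms] by simp
  show "(\<lambda>z. indicator {0<..<1} z * k z) \<in> borel_measurable lborel"
    by (intro borel_measurable_times borel_measurable_indicator k) simp
  show "(\<lambda>z. k z * indicator {0..1} z) \<in> borel_measurable lborel"
    by (intro borel_measurable_times borel_measurable_indicator k) simp
  have "AE z in lborel. z \<noteq> (0::real)" "AE z in lborel. z \<noteq> (1::real)" by (rule AE_lborel_singleton)+
  then show "AE z in lborel. indicator {0<..<1} z * k z = k z * indicator {0..1} z"
    by eventually_elim (auto simp: indicator_def)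
qed

lemma z_integral_FTC:
  assumes "\<And>z. (F has_real_derivative k z) (at z)" "continuous_on UNIV k"
  shows "(\<integral>z. indicator {0<..<1} z * k z \<partial>lborel) = F 1 - F 0"
  unfolding integral_open_unit[OF assms(2)]
  by (rule integral_FTC_Icc_real) (use assms in \<open>auto simp: continuous_on_eq_continuous_at\<close>)

lemma z_slice_continuous:
  fixes \<phi> :: "'a::euclidean_space \<times> real \<Rightarrow> real"
  assumes "test_fun V \<phi>"
  shows "continuous_on UNIV (\<lambda>z. \<phi> (y, z))"
  by (intro continuous_on_compose2[OF test_fun_continuous[OF assms]] continuous_intros) simp

lemma z_integral_pd:
  assumes "test_fun V \<phi>"
  shows "(\<integral>z. indicator {0<..<1} z * pd ez \<phi> (y, z) \<partial>lborel) = \<phi> (y, 1) - \<phi> (y, 0)"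
  by (rule z_integral_FTC[OF slice2_deriv[OF test_fun_differentiable[OF assms]]
      z_slice_continuous[OF test_fun_pd[OF assms ez_Basis]]])

text \<open>The integrand is the z-derivative of \<phi>(y, z) (z - 1). The factor vanishes at the
  top and equals -1 at the bottom, so only the value at z = 0 survives.\<close>

lemma z_integral_pd_linear:
  assumes "test_fun V \<phi>"
  shows "(\<integral>z. indicator {0<..<1} z * (pd ez \<phi> (y, z) * (z - 1) + \<phi> (y, z)) \<partial>lborel) = \<phi> (y, 0)"
proof -
  have "((\<lambda>z. \<phi> (y, z) * (z - 1)) has_real_derivative (pd ez \<phi> (y, z) * (z - 1) + \<phi> (y, z))) (at z)" for z
  proof -
    have "((\<lambda>z. z - 1) has_real_derivative 1) (at z)" by (auto intro!: derivative_eq_intros)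
    from DERIV_mult[OF slice2_deriv[OF test_fun_differentiable[OF assms], of y z] this]
    show ?thesis by simp
  qed
  from z_integral_FTC[OF this] show ?thesis
    by (simp add: continuous_intros z_slice_continuous[OF assms] z_slice_continuous[OF test_fun_pd[OF assms ez_Basis]])
qed

locale cylinder =
  fixes \<Gamma> :: "'a::euclidean_space set"
  assumes open_G: "open \<Gamma>" and bounded_G: "bounded \<Gamma>"
begin

abbreviation "\<Omega> \<equiv> Omega2 \<Gamma>"

lemma G_lm: "\<Gamma> \<in> lmeasurable"
  by (rule lmeasurable_open[OF bounded_G open_G])

lemma G_leb: "\<Gamma> \<in> sets lebesgue"
  by (rule fmeasurableD[OF G_lm])

lemma open_O: "open \<Omega>"
  by (rule open_Omega2[OF open_G])

lemma O_lm: "\<Omega> \<in> lmeasurable"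
proof (rule lmeasurable_open[OF _ open_O])
  show "bounded \<Omega>" unfolding Omega2_def by (intro bounded_Times bounded_G) simp
qed

lemma O_leb: "\<Omega> \<in> sets lebesgue"
  by (rule fmeasurableD[OF O_lm])

lemma integral_pd_ez_lift:
  assumes \<phi>: "test_fun V \<phi>" and h: "L2 \<Gamma> h"
  shows "(\<integral>x. pd ez \<phi> x *\<^sub>R h (fst x) \<partial>lebesgue_on \<Omega>) = (\<integral>y. (\<phi> (y, 1) - \<phi> (y, 0)) *\<^sub>R h y \<partial>lebesgue_on \<Gamma>)"
proof -
  obtain C where C: "C > 0" "\<And>x. \<bar>pd ez \<phi> x\<bar> \<le> C"
    by (rule test_fun_bounded[OF test_fun_pd[OF \<phi> ez_Basis]]) (rule that)
  show ?thesis
    using Fubini_Omega2(2)[OF open_G L2_integrable[OF G_lm h] test_fun_borel[OF test_fun_pd[OF \<phi> ez_Basis]] C(2)]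
    by (simp only: z_integral_pd[OF \<phi>])
qed

lemma L2_linear_lift:
  fixes f :: "'a \<Rightarrow> real"
  assumes f: "L2 \<Gamma> f"
  shows "L2 \<Omega> (\<lambda>x. (snd x - 1) * f (fst x))"
    "l2norm \<Omega> (\<lambda>x. (snd x - 1) * f (fst x)) \<le> l2norm \<Gamma> f"
proof -
  have "snd \<in> borel_measurable (borel :: ('a \<times> real) measure)"
    by (intro borel_measurable_continuous_onI continuous_on_snd continuous_on_id)
  then have "(\<lambda>x::'a \<times> real. snd x - 1) \<in> borel_measurable borel" by simp
  then have m: "(\<lambda>x. (snd x - 1) * f (fst x)) \<in> borel_measurable (lebesgue_on \<Omega>)"
    by (intro borel_measurable_times borel_lebesgue_on lift_measurable[OF open_G] L2_measurable[OF f])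
  have ae: "AE x in lebesgue_on \<Omega>. norm ((snd x - 1) * f (fst x)) \<le> 1 * norm (f (fst x))"
  proof (rule AE_I2)
    fix x assume "x \<in> space (lebesgue_on \<Omega>)"
    then have "\<bar>snd x - 1\<bar> \<le> 1" by (auto simp: Omega2_def)
    then show "norm ((snd x - 1) * f (fst x)) \<le> 1 * norm (f (fst x))"
      by (simp add: abs_mult mult_left_le_one_le)
  qed
  show l: "L2 \<Omega> (\<lambda>x. (snd x - 1) * f (fst x))" by (rule L2_bounded[OF L2_lift(1)[OF open_G f] m ae])
  show "l2norm \<Omega> (\<lambda>x. (snd x - 1) * f (fst x)) \<le> l2norm \<Gamma> f"
    using l2norm_mono[OF L2_lift(1)[OF open_G f] l ae] by (simp add: L2_lift(2)[OF open_G f])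
qed

text \<open>Integration by parts in z for the profile (z - 1) f. Since the profile vanishes at the
  top, one identity yields at once its z-derivative, its trace - f at 0 and its trace 0 at
  1.\<close>

lemma integral_pd_ez_linear_lift:
  fixes f :: "'a \<Rightarrow> real"
  assumes \<phi>: "test_fun V \<phi>" and f: "L2 \<Gamma> f"
  shows "(\<integral>x. pd ez \<phi> x *\<^sub>R ((snd x - 1) * f (fst x)) + \<phi> x *\<^sub>R f (fst x) \<partial>lebesgue_on \<Omega>) =
    (\<integral>y. \<phi> (y, 0) * f y \<partial>lebesgue_on \<Gamma>)"
proof -
  \<comment> \<open>The factor z - 1 is clamped outside the unit interval, so that the weight is
    bounded everywhere as the Fubini lemma demands; over the cylinder nothing changes.\<close>
  define cl where "cl z = max 0 (min 1 z) - 1" for z :: real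
  have cl: "\<bar>cl z\<bar> \<le> 1" for z by (simp add: cl_def)
  have cl_eq: "cl z = z - 1" if "0 < z" "z < 1" for z using that by (simp add: cl_def)
  obtain C where C: "C > 0" "\<And>x. \<bar>pd ez \<phi> x\<bar> \<le> C"
    by (rule test_fun_bounded[OF test_fun_pd[OF \<phi> ez_Basis]]) (rule that)
  obtain D where D: "D > 0" "\<And>x. \<bar>\<phi> x\<bar> \<le> D" by (rule test_fun_bounded[OF \<phi>]) (rule that)
  let ?c = "\<lambda>x. pd ez \<phi> x * cl (snd x) + \<phi> x"
  have "\<bar>?c x\<bar> \<le> C + D" for x
  proof -
    have "\<bar>pd ez \<phi> x * cl (snd x)\<bar> \<le> C * 1" unfolding abs_mult by (intro mult_mono C(2) cl) (use C in auto)
    then show ?thesis using D(2)[of x] by linarith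
  qed
  moreover have "?c \<in> borel_measurable borel"
  proof -
    have "continuous_on UNIV (\<lambda>x::'a \<times> real. cl (snd x))" unfolding cl_def by (intro continuous_intros)
    then show ?thesis
      by (intro borel_measurable_add borel_measurable_times test_fun_borel[OF \<phi>]
          test_fun_borel[OF test_fun_pd[OF \<phi> ez_Basis]] borel_measurable_continuous_onI)
  qed
  ultimately have "(\<integral>x. ?c x *\<^sub>R f (fst x) \<partial>lebesgue_on \<Omega>) =
      (\<integral>y. (\<integral>z. indicator {0<..<1} z * ?c (y, z) \<partial>lborel) *\<^sub>R f y \<partial>lebesgue_on \<Gamma>)"
    by (intro Fubini_Omega2(2)[OF open_G L2_integrable[OF G_lm f]])
  moreover have "indicator {0<..<1} z * ?c (y, z) = indicator {0<..<1} z * (pd ez \<phi> (y, z) * (z - 1) + \<phi> (y, z))" for y z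
    by (simp add: indicator_def cl_eq)
  then have "(\<integral>z. indicator {0<..<1} z * ?c (y, z) \<partial>lborel) = \<phi> (y, 0)" for y
    by (simp only: z_integral_pd_linear[OF \<phi>])
  moreover have "(\<integral>x. ?c x *\<^sub>R f (fst x) \<partial>lebesgue_on \<Omega>) =
     (\<integral>x. pd ez \<phi> x *\<^sub>R ((snd x - 1) * f (fst x)) + \<phi> x *\<^sub>R f (fst x) \<partial>lebesgue_on \<Omega>)"
  proof (rule Bochner_Integration.integral_cong[OF refl])
    fix x assume "x \<in> space (lebesgue_on \<Omega>)"
    then have "cl (snd x) = snd x - 1" by (intro cl_eq) (auto simp: Omega2_def)
    then show "?c x *\<^sub>R f (fst x) = pd ez \<phi> x *\<^sub>R ((snd x - 1) * f (fst x)) + \<phi> x *\<^sub>R f (fst x)"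
      by (simp add: distrib_right)
  qed
  ultimately show ?thesis by simp
qed

lemma test_fun_O_boundary:
  assumes "test_fun \<Omega> \<phi>"
  shows "\<phi> (y, 0) = 0" "\<phi> (y, 1) = 0"
  by (rule test_fun_eq_0[OF assms], simp add: Omega2_def)+

lemma test_int:
  assumes "test_fun V \<phi>" "L2 \<Omega> u"
  shows "integrable (lebesgue_on \<Omega>) (\<lambda>x. \<phi> x *\<^sub>R u x)"
  by (rule test_fun_scaleR_integrable[OF assms(1) O_leb assms(2)])

lemma test_intG:
  assumes "test_fun V \<phi>" "L2 \<Gamma> u"
  shows "integrable (lebesgue_on \<Gamma>) (\<lambda>x. \<phi> x *\<^sub>R u x)"
  by (rule test_fun_scaleR_integrable[OF assms(1) G_leb assms(2)])

section \<open>Weak derivatives and traces of z-independent and of linear profiles\<close>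

lemma has_wpd_lift_z:
  assumes "L2 \<Gamma> h"
  shows "has_wpd \<Omega> (\<lambda>x. h (fst x)) ez (\<lambda>x. 0)"
  unfolding has_wpd_def
  using L2_lift(1)[OF open_G assms] integral_pd_ez_lift[OF _ assms] by (simp add: L2_zero test_fun_O_boundary)

lemma has_wpd_linear_lift_z:
  fixes f :: "'a \<Rightarrow> real"
  assumes f: "L2 \<Gamma> f"
  shows "has_wpd \<Omega> (\<lambda>x. (snd x - 1) * f (fst x)) ez (\<lambda>x. f (fst x))"
  unfolding has_wpd_def
proof (intro conjI allI impI L2_linear_lift f L2_lift open_G)
  fix \<phi> assume \<phi>: "test_fun \<Omega> \<phi>"
  have "(\<integral>x. pd ez \<phi> x *\<^sub>R ((snd x - 1) * f (fst x)) + \<phi> x *\<^sub>R f (fst x) \<partial>lebesgue_on \<Omega>) = 0"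
    unfolding integral_pd_ez_linear_lift[OF \<phi> f] by (simp add: test_fun_O_boundary[OF \<phi>])
  then show "(\<integral>x. pd ez \<phi> x *\<^sub>R ((snd x - 1) * f (fst x)) \<partial>lebesgue_on \<Omega>) = - (\<integral>x. \<phi> x *\<^sub>R f (fst x) \<partial>lebesgue_on \<Omega>)"
    using test_int[OF test_fun_pd[OF \<phi> ez_Basis] L2_linear_lift(1)[OF f]] test_int[OF \<phi> L2_lift(1)[OF open_G f]]
    by (simp del: real_scaleR_def)
qed

lemma ztrace0_lift:
  assumes h: "L2 \<Gamma> h"
  shows "ztrace0 \<Gamma> (\<lambda>x. h (fst x)) h"
  unfolding ztrace0_def
proof (intro conjI h exI[of _ "\<lambda>x. 0"] has_wpd_lift_z allI impI)
  fix \<phi> assume \<phi>: "test_fun (\<Gamma> \<times> {..<1::real}) \<phi>"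
  have "\<phi> (y, 1) = 0" for y by (rule test_fun_eq_0[OF \<phi>]) simp
  then show "(\<integral>x. pd ez \<phi> x *\<^sub>R h (fst x) + \<phi> x *\<^sub>R 0 \<partial>lebesgue_on \<Omega>) = - (\<integral>y. \<phi> (y, 0) *\<^sub>R h y \<partial>lebesgue_on \<Gamma>)"
    using integral_pd_ez_lift[OF \<phi> h] by simp
qed

lemma ztrace0_linear_lift:
  fixes f :: "'a \<Rightarrow> real"
  assumes f: "L2 \<Gamma> f"
  shows "ztrace0 \<Gamma> (\<lambda>x. (snd x - 1) * f (fst x)) (\<lambda>y. - f y)"
  unfolding ztrace0_def
  by (intro conjI L2_minus f exI[of _ "\<lambda>x. f (fst x)"] has_wpd_linear_lift_z allI impI)
    (simp only: integral_pd_ez_linear_lift f, simp)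

lemma ztrace1_linear_lift:
  fixes f :: "'a \<Rightarrow> real"
  assumes f: "L2 \<Gamma> f"
  shows "ztrace1 \<Gamma> (\<lambda>x. (snd x - 1) * f (fst x)) (\<lambda>_. 0)"
  unfolding ztrace1_def
proof (intro conjI L2_zero f exI[of _ "\<lambda>x. f (fst x)"] has_wpd_linear_lift_z allI impI)
  fix \<phi> assume \<phi>: "test_fun (\<Gamma> \<times> {0::real<..}) \<phi>"
  have "\<phi> (y, 0) = 0" for y by (rule test_fun_eq_0[OF \<phi>]) simp
  then show "(\<integral>x. pd ez \<phi> x *\<^sub>R ((snd x - 1) * f (fst x)) + \<phi> x *\<^sub>R f (fst x) \<partial>lebesgue_on \<Omega>) =
      (\<integral>y. \<phi> (y, 1) *\<^sub>R 0 \<partial>lebesgue_on \<Gamma>)"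
    unfolding integral_pd_ez_linear_lift[OF \<phi> f] by simp
qed

lemma pd_identity_cong_AE:
  fixes u u' g g' :: "'a \<times> real \<Rightarrow> 'b::euclidean_space"
  assumes \<phi>: "test_fun V \<phi>" and e: "e \<in> Basis" and L: "L2 \<Omega> u" "L2 \<Omega> g" "L2 \<Omega> u'" "L2 \<Omega> g'"
    and ae: "AE x in lebesgue_on \<Omega>. u x = u' x" "AE x in lebesgue_on \<Omega>. g x = g' x"
  shows "(\<integral>x. pd e \<phi> x *\<^sub>R u x + \<phi> x *\<^sub>R g x \<partial>lebesgue_on \<Omega>) = (\<integral>x. pd e \<phi> x *\<^sub>R u' x + \<phi> x *\<^sub>R g' x \<partial>lebesgue_on \<Omega>)"
proof (rule integral_cong_AE)
  show "AE x in lebesgue_on \<Omega>. pd e \<phi> x *\<^sub>R u x + \<phi> x *\<^sub>R g x = pd e \<phi> x *\<^sub>R u' x + \<phi> x *\<^sub>R g' x"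
    using ae by eventually_elim simp
qed (intro borel_measurable_add L2_scaleR_measurable[OF \<phi>] L2_scaleR_measurable[OF test_fun_pd[OF \<phi> e]] L2_measurable L)+

text \<open>A trace comes with some z-derivative hidden under an existential quantifier. Uniqueness
  of weak derivatives makes the identity available for any prescribed one.\<close>

lemma ztrace0_identity:
  assumes z: "ztrace0 \<Gamma> u g" and w: "has_wpd \<Omega> u ez du" and \<phi>: "test_fun (\<Gamma> \<times> {..<1}) \<phi>"
  shows "(\<integral>x. pd ez \<phi> x *\<^sub>R u x + \<phi> x *\<^sub>R du x \<partial>lebesgue_on \<Omega>) = - (\<integral>y. \<phi> (y, 0) *\<^sub>R g y \<partial>lebesgue_on \<Gamma>)"
proof -
  obtain du' where du': "has_wpd \<Omega> u ez du'"
    "(\<integral>x. pd ez \<phi> x *\<^sub>R u x + \<phi> x *\<^sub>R du' x \<partial>lebesgue_on \<Omega>) = - (\<integral>y. \<phi> (y, 0) *\<^sub>R g y \<partial>lebesgue_on \<Gamma>)"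
    using z \<phi> unfolding ztrace0_def by auto
  have "(\<integral>x. pd ez \<phi> x *\<^sub>R u x + \<phi> x *\<^sub>R du x \<partial>lebesgue_on \<Omega>) = (\<integral>x. pd ez \<phi> x *\<^sub>R u x + \<phi> x *\<^sub>R du' x \<partial>lebesgue_on \<Omega>)"
    by (rule pd_identity_cong_AE[OF \<phi> ez_Basis])
      (use w du' has_wpd_unique[OF open_O w du'(1)] in \<open>simp_all add: has_wpd_def\<close>)
  then show ?thesis using du' by simp
qed

lemma ztrace1_identity:
  assumes z: "ztrace1 \<Gamma> u g" and w: "has_wpd \<Omega> u ez du" and \<phi>: "test_fun (\<Gamma> \<times> {0<..}) \<phi>"
  shows "(\<integral>x. pd ez \<phi> x *\<^sub>R u x + \<phi> x *\<^sub>R du x \<partial>lebesgue_on \<Omega>) = (\<integral>y. \<phi> (y, 1) *\<^sub>R g y \<partial>lebesgue_on \<Gamma>)"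
proof -
  obtain du' where du': "has_wpd \<Omega> u ez du'"
    "(\<integral>x. pd ez \<phi> x *\<^sub>R u x + \<phi> x *\<^sub>R du' x \<partial>lebesgue_on \<Omega>) = (\<integral>y. \<phi> (y, 1) *\<^sub>R g y \<partial>lebesgue_on \<Gamma>)"
    using z \<phi> unfolding ztrace1_def by auto
  have "(\<integral>x. pd ez \<phi> x *\<^sub>R u x + \<phi> x *\<^sub>R du x \<partial>lebesgue_on \<Omega>) = (\<integral>x. pd ez \<phi> x *\<^sub>R u x + \<phi> x *\<^sub>R du' x \<partial>lebesgue_on \<Omega>)"
    by (rule pd_identity_cong_AE[OF \<phi> ez_Basis])
      (use w du' has_wpd_unique[OF open_O w du'(1)] in \<open>simp_all add: has_wpd_def\<close>)
  then show ?thesis using du' by simp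
qed

lemma ztrace0_cong_AE:
  assumes z: "ztrace0 \<Gamma> u g" and u': "u' \<in> borel_measurable (lebesgue_on \<Omega>)" "AE x in lebesgue_on \<Omega>. u x = u' x"
  shows "ztrace0 \<Gamma> u' g"
proof -
  obtain du where du: "has_wpd \<Omega> u ez du" using z unfolding ztrace0_def by auto
  have L: "L2 \<Omega> u" "L2 \<Omega> du" using du by (simp_all add: has_wpd_def)
  have w: "has_wpd \<Omega> u' ez du" by (rule has_wpd_cong_AE[OF du ez_Basis u' L2_measurable[OF L(2)]]) simp
  have "(\<integral>x. pd ez \<phi> x *\<^sub>R u' x + \<phi> x *\<^sub>R du x \<partial>lebesgue_on \<Omega>) = - (\<integral>y. \<phi> (y, 0) *\<^sub>R g y \<partial>lebesgue_on \<Gamma>)"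
    if \<phi>: "test_fun (\<Gamma> \<times> {..<1}) \<phi>" for \<phi>
    unfolding ztrace0_identity[OF z du \<phi>, symmetric]
    by (rule pd_identity_cong_AE[OF \<phi> ez_Basis])
      (use L L2_cong_AE[OF L(1) u'] u'(2) in \<open>simp_all add: eq_commute\<close>)
  then show ?thesis using w z unfolding ztrace0_def by blast
qed

lemma ztrace1_cong_AE:
  assumes z: "ztrace1 \<Gamma> u g" and u': "u' \<in> borel_measurable (lebesgue_on \<Omega>)" "AE x in lebesgue_on \<Omega>. u x = u' x"
  shows "ztrace1 \<Gamma> u' g"
proof -
  obtain du where du: "has_wpd \<Omega> u ez du" using z unfolding ztrace1_def by auto
  have L: "L2 \<Omega> u" "L2 \<Omega> du" using du by (simp_all add: has_wpd_def)
  have w: "has_wpd \<Omega> u' ez du" by (rule has_wpd_cong_AE[OF du ez_Basis u' L2_measurable[OF L(2)]]) simp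
  have "(\<integral>x. pd ez \<phi> x *\<^sub>R u' x + \<phi> x *\<^sub>R du x \<partial>lebesgue_on \<Omega>) = (\<integral>y. \<phi> (y, 1) *\<^sub>R g y \<partial>lebesgue_on \<Gamma>)"
    if \<phi>: "test_fun (\<Gamma> \<times> {0<..}) \<phi>" for \<phi>
    unfolding ztrace1_identity[OF z du \<phi>, symmetric]
    by (rule pd_identity_cong_AE[OF \<phi> ez_Basis])
      (use L L2_cong_AE[OF L(1) u'] u'(2) in \<open>simp_all add: eq_commute\<close>)
  then show ?thesis using w z unfolding ztrace1_def by blast
qed

text \<open>Products of a test function on \<Gamma> with a fixed bump in z isolate the pairing of
  the trace with the first factor.\<close>

lemma ztrace0_unique:
  assumes z: "ztrace0 \<Gamma> u g" "ztrace0 \<Gamma> u g'"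
  shows "AE y in lebesgue_on \<Gamma>. g y = g' y"
proof (rule AE_eq_if_test_fun_integrals_eq[OF open_G])
  show "L2 \<Gamma> g" "L2 \<Gamma> g'" using z by (simp_all add: ztrace0_def)
  obtain du where du: "has_wpd \<Omega> u ez du" using z unfolding ztrace0_def by auto
  \<comment> \<open>The bump is nonzero at height 0 and supported below height 1, so the product is
    admissible for the trace at the bottom.\<close>
  let ?b = "box_bump 1 (- 1/2) (1/2 :: real)"
  have b0: "?b 0 \<noteq> 0" by (simp add: box_bump_nonzero_iff)
  have tb: "test_fun {..<1} ?b" by (rule test_fun_box_bump) auto
  fix \<theta> assume \<theta>: "test_fun \<Gamma> \<theta>"
  let ?\<phi> = "\<lambda>x. \<theta> (fst x) * (?b (snd x))"
  have \<phi>: "test_fun (\<Gamma> \<times> {..<1}) ?\<phi>" by (rule test_fun_tensor[OF \<theta> tb])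
  have "(\<integral>y. ?\<phi> (y, 0) *\<^sub>R g y \<partial>lebesgue_on \<Gamma>) = (\<integral>y. ?\<phi> (y, 0) *\<^sub>R g' y \<partial>lebesgue_on \<Gamma>)"
    using ztrace0_identity[OF z(1) du \<phi>] ztrace0_identity[OF z(2) du \<phi>] by simp
  moreover have "?\<phi> (y, 0) *\<^sub>R h = ?b 0 *\<^sub>R (\<theta> y *\<^sub>R h)" for y and h :: 'b by (simp add: mult.commute)
  ultimately have "?b 0 *\<^sub>R (\<integral>y. \<theta> y *\<^sub>R g y \<partial>lebesgue_on \<Gamma>) = ?b 0 *\<^sub>R (\<integral>y. \<theta> y *\<^sub>R g' y \<partial>lebesgue_on \<Gamma>)"
    by (simp only: integral_scaleR_right)
  then show "(\<integral>y. \<theta> y *\<^sub>R g y \<partial>lebesgue_on \<Gamma>) = (\<integral>y. \<theta> y *\<^sub>R g' y \<partial>lebesgue_on \<Gamma>)"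
    using b0 by simp
qed

lemma tr0_AE:
  assumes "ztrace0 \<Gamma> u g"
  shows "ztrace0 \<Gamma> u (tr0 \<Gamma> u)" "AE y in lebesgue_on \<Gamma>. tr0 \<Gamma> u y = g y"
proof -
  show z: "ztrace0 \<Gamma> u (tr0 \<Gamma> u)" using someI[of "ztrace0 \<Gamma> u" g] assms by (simp add: tr0_def)
  show "AE y in lebesgue_on \<Gamma>. tr0 \<Gamma> u y = g y" by (rule ztrace0_unique[OF z assms])
qed

lemma pd_b_Basis: "b \<in> Basis \<Longrightarrow> (b, 0::real) \<in> Basis"
  by (auto simp: Basis_prod_def)

text \<open>Tangential integration by parts is reduced to each height separately. The slice identity
  is left as a hypothesis since it is needed both for slices supported in \<Gamma>, giving weak
  derivatives, and for arbitrary slices, giving the lateral boundary condition.\<close>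

lemma integral_pd_b_lift:
  assumes \<phi>: "test_fun V \<phi>" and b: "b \<in> Basis" and L: "L2 \<Gamma> h" "L2 \<Gamma> g"
    and slice: "\<And>z. 0 < z \<Longrightarrow> z < 1 \<Longrightarrow>
      (\<integral>y. pd b (\<lambda>y. \<phi> (y, z)) y *\<^sub>R h y + \<phi> (y, z) *\<^sub>R g y \<partial>lebesgue_on \<Gamma>) = 0"
  shows "(\<integral>x. pd (b, 0) \<phi> x *\<^sub>R h (fst x) + \<phi> x *\<^sub>R g (fst x) \<partial>lebesgue_on \<Omega>) = 0"
proof -
  note pb = test_fun_pd[OF \<phi> pd_b_Basis[OF b]]
  obtain C where C: "C > 0" "\<And>x. \<bar>pd (b, 0) \<phi> x\<bar> \<le> C" by (rule test_fun_bounded[OF pb]) (rule that)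
  obtain D where D: "D > 0" "\<And>x. \<bar>\<phi> x\<bar> \<le> D" by (rule test_fun_bounded[OF \<phi>]) (rule that)
  note F1 = Fubini_Omega2[OF open_G L2_integrable[OF G_lm L(1)] test_fun_borel[OF pb] C(2)]
  note F2 = Fubini_Omega2[OF open_G L2_integrable[OF G_lm L(2)] test_fun_borel[OF \<phi>] D(2)]
  have s: "indicator {0<..<1} z *\<^sub>R (\<integral>y. pd (b, 0) \<phi> (y, z) *\<^sub>R h y \<partial>lebesgue_on \<Gamma>) =
     - (indicator {0<..<1} z *\<^sub>R (\<integral>y. \<phi> (y, z) *\<^sub>R g y \<partial>lebesgue_on \<Gamma>))" for z
  proof (cases "0 < z \<and> z < 1")
    case True
    have ts: "test_fun UNIV (\<lambda>y. \<phi> (y, z))" by (rule test_fun_mono[OF test_fun_slice[OF \<phi>]]) simp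
    have eq: "pd b (\<lambda>y. \<phi> (y, z)) y = pd (b, 0) \<phi> (y, z)" for y
      by (rule pd_slice1[OF test_fun_differentiable[OF \<phi>]])
    have "integrable (lebesgue_on \<Gamma>) (\<lambda>y. pd b (\<lambda>y. \<phi> (y, z)) y *\<^sub>R h y)"
      by (rule test_intG[OF test_fun_pd[OF ts b] L(1)])
    then have "(\<integral>y. pd (b, 0) \<phi> (y, z) *\<^sub>R h y \<partial>lebesgue_on \<Gamma>) + (\<integral>y. \<phi> (y, z) *\<^sub>R g y \<partial>lebesgue_on \<Gamma>) = 0"
      using slice[of z] True test_intG[OF ts L(2)] by (simp add: eq)
    then show ?thesis using True by (simp add: eq_neg_iff_add_eq_0)
  qed simp
  have "(\<integral>x. pd (b, 0) \<phi> x *\<^sub>R h (fst x) \<partial>lebesgue_on \<Omega>) = - (\<integral>x. \<phi> x *\<^sub>R g (fst x) \<partial>lebesgue_on \<Omega>)"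
    unfolding F1(3) F2(3) s by simp
  then show ?thesis using F1(1) F2(1) by simp
qed

lemma has_wpd_lift_b:
  assumes b: "b \<in> Basis" and w: "has_wpd \<Gamma> h b g"
  shows "has_wpd \<Omega> (\<lambda>x. h (fst x)) (b, 0) (\<lambda>x. g (fst x))"
proof -
  have L: "L2 \<Gamma> h" "L2 \<Gamma> g" using w by (simp_all add: has_wpd_def)
  note LL = L2_lift(1)[OF open_G L(1)] L2_lift(1)[OF open_G L(2)]
  have "(\<integral>x. pd (b, 0) \<phi> x *\<^sub>R h (fst x) \<partial>lebesgue_on \<Omega>) = - (\<integral>x. \<phi> x *\<^sub>R g (fst x) \<partial>lebesgue_on \<Omega>)"
    if \<phi>: "test_fun \<Omega> \<phi>" for \<phi>
  proof -
    have "(\<integral>x. pd (b, 0) \<phi> x *\<^sub>R h (fst x) + \<phi> x *\<^sub>R g (fst x) \<partial>lebesgue_on \<Omega>) = 0"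
    proof (rule integral_pd_b_lift[OF \<phi> b L])
      fix z :: real assume "0 < z" "z < 1"
      have t: "test_fun \<Gamma> (\<lambda>y. \<phi> (y, z))"
        by (rule test_fun_mono[OF test_fun_slice[OF \<phi>]]) (auto simp: Omega2_def)
      then show "(\<integral>y. pd b (\<lambda>y. \<phi> (y, z)) y *\<^sub>R h y + \<phi> (y, z) *\<^sub>R g y \<partial>lebesgue_on \<Gamma>) = 0"
        using w test_intG[OF test_fun_pd[OF t b] L(1)] test_intG[OF t L(2)] by (simp add: has_wpd_def)
    qed
    then show ?thesis
      using test_int[OF test_fun_pd[OF \<phi> pd_b_Basis[OF b]] LL(1)] test_int[OF \<phi> LL(2)]
      by (simp add: eq_neg_iff_add_eq_0)
  qed
  then show ?thesis using LL by (simp add: has_wpd_def)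
qed

end

section \<open>Reduction to fields on the interface\<close>

text \<open>If every test function on the unit interval had integral zero, the fundamental lemma
  would make the constant 1 vanish there. Any test function with nonzero integral is then
  normalised.\<close>

lemma exists_unit_bump:
  "\<exists>\<eta> E. test_fun {0<..<1::real} \<eta> \<and> (\<integral>z. indicator {0<..<1} z * \<eta> z \<partial>lborel) = 1 \<and> 0 \<le> E \<and> (\<forall>z. \<bar>\<eta> z\<bar> \<le> E)"
proof -
  let ?U = "{0<..<1::real}"
  have Ul: "?U \<in> lmeasurable" by (rule lmeasurable_open) auto
  have one: "L2 ?U (\<lambda>x. 1 :: real)"
    using L2_cong_AE[OF L2_indicator[OF fmeasurableD[OF Ul] Ul], of "\<lambda>x. 1"] by (simp add: AE_lebesgue_on)
  have "\<exists>\<phi>. test_fun ?U \<phi> \<and> (\<integral>x. \<phi> x *\<^sub>R (1::real) \<partial>lebesgue_on ?U) \<noteq> 0"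
  proof (rule ccontr)
    assume "\<not> ?thesis"
    then have "AE x in lebesgue_on ?U. (1::real) = 0"
      by (intro test_fun_integral_zero_AE[OF _ one]) auto
    then have "AE x in lborel. x \<notin> ?U" by (simp add: AE_lebesgue_on)
    then have "?U \<in> null_sets lborel" using AE_iff_null_sets[of ?U lborel] by simp
    from null_setsD1[OF this] show False by simp
  qed
  then obtain \<phi> where \<phi>: "test_fun ?U \<phi>" "(\<integral>x. \<phi> x *\<^sub>R (1::real) \<partial>lebesgue_on ?U) \<noteq> 0" by auto
  define I where "I = (\<integral>z. indicator ?U z * \<phi> z \<partial>lborel)"
  have "(\<integral>x. \<phi> x *\<^sub>R (1::real) \<partial>lebesgue_on ?U) = (\<integral>z. indicator ?U z * \<phi> z \<partial>lebesgue)"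
    using fmeasurableD[OF Ul] by (simp add: integral_lebesgue_on)
  also have "\<dots> = I"
    unfolding I_def
    by (rule integral_completion) (use test_fun_borel[OF \<phi>(1)] in \<open>simp add: borel_measurable_times borel_measurable_indicator\<close>)
  finally have I: "I \<noteq> 0" using \<phi>(2) by simp
  have t: "test_fun ?U (\<lambda>z. (1 / I) * \<phi> z)" by (rule test_fun_scale[OF \<phi>(1)])
  obtain E where E: "E > 0" "\<And>x. \<bar>(1 / I) * \<phi> x\<bar> \<le> E" by (rule test_fun_bounded[OF t]) (rule that)
  have "indicator ?U z * ((1 / I) * \<phi> z) = (1 / I) * (indicator ?U z * \<phi> z)" for z by simp
  then have "(\<integral>z. indicator ?U z * ((1 / I) * \<phi> z) \<partial>lborel) = (1 / I) * I"
    unfolding I_def by (simp only: integral_mult_right_zero)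
  then show ?thesis using t E I by (intro exI[of _ "\<lambda>z. (1 / I) * \<phi> z"] exI[of _ E]) auto
qed

text \<open>The geometry in the form in which it is used: \<Gamma> lies on the boundary of
  \<Omega>1, and a short vertical segment under each of its points lies in \<Omega>1, along which
  values on \<Gamma> can be estimated.\<close>

locale two_domains = cylinder \<Gamma> for \<Gamma> :: "'a::euclidean_space set" +
  fixes \<Omega>1 :: "('a \<times> real) set"
  assumes open_1: "open \<Omega>1" and bounded_1: "bounded \<Omega>1"
    and interface_frontier: "y \<in> \<Gamma> \<Longrightarrow> (y, 0) \<in> frontier \<Omega>1"
    and below: "y \<in> \<Gamma> \<Longrightarrow> \<exists>\<rho>>0. \<forall>t. - \<rho> < t \<and> t < 0 \<longrightarrow> (y, t) \<in> \<Omega>1"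
begin

text \<open>Test functions on this open set vanish near the rest of the boundary of \<Omega>1 but
  may be nonzero on \<Gamma>, so Green's formula with them involves the normal trace on \<Gamma>
  alone.\<close>

abbreviation "free \<equiv> - closure (frontier \<Omega>1 - \<Gamma> \<times> {0})"

lemma O1_leb: "\<Omega>1 \<in> sets lebesgue"
  using open_1 by simp

(* (w1, d1) is a field on Omega_1 with its divergence; tau and g b are the trace w_T and its b-derivative,
   so w_T = tau o fst; f is d_z w_N, so w_N = (z - 1) f and the trace on z = 0 is - f. *)
definition reduced :: "('a \<times> real \<Rightarrow> 'a \<times> real) \<Rightarrow> ('a \<times> real \<Rightarrow> real) \<Rightarrow> ('a \<Rightarrow> 'a) \<Rightarrow> ('a \<Rightarrow> 'a \<Rightarrow> 'a) \<Rightarrow> ('a \<Rightarrow> real) \<Rightarrow> bool" where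
  "reduced w1 d1 \<tau> g f \<longleftrightarrow> L2 \<Omega>1 w1 \<and> L2 \<Omega>1 d1 \<and> L2 \<Gamma> \<tau> \<and> (\<forall>b\<in>Basis. L2 \<Gamma> (g b)) \<and> L2 \<Gamma> f \<and>
    (\<forall>\<phi>. test_fun free \<phi> \<longrightarrow> (\<integral>x. w1 x \<bullet> grad \<phi> x + \<phi> x * d1 x \<partial>lebesgue_on \<Omega>1) = - (\<integral>y. f y * \<phi> (y, 0) \<partial>lebesgue_on \<Gamma>)) \<and>
    (\<forall>b\<in>Basis. \<forall>\<phi>. test_fun UNIV \<phi> \<longrightarrow> (\<integral>y. pd b \<phi> y *\<^sub>R \<tau> y + \<phi> y *\<^sub>R g b y \<partial>lebesgue_on \<Gamma>) = 0)"

definition represents where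
  "represents w1 wT wN d1 \<tau> g f \<longleftrightarrow> reduced w1 d1 \<tau> g f \<and>
    wT \<in> borel_measurable (lebesgue_on \<Omega>) \<and> wN \<in> borel_measurable (lebesgue_on \<Omega>) \<and>
    (AE x in lebesgue_on \<Omega>. \<tau> (fst x) = wT x) \<and> (AE x in lebesgue_on \<Omega>. (snd x - 1) * f (fst x) = wN x)"

lemma L2_grad:
  assumes "test_fun V \<phi>" "U \<in> sets lebesgue"
  shows "L2 U (grad \<phi>)"
proof -
  have "L2 U (\<lambda>x. \<Sum>b\<in>Basis. pd b \<phi> x *\<^sub>R b)"
    by (intro L2_sum L2_scaleR_const test_fun_L2[OF test_fun_pd[OF assms(1)] assms(2)])
  then show ?thesis by (simp add: grad_def[abs_def])
qed

lemma reduced_D: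
  assumes "reduced w1 d1 \<tau> g f"
  shows "L2 \<Omega>1 w1" "L2 \<Omega>1 d1" "L2 \<Gamma> \<tau>" "b \<in> Basis \<Longrightarrow> L2 \<Gamma> (g b)" "L2 \<Gamma> f"
  using assms by (simp_all add: reduced_def)

text \<open>A test function supported inside \<Omega>1 is one of the \<open>free\<close> ones, and
  it vanishes on \<Gamma>, which belongs to the boundary. The interface identity then becomes the
  definition of the weak divergence.\<close>

lemma reduced_has_wdiv:
  assumes r: "reduced w1 d1 \<tau> g f"
  shows "has_wdiv \<Omega>1 w1 d1"
  unfolding has_wdiv_def
proof (intro conjI reduced_D[OF r] allI impI)
  fix \<phi> assume \<phi>: "test_fun \<Omega>1 \<phi>"
  have "closure (frontier \<Omega>1 - \<Gamma> \<times> {0}) \<subseteq> frontier \<Omega>1"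
    by (rule closure_minimal) auto
  moreover have disj: "frontier \<Omega>1 \<inter> \<Omega>1 = {}" using open_1 by (auto simp: frontier_def interior_open)
  ultimately have "\<Omega>1 \<subseteq> free" by blast
  then have "test_fun free \<phi>" by (rule test_fun_mono[OF \<phi>])
  moreover have "\<phi> (y, 0) = 0" if "y \<in> \<Gamma>" for y
    using interface_frontier[OF that] disj by (intro test_fun_eq_0[OF \<phi>]) blast
  then have "(\<integral>y. f y * \<phi> (y, 0) \<partial>lebesgue_on \<Gamma>) = (\<integral>y. 0 \<partial>lebesgue_on \<Gamma>)"
    by (intro Bochner_Integration.integral_cong) auto
  ultimately have "(\<integral>x. w1 x \<bullet> grad \<phi> x + \<phi> x * d1 x \<partial>lebesgue_on \<Omega>1) = 0"
    using r by (simp add: reduced_def)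
  then show "(\<integral>x. w1 x \<bullet> grad \<phi> x \<partial>lebesgue_on \<Omega>1) = - (\<integral>x. \<phi> x * d1 x \<partial>lebesgue_on \<Omega>1)"
    using L2_integrable_inner[OF reduced_D(1)[OF r] L2_grad[OF \<phi> O1_leb]]
      L2_real_integrable_mult[OF test_fun_L2[OF \<phi> O1_leb] reduced_D(2)[OF r]] by simp
qed

lemma integral_wdiv_cong:
  assumes w: "has_wdiv \<Omega>1 w1 d" and \<phi>: "test_fun V \<phi>"
  shows "(\<integral>x. w1 x \<bullet> grad \<phi> x + \<phi> x * wdiv \<Omega>1 w1 x \<partial>lebesgue_on \<Omega>1) = (\<integral>x. w1 x \<bullet> grad \<phi> x + \<phi> x * d x \<partial>lebesgue_on \<Omega>1)"
proof (rule integral_cong_AE)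
  have L: "L2 \<Omega>1 w1" "L2 \<Omega>1 d" "L2 \<Omega>1 (wdiv \<Omega>1 w1)" using w has_wdiv_wdiv[OF w] by (simp_all add: has_wdiv_def)
  show "AE x in lebesgue_on \<Omega>1. w1 x \<bullet> grad \<phi> x + \<phi> x * wdiv \<Omega>1 w1 x = w1 x \<bullet> grad \<phi> x + \<phi> x * d x"
    using wdiv_AE[OF open_1 w] by eventually_elim simp
  note i = borel_measurable_add borel_measurable_times borel_measurable_inner L[THEN L2_measurable]
    test_fun_measurable[OF \<phi>] L2_measurable[OF L2_grad[OF \<phi> O1_leb]]
  show "(\<lambda>x. w1 x \<bullet> grad \<phi> x + \<phi> x * wdiv \<Omega>1 w1 x) \<in> borel_measurable (lebesgue_on \<Omega>1)" by (intro i)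
  show "(\<lambda>x. w1 x \<bullet> grad \<phi> x + \<phi> x * d x) \<in> borel_measurable (lebesgue_on \<Omega>1)" by (intro i)
qed

lemma represents_facts:
  assumes "represents w1 wT wN d1 \<tau> g f"
  shows "\<And>b. b \<in> Basis \<Longrightarrow> has_wpd \<Omega> wT (b, 0) (\<lambda>x. g b (fst x))"
    "has_wpd \<Omega> wT ez (\<lambda>x. 0)" "has_wpd \<Omega> wN ez (\<lambda>x. f (fst x))"
    "ztrace0 \<Gamma> wT \<tau>" "ztrace0 \<Gamma> wN (\<lambda>y. - f y)" "ztrace1 \<Gamma> wN (\<lambda>_. 0)"
    "L2 \<Omega> wT" "L2 \<Omega> wN"
proof -
  have r: "reduced w1 d1 \<tau> g f" and m: "wT \<in> borel_measurable (lebesgue_on \<Omega>)" "wN \<in> borel_measurable (lebesgue_on \<Omega>)"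
    and ae: "AE x in lebesgue_on \<Omega>. \<tau> (fst x) = wT x" "AE x in lebesgue_on \<Omega>. (snd x - 1) * f (fst x) = wN x"
    using assms by (simp_all add: represents_def)
  note L = reduced_D[OF r]
  have G: "has_wpd \<Gamma> \<tau> b (g b)" if b: "b \<in> Basis" for b
    unfolding has_wpd_def
  proof (intro conjI L b allI impI)
    fix \<phi> assume \<phi>: "test_fun \<Gamma> \<phi>"
    then have "test_fun UNIV \<phi>" by (rule test_fun_mono) simp
    then have "(\<integral>y. pd b \<phi> y *\<^sub>R \<tau> y + \<phi> y *\<^sub>R g b y \<partial>lebesgue_on \<Gamma>) = 0" using r b by (simp add: reduced_def)
    then show "(\<integral>y. pd b \<phi> y *\<^sub>R \<tau> y \<partial>lebesgue_on \<Gamma>) = - (\<integral>y. \<phi> y *\<^sub>R g b y \<partial>lebesgue_on \<Gamma>)"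
      using test_intG[OF test_fun_pd[OF \<phi> b] L(3)] test_intG[OF \<phi> L(4)[OF b]] by (simp add: eq_neg_iff_add_eq_0)
  qed
  show "has_wpd \<Omega> wT (b, 0) (\<lambda>x. g b (fst x))" if b: "b \<in> Basis" for b
    by (rule has_wpd_cong_AE[OF has_wpd_lift_b[OF b G[OF b]] pd_b_Basis[OF b] m(1) ae(1)
          L2_measurable[OF L2_lift(1)[OF open_G L(4)[OF b]]]]) simp
  show "has_wpd \<Omega> wT ez (\<lambda>x. 0)"
    by (rule has_wpd_cong_AE[OF has_wpd_lift_z[OF L(3)] ez_Basis m(1) ae(1)]) simp_all
  show "has_wpd \<Omega> wN ez (\<lambda>x. f (fst x))"
    by (rule has_wpd_cong_AE[OF has_wpd_linear_lift_z[OF L(5)] ez_Basis m(2) ae(2)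
          L2_measurable[OF L2_lift(1)[OF open_G L(5)]]]) simp
  show "ztrace0 \<Gamma> wT \<tau>" by (rule ztrace0_cong_AE[OF ztrace0_lift[OF L(3)] m(1) ae(1)])
  show "ztrace0 \<Gamma> wN (\<lambda>y. - f y)" by (rule ztrace0_cong_AE[OF ztrace0_linear_lift[OF L(5)] m(2) ae(2)])
  show "ztrace1 \<Gamma> wN (\<lambda>_. 0)" by (rule ztrace1_cong_AE[OF ztrace1_linear_lift[OF L(5)] m(2) ae(2)])
  show "L2 \<Omega> wT" by (rule L2_cong_AE[OF L2_lift(1)[OF open_G L(3)] m(1) ae(1)])
  show "L2 \<Omega> wN" by (rule L2_cong_AE[OF L2_linear_lift(1)[OF L(5)] m(2) ae(2)])
qed

lemma has_wpd_L2: "has_wpd U u e g \<Longrightarrow> L2 U g" "has_wpd U u e g \<Longrightarrow> L2 U u"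
  by (simp_all add: has_wpd_def)

section \<open>Passing between X^0 and reduced fields\<close>

lemma represents_X0:
  assumes R: "represents w1 wT wN d1 \<tau> g f"
  shows "X0 \<Omega>1 \<Gamma> w1 wT wN"
proof -
  note F = represents_facts[OF R]
  have r: "reduced w1 d1 \<tau> g f" and aeT: "AE x in lebesgue_on \<Omega>. \<tau> (fst x) = wT x"
    using R by (simp_all add: represents_def)
  note L = reduced_D[OF r]
  have H1: "H1 \<Omega> wT"
    unfolding H1_def Basis_prod_real using F(1,2,7) by auto
  have "lateral_zero \<Gamma> wT"
    unfolding lateral_zero_def
  proof (intro conjI H1 ballI allI impI)
    fix e :: "'a \<times> real" and \<phi>
    assume e: "e \<in> Basis" and \<phi>: "test_fun (- (closure \<Gamma> \<times> {0, 1 :: real})) \<phi>"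
    have LT: "L2 \<Omega> (\<lambda>x. \<tau> (fst x))" by (rule L2_lift(1)[OF open_G L(3)])
    have aeT': "AE x in lebesgue_on \<Omega>. wT x = \<tau> (fst x)" using aeT by eventually_elim simp
    show "(\<integral>x. pd e \<phi> x *\<^sub>R wT x + \<phi> x *\<^sub>R wpd \<Omega> wT e x \<partial>lebesgue_on \<Omega>) = 0"
    proof (cases "e = ez")
      case True
      have "(\<integral>x. pd e \<phi> x *\<^sub>R wT x + \<phi> x *\<^sub>R wpd \<Omega> wT e x \<partial>lebesgue_on \<Omega>) =
          (\<integral>x. pd ez \<phi> x *\<^sub>R \<tau> (fst x) + \<phi> x *\<^sub>R 0 \<partial>lebesgue_on \<Omega>)"
        unfolding True
        by (rule pd_identity_cong_AE[OF \<phi> ez_Basis F(7) has_wpd_L2(1)[OF has_wpd_wpd[OF F(2)]] LT L2_zero aeT' wpd_AE[OF open_O F(2)]])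
      also have "\<dots> = (\<integral>y. (\<phi> (y, 1) - \<phi> (y, 0)) *\<^sub>R \<tau> y \<partial>lebesgue_on \<Gamma>)"
        using integral_pd_ez_lift[OF \<phi> L(3)] by simp
      also have "\<dots> = (\<integral>y. 0 \<partial>lebesgue_on \<Gamma>)"
      proof (rule Bochner_Integration.integral_cong[OF refl])
        \<comment> \<open>The support of \<phi> avoids both end faces over the closure of \<Gamma>,
          so no boundary term remains in the z-direction.\<close>
        fix y assume "y \<in> space (lebesgue_on \<Gamma>)"
        then have "y \<in> closure \<Gamma>" using closure_subset[of \<Gamma>] by auto
        then have "\<phi> (y, 0) = 0" "\<phi> (y, 1) = 0" by (auto intro!: test_fun_eq_0[OF \<phi>])
        then show "(\<phi> (y, 1) - \<phi> (y, 0)) *\<^sub>R \<tau> y = 0" by simp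
      qed
      finally show ?thesis by simp
    next
      case False
      then obtain b where b: "b \<in> Basis" "e = (b, 0)" using e by (auto simp: Basis_prod_real)
      have "(\<integral>x. pd e \<phi> x *\<^sub>R wT x + \<phi> x *\<^sub>R wpd \<Omega> wT e x \<partial>lebesgue_on \<Omega>) =
          (\<integral>x. pd (b, 0) \<phi> x *\<^sub>R \<tau> (fst x) + \<phi> x *\<^sub>R g b (fst x) \<partial>lebesgue_on \<Omega>)"
        unfolding b(2)
        by (rule pd_identity_cong_AE[OF \<phi> pd_b_Basis[OF b(1)] F(7) has_wpd_L2(1)[OF has_wpd_wpd[OF F(1)[OF b(1)]]]
              LT L2_lift(1)[OF open_G L(4)[OF b(1)]] aeT' wpd_AE[OF open_O F(1)[OF b(1)]]])
      also have "\<dots> = 0"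
      proof (rule integral_pd_b_lift[OF \<phi> b(1) L(3) L(4)[OF b(1)]])
        \<comment> \<open>A slice may be nonzero on the boundary of \<Gamma>. This is covered,
          because the identities in \<open>reduced\<close> hold for test functions on the whole
          space, which encodes the zero boundary values of \<tau>.\<close>
        fix z :: real
        have "test_fun UNIV (\<lambda>y. \<phi> (y, z))" by (rule test_fun_mono[OF test_fun_slice[OF \<phi>]]) simp
        then show "(\<integral>y. pd b (\<lambda>y. \<phi> (y, z)) y *\<^sub>R \<tau> y + \<phi> (y, z) *\<^sub>R g b y \<partial>lebesgue_on \<Gamma>) = 0"
          using r b(1) by (simp add: reduced_def)
      qed
      finally show ?thesis .
    qed
  qed
  moreover have "zindep \<Gamma> wT"
    unfolding zindep_def by (rule exI[of _ \<tau>]) (use aeT in \<open>eventually_elim, simp\<close>)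
  moreover have "Hz \<Gamma> wN" unfolding Hz_def using F(3,8) by auto
  moreover have "zindep \<Gamma> (wpd \<Omega> wN ez)"
    unfolding zindep_def by (rule exI[of _ f], rule wpd_AE[OF open_O F(3)])
  ultimately have X2: "X20 \<Gamma> wT wN" using H1 F(6) by (simp add: X20_def)
  have div: "has_wdiv \<Omega>1 w1 d1" by (rule reduced_has_wdiv[OF r])
  then have Hd: "Hdiv \<Omega>1 w1" unfolding Hdiv_def by (rule exI[of "has_wdiv \<Omega>1 w1"])
  have "normal_trace_on \<Omega>1 \<Gamma> w1 (\<lambda>y. - f y)"
    unfolding normal_trace_on_def
  proof (intro conjI Hd L2_minus L allI impI)
    fix \<phi> assume \<phi>: "test_fun free \<phi>"
    show "(\<integral>x. w1 x \<bullet> grad \<phi> x + \<phi> x * wdiv \<Omega>1 w1 x \<partial>lebesgue_on \<Omega>1) = (\<integral>y. - f y * \<phi> (y, 0) \<partial>lebesgue_on \<Gamma>)"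
      using integral_wdiv_cong[OF div \<phi>] r \<phi> by (simp add: reduced_def)
  qed
  then show ?thesis unfolding X0_def using Hd X2 F(5) by auto
qed

text \<open>A weight in z of integral one averages out the height and leaves the integral over
  \<Gamma>.\<close>

lemma integral_tensor:
  assumes \<phi>: "test_fun V \<phi>" and \<eta>: "test_fun W \<eta>" "(\<integral>z. indicator {0<..<1} z * \<eta> z \<partial>lborel) = 1" and h: "L2 \<Gamma> h"
  shows "(\<integral>x. (\<phi> (fst x) * \<eta> (snd x)) *\<^sub>R h (fst x) \<partial>lebesgue_on \<Omega>) = (\<integral>y. \<phi> y *\<^sub>R h y \<partial>lebesgue_on \<Gamma>)"
proof -
  note t = test_fun_tensor[OF \<phi> \<eta>(1)]
  obtain C where C: "C > 0" "\<And>x. \<bar>\<phi> (fst x) * \<eta> (snd x)\<bar> \<le> C" by (rule test_fun_bounded[OF t]) (rule that)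
  have "indicator {0<..<1} z * (\<phi> y * \<eta> z) = \<phi> y * (indicator {0<..<1} z * \<eta> z)" for y z by simp
  then have "(\<integral>z. indicator {0<..<1} z * (\<phi> y * \<eta> z) \<partial>lborel) = \<phi> y" for y
    by (simp only: integral_mult_right_zero \<eta>(2))
  then show ?thesis
    using Fubini_Omega2(2)[OF open_G L2_integrable[OF G_lm h] test_fun_borel[OF t] C(2)] by simp
qed

(* The b-derivative of a z-independent function is again z-independent: it is recovered by averaging
   against a weight eta(z), and the average is obtained from the Riesz lemma on test functions. *)
lemma exists_reduced_derivative:
  fixes wT :: "'a \<times> real \<Rightarrow> 'a"
  assumes lat: "lateral_zero \<Gamma> wT" and \<tau>: "L2 \<Gamma> \<tau>" "AE x in lebesgue_on \<Omega>. \<tau> (fst x) = wT x" and b: "b \<in> Basis"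
  shows "\<exists>g. L2 \<Gamma> g \<and> (\<forall>\<phi>. test_fun UNIV \<phi> \<longrightarrow> (\<integral>y. pd b \<phi> y *\<^sub>R \<tau> y + \<phi> y *\<^sub>R g y \<partial>lebesgue_on \<Gamma>) = 0)"
proof -
  obtain \<eta> :: "real \<Rightarrow> real" and E where \<eta>: "test_fun {0<..<1} \<eta>" "(\<integral>z. indicator {0<..<1} z * \<eta> z \<partial>lborel) = 1"
    and E: "0 \<le> E" "\<And>z. \<bar>\<eta> z\<bar> \<le> E"
    using exists_unit_bump by auto
  let ?D = "wpd \<Omega> wT (b, 0)"
  have H1: "H1 \<Omega> wT" using lat by (simp add: lateral_zero_def)
  then obtain G where "has_wpd \<Omega> wT (b, 0) G" using pd_b_Basis[OF b] by (auto simp: H1_def)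
  then have D: "has_wpd \<Omega> wT (b, 0) ?D" by (rule has_wpd_wpd)
  have LD: "L2 \<Omega> ?D" and LT: "L2 \<Omega> wT" using D by (simp_all add: has_wpd_def)
  \<comment> \<open>The weight \<eta> is supported strictly between the end faces, so the product is
    admissible in the lateral condition for every \<phi> on the whole space.\<close>
  have ten: "test_fun (- (closure \<Gamma> \<times> {0, 1})) (\<lambda>x. \<phi> (fst x) * \<eta> (snd x))" if "test_fun UNIV \<phi>" for \<phi> :: "'a \<Rightarrow> real"
    by (rule test_fun_mono[OF test_fun_tensor[OF that \<eta>(1)]]) auto
  define l where "l c \<phi> = (\<integral>x. (\<phi> (fst x) * \<eta> (snd x)) * (?D x \<bullet> c) \<partial>lebesgue_on \<Omega>)" for c and \<phi> :: "'a \<Rightarrow> real"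
  have int: "integrable (lebesgue_on \<Omega>) (\<lambda>x. (\<phi> (fst x) * \<eta> (snd x)) * (?D x \<bullet> c))" if "test_fun UNIV \<phi>" for \<phi> c
    using test_int[OF ten[OF that] L2_inner_const[OF LD, of c]] by simp
  have "\<exists>u. L2 \<Gamma> u \<and> l2norm \<Gamma> u \<le> E * l2norm \<Omega> (\<lambda>x. ?D x \<bullet> c) \<and> (\<forall>f. test_fun UNIV f \<longrightarrow> (\<integral>x. f x * u x \<partial>lebesgue_on \<Gamma>) = l c f)" for c
  proof (rule test_fun_riesz[OF G_leb])
    show "l c (\<lambda>x. f x + h x) = l c f + l c h" if "test_fun UNIV f" "test_fun UNIV h" for f h
      using int[OF that(1), of c] int[OF that(2), of c] by (simp add: l_def distrib_right)
    show "l c (\<lambda>x. r * f x) = r * l c f" for r f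
      by (simp add: l_def mult.assoc)
    show "0 \<le> E * l2norm \<Omega> (\<lambda>x. ?D x \<bullet> c)" using E by simp
    fix f :: "'a \<Rightarrow> real" assume f: "test_fun UNIV f"
    have "\<bar>l c f\<bar> \<le> l2norm \<Omega> (\<lambda>x. f (fst x) * \<eta> (snd x)) * l2norm \<Omega> (\<lambda>x. ?D x \<bullet> c)"
      using l2ip_bound[OF test_fun_L2[OF ten[OF f] O_leb] L2_inner_const[OF LD, of c]] by (simp add: l_def)
    also have "\<dots> \<le> (E * l2norm \<Omega> (\<lambda>x. f (fst x))) * l2norm \<Omega> (\<lambda>x. ?D x \<bullet> c)"
    proof (intro mult_right_mono l2norm_mono)
      show "L2 \<Omega> (\<lambda>x. f (fst x))" by (rule L2_lift(1)[OF open_G test_fun_L2[OF f G_leb]])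
      show "L2 \<Omega> (\<lambda>x. f (fst x) * \<eta> (snd x))" by (rule test_fun_L2[OF ten[OF f] O_leb])
      show "AE x in lebesgue_on \<Omega>. norm (f (fst x) * \<eta> (snd x)) \<le> E * norm (f (fst x))"
        using E(2) by (intro AE_I2) (simp add: abs_mult mult.commute mult_right_mono)
    qed (simp_all add: E)
    finally show "\<bar>l c f\<bar> \<le> E * l2norm \<Omega> (\<lambda>x. ?D x \<bullet> c) * l2norm \<Gamma> f"
      using L2_lift(2)[OF open_G test_fun_L2[OF f G_leb]] by (simp add: mult_ac)
  qed
  then have "\<forall>c. \<exists>u. L2 \<Gamma> u \<and> (\<forall>f. test_fun UNIV f \<longrightarrow> (\<integral>x. f x * u x \<partial>lebesgue_on \<Gamma>) = l c f)" by meson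
  from choice[OF this] obtain u where u: "\<forall>c. L2 \<Gamma> (u c) \<and> (\<forall>f. test_fun UNIV f \<longrightarrow> (\<integral>x. f x * u c x \<partial>lebesgue_on \<Gamma>) = l c f)"
    by (rule exE)
  \<comment> \<open>The Riesz lemma is for real functions; the vector-valued derivative is assembled
    from its components.\<close>
  define g where "g y = (\<Sum>c\<in>Basis. u c y *\<^sub>R c)" for y
  have g: "L2 \<Gamma> g" unfolding g_def[abs_def] using u by (intro L2_sum L2_scaleR_const) auto
  have gc: "g y \<bullet> c = u c y" if "c \<in> Basis" for y c unfolding g_def using that by (simp add: inner_sum_left inner_Basis if_distrib[of "\<lambda>x. _ * x"] cong: if_cong)
  have "(\<integral>y. pd b \<phi> y *\<^sub>R \<tau> y + \<phi> y *\<^sub>R g y \<partial>lebesgue_on \<Gamma>) = 0" if \<phi>: "test_fun UNIV \<phi>" for \<phi>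
  proof -
    let ?\<Phi> = "\<lambda>x. \<phi> (fst x) * \<eta> (snd x)"
    note pb = test_fun_pd[OF \<phi> b]
    note P = test_fun_pd[OF ten[OF \<phi>] pd_b_Basis[OF b]]
    have pdeq: "pd (b, 0) ?\<Phi> x = pd b \<phi> (fst x) * \<eta> (snd x)" for x
      by (rule pd_tensor(1)[OF test_fun_differentiable[OF \<phi>] test_fun_differentiable[OF \<eta>(1)]])
    have "(\<integral>x. pd (b, 0) ?\<Phi> x *\<^sub>R wT x + ?\<Phi> x *\<^sub>R ?D x \<partial>lebesgue_on \<Omega>) = 0"
      using lat ten[OF \<phi>] pd_b_Basis[OF b] by (simp add: lateral_zero_def)
    then have A: "(\<integral>x. pd (b, 0) ?\<Phi> x *\<^sub>R wT x \<partial>lebesgue_on \<Omega>) + (\<integral>x. ?\<Phi> x *\<^sub>R ?D x \<partial>lebesgue_on \<Omega>) = 0"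
      using test_int[OF P LT] test_int[OF ten[OF \<phi>] LD] by simp
    have "(\<integral>x. pd (b, 0) ?\<Phi> x *\<^sub>R wT x \<partial>lebesgue_on \<Omega>) = (\<integral>x. pd (b, 0) ?\<Phi> x *\<^sub>R \<tau> (fst x) \<partial>lebesgue_on \<Omega>)"
      by (rule test_fun_integral_cong_AE[OF P L2_measurable[OF LT] L2_measurable[OF L2_lift(1)[OF open_G \<tau>(1)]]])
        (use \<tau>(2) in \<open>eventually_elim, simp\<close>)
    also have "\<dots> = (\<integral>y. pd b \<phi> y *\<^sub>R \<tau> y \<partial>lebesgue_on \<Gamma>)"
      unfolding pdeq by (rule integral_tensor[OF pb \<eta> \<tau>(1)])
    finally have B: "(\<integral>x. pd (b, 0) ?\<Phi> x *\<^sub>R wT x \<partial>lebesgue_on \<Omega>) = (\<integral>y. pd b \<phi> y *\<^sub>R \<tau> y \<partial>lebesgue_on \<Gamma>)" .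
    have "(\<integral>y. \<phi> y *\<^sub>R g y \<partial>lebesgue_on \<Gamma>) = (\<integral>x. ?\<Phi> x *\<^sub>R ?D x \<partial>lebesgue_on \<Omega>)"
    proof (rule euclidean_eqI)
      fix c :: 'a assume c: "c \<in> Basis"
      have "(\<integral>y. \<phi> y *\<^sub>R g y \<partial>lebesgue_on \<Gamma>) \<bullet> c = (\<integral>y. (\<phi> y *\<^sub>R g y) \<bullet> c \<partial>lebesgue_on \<Gamma>)"
        by (rule integral_inner_left[symmetric]) (rule test_intG[OF \<phi> g])
      also have "\<dots> = l c \<phi>" using u \<phi> by (simp add: gc[OF c])
      also have "\<dots> = (\<integral>x. (?\<Phi> x *\<^sub>R ?D x) \<bullet> c \<partial>lebesgue_on \<Omega>)" by (simp add: l_def)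
      also have "\<dots> = (\<integral>x. ?\<Phi> x *\<^sub>R ?D x \<partial>lebesgue_on \<Omega>) \<bullet> c"
        by (rule integral_inner_left) (rule test_int[OF ten[OF \<phi>] LD])
      finally show "(\<integral>y. \<phi> y *\<^sub>R g y \<partial>lebesgue_on \<Gamma>) \<bullet> c = (\<integral>x. ?\<Phi> x *\<^sub>R ?D x \<partial>lebesgue_on \<Omega>) \<bullet> c" .
    qed
    then show ?thesis using A B test_intG[OF pb \<tau>(1)] test_intG[OF \<phi> g] by simp
  qed
  then show ?thesis using g by auto
qed

text \<open>The difference of \<open>wN\<close> and the linear profile is orthogonal to all
  z-derivatives of test functions that may be nonzero at z = 1. Pushing an arbitrary test function
  upwards keeps it in this class, and after a shift by the full height it is gone from the cylinder;
  the shift estimate with bound 0 then annihilates the original pairing.\<close>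

lemma normal_profile_linear:
  fixes wN :: "'a \<times> real \<Rightarrow> real"
  assumes w: "has_wpd \<Omega> wN ez (\<lambda>x. f (fst x))" and f: "L2 \<Gamma> f" and z1: "ztrace1 \<Gamma> wN (\<lambda>_. 0)"
  shows "AE x in lebesgue_on \<Omega>. (snd x - 1) * f (fst x) = wN x"
proof -
  let ?m = "\<lambda>x. (snd x - 1) * f (fst x)"
  note Lm = L2_linear_lift(1)[OF f] and Lf = L2_lift(1)[OF open_G f]
  have LN: "L2 \<Omega> wN" using w by (simp add: has_wpd_def)
  have key: "(\<integral>x. pd ez \<phi> x * (?m x - wN x) \<partial>lebesgue_on \<Omega>) = 0" if \<phi>: "test_fun (\<Gamma> \<times> {0<..}) \<phi>" for \<phi>
  proof -
    note P = test_fun_pd[OF \<phi> ez_Basis]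
    have "(\<integral>x. pd ez \<phi> x *\<^sub>R wN x + \<phi> x *\<^sub>R f (fst x) \<partial>lebesgue_on \<Omega>) =
        (\<integral>x. pd ez \<phi> x *\<^sub>R ?m x + \<phi> x *\<^sub>R f (fst x) \<partial>lebesgue_on \<Omega>)"
      using ztrace1_identity[OF z1 w \<phi>] ztrace1_identity[OF ztrace1_linear_lift[OF f] has_wpd_linear_lift_z[OF f] \<phi>] by simp
    then have "(\<integral>x. pd ez \<phi> x *\<^sub>R wN x \<partial>lebesgue_on \<Omega>) = (\<integral>x. pd ez \<phi> x *\<^sub>R ?m x \<partial>lebesgue_on \<Omega>)"
      using test_int[OF P LN] test_int[OF P Lm] test_int[OF \<phi> Lf] by (simp del: real_scaleR_def)
    then show ?thesis using test_int[OF P LN] test_int[OF P Lm] by (simp add: right_diff_distrib)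
  qed
  have Ld: "L2 \<Omega> (\<lambda>x. ?m x - wN x)" by (rule L2_diff[OF Lm LN])
  have "AE x in lebesgue_on \<Omega>. ?m x - wN x = 0"
  proof (rule test_fun_integral_zero_AE[OF open_O Ld])
    fix \<psi> assume \<psi>: "test_fun \<Omega> \<psi>"
    have "\<bar>\<integral>x. (\<psi> x - \<psi> (x - 1 *\<^sub>R ez)) * (?m x - wN x) \<partial>lebesgue_on \<Omega>\<bar> \<le> 1 * 0"
    proof (rule shift_estimate[OF O_lm Ld ez_Basis _ \<psi>])
      \<comment> \<open>The support moves upwards and may cross z = 1. The zero trace there is what
        still yields orthogonality.\<close>
      fix s :: real assume s: "0 \<le> s" "s \<le> 1"
      have "test_fun (\<Gamma> \<times> {0<..}) (\<lambda>x. \<psi> (x - s *\<^sub>R ez))"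
        by (rule test_fun_translate[OF \<psi>]) (use s in \<open>auto simp: Omega2_def ez_def\<close>)
      from key[OF this] show "\<bar>\<integral>x. pd ez \<psi> (x - s *\<^sub>R ez) * (?m x - wN x) \<partial>lebesgue_on \<Omega>\<bar> \<le> 0"
        by (simp add: pd_translate[OF test_fun_differentiable[OF \<psi>]])
    qed simp
    then have "(\<integral>x. (\<psi> x - \<psi> (x - 1 *\<^sub>R ez)) * (?m x - wN x) \<partial>lebesgue_on \<Omega>) = 0" by simp
    moreover have "(\<integral>x. (\<psi> x - \<psi> (x - 1 *\<^sub>R ez)) * (?m x - wN x) \<partial>lebesgue_on \<Omega>) = (\<integral>x. \<psi> x *\<^sub>R (?m x - wN x) \<partial>lebesgue_on \<Omega>)"
    proof (rule Bochner_Integration.integral_cong[OF refl])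
      fix x assume "x \<in> space (lebesgue_on \<Omega>)"
      then have "x - 1 *\<^sub>R ez \<notin> \<Omega>" by (cases x) (auto simp: Omega2_def ez_def)
      then show "(\<psi> x - \<psi> (x - 1 *\<^sub>R ez)) * (?m x - wN x) = \<psi> x *\<^sub>R (?m x - wN x)"
        using test_fun_eq_0[OF \<psi>] by simp
    qed
    ultimately show "(\<integral>x. \<psi> x *\<^sub>R (?m x - wN x) \<partial>lebesgue_on \<Omega>) = 0" by simp
  qed
  then show ?thesis by eventually_elim simp
qed

text \<open>\<tau> and f come from the z-independence requirements, g from averaging in z. The trace
  shared by the normal component and \<open>wN\<close> is the one of the linear profile by
  uniqueness, which turns it into - f.\<close>

lemma X0_represents:
  assumes X: "X0 \<Omega>1 \<Gamma> w1 wT wN"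
  shows "\<exists>\<tau> g f. represents w1 wT wN (wdiv \<Omega>1 w1) \<tau> g f"
proof -
  have Hd: "Hdiv \<Omega>1 w1" and X2: "X20 \<Gamma> wT wN" using X by (simp_all add: X0_def)
  obtain tr where tr: "ztrace0 \<Gamma> wN tr" "normal_trace_on \<Omega>1 \<Gamma> w1 tr" using X by (auto simp: X0_def)
  have H1: "H1 \<Omega> wT" and lat: "lateral_zero \<Gamma> wT" and z1: "ztrace1 \<Gamma> wN (\<lambda>_. 0)"
    using X2 by (simp_all add: X20_def)
  have LT: "L2 \<Omega> wT" using H1 by (simp add: H1_def)
  obtain \<tau> where ae\<tau>: "AE x in lebesgue_on \<Omega>. wT x = \<tau> (fst x)" using X2 by (auto simp: X20_def zindep_def)
  have \<tau>: "L2 \<Gamma> \<tau>" by (rule zindep_L2[OF open_G LT ae\<tau>])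
  have ae\<tau>': "AE x in lebesgue_on \<Omega>. \<tau> (fst x) = wT x" using ae\<tau> by eventually_elim simp
  obtain f where aef: "AE x in lebesgue_on \<Omega>. wpd \<Omega> wN ez x = f (fst x)" using X2 by (auto simp: X20_def zindep_def)
  obtain du where "has_wpd \<Omega> wN ez du" using X2 by (auto simp: X20_def Hz_def)
  then have wp: "has_wpd \<Omega> wN ez (wpd \<Omega> wN ez)" by (rule has_wpd_wpd)
  have LN: "L2 \<Omega> wN" and LD: "L2 \<Omega> (wpd \<Omega> wN ez)" using wp by (simp_all add: has_wpd_def)
  have f: "L2 \<Gamma> f" by (rule zindep_L2[OF open_G LD aef])
  have wf: "has_wpd \<Omega> wN ez (\<lambda>x. f (fst x))"
    by (rule has_wpd_cong_AE[OF wp ez_Basis L2_measurable[OF LN] _ L2_measurable[OF L2_lift(1)[OF open_G f]] aef]) simp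
  have aeN: "AE x in lebesgue_on \<Omega>. (snd x - 1) * f (fst x) = wN x" by (rule normal_profile_linear[OF wf f z1])
  have "ztrace0 \<Gamma> wN (\<lambda>y. - f y)" by (rule ztrace0_cong_AE[OF ztrace0_linear_lift[OF f] L2_measurable[OF LN] aeN])
  then have aetr: "AE y in lebesgue_on \<Gamma>. tr y = - f y" by (rule ztrace0_unique[OF tr(1)])
  have "\<forall>b. \<exists>g. b \<in> Basis \<longrightarrow> L2 \<Gamma> g \<and> (\<forall>\<phi>. test_fun UNIV \<phi> \<longrightarrow> (\<integral>y. pd b \<phi> y *\<^sub>R \<tau> y + \<phi> y *\<^sub>R g y \<partial>lebesgue_on \<Gamma>) = 0)"
    using exists_reduced_derivative[OF lat \<tau> ae\<tau>'] by meson
  from choice[OF this] obtain g where g: "\<forall>b. b \<in> Basis \<longrightarrow> L2 \<Gamma> (g b) \<and>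
      (\<forall>\<phi>. test_fun UNIV \<phi> \<longrightarrow> (\<integral>y. pd b \<phi> y *\<^sub>R \<tau> y + \<phi> y *\<^sub>R g b y \<partial>lebesgue_on \<Gamma>) = 0)"
    by (rule exE)
  obtain d where "has_wdiv \<Omega>1 w1 d" using Hd by (auto simp: Hdiv_def)
  then have wd: "has_wdiv \<Omega>1 w1 (wdiv \<Omega>1 w1)" by (rule has_wdiv_wdiv)
  have nt: "(\<integral>x. w1 x \<bullet> grad \<phi> x + \<phi> x * wdiv \<Omega>1 w1 x \<partial>lebesgue_on \<Omega>1) = - (\<integral>y. f y * \<phi> (y, 0) \<partial>lebesgue_on \<Gamma>)"
    if \<phi>: "test_fun free \<phi>" for \<phi>
  proof -
    have ts: "test_fun UNIV (\<lambda>y. \<phi> (y, 0))" by (rule test_fun_mono[OF test_fun_slice[OF \<phi>]]) simp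
    have Ltr: "L2 \<Gamma> tr" using tr(1) by (simp add: ztrace0_def)
    have "(\<integral>y. tr y * \<phi> (y, 0) \<partial>lebesgue_on \<Gamma>) = (\<integral>y. - (f y * \<phi> (y, 0)) \<partial>lebesgue_on \<Gamma>)"
    proof (rule integral_cong_AE)
      show "AE y in lebesgue_on \<Gamma>. tr y * \<phi> (y, 0) = - (f y * \<phi> (y, 0))" using aetr by eventually_elim simp
      show "(\<lambda>y. tr y * \<phi> (y, 0)) \<in> borel_measurable (lebesgue_on \<Gamma>)"
        by (intro borel_measurable_times L2_measurable[OF Ltr] test_fun_measurable[OF ts])
      show "(\<lambda>y. - (f y * \<phi> (y, 0))) \<in> borel_measurable (lebesgue_on \<Gamma>)"
        by (intro borel_measurable_uminus borel_measurable_times L2_measurable[OF f] test_fun_measurable[OF ts])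
    qed
    then show ?thesis using tr(2) \<phi> by (simp add: normal_trace_on_def)
  qed
  have "reduced w1 (wdiv \<Omega>1 w1) \<tau> g f"
    using wd \<tau> f g nt by (simp add: reduced_def has_wdiv_def)
  then have "represents w1 wT wN (wdiv \<Omega>1 w1) \<tau> g f"
    using L2_measurable[OF LT] L2_measurable[OF LN] ae\<tau>' aeN by (simp add: represents_def)
  then show ?thesis by (intro exI)
qed

end

section \<open>Poincare inequalities\<close>

lemma l2norm_sq: "(l2norm U u)\<^sup>2 = (\<integral>x. (norm (u x))\<^sup>2 \<partial>lebesgue_on U)"
  by (simp add: l2norm_def)

lemma l2norm_translate_le:
  assumes \<phi>: "test_fun U \<phi>" and U: "U \<in> sets lebesgue" and V: "V \<in> sets lebesgue"
  shows "l2norm V (\<lambda>x. \<phi> (x - c)) \<le> l2norm U \<phi>"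
proof -
  have tr: "test_fun UNIV (\<lambda>x. \<phi> (x - c))" by (rule test_fun_translate[OF \<phi>]) simp
  have m1: "(\<lambda>x. (\<phi> x)\<^sup>2) \<in> borel_measurable borel" using test_fun_borel[OF \<phi>] by simp
  have m2: "(\<lambda>x. (\<phi> (x - c))\<^sup>2) \<in> borel_measurable borel" using test_fun_borel[OF tr] by simp
  have i2: "integrable lebesgue (\<lambda>x. (\<phi> (x - c))\<^sup>2)"
    using test_fun_L2[OF tr, of UNIV] by (simp add: L2_def integrable_lebesgue_on_iff)
  have iV: "integrable lebesgue (\<lambda>x. indicator V x *\<^sub>R (\<phi> (x - c))\<^sup>2)"
    using test_fun_L2[OF tr V] V by (simp add: L2_def integrable_lebesgue_on_iff)
  have "(l2norm V (\<lambda>x. \<phi> (x - c)))\<^sup>2 = (\<integral>x. indicator V x *\<^sub>R (\<phi> (x - c))\<^sup>2 \<partial>lebesgue)"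
    using V by (simp add: l2norm_sq integral_lebesgue_on)
  also have "\<dots> \<le> (\<integral>x. (\<phi> (x - c))\<^sup>2 \<partial>lebesgue)"
    by (rule integral_mono[OF iV i2]) (simp add: indicator_def)
  also have "\<dots> = (\<integral>x. (\<phi> (x - c))\<^sup>2 \<partial>lborel)" by (rule integral_completion) (use m2 in simp)
  also have "\<dots> = (\<integral>x. (\<phi> (x - c))\<^sup>2 \<partial>distr lborel borel ((+) c))" by (simp only: lborel_distr_plus)
  also have "\<dots> = (\<integral>x. (\<phi> x)\<^sup>2 \<partial>lborel)" by (subst integral_distr) (use m2 in simp_all)
  also have "\<dots> = (\<integral>x. (\<phi> x)\<^sup>2 \<partial>lebesgue)" by (rule integral_completion[symmetric]) (use m1 in simp)
  also have "\<dots> = (\<integral>x. indicator U x *\<^sub>R (\<phi> x)\<^sup>2 \<partial>lebesgue)"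
    by (rule Bochner_Integration.integral_cong) (use test_fun_eq_0[OF \<phi>] in \<open>auto simp: indicator_def\<close>)
  also have "\<dots> = (l2norm U \<phi>)\<^sup>2" using U by (simp add: l2norm_sq integral_lebesgue_on)
  finally show ?thesis by (rule power2_le_imp_le) simp
qed

lemma l2norm_components:
  fixes u :: "'e::euclidean_space \<Rightarrow> 'b::euclidean_space"
  assumes "L2 U u"
  shows "(l2norm U u)\<^sup>2 = (\<Sum>c\<in>Basis. (l2norm U (\<lambda>x. u x \<bullet> c))\<^sup>2)"
proof -
  have "(norm (u x))\<^sup>2 = (\<Sum>c\<in>Basis. (norm (u x \<bullet> c))\<^sup>2)" for x
    by (subst power2_norm_eq_inner, subst euclidean_inner) (simp add: power2_eq_square)
  then have "(l2norm U u)\<^sup>2 = (\<integral>x. (\<Sum>c\<in>Basis. (norm (u x \<bullet> c))\<^sup>2) \<partial>lebesgue_on U)" by (simp add: l2norm_sq)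
  also have "\<dots> = (\<Sum>c\<in>Basis. \<integral>x. (norm (u x \<bullet> c))\<^sup>2 \<partial>lebesgue_on U)"
    by (rule Bochner_Integration.integral_sum) (use L2_inner_const[OF assms] in \<open>simp add: L2_def\<close>)
  finally show ?thesis by (simp add: l2norm_sq)
qed

context cylinder
begin

text \<open>By duality it suffices to pair \<tau> with a test function on \<Gamma>. Shifted by T in
  direction b, the test function no longer meets \<Gamma>, so the pairing equals that with the
  difference, and the shift estimate bounds it by the derivative g. The identities for test
  functions on the whole space are essential here, since the intermediate translates cross the
  boundary.\<close>

lemma poincare:
  "\<exists>T\<ge>0. \<forall>\<tau> g b. b \<in> Basis \<longrightarrow> L2 \<Gamma> \<tau> \<longrightarrow> L2 \<Gamma> g \<longrightarrow>
    (\<forall>\<phi>. test_fun UNIV \<phi> \<longrightarrow> (\<integral>y. pd b \<phi> y *\<^sub>R \<tau> y + \<phi> y *\<^sub>R g y \<partial>lebesgue_on \<Gamma>) = 0) \<longrightarrow>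
    l2norm \<Gamma> (\<tau> :: 'a \<Rightarrow> 'b::euclidean_space) \<le> T * l2norm \<Gamma> g"
proof -
  obtain R where R: "R > 0" "\<And>x. x \<in> \<Gamma> \<Longrightarrow> norm x \<le> R" using bounded_G by (auto simp: bounded_pos)
  \<comment> \<open>A shift by more than twice the radius carries the ball containing \<Gamma> off
    itself.\<close>
  define T where "T = 2 * R + 1"
  have T: "T \<ge> 0" using R by (simp add: T_def)
  have "l2norm \<Gamma> \<tau> \<le> T * l2norm \<Gamma> g"
    if b: "b \<in> Basis" and L: "L2 \<Gamma> \<tau>" "L2 \<Gamma> g"
      and eq: "\<And>\<phi>. test_fun UNIV \<phi> \<Longrightarrow> (\<integral>y. pd b \<phi> y *\<^sub>R \<tau> y + \<phi> y *\<^sub>R g y \<partial>lebesgue_on \<Gamma>) = 0"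
    for \<tau> g :: "'a \<Rightarrow> 'b" and b
  proof -
    \<comment> \<open>The shift estimate and the duality bound concern real functions, hence the
      argument runs componentwise; squares are added at the end.\<close>
    have comp: "l2norm \<Gamma> (\<lambda>x. \<tau> x \<bullet> c) \<le> T * l2norm \<Gamma> (\<lambda>x. g x \<bullet> c)" if c: "c \<in> Basis" for c
    proof (rule l2norm_le_if_test_fun_bound[OF open_G L2_inner_const[OF L(1)]])
      show "0 \<le> T * l2norm \<Gamma> (\<lambda>x. g x \<bullet> c)" using T by simp
      fix \<phi> assume \<phi>: "test_fun \<Gamma> \<phi>"
      have "\<bar>\<integral>x. (\<phi> x - \<phi> (x - T *\<^sub>R b)) * (\<tau> x \<bullet> c) \<partial>lebesgue_on \<Gamma>\<bar> \<le> T * (l2norm \<Gamma> \<phi> * l2norm \<Gamma> (\<lambda>x. g x \<bullet> c))"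
      proof (rule shift_estimate[OF G_lm L2_inner_const[OF L(1)] b T \<phi>])
        fix s
        let ?p = "\<lambda>x. \<phi> (x - s *\<^sub>R b)"
        have p: "test_fun UNIV ?p" by (rule test_fun_translate[OF \<phi>]) simp
        note P = test_fun_pd[OF p b]
        have "(\<integral>y. pd b ?p y *\<^sub>R \<tau> y \<partial>lebesgue_on \<Gamma>) + (\<integral>y. ?p y *\<^sub>R g y \<partial>lebesgue_on \<Gamma>) = 0"
          using eq[OF p] test_intG[OF P L(1)] test_intG[OF p L(2)] by simp
        then have Z: "((\<integral>y. pd b ?p y *\<^sub>R \<tau> y \<partial>lebesgue_on \<Gamma>) + (\<integral>y. ?p y *\<^sub>R g y \<partial>lebesgue_on \<Gamma>)) \<bullet> c = 0" by simp
        have "(\<integral>y. (pd b ?p y *\<^sub>R \<tau> y) \<bullet> c \<partial>lebesgue_on \<Gamma>) = (\<integral>y. pd b ?p y *\<^sub>R \<tau> y \<partial>lebesgue_on \<Gamma>) \<bullet> c"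
          by (rule integral_inner_left) (rule test_intG[OF P L(1)])
        moreover have "(\<integral>y. (?p y *\<^sub>R g y) \<bullet> c \<partial>lebesgue_on \<Gamma>) = (\<integral>y. ?p y *\<^sub>R g y \<partial>lebesgue_on \<Gamma>) \<bullet> c"
          by (rule integral_inner_left) (rule test_intG[OF p L(2)])
        ultimately have "(\<integral>y. (pd b ?p y *\<^sub>R \<tau> y) \<bullet> c \<partial>lebesgue_on \<Gamma>) + (\<integral>y. (?p y *\<^sub>R g y) \<bullet> c \<partial>lebesgue_on \<Gamma>) = 0"
          using Z by (simp only: inner_add_left)
        then have "(\<integral>x. pd b \<phi> (x - s *\<^sub>R b) * (\<tau> x \<bullet> c) \<partial>lebesgue_on \<Gamma>) = - (\<integral>y. ?p y * (g y \<bullet> c) \<partial>lebesgue_on \<Gamma>)"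
          by (simp add: pd_translate[OF test_fun_differentiable[OF \<phi>]])
        moreover have "\<bar>\<integral>y. ?p y * (g y \<bullet> c) \<partial>lebesgue_on \<Gamma>\<bar> \<le> l2norm \<Gamma> ?p * l2norm \<Gamma> (\<lambda>x. g x \<bullet> c)"
          using l2ip_bound[OF test_fun_L2[OF p G_leb] L2_inner_const[OF L(2), of c]] by simp
        moreover have "l2norm \<Gamma> ?p * l2norm \<Gamma> (\<lambda>x. g x \<bullet> c) \<le> l2norm \<Gamma> \<phi> * l2norm \<Gamma> (\<lambda>x. g x \<bullet> c)"
          by (intro mult_right_mono l2norm_translate_le[OF \<phi> G_leb G_leb]) simp
        ultimately show "\<bar>\<integral>x. pd b \<phi> (x - s *\<^sub>R b) * (\<tau> x \<bullet> c) \<partial>lebesgue_on \<Gamma>\<bar> \<le> l2norm \<Gamma> \<phi> * l2norm \<Gamma> (\<lambda>x. g x \<bullet> c)"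
          by simp
      qed
      moreover have "(\<integral>x. (\<phi> x - \<phi> (x - T *\<^sub>R b)) * (\<tau> x \<bullet> c) \<partial>lebesgue_on \<Gamma>) = (\<integral>x. \<phi> x * (\<tau> x \<bullet> c) \<partial>lebesgue_on \<Gamma>)"
      proof (rule Bochner_Integration.integral_cong[OF refl])
        fix x assume "x \<in> space (lebesgue_on \<Gamma>)"
        then have "norm x \<le> R" using R(2) by simp
        moreover have "norm (T *\<^sub>R b) = T" using b T by simp
        ultimately have "norm (x - T *\<^sub>R b) > R"
          using norm_triangle_ineq2[of "T *\<^sub>R b" x] by (simp add: T_def norm_minus_commute)
        then have "x - T *\<^sub>R b \<notin> \<Gamma>" using R(2) by (meson not_le)
        then show "(\<phi> x - \<phi> (x - T *\<^sub>R b)) * (\<tau> x \<bullet> c) = \<phi> x * (\<tau> x \<bullet> c)" using test_fun_eq_0[OF \<phi>] by simp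
      qed
      ultimately show "\<bar>\<integral>x. \<phi> x * (\<tau> x \<bullet> c) \<partial>lebesgue_on \<Gamma>\<bar> \<le> T * l2norm \<Gamma> (\<lambda>x. g x \<bullet> c) * l2norm \<Gamma> \<phi>"
        by (simp add: mult_ac)
    qed
    have "(l2norm \<Gamma> \<tau>)\<^sup>2 \<le> (\<Sum>c\<in>Basis. (T * l2norm \<Gamma> (\<lambda>x. g x \<bullet> c))\<^sup>2)"
      unfolding l2norm_components[OF L(1)] by (intro sum_mono power_mono comp) simp_all
    also have "\<dots> = (T * l2norm \<Gamma> g)\<^sup>2"
      by (simp add: power_mult_distrib l2norm_components[OF L(2)] sum_distrib_left)
    finally show ?thesis by (rule power2_le_imp_le) (simp add: T)
  qed
  then show ?thesis using T by (intro exI[of _ T]) simp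
qed

end

section \<open>One-dimensional Poincare inequalities along vertical lines\<close>

text \<open>Cauchy-Schwarz on the interval, obtained by expanding the nonnegative integral of (F' -
  m)^2 with \<open>m\<close> the mean slope of F.\<close>

lemma interval_square_bound:
  fixes F F' :: "real \<Rightarrow> real"
  assumes F: "\<And>t. (F has_real_derivative F' t) (at t)" "continuous_on UNIV F'" and cs: "c < s" and Fc: "F c = 0"
  shows "(F s)\<^sup>2 \<le> (s - c) * (\<integral>t. (F' t)\<^sup>2 * indicator {c..s} t \<partial>lborel)"
proof -
  define m where "m = F s / (s - c)"
  have isC: "isCont F' t" for t using F(2) by (simp add: continuous_on_eq_continuous_at)
  have I: "(\<integral>t. F' t * indicator {c..s} t \<partial>lborel) = F s"
    using integral_FTC_Icc_real[of c s F F'] F(1) isC cs Fc by simp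
  have i1: "integrable lborel (\<lambda>t. F' t * indicator {c..s} t)"
    by (rule borel_integrable_atLeastAtMost) (rule isC)
  have i2: "integrable lborel (\<lambda>t. (F' t)\<^sup>2 * indicator {c..s} t)"
    by (rule borel_integrable_atLeastAtMost) (intro continuous_intros isC)
  have i0: "integrable lborel (\<lambda>t. indicator {c..s} t :: real)"
    by (rule integrable_real_indicator) (use cs in simp_all)
  have "0 \<le> (\<integral>t. (F' t - m)\<^sup>2 * indicator {c..s} t \<partial>lborel)" by (rule integral_nonneg_AE) simp
  also have "\<dots> = (\<integral>t. (F' t)\<^sup>2 * indicator {c..s} t - 2 * m * (F' t * indicator {c..s} t) + m\<^sup>2 * indicator {c..s} t \<partial>lborel)"
    by (rule Bochner_Integration.integral_cong) (simp_all add: power2_diff algebra_simps)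
  also have "\<dots> = (\<integral>t. (F' t)\<^sup>2 * indicator {c..s} t \<partial>lborel) - 2 * m * F s + m\<^sup>2 * (s - c)"
    using i0 i1 i2 cs by (simp add: I)
  also have "\<dots> = (\<integral>t. (F' t)\<^sup>2 * indicator {c..s} t \<partial>lborel) - (F s)\<^sup>2 / (s - c)"
  proof -
    have e: "F s = m * (s - c)" using cs by (simp add: m_def)
    have "s - c \<noteq> 0" using cs by simp
    then show ?thesis unfolding e by (simp add: power2_eq_square)
  qed
  finally show ?thesis using cs by (simp add: field_simps)
qed

text \<open>The interval below \<open>s\<close> is followed to \<open>c\<close>, the last point
  below \<open>s\<close> outside S. Then S contains all points between \<open>c\<close> and
  \<open>s\<close>, and \<open>c\<close> is a boundary point of S, where F vanishes. The hypothesis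
  on \<rho> keeps \<open>c\<close> below \<open>s\<close>; it replaces membership of
  \<open>s\<close> in S, so that \<open>s\<close> may itself be a boundary point.\<close>

lemma one_dim_poincare_down:
  fixes F F' :: "real \<Rightarrow> real"
  assumes F: "\<And>t. (F has_real_derivative F' t) (at t)" "continuous_on UNIV F'"
    and S: "open S" "S \<subseteq> {- R..R}" and s: "s \<le> R" and \<rho>: "\<rho> > 0" "{s - \<rho><..<s} \<subseteq> S"
    and zero: "\<And>c. c < s \<Longrightarrow> c \<notin> S \<Longrightarrow> c \<in> closure S \<Longrightarrow> F c = 0"
  shows "(F s)\<^sup>2 \<le> 2 * R * (\<integral>t. indicator S t * (F' t)\<^sup>2 \<partial>lborel)"
proof -
  define A where "A = {t. t < s \<and> t \<notin> S}"
  define c where "c = Sup A"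
  have Ale: "t \<le> s - \<rho>" if "t \<in> A" for t
  proof (rule ccontr)
    assume "\<not> t \<le> s - \<rho>"
    then have "t \<in> {s - \<rho><..<s}" using that by (simp add: A_def)
    then show False using that \<rho>(2) by (auto simp: A_def)
  qed
  have mid: "s - \<rho>/2 \<in> S" using \<rho> by (intro subsetD[OF \<rho>(2)]) auto
  then have "- R \<le> s - \<rho>/2" using S(2) by auto
  then have sR: "- R - 1 < s" using \<rho> by linarith
  \<comment> \<open>A point surely outside S, to make the supremum meaningful.\<close>
  have An: "- R - 1 \<in> A" using S(2) sR by (auto simp: A_def)
  have bdd: "bdd_above A" using Ale by (intro bdd_aboveI)
  have c_le: "c \<le> s - \<rho>" unfolding c_def using An Ale by (intro cSup_least) auto
  then have cs: "c < s" using \<rho> by linarith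
  have up: "t \<in> S" if "c < t" "t < s" for t
  proof (rule ccontr)
    assume "t \<notin> S"
    then have "t \<in> A" using that by (simp add: A_def)
    then have "t \<le> c" unfolding c_def by (rule cSup_upper[OF _ bdd])
    then show False using that by simp
  qed
  have cS: "c \<notin> S"
  proof
    assume "c \<in> S"
    then obtain \<delta> where \<delta>: "\<delta> > 0" "\<And>t. \<bar>t - c\<bar> < \<delta> \<Longrightarrow> t \<in> S" using S(1) unfolding open_dist dist_real_def by auto
    obtain t where t: "t \<in> A" "c - \<delta> < t" using less_cSupD[of A "c - \<delta>"] An \<delta>(1) by (auto simp: c_def)
    have "t \<le> c" unfolding c_def by (rule cSup_upper[OF t(1) bdd])
    then have "t \<in> S" using t(2) by (intro \<delta>(2)) simp
    then show False using t(1) by (simp add: A_def)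
  qed
  have ccl: "c \<in> closure S"
  proof -
    have "{c<..<s} \<subseteq> S" using up by auto
    then have "closure {c<..<s} \<subseteq> closure S" by (rule closure_mono)
    then show ?thesis using cs by (auto simp: closure_greaterThanLessThan)
  qed
  have cR: "- R \<le> c"
  proof -
    have "closure S \<subseteq> {- R..R}" by (rule closure_minimal[OF S(2)]) simp
    then show ?thesis using ccl by auto
  qed
  have isC: "isCont F' t" for t using F(2) by (simp add: continuous_on_eq_continuous_at)
  have i2: "integrable lborel (\<lambda>t. (F' t)\<^sup>2 * indicator {- R..R} t)"
    by (rule borel_integrable_atLeastAtMost) (intro continuous_intros isC)
  have F'm: "(\<lambda>t. (F' t)\<^sup>2) \<in> borel_measurable lborel" using borel_measurable_continuous_onI[OF F(2)] by simp
  have Sm: "(\<lambda>t. indicator S t * (F' t)\<^sup>2) \<in> borel_measurable lborel"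
    by (intro borel_measurable_times F'm borel_measurable_indicator) (use S(1) in simp)
  have iS: "integrable lborel (\<lambda>t. indicator S t * (F' t)\<^sup>2)"
  proof (rule Bochner_Integration.integrable_bound[OF i2 Sm], rule AE_I2)
    fix t
    show "norm (indicator S t * (F' t)\<^sup>2) \<le> norm ((F' t)\<^sup>2 * indicator {- R..R} t)"
      using S(2) by (cases "t \<in> S") auto
  qed
  have i3: "integrable lborel (\<lambda>t. (F' t)\<^sup>2 * indicator {c..s} t)"
    by (rule borel_integrable_atLeastAtMost) (intro continuous_intros isC)
  have "(F s)\<^sup>2 \<le> (s - c) * (\<integral>t. (F' t)\<^sup>2 * indicator {c..s} t \<partial>lborel)"
    by (rule interval_square_bound[OF F cs zero[OF cs cS ccl]])
  also have "\<dots> \<le> (2 * R) * (\<integral>t. (F' t)\<^sup>2 * indicator {c..s} t \<partial>lborel)"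
    by (intro mult_right_mono integral_nonneg_AE) (use cR s in auto)
  also have "\<dots> \<le> (2 * R) * (\<integral>t. indicator S t * (F' t)\<^sup>2 \<partial>lborel)"
  proof (intro mult_left_mono integral_mono_AE i3 iS)
    have "AE t in lborel. t \<noteq> c" "AE t in lborel. t \<noteq> s" by (rule AE_lborel_singleton)+
    then show "AE t in lborel. (F' t)\<^sup>2 * indicator {c..s} t \<le> indicator S t * (F' t)\<^sup>2"
      by eventually_elim (use up in \<open>auto simp: indicator_def\<close>)
  qed (use cR s cs in linarith)
  finally show ?thesis .
qed

text \<open>The downward version applied to the reflected line.\<close>

lemma one_dim_poincare_up:
  fixes F F' :: "real \<Rightarrow> real"
  assumes F: "\<And>t. (F has_real_derivative F' t) (at t)" "continuous_on UNIV F'"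
    and S: "open S" "S \<subseteq> {- R..R}" and s: "- R \<le> s" and \<rho>: "\<rho> > 0" "{s<..<s + \<rho>} \<subseteq> S"
    and zero: "\<And>c. s < c \<Longrightarrow> c \<notin> S \<Longrightarrow> c \<in> closure S \<Longrightarrow> F c = 0"
  shows "(F s)\<^sup>2 \<le> 2 * R * (\<integral>t. indicator S t * (F' t)\<^sup>2 \<partial>lborel)"
proof -
  have S': "uminus ` S = {t. - t \<in> S}" by force
  have cl: "- c \<in> closure S" if "c \<in> closure (uminus ` S)" for c
  proof -
    have "uminus ` closure (uminus ` S) \<subseteq> closure (uminus ` (uminus ` S))"
      by (rule continuous_image_closure_subset[of UNIV]) (intro continuous_intros, simp)
    also have "uminus ` (uminus ` S) = S" by (simp add: image_image)
    finally show ?thesis using that by auto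
  qed
  have "(F (- (- s)))\<^sup>2 \<le> 2 * R * (\<integral>t. indicator (uminus ` S) t * (- F' (- t))\<^sup>2 \<partial>lborel)"
  proof (rule one_dim_poincare_down[where F = "\<lambda>t. F (- t)" and \<rho> = \<rho>])
    show "((\<lambda>t. F (- t)) has_real_derivative - F' (- t)) (at t)" for t
    proof -
      have "(uminus has_real_derivative -1) (at t)" by (auto intro!: derivative_eq_intros)
      from DERIV_chain2[OF F(1)[of "- t"] this] show ?thesis by simp
    qed
    show "continuous_on UNIV (\<lambda>t. - F' (- t))"
      by (intro continuous_on_minus continuous_on_compose2[OF F(2)] continuous_on_id) simp
    show "open (uminus ` S)" by (rule open_negations[OF S(1)])
    show "uminus ` S \<subseteq> {- R..R}" using S(2) by auto
    show "- s \<le> R" using s by simp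
    show "{- s - \<rho><..<- s} \<subseteq> uminus ` S" using \<rho>(2) unfolding S' by auto
    fix c assume "c < - s" "c \<notin> uminus ` S" and cc: "c \<in> closure (uminus ` S)"
    then show "F (- c) = 0" using cl[OF cc] unfolding S' by (intro zero) auto
  qed (rule \<rho>(1))
  also have "(\<integral>t. indicator (uminus ` S) t * (- F' (- t))\<^sup>2 \<partial>lborel) = (\<integral>t. indicator S t * (F' t)\<^sup>2 \<partial>lborel)"
    using lborel_integral_real_affine[of "- 1" "\<lambda>t. indicator S t * (F' t)\<^sup>2" 0]
    unfolding S' by (simp add: indicator_def)
  finally show ?thesis by simp
qed

section \<open>Solving the divergence equation with prescribed normal trace\<close>

context two_domains
begin

lemma free_eq_0:
  assumes "test_fun free \<phi>" "p \<in> frontier \<Omega>1" "p \<notin> \<Gamma> \<times> {0}"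
  shows "\<phi> p = 0"
proof (rule test_fun_eq_0[OF assms(1)])
  have "p \<in> closure (frontier \<Omega>1 - \<Gamma> \<times> {0})" using assms(2,3) by (intro subsetD[OF closure_subset]) simp
  then show "p \<notin> free" by simp
qed

lemma slice_open: "open {t. (x, t) \<in> \<Omega>1}"
proof -
  have "open ((\<lambda>t. (x, t)) -` \<Omega>1)" by (rule open_vimage[OF open_1]) (intro continuous_intros)
  then show ?thesis by (simp add: vimage_def)
qed

lemma slice_boundary:
  assumes "c \<notin> {t. (x, t) \<in> \<Omega>1}" "c \<in> closure {t. (x, t) \<in> \<Omega>1}"
  shows "(x, c) \<in> frontier \<Omega>1"
proof -
  have "(\<lambda>t. (x, t)) ` closure {t. (x, t) \<in> \<Omega>1} \<subseteq> closure ((\<lambda>t. (x, t)) ` {t. (x, t) \<in> \<Omega>1})"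
    by (rule continuous_image_closure_subset[of UNIV]) (intro continuous_intros, simp)
  also have "\<dots> \<subseteq> closure \<Omega>1" by (rule closure_mono) auto
  finally have "(x, c) \<in> closure \<Omega>1" using assms(2) by auto
  then show ?thesis using assms(1) open_1 by (simp add: frontier_def interior_open)
qed

text \<open>A \<open>free\<close> test function vanishes on the boundary except on \<Gamma>, which
  sits at height 0. From heights at most 0 the line is followed down, from positive heights up, so
  its end point has nonzero height and the function vanishes there. Points of \<Gamma> are included:
  below them the line starts inside \<Omega>1.\<close>

lemma slice_poincare:
  "\<exists>R>0. \<forall>\<phi>. test_fun free \<phi> \<longrightarrow> \<Omega>1 \<subseteq> UNIV \<times> {- R..R} \<and>
     (\<forall>x s. (x, s) \<in> \<Omega>1 \<or> (x \<in> \<Gamma> \<and> s = 0) \<longrightarrow>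
      (\<phi> (x, s))\<^sup>2 \<le> 2 * R * (\<integral>t. indicator \<Omega>1 (x, t) * (pd ez \<phi> (x, t))\<^sup>2 \<partial>lborel))"
proof -
  obtain R where R: "R > 0" "\<And>p. p \<in> \<Omega>1 \<Longrightarrow> norm p \<le> R" using bounded_1 by (auto simp: bounded_pos)
  have RR: "\<bar>t\<bar> \<le> R" if "(x, t) \<in> \<Omega>1" for x t
    using R(2)[OF that] norm_snd_le[of t x] by simp
  have "(\<phi> (x, s))\<^sup>2 \<le> 2 * R * (\<integral>t. indicator \<Omega>1 (x, t) * (pd ez \<phi> (x, t))\<^sup>2 \<partial>lborel)"
    if \<phi>: "test_fun free \<phi>" and xs: "(x, s) \<in> \<Omega>1 \<or> (x \<in> \<Gamma> \<and> s = 0)" for \<phi> x s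
  proof -
    let ?S = "{t. (x, t) \<in> \<Omega>1}"
    have SR: "?S \<subseteq> {- R..R}" using RR[of x] by (auto simp: abs_le_iff minus_le_iff)
    have sR: "\<bar>s\<bar> \<le> R" using xs RR R(1) by auto
    note D = slice2_deriv[OF test_fun_differentiable[OF \<phi>], of x]
      z_slice_continuous[OF test_fun_pd[OF \<phi> ez_Basis], of x]
    have ind: "indicator \<Omega>1 (x, t) = (indicator ?S t :: real)" for t by (simp add: indicator_def)
    have nb: "\<exists>\<rho>>0. \<forall>t. \<bar>t - s\<bar> < \<rho> \<longrightarrow> t \<in> ?S" if "(x, s) \<in> \<Omega>1"
      using slice_open[of x] that unfolding open_dist dist_real_def by auto
    show ?thesis
    proof (cases "s \<le> 0")
      case True
      have "\<exists>\<rho>>0. {s - \<rho><..<s} \<subseteq> ?S"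
      proof (cases "(x, s) \<in> \<Omega>1")
        case True
        then obtain \<rho> where "\<rho> > 0" "\<forall>t. \<bar>t - s\<bar> < \<rho> \<longrightarrow> t \<in> ?S" using nb by auto
        then show ?thesis by (intro exI[of _ \<rho>]) auto
      next
        case False
        then have "x \<in> \<Gamma>" "s = 0" using xs by auto
        then obtain \<rho> where "\<rho> > 0" "\<forall>t. - \<rho> < t \<and> t < 0 \<longrightarrow> (x, t) \<in> \<Omega>1" using below by auto
        then show ?thesis using \<open>s = 0\<close> by (intro exI[of _ \<rho>]) auto
      qed
      then obtain \<rho> where \<rho>: "\<rho> > 0" "{s - \<rho><..<s} \<subseteq> ?S" by auto
      show ?thesis
        unfolding ind
      proof (rule one_dim_poincare_down[OF D slice_open SR _ \<rho>])
        show "s \<le> R" using sR by simp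
        fix c assume "c < s" "c \<notin> ?S" "c \<in> closure ?S"
        then show "\<phi> (x, c) = 0" using True by (intro free_eq_0[OF \<phi>] slice_boundary) auto
      qed
    next
      case False
      then have "(x, s) \<in> \<Omega>1" using xs by auto
      then obtain \<rho> where r: "\<rho> > 0" "\<forall>t. \<bar>t - s\<bar> < \<rho> \<longrightarrow> t \<in> ?S" using nb by auto
      then have \<rho>: "\<rho> > 0" "{s<..<s + \<rho>} \<subseteq> ?S" by auto
      show ?thesis
        unfolding ind
      proof (rule one_dim_poincare_up[OF D slice_open SR _ \<rho>])
        show "- R \<le> s" using sR by simp
        fix c assume "s < c" "c \<notin> ?S" "c \<in> closure ?S"
        then show "\<phi> (x, c) = 0" using False by (intro free_eq_0[OF \<phi>] slice_boundary) auto
      qed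
    qed
  qed
  moreover have "\<Omega>1 \<subseteq> UNIV \<times> {- R..R}" using RR by (auto simp: abs_le_iff minus_le_iff)
  ultimately show ?thesis using R(1) by (intro exI[of _ R]) simp
qed

text \<open>The slice bound does not depend on the height s. Integrating it over \<Omega>1 costs
  another factor 2 R for the range of heights, while integrating it over \<Gamma> gives the estimate
  for the values at height 0.\<close>

lemma free_poincare:
  "\<exists>C\<ge>0. \<forall>\<phi>. test_fun free \<phi> \<longrightarrow> l2norm \<Omega>1 \<phi> \<le> C * l2norm \<Omega>1 (pd ez \<phi>) \<and>
     l2norm \<Gamma> (\<lambda>y. \<phi> (y, 0)) \<le> C * l2norm \<Omega>1 (pd ez \<phi>)"
proof -
  obtain R where R: "R > 0" and PP: "\<forall>\<phi>. test_fun free \<phi> \<longrightarrow> \<Omega>1 \<subseteq> UNIV \<times> {- R..R} \<and>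
     (\<forall>x s. (x, s) \<in> \<Omega>1 \<or> (x \<in> \<Gamma> \<and> s = 0) \<longrightarrow>
      (\<phi> (x, s))\<^sup>2 \<le> 2 * R * (\<integral>t. indicator \<Omega>1 (x, t) * (pd ez \<phi> (x, t))\<^sup>2 \<partial>lborel))"
    using slice_poincare by (elim exE conjE)
  have P: "\<Omega>1 \<subseteq> UNIV \<times> {- R..R}" "\<And>x s. (x, s) \<in> \<Omega>1 \<or> (x \<in> \<Gamma> \<and> s = 0) \<Longrightarrow>
      (\<phi> (x, s))\<^sup>2 \<le> 2 * R * (\<integral>t. indicator \<Omega>1 (x, t) * (pd ez \<phi> (x, t))\<^sup>2 \<partial>lborel)"
    if "test_fun free \<phi>" for \<phi>
  proof -
    note Q = PP[rule_format, OF that]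
    show "\<Omega>1 \<subseteq> UNIV \<times> {- R..R}" by (rule conjunct1[OF Q])
    show "(\<phi> (x, s))\<^sup>2 \<le> 2 * R * (\<integral>t. indicator \<Omega>1 (x, t) * (pd ez \<phi> (x, t))\<^sup>2 \<partial>lborel)"
      if "(x, s) \<in> \<Omega>1 \<or> (x \<in> \<Gamma> \<and> s = 0)" for x s
      by (rule conjunct2[OF Q, rule_format, OF that])
  qed
  have O1b: "\<Omega>1 \<in> sets borel" using open_1 by simp
  have "l2norm \<Omega>1 \<phi> \<le> (2 * R + 1) * l2norm \<Omega>1 (pd ez \<phi>) \<and> l2norm \<Gamma> (\<lambda>y. \<phi> (y, 0)) \<le> (2 * R + 1) * l2norm \<Omega>1 (pd ez \<phi>)"
    if \<phi>: "test_fun free \<phi>" for \<phi>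
  proof -
    note pz = test_fun_pd[OF \<phi> ez_Basis]
    let ?h = "\<lambda>p. indicator \<Omega>1 p * (pd ez \<phi> p)\<^sup>2" and ?k = "\<lambda>p. indicator \<Omega>1 p * (\<phi> p)\<^sup>2"
    have sq: "(l2norm \<Omega>1 u)\<^sup>2 = (\<integral>p. indicator \<Omega>1 p * (u p)\<^sup>2 \<partial>(lborel \<Otimes>\<^sub>M lborel))"
        "integrable (lborel \<Otimes>\<^sub>M lborel) (\<lambda>p. indicator \<Omega>1 p * (u p)\<^sup>2)"
      if u: "test_fun free u" for u
    proof -
      have um: "u \<in> borel_measurable lborel" using test_fun_borel[OF u] by simp
      have m: "(\<lambda>p. indicator \<Omega>1 p * (u p)\<^sup>2) \<in> borel_measurable lborel"
        by (intro borel_measurable_times borel_measurable_indicator borel_measurable_power um) (use O1b in simp)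
      show "(l2norm \<Omega>1 u)\<^sup>2 = (\<integral>p. indicator \<Omega>1 p * (u p)\<^sup>2 \<partial>(lborel \<Otimes>\<^sub>M lborel))"
        using O1_leb integral_completion[OF m] by (simp add: l2norm_sq integral_lebesgue_on lborel_prod)
      show "integrable (lborel \<Otimes>\<^sub>M lborel) (\<lambda>p. indicator \<Omega>1 p * (u p)\<^sup>2)"
        using O1_leb integrable_completion[OF m] test_fun_L2[OF u O1_leb]
        by (simp add: L2_def integrable_lebesgue_on_iff lborel_prod)
    qed
    define G where "G x = (\<integral>t. ?h (x, t) \<partial>lborel)" for x
    have Gi: "integrable lborel G" unfolding G_def by (rule lborel_pair.integrable_fst'[OF sq(2)[OF pz]])
    have Gint: "(\<integral>x. G x \<partial>lborel) = (l2norm \<Omega>1 (pd ez \<phi>))\<^sup>2"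
      unfolding G_def sq(1)[OF pz] by (rule lborel_pair.integral_fst'[OF sq(2)[OF pz]])
    have G0: "0 \<le> G x" for x unfolding G_def by (rule integral_nonneg_AE) simp
    have "(l2norm \<Omega>1 \<phi>)\<^sup>2 = (\<integral>x. (\<integral>s. ?k (x, s) \<partial>lborel) \<partial>lborel)"
      unfolding sq(1)[OF \<phi>] by (rule lborel_pair.integral_fst'[OF sq(2)[OF \<phi>], symmetric])
    also have "\<dots> \<le> (\<integral>x. (2 * R)\<^sup>2 * G x \<partial>lborel)"
    proof (rule integral_mono_AE)
      show "integrable lborel (\<lambda>x. \<integral>s. ?k (x, s) \<partial>lborel)" by (rule lborel_pair.integrable_fst'[OF sq(2)[OF \<phi>]])
      show "integrable lborel (\<lambda>x. (2 * R)\<^sup>2 * G x)" using Gi by simp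
      have "AE x in lborel. integrable lborel (\<lambda>s. ?k (x, s))" by (rule lborel_pair.AE_integrable_fst'[OF sq(2)[OF \<phi>]])
      then show "AE x in lborel. (\<integral>s. ?k (x, s) \<partial>lborel) \<le> (2 * R)\<^sup>2 * G x"
      proof eventually_elim
        case (elim x)
        have "(\<integral>s. ?k (x, s) \<partial>lborel) \<le> (\<integral>s. indicator {- R..R} s * (2 * R * G x) \<partial>lborel)"
        proof (rule integral_mono[OF elim])
          show "integrable lborel (\<lambda>s. indicator {- R..R} s * (2 * R * G x))"
            by (rule integrable_mult_left, rule integrable_real_indicator) (use R in simp_all)
          fix s
          show "?k (x, s) \<le> indicator {- R..R} s * (2 * R * G x)"
          proof (cases "(x, s) \<in> \<Omega>1")
            case True
            then have "s \<in> {- R..R}" using P(1)[OF \<phi>] by auto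
            then show ?thesis using True P(2)[OF \<phi>, of x s] by (simp add: G_def)
          next
            case False
            then show ?thesis using R G0[of x] by simp
          qed
        qed
        also have "\<dots> = (2 * R)\<^sup>2 * G x" using R by (simp add: power2_eq_square)
        finally show ?case .
      qed
    qed
    also have "\<dots> = (2 * R * l2norm \<Omega>1 (pd ez \<phi>))\<^sup>2" by (simp add: Gint power_mult_distrib)
    finally have 1: "l2norm \<Omega>1 \<phi> \<le> 2 * R * l2norm \<Omega>1 (pd ez \<phi>)"
      by (rule power2_le_imp_le) (use R in simp)
    have ts: "test_fun UNIV (\<lambda>y. \<phi> (y, 0))" by (rule test_fun_mono[OF test_fun_slice[OF \<phi>]]) simp
    have Gl: "integrable lebesgue (\<lambda>x. 2 * R * G x)"
      using Gi integrable_completion[of "\<lambda>x. 2 * R * G x" lborel] by (simp add: borel_measurable_integrable)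
    have "(l2norm \<Gamma> (\<lambda>y. \<phi> (y, 0)))\<^sup>2 = (\<integral>y. indicator \<Gamma> y * (\<phi> (y, 0))\<^sup>2 \<partial>lebesgue)"
      using G_leb by (simp add: l2norm_sq integral_lebesgue_on)
    also have "\<dots> \<le> (\<integral>y. 2 * R * G y \<partial>lebesgue)"
    proof (rule integral_mono[OF _ Gl])
      show "integrable lebesgue (\<lambda>y. indicator \<Gamma> y * (\<phi> (y, 0))\<^sup>2)"
        using G_leb test_fun_L2[OF ts G_leb] by (simp add: L2_def integrable_lebesgue_on_iff)
      show "indicator \<Gamma> y * (\<phi> (y, 0))\<^sup>2 \<le> 2 * R * G y" for y
        using P(2)[OF \<phi>, of y 0] G0[of y] R by (simp add: indicator_def G_def)
    qed
    also have "\<dots> = 2 * R * (l2norm \<Omega>1 (pd ez \<phi>))\<^sup>2"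
      using integral_completion[of G lborel] Gi by (simp add: Gint borel_measurable_integrable)
    \<comment> \<open>The added 1 lets one constant dominate both 2 R and its square root.\<close>
    also have "\<dots> \<le> (2 * R + 1)\<^sup>2 * (l2norm \<Omega>1 (pd ez \<phi>))\<^sup>2"
      using R by (intro mult_right_mono) (auto simp: power2_eq_square algebra_simps)
    finally have "(l2norm \<Gamma> (\<lambda>y. \<phi> (y, 0)))\<^sup>2 \<le> ((2 * R + 1) * l2norm \<Omega>1 (pd ez \<phi>))\<^sup>2"
      by (simp add: power_mult_distrib)
    then have 2: "l2norm \<Gamma> (\<lambda>y. \<phi> (y, 0)) \<le> (2 * R + 1) * l2norm \<Omega>1 (pd ez \<phi>)"
      by (rule power2_le_imp_le) (use R in simp)
    have "2 * R * l2norm \<Omega>1 (pd ez \<phi>) \<le> (2 * R + 1) * l2norm \<Omega>1 (pd ez \<phi>)" by (intro mult_right_mono) simp_all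
    then show ?thesis using 1 2 by linarith
  qed
  then show ?thesis using R by (intro exI[of _ "2 * R + 1"]) simp
qed

(* A vertical field (0, W) suffices: W represents the functional below on the functions d_z phi. *)
lemma exists_vertical_field:
  "\<exists>C\<ge>0. \<forall>d f. L2 \<Omega>1 d \<longrightarrow> L2 \<Gamma> f \<longrightarrow> (\<exists>W. L2 \<Omega>1 W \<and> l2norm \<Omega>1 W \<le> C * (l2norm \<Omega>1 d + l2norm \<Gamma> f) \<and>
    (\<forall>\<phi>. test_fun free \<phi> \<longrightarrow> (\<integral>x. W x * pd ez \<phi> x \<partial>lebesgue_on \<Omega>1) =
      - (\<integral>x. \<phi> x * d x \<partial>lebesgue_on \<Omega>1) - (\<integral>y. f y * \<phi> (y, 0) \<partial>lebesgue_on \<Gamma>)))"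
proof -
  obtain C where C: "C \<ge> 0" and P: "\<And>\<phi>. test_fun free \<phi> \<Longrightarrow> l2norm \<Omega>1 \<phi> \<le> C * l2norm \<Omega>1 (pd ez \<phi>)"
     "\<And>\<phi>. test_fun free \<phi> \<Longrightarrow> l2norm \<Gamma> (\<lambda>y. \<phi> (y, 0)) \<le> C * l2norm \<Omega>1 (pd ez \<phi>)"
    using free_poincare by auto
  have ts: "L2 \<Gamma> (\<lambda>y. \<phi> (y, 0))" if "test_fun free \<phi>" for \<phi>
    by (rule test_fun_L2[OF test_fun_slice[OF that] G_leb])
  have "\<exists>W. L2 \<Omega>1 W \<and> l2norm \<Omega>1 W \<le> C * (l2norm \<Omega>1 d + l2norm \<Gamma> f) \<and>
    (\<forall>\<phi>. test_fun free \<phi> \<longrightarrow> (\<integral>x. W x * pd ez \<phi> x \<partial>lebesgue_on \<Omega>1) =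
      - (\<integral>x. \<phi> x * d x \<partial>lebesgue_on \<Omega>1) - (\<integral>y. f y * \<phi> (y, 0) \<partial>lebesgue_on \<Gamma>))"
    if d: "L2 \<Omega>1 d" and f: "L2 \<Gamma> f" for d f
  proof -
    define l where "l \<phi> = - (\<integral>x. \<phi> x * d x \<partial>lebesgue_on \<Omega>1) - (\<integral>y. f y * \<phi> (y, 0) \<partial>lebesgue_on \<Gamma>)" for \<phi> :: "'a \<times> real \<Rightarrow> real"
    have i1: "integrable (lebesgue_on \<Omega>1) (\<lambda>x. \<phi> x * d x)" if "test_fun free \<phi>" for \<phi>
      by (rule L2_real_integrable_mult[OF test_fun_L2[OF that O1_leb] d])
    have i2: "integrable (lebesgue_on \<Gamma>) (\<lambda>y. f y * \<phi> (y, 0))" if "test_fun free \<phi>" for \<phi>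
      by (rule L2_real_integrable_mult[OF f ts[OF that]])
    have "\<exists>u\<in>{u. L2 \<Omega>1 u}. (\<forall>\<phi>\<in>{\<phi>. test_fun free \<phi>}. l2ip \<Omega>1 u (pd ez \<phi>) = l \<phi>) \<and>
        L2.nrm \<Omega>1 u \<le> C * (l2norm \<Omega>1 d + l2norm \<Gamma> f) \<and>
        (\<exists>s. (\<forall>n. s n \<in> {\<phi>. test_fun free \<phi>}) \<and> (\<lambda>n. L2.nrm \<Omega>1 (pd ez (s n) - u)) \<longlonglongrightarrow> 0)"
    \<comment> \<open>The image of \<phi> is its z-derivative. By the Poincare bounds
      \<open>l\<close> is controlled by that derivative, so the functional can be represented on the
      span of z-derivatives.\<close>
    proof (rule L2.riesz[where T = "pd ez"])
      show "subspace {\<phi>. test_fun free \<phi>}" by (rule test_fun_subspace)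
      show "pd ez \<phi> \<in> {u. L2 \<Omega>1 u}" if "\<phi> \<in> {\<phi>. test_fun free \<phi>}" for \<phi>
        using test_fun_L2[OF test_fun_pd[OF _ ez_Basis] O1_leb, of free \<phi>] that by simp
      show "pd ez (\<phi> + \<psi>) = pd ez \<phi> + pd ez \<psi>" if "\<phi> \<in> {\<phi>. test_fun free \<phi>}" "\<psi> \<in> {\<phi>. test_fun free \<phi>}" for \<phi> \<psi>
        unfolding plus_fun_def using that by (intro ext pd_add) (simp_all add: test_fun_differentiable)
      show "pd ez (r *\<^sub>R \<phi>) = r *\<^sub>R pd ez \<phi>" if "\<phi> \<in> {\<phi>. test_fun free \<phi>}" for r \<phi>
        unfolding scaleR_fun_def using that by (intro ext pd_scaleR) (simp_all add: test_fun_differentiable)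
      show "l (\<phi> + \<psi>) = l \<phi> + l \<psi>" if "\<phi> \<in> {\<phi>. test_fun free \<phi>}" "\<psi> \<in> {\<phi>. test_fun free \<phi>}" for \<phi> \<psi>
        using i1[of \<phi>] i1[of \<psi>] i2[of \<phi>] i2[of \<psi>] that by (simp add: l_def distrib_left distrib_right)
      show "l (r *\<^sub>R \<phi>) = r * l \<phi>" if "\<phi> \<in> {\<phi>. test_fun free \<phi>}" for r \<phi>
      proof -
        have "(\<lambda>y. f y * (r * \<phi> (y, 0))) = (\<lambda>y. r * (f y * \<phi> (y, 0)))" by (simp add: mult_ac)
        then show ?thesis by (simp add: l_def mult.assoc right_diff_distrib)
      qed
      show "0 \<le> C * (l2norm \<Omega>1 d + l2norm \<Gamma> f)" using C by simp
      fix \<phi> :: "'a \<times> real \<Rightarrow> real" assume "\<phi> \<in> {\<phi>. test_fun free \<phi>}"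
      then have \<phi>: "test_fun free \<phi>" by simp
      have a1: "\<bar>\<integral>x. \<phi> x * d x \<partial>lebesgue_on \<Omega>1\<bar> \<le> l2norm \<Omega>1 \<phi> * l2norm \<Omega>1 d"
        using l2ip_bound[OF test_fun_L2[OF \<phi> O1_leb] d] by simp
      have a2: "\<bar>\<integral>y. f y * \<phi> (y, 0) \<partial>lebesgue_on \<Gamma>\<bar> \<le> l2norm \<Gamma> f * l2norm \<Gamma> (\<lambda>y. \<phi> (y, 0))"
        using l2ip_bound[OF f ts[OF \<phi>]] by simp
      have b1: "l2norm \<Omega>1 \<phi> * l2norm \<Omega>1 d \<le> (C * l2norm \<Omega>1 (pd ez \<phi>)) * l2norm \<Omega>1 d"
        by (intro mult_right_mono P \<phi>) simp
      have b2: "l2norm \<Gamma> f * l2norm \<Gamma> (\<lambda>y. \<phi> (y, 0)) \<le> l2norm \<Gamma> f * (C * l2norm \<Omega>1 (pd ez \<phi>))"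
        by (intro mult_left_mono P \<phi>) simp
      have "\<bar>l \<phi>\<bar> \<le> (C * l2norm \<Omega>1 (pd ez \<phi>)) * l2norm \<Omega>1 d + l2norm \<Gamma> f * (C * l2norm \<Omega>1 (pd ez \<phi>))"
        unfolding l_def using a1 a2 b1 b2 by linarith
      then show "\<bar>l \<phi>\<bar> \<le> C * (l2norm \<Omega>1 d + l2norm \<Gamma> f) * L2.nrm \<Omega>1 (pd ez \<phi>)"
        by (simp add: l2norm_nrm algebra_simps)
    qed
    then obtain W where "L2 \<Omega>1 W" "l2norm \<Omega>1 W \<le> C * (l2norm \<Omega>1 d + l2norm \<Gamma> f)"
      "\<forall>\<phi>. test_fun free \<phi> \<longrightarrow> l2ip \<Omega>1 W (pd ez \<phi>) = l \<phi>"
      by (auto simp: l2norm_nrm)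
    then show ?thesis by (intro exI[of _ W]) (simp add: l2ip_def l_def)
  qed
  then show ?thesis using C by (intro exI[of _ C]) simp
qed

end

section \<open>Positive square roots\<close>

text \<open>For a symmetric operator the quadratic form determines the bilinear form by
  polarisation, so its bound is a bound of the operator norm.\<close>

lemma norm_symmetric_blinfun_le:
  fixes T :: "'e::euclidean_space \<Rightarrow>\<^sub>L 'e"
  assumes sym: "sym_op T" and q: "\<And>y. \<bar>T y \<bullet> y\<bar> \<le> q * (norm y)\<^sup>2" "0 \<le> q"
  shows "norm T \<le> q"
proof (rule norm_blinfun_bound[OF q(2)])
  fix x
  have pol: "4 * (T u \<bullet> v) \<le> 2 * q * ((norm u)\<^sup>2 + (norm v)\<^sup>2)" for u v
  proof -
    have "4 * (T u \<bullet> v) = T (u + v) \<bullet> (u + v) - T (u - v) \<bullet> (u - v)"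
      using sym by (simp add: sym_op_def blinfun.add_right blinfun.diff_right inner_add inner_diff inner_commute)
    also have "\<dots> \<le> q * (norm (u + v))\<^sup>2 + q * (norm (u - v))\<^sup>2" using q(1)[of "u + v"] q(1)[of "u - v"] by linarith
    also have "\<dots> = 2 * q * ((norm u)\<^sup>2 + (norm v)\<^sup>2)"
      by (simp add: power2_norm_eq_inner inner_add inner_diff inner_commute algebra_simps)
    finally show ?thesis .
  qed
  show "norm (T x) \<le> q * norm x"
  proof (cases "T x = 0 \<or> x = 0")
    case True
    then show ?thesis using q(2) by (auto simp: blinfun.zero_right)
  next
    case False
    then have pos: "norm (T x) > 0" "norm x > 0" by auto
    \<comment> \<open>The vector in direction T x of the same length as x, for which polarisation is
      sharp.\<close>
    let ?v = "(norm x / norm (T x)) *\<^sub>R T x"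
    have "norm ?v = norm x" using pos by simp
    then have i: "4 * (T x \<bullet> ?v) \<le> 2 * q * ((norm x)\<^sup>2 + (norm x)\<^sup>2)" using pol[of x ?v] by (simp only:)
    have e: "T x \<bullet> ?v = norm x * norm (T x)"
      using pos by (simp add: power2_norm_eq_inner[symmetric] power2_eq_square)
    have "norm (T x) * norm x \<le> (q * norm x) * norm x"
      using i unfolding e by (simp add: power2_eq_square algebra_simps)
    then show ?thesis using pos by simp
  qed
qed

(* Iteration for Y = (B + Y o Y) / 2; then M^(1/2) (1 - Y) is the square root of M (1 - B). *)
primrec sqrt_iter :: "('e::euclidean_space \<Rightarrow>\<^sub>L 'e) \<Rightarrow> nat \<Rightarrow> ('e \<Rightarrow>\<^sub>L 'e)" where
  "sqrt_iter B 0 = 0"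
| "sqrt_iter B (Suc n) = (1/2) *\<^sub>R (B + (sqrt_iter B n o\<^sub>L sqrt_iter B n))"

text \<open>Each iterate is a polynomial in \<open>B\<close>. Continuity of these polynomials is
  what later makes the square root of a measurable coefficient measurable.\<close>

lemma continuous_sqrt_iter: "continuous_on UNIV (\<lambda>B. sqrt_iter B n)"
  by (induction n) (simp_all add: continuous_on_const, intro continuous_intros
      bounded_bilinear.continuous_on[OF bounded_bilinear_blinfun_compose])

lemma sqrt_iter_norm:
  assumes "norm B \<le> q" "0 \<le> q" "q < 1"
  shows "norm (sqrt_iter B n) \<le> q"
proof (induction n)
  case (Suc n)
  have "norm (sqrt_iter B n o\<^sub>L sqrt_iter B n) \<le> q * q"
    by (rule order_trans[OF norm_blinfun_compose]) (intro mult_mono Suc assms norm_ge_zero)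
  also have "\<dots> \<le> q * 1" using assms by (intro mult_left_mono) auto
  finally have "norm (B + (sqrt_iter B n o\<^sub>L sqrt_iter B n)) \<le> q + q"
    using assms(1) norm_triangle_ineq[of B "sqrt_iter B n o\<^sub>L sqrt_iter B n"] by linarith
  then show ?case by simp
qed (use assms in simp)

lemma sqrt_iter_Cauchy_step:
  assumes B: "norm B \<le> q" "0 \<le> q" "q < 1"
  shows "norm (sqrt_iter B (Suc n) - sqrt_iter B n) \<le> q ^ n"
proof (induction n)
  case 0
  then show ?case using sqrt_iter_norm[OF B, of 1] B by simp
next
  case (Suc n)
  let ?Y = "sqrt_iter B (Suc n)" and ?Z = "sqrt_iter B n"
  \<comment> \<open>Y Y - Z Z = Y (Y - Z) + (Y - Z) Z, with both factors in the ball of radius q;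
    with the factor 1/2 the contraction rate is q.\<close>
  have "sqrt_iter B (Suc (Suc n)) - ?Y = (1/2) *\<^sub>R ((?Y o\<^sub>L (?Y - ?Z)) + ((?Y - ?Z) o\<^sub>L ?Z))"
    by (rule blinfun_eqI) (simp add: blinfun.bilinear_simps algebra_simps)
  then have "norm (sqrt_iter B (Suc (Suc n)) - ?Y) \<le> (1/2) * (norm (?Y o\<^sub>L (?Y - ?Z)) + norm ((?Y - ?Z) o\<^sub>L ?Z))"
    using norm_triangle_ineq by (metis (no_types, lifting) norm_scaleR abs_of_pos half_gt_zero_iff mult_left_mono less_eq_real_def zero_less_one)
  also have "\<dots> \<le> (1/2) * (q * q ^ n + q ^ n * q)"
    by (intro mult_left_mono add_mono order_trans[OF norm_blinfun_compose] mult_mono Suc sqrt_iter_norm[OF B] B norm_ge_zero)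
      (use B in simp_all)
  finally show ?case by simp
qed

text \<open>After scaling by M, the operator A is the identity minus a \<open>B\<close> of norm at
  most q = 1 - c / M < 1, for which the iteration converges. The explicit limit is part of the
  conclusion because measurability in a parameter is read off from it.\<close>

lemma exists_square_root:
  fixes A :: "'e::euclidean_space \<Rightarrow>\<^sub>L 'e"
  assumes sym: "sym_op A" and low: "\<And>y. c * (norm y)\<^sup>2 \<le> A y \<bullet> y" and c: "0 < c" "c \<le> M" and up: "norm A \<le> M"
  shows "sym_op (psqrt A)" "0 \<le> psqrt A y \<bullet> y" "norm (psqrt A) \<le> 2 * sqrt M"
    "(\<lambda>n. sqrt M *\<^sub>R (id_blinfun - sqrt_iter (id_blinfun - (1 / M) *\<^sub>R A) n)) \<longlonglongrightarrow> psqrt A"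
proof -
  have M: "M > 0" using c by simp
  define q where "q = 1 - c / M"
  have q: "0 \<le> q" "q < 1" using c M by (simp_all add: q_def)
  define B where "B = id_blinfun - (1 / M) *\<^sub>R A"
  have Bsym: "sym_op B" using sym by (simp add: sym_op_def B_def blinfun.bilinear_simps inner_diff)
  have "\<bar>B y \<bullet> y\<bar> \<le> q * (norm y)\<^sup>2" for y
  proof -
    have "B y \<bullet> y = (norm y)\<^sup>2 - A y \<bullet> y / M"
      by (simp add: B_def blinfun.bilinear_simps inner_diff power2_norm_eq_inner)
    moreover have "A y \<bullet> y \<le> M * (norm y)\<^sup>2"
    proof -
      have "A y \<bullet> y \<le> norm (A y) * norm y" by (rule norm_cauchy_schwarz)
      also have "\<dots> \<le> (M * norm y) * norm y"
        by (intro mult_right_mono order_trans[OF norm_blinfun] up) simp_all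
      finally show ?thesis by (simp add: power2_eq_square)
    qed
    then have "A y \<bullet> y / M \<le> (norm y)\<^sup>2" using M by (simp add: field_simps)
    moreover have "c / M * (norm y)\<^sup>2 \<le> A y \<bullet> y / M" using low[of y] M by (simp add: field_simps)
    ultimately show ?thesis by (simp add: q_def algebra_simps)
  qed
  then have Bq: "norm B \<le> q" by (rule norm_symmetric_blinfun_le[OF Bsym _ q(1)])
  note N = sqrt_iter_norm[OF Bq q] and step = sqrt_iter_Cauchy_step[OF Bq q]
  have "summable (\<lambda>n. sqrt_iter B (Suc n) - sqrt_iter B n)"
    by (rule summable_comparison_test'[where g = "\<lambda>n. q ^ n"]) (use q step in \<open>auto intro: summable_geometric\<close>)
  then have "convergent (\<lambda>n. \<Sum>i<n. sqrt_iter B (Suc i) - sqrt_iter B i)" by (simp add: summable_iff_convergent)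
  then have "convergent (\<lambda>n. sqrt_iter B n - sqrt_iter B 0)" by (simp only: sum_lessThan_telescope)
  then obtain Y where Y: "(\<lambda>n. sqrt_iter B n) \<longlonglongrightarrow> Y" by (auto simp: convergent_def)
  have comp: "(\<lambda>n. U n o\<^sub>L V n) \<longlonglongrightarrow> (u o\<^sub>L v)" if "U \<longlonglongrightarrow> u" "V \<longlonglongrightarrow> v" for U V and u v :: "'e \<Rightarrow>\<^sub>L 'e"
    by (rule bounded_bilinear.tendsto[OF bounded_bilinear_blinfun_compose that])
  have "(\<lambda>n. sqrt_iter B (Suc n)) \<longlonglongrightarrow> (1/2) *\<^sub>R (B + (Y o\<^sub>L Y))"
    unfolding sqrt_iter.simps by (intro tendsto_intros comp Y)
  moreover have "(\<lambda>n. sqrt_iter B (Suc n)) \<longlonglongrightarrow> Y" using Y by (rule LIMSEQ_Suc)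
  ultimately have fp: "Y = (1/2) *\<^sub>R (B + (Y o\<^sub>L Y))" by (rule LIMSEQ_unique[rotated])
  have Yq: "norm Y \<le> q" by (rule LIMSEQ_le_const2[OF tendsto_norm[OF Y]]) (use N in auto)
  have itsym: "sym_op (sqrt_iter B n)" for n
    by (induction n) (use Bsym in \<open>auto simp: sym_op_def blinfun.bilinear_simps inner_add\<close>)
  have app: "(\<lambda>n. U n x) \<longlonglongrightarrow> u x" if "U \<longlonglongrightarrow> u" for U and u :: "'e \<Rightarrow>\<^sub>L 'e" and x
    by (intro blinfun.tendsto that tendsto_const)
  have Ysym: "sym_op Y"
    unfolding sym_op_def
  proof (intro allI)
    fix y z
    have "(\<lambda>n. sqrt_iter B n y \<bullet> z) \<longlonglongrightarrow> Y y \<bullet> z" by (intro tendsto_intros app Y)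
    moreover have "(\<lambda>n. sqrt_iter B n y \<bullet> z) \<longlonglongrightarrow> y \<bullet> Y z"
    proof -
      have "(\<lambda>n. y \<bullet> sqrt_iter B n z) \<longlonglongrightarrow> y \<bullet> Y z" by (intro tendsto_intros app Y)
      then show ?thesis using itsym by (simp add: sym_op_def)
    qed
    ultimately show "Y y \<bullet> z = y \<bullet> Y z" by (rule LIMSEQ_unique)
  qed
  define S where "S = sqrt M *\<^sub>R (id_blinfun - Y)"
  have Ssym: "sym_op S" using Ysym by (simp add: sym_op_def S_def blinfun.bilinear_simps inner_diff)
  have Scoer: "sqrt M * (1 - q) * (norm y)\<^sup>2 \<le> S y \<bullet> y" for y
  proof -
    have "Y y \<bullet> y \<le> norm (Y y) * norm y" by (rule norm_cauchy_schwarz)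
    also have "\<dots> \<le> (q * norm y) * norm y"
      by (intro mult_right_mono order_trans[OF norm_blinfun] Yq) simp_all
    finally have "(1 - q) * (norm y)\<^sup>2 \<le> (norm y)\<^sup>2 - Y y \<bullet> y" by (simp add: power2_eq_square algebra_simps)
    then have "sqrt M * ((1 - q) * (norm y)\<^sup>2) \<le> sqrt M * ((norm y)\<^sup>2 - Y y \<bullet> y)" using M by (intro mult_left_mono) auto
    then show ?thesis by (simp add: S_def blinfun.bilinear_simps inner_diff power2_norm_eq_inner mult.assoc)
  qed
  have Spos: "0 \<le> S y \<bullet> y" for y
    by (rule order_trans[OF _ Scoer]) (use q M in simp)
  have SS: "S o\<^sub>L S = A"
  proof (rule blinfun_eqI)
    fix x
    \<comment> \<open>The fixed point equation 2 Y = B + Y Y is the same as (1 - Y)^2 = 1 -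
      B.\<close>
    have "2 *\<^sub>R Y x = B x + Y (Y x)"
      using arg_cong[OF fp, of "\<lambda>F. 2 *\<^sub>R blinfun_apply F x"] by (simp add: blinfun.bilinear_simps)
    then have "x - Y x - Y x + Y (Y x) = x - B x" by (simp add: scaleR_2 algebra_simps)
    moreover have "x - B x = (1 / M) *\<^sub>R A x" by (simp add: B_def blinfun.bilinear_simps)
    moreover have "(S o\<^sub>L S) x = (sqrt M * sqrt M) *\<^sub>R (x - Y x - Y x + Y (Y x))"
      by (simp add: S_def blinfun.bilinear_simps algebra_simps)
    ultimately show "(S o\<^sub>L S) x = A x" using M by simp
  qed
  \<comment> \<open>Any root commutes with A, hence with all iterates and with S. Then (S + T) (S -
    T) = 0, and coercivity of S with nonnegativity of T forces S = T.\<close>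
  have uniq: "T = S" if T: "sym_op T \<and> (\<forall>y. 0 \<le> T y \<bullet> y) \<and> T o\<^sub>L T = A" for T
  proof -
    have TA: "T (A x) = A (T x)" for x using T by (metis blinfun_apply_blinfun_compose)
    have TB: "T (B x) = B (T x)" for x by (simp add: B_def blinfun.bilinear_simps TA)
    have Tit: "T (sqrt_iter B n x) = sqrt_iter B n (T x)" for n x
      by (induction n arbitrary: x) (simp_all add: blinfun.bilinear_simps TB)
    have TY: "T (Y x) = Y (T x)" for x
    proof -
      have "(\<lambda>n. T (sqrt_iter B n x)) \<longlonglongrightarrow> T (Y x)" by (intro blinfun.tendsto tendsto_const app Y)
      moreover have "(\<lambda>n. T (sqrt_iter B n x)) \<longlonglongrightarrow> Y (T x)" unfolding Tit by (rule app[OF Y])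
      ultimately show ?thesis by (rule LIMSEQ_unique)
    qed
    have TS: "T (S x) = S (T x)" for x by (simp add: S_def blinfun.bilinear_simps TY)
    show "T = S"
    proof (rule blinfun_eqI)
      fix x
      \<comment> \<open>S + T annihilates this vector, so its quadratic forms under S and T add up
        to zero.\<close>
      let ?y = "S x - T x"
      have "S ?y + T ?y = S (S x) - T (T x)" by (simp add: blinfun.bilinear_simps TS)
      also have "\<dots> = 0" using T SS by (metis blinfun_apply_blinfun_compose right_minus_eq)
      finally have "S ?y \<bullet> ?y + T ?y \<bullet> ?y = 0" by (metis inner_add_left inner_zero_left)
      moreover have "0 \<le> T ?y \<bullet> ?y" using T by blast
      ultimately have "sqrt M * (1 - q) * (norm ?y)\<^sup>2 \<le> 0" using Scoer[of ?y] by linarith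
      moreover have "sqrt M * (1 - q) > 0" using M q by simp
      ultimately have "(norm ?y)\<^sup>2 \<le> 0"
        by (metis mult_le_cancel_left_pos mult_zero_right)
      then show "T x = S x" by simp
    qed
  qed
  have "psqrt A = S"
    unfolding psqrt_def by (rule the_equality) (use Ssym Spos SS uniq in auto)
  moreover have "norm S \<le> 2 * sqrt M"
  proof -
    have "norm (id_blinfun - Y) \<le> norm (id_blinfun :: 'e \<Rightarrow>\<^sub>L 'e) + norm Y" by (rule norm_triangle_ineq4)
    also have "\<dots> \<le> 2" using Yq q norm_blinfun_id_le[where 'a = 'e] by linarith
    finally show ?thesis using M by (simp add: S_def mult.commute mult_left_mono)
  qed
  moreover have "(\<lambda>n. sqrt M *\<^sub>R (id_blinfun - sqrt_iter B n)) \<longlonglongrightarrow> S" unfolding S_def by (intro tendsto_intros Y)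
  ultimately show "sym_op (psqrt A)" "0 \<le> psqrt A y \<bullet> y" "norm (psqrt A) \<le> 2 * sqrt M"
    "(\<lambda>n. sqrt M *\<^sub>R (id_blinfun - sqrt_iter (id_blinfun - (1 / M) *\<^sub>R A) n)) \<longlonglongrightarrow> psqrt A"
    using Ssym Spos by (simp_all add: B_def)
qed

text \<open>The square root is a pointwise limit of continuous functions of A.\<close>

lemma measurable_psqrt:
  fixes A :: "'x \<Rightarrow> ('e::euclidean_space \<Rightarrow>\<^sub>L 'e)"
  assumes A: "A \<in> borel_measurable N" and c: "0 < c" "c \<le> M"
    and pr: "\<And>x. x \<in> space N \<Longrightarrow> sym_op (A x)" "\<And>x y. x \<in> space N \<Longrightarrow> c * (norm y)\<^sup>2 \<le> A x y \<bullet> y"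
      "\<And>x. x \<in> space N \<Longrightarrow> norm (A x) \<le> M"
  shows "(\<lambda>x. psqrt (A x)) \<in> borel_measurable N"
proof (rule borel_measurable_LIMSEQ_metric)
  fix n
  have "continuous_on UNIV (\<lambda>A::'e \<Rightarrow>\<^sub>L 'e. sqrt M *\<^sub>R (id_blinfun - sqrt_iter (id_blinfun - (1 / M) *\<^sub>R A) n))"
    by (intro continuous_intros continuous_on_compose2[OF continuous_sqrt_iter]) simp
  from measurable_compose[OF A borel_measurable_continuous_onI[OF this]]
  show "(\<lambda>x. sqrt M *\<^sub>R (id_blinfun - sqrt_iter (id_blinfun - (1 / M) *\<^sub>R A x) n)) \<in> borel_measurable N" .
next
  fix x assume "x \<in> space N"
  then show "(\<lambda>n. sqrt M *\<^sub>R (id_blinfun - sqrt_iter (id_blinfun - (1 / M) *\<^sub>R A x) n)) \<longlonglongrightarrow> psqrt (A x)"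
    by (intro exists_square_root(4)[OF pr(1) pr(2) c pr(3)])
qed

lemma measurable_blinfun_apply_euclidean:
  fixes A :: "'x \<Rightarrow> ('e::euclidean_space \<Rightarrow>\<^sub>L 'e)"
  assumes A: "A \<in> borel_measurable N" and u: "u \<in> borel_measurable N"
  shows "(\<lambda>x. A x (u x)) \<in> borel_measurable N"
proof -
  have "A x (u x) = (\<Sum>e\<in>Basis. (u x \<bullet> e) *\<^sub>R A x e)" for x
  proof -
    have "A x (u x) = A x (\<Sum>e\<in>Basis. (u x \<bullet> e) *\<^sub>R e)" by (simp only: euclidean_representation)
    then show ?thesis by (simp only: blinfun.sum_right blinfun.scaleR_right)
  qed
  moreover have "(\<lambda>x. A x e) \<in> borel_measurable N" for e
  proof -
    have "continuous_on UNIV (\<lambda>F::'e \<Rightarrow>\<^sub>L 'e. F e)" by (intro continuous_intros)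
    from measurable_compose[OF A borel_measurable_continuous_onI[OF this]] show ?thesis .
  qed
  then have "(\<lambda>x. \<Sum>e\<in>Basis. (u x \<bullet> e) *\<^sub>R A x e) \<in> borel_measurable N"
    using u by (intro borel_measurable_sum borel_measurable_scaleR borel_measurable_inner borel_measurable_const)
  ultimately show ?thesis by simp
qed

lemma L2_blinfun_apply:
  fixes A :: "'x::euclidean_space \<Rightarrow> ('e::euclidean_space \<Rightarrow>\<^sub>L 'e)"
  assumes A: "A \<in> borel_measurable (lebesgue_on U)" and u: "L2 U u" and M: "\<And>x. x \<in> U \<Longrightarrow> norm (A x) \<le> M"
  shows "L2 U (\<lambda>x. A x (u x))"
proof (rule L2_bounded[OF u measurable_blinfun_apply_euclidean[OF A L2_measurable[OF u]]], rule AE_I2)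
  fix x assume "x \<in> space (lebesgue_on U)"
  then have "norm (A x) * norm (u x) \<le> M * norm (u x)" by (intro mult_right_mono M) auto
  then show "norm (A x (u x)) \<le> M * norm (u x)" using norm_blinfun[of "A x" "u x"] by linarith
qed

section \<open>The geometry at the interface\<close>

text \<open>Points strictly under the graph belong to the open set U and hence not to its frontier.
  Conversely a frontier point is a limit of points of U; split into components along and across
  \<nu>, these lie under the graph, and \<gamma> is continuous.\<close>

lemma local_graph_frontier:
  assumes U: "open U" and g: "local_graph U x0 \<nu> r h \<gamma>" and lip: "L-lipschitz_on {y. y \<bullet> \<nu> = 0} \<gamma>"
    and p: "x0 + w + t *\<^sub>R \<nu> \<in> frontier U" "w \<bullet> \<nu> = 0" "norm w < r" "\<bar>t\<bar> < h"
  shows "t = \<gamma> w"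
proof -
  have G: "x0 + y + t *\<^sub>R \<nu> \<in> U \<longleftrightarrow> t < \<gamma> y" if "y \<bullet> \<nu> = 0" "norm y < r" "\<bar>t\<bar> < h" for y t
    using g that unfolding local_graph_def by blast
  have n1: "\<nu> \<bullet> \<nu> = 1" using g by (simp add: local_graph_def power2_norm_eq_inner[symmetric])
  have "\<not> t < \<gamma> w"
    using G[OF p(2-4)] p(1) U by (simp add: frontier_def interior_open)
  moreover have "t \<le> \<gamma> w"
  proof -
    have "x0 + w + t *\<^sub>R \<nu> \<in> closure U" using p(1) by (simp add: frontier_def)
    then obtain P where P: "\<And>n. P n \<in> U" "P \<longlonglongrightarrow> x0 + w + t *\<^sub>R \<nu>" unfolding closure_sequential by auto
    define T where "T n = (P n - x0) \<bullet> \<nu>" for n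
    define W where "W n = P n - x0 - T n *\<^sub>R \<nu>" for n
    have "T \<longlonglongrightarrow> ((x0 + w + t *\<^sub>R \<nu>) - x0) \<bullet> \<nu>" unfolding T_def by (intro tendsto_intros P)
    then have T: "T \<longlonglongrightarrow> t" using p(2) n1 by (simp add: inner_add_left)
    have "W \<longlonglongrightarrow> (x0 + w + t *\<^sub>R \<nu>) - x0 - t *\<^sub>R \<nu>" unfolding W_def by (intro tendsto_intros P T)
    then have W: "W \<longlonglongrightarrow> w" by simp
    have W0: "W n \<bullet> \<nu> = 0" for n by (simp add: W_def T_def inner_diff_left n1)
    have eq: "x0 + W n + T n *\<^sub>R \<nu> = P n" for n by (simp add: W_def)
    have "continuous_on {y. y \<bullet> \<nu> = 0} \<gamma>" by (rule lipschitz_on_continuous_on[OF lip])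
    then have \<gamma>W: "(\<lambda>n. \<gamma> (W n)) \<longlonglongrightarrow> \<gamma> w"
      by (rule continuous_on_tendsto_compose[OF _ W]) (auto simp: W0 p(2))
    have "\<forall>\<^sub>F n in sequentially. norm (W n) < r" by (rule order_tendstoD(2)[OF tendsto_norm[OF W] p(3)])
    moreover have "\<forall>\<^sub>F n in sequentially. \<bar>T n\<bar> < h" by (rule order_tendstoD(2)[OF tendsto_rabs[OF T] p(4)])
    ultimately have "\<forall>\<^sub>F n in sequentially. T n \<le> \<gamma> (W n)"
    proof eventually_elim
      case (elim n)
      then show ?case using G[OF W0 elim] P(1)[of n] by (simp add: eq)
    qed
    then show ?thesis by (rule tendsto_le[OF trivial_limit_sequentially \<gamma>W T])
  qed
  ultimately show ?thesis by simp
qed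

(* Over Gamma the boundary graph is flat; a point (y, s) and a point (y + v, 0) of Gamma lie on the same
   line in direction nu, which decides on which side of the graph (y, s) lies. *)
lemma interface_below:
  fixes \<Gamma> :: "'a::euclidean_space set" and \<Omega>1 :: "('a \<times> real) set"
  assumes open_G: "open \<Gamma>" and lip: "lipschitz_domain \<Omega>1" and disj: "\<Omega>1 \<inter> Omega2 \<Gamma> = {}"
    and fr: "\<And>y. y \<in> \<Gamma> \<Longrightarrow> (y, 0) \<in> frontier \<Omega>1" and y: "y \<in> \<Gamma>"
  shows "\<exists>\<rho>>0. \<forall>t. - \<rho> < t \<and> t < 0 \<longrightarrow> (y, t) \<in> \<Omega>1"
proof -
  have U: "open \<Omega>1" using lip by (simp add: lipschitz_domain_def)
  obtain \<nu> r h \<gamma> L where g: "local_graph \<Omega>1 (y, 0) \<nu> r h \<gamma>" and L: "L-lipschitz_on {y. y \<bullet> \<nu> = 0} \<gamma>"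
    using lip fr[OF y] unfolding lipschitz_domain_def by blast
  have rh: "r > 0" "h > 0" and n1: "norm \<nu> = 1" and g0: "\<gamma> 0 = 0" using g by (simp_all add: local_graph_def)
  have nn: "\<nu> \<bullet> \<nu> = 1" using n1 by (simp add: power2_norm_eq_inner[symmetric])
  obtain \<delta> where \<delta>: "\<delta> > 0" "\<And>x. dist x y < \<delta> \<Longrightarrow> x \<in> \<Gamma>" using open_G y unfolding open_dist by auto
  obtain n k where \<nu>: "\<nu> = (n, k)" by (cases \<nu>)
  have nk: "norm n \<le> 1" "\<bar>k\<bar> \<le> 1" using norm_fst_le[of n k] norm_snd_le[of k n] n1 by (simp_all add: \<nu>)
  \<comment> \<open>Were \<nu> horizontal, a short segment along it would stay in \<Gamma> and hence
    on the frontier, while a line in direction \<nu> meets the graph only once.\<close>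
  have k0: "k \<noteq> 0"
  proof
    assume k: "k = 0"
    define s where "s = min \<delta> h / 2"
    have s: "s > 0" "s < \<delta>" "s < h" using \<delta>(1) rh by (auto simp: s_def)
    have "norm n = 1" using n1 by (simp add: \<nu> k norm_Pair)
    then have "y + s *\<^sub>R n \<in> \<Gamma>" using s by (intro \<delta>(2)) (simp add: dist_norm)
    then have "(y, 0) + 0 + s *\<^sub>R \<nu> \<in> frontier \<Omega>1" using fr by (simp add: \<nu> k)
    then have "s = \<gamma> 0" by (rule local_graph_frontier[OF U g L]) (use s rh in simp_all)
    then show False using g0 s by simp
  qed
  \<comment> \<open>The bounds keep, in this order, the transverse part \<open>w\<close> within the
    radius r, the coordinate \<open>t0\<close> within h / 2, the displacement \<open>c\<close> below
    h / 2, and the displaced base point inside \<Gamma>.\<close>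
  define \<rho> where "\<rho> = min (min (r / 2) (h / 2)) (min (h * \<bar>k\<bar> / 2) (\<delta> * \<bar>k\<bar>))"
  have \<rho>: "\<rho> > 0" using rh \<delta>(1) k0 by (simp add: \<rho>_def)
  have side: "(y, s) \<in> \<Omega>1 \<longleftrightarrow> - (s / k) > 0" if s: "\<bar>s\<bar> < \<rho>" for s
  proof -
    \<comment> \<open>Moving from (y, s) by \<open>c\<close> along \<nu> reaches height 0, at a
      point of \<Gamma>. \<open>t0\<close> and \<open>w\<close> are the coordinates of (y, s) along
      and across \<nu>, so this point fixes the graph over \<open>w\<close> at t0 + c.\<close>
    define c where "c = - (s / k)"
    define t0 where "t0 = s * k"
    define w where "w = (0, s) - t0 *\<^sub>R \<nu>"
    have ck: "c * k = - s" using k0 by (simp add: c_def)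
    have ca: "\<bar>c\<bar> * \<bar>k\<bar> = \<bar>s\<bar>" using ck by (simp add: abs_mult[symmetric])
    have wn: "w \<bullet> \<nu> = 0" using nn by (simp add: w_def inner_diff_left) (simp add: \<nu> t0_def)
    have t0: "\<bar>t0\<bar> \<le> \<bar>s\<bar>" using nk by (simp add: t0_def abs_mult mult_left_le)
    have "norm w \<le> \<bar>s\<bar> + \<bar>t0\<bar>"
      using norm_triangle_ineq4[of "(0::'a, s)" "t0 *\<^sub>R \<nu>"] n1 by (simp add: w_def norm_Pair)
    then have w: "norm w < r" using t0 s by (simp add: \<rho>_def)
    have t0h: "\<bar>t0\<bar> < h" using t0 s rh by (simp add: \<rho>_def)
    have "\<bar>c\<bar> * \<bar>k\<bar> < (h / 2) * \<bar>k\<bar>" using s ca by (simp add: \<rho>_def)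
    then have ch: "\<bar>c\<bar> < h / 2" using k0 by simp
    have "\<bar>c\<bar> * \<bar>k\<bar> < \<delta> * \<bar>k\<bar>" using s ca by (simp add: \<rho>_def)
    then have cd: "\<bar>c\<bar> < \<delta>" using k0 by simp
    have "norm (c *\<^sub>R n) \<le> \<bar>c\<bar>" using nk by (simp add: mult_left_le)
    then have "y + c *\<^sub>R n \<in> \<Gamma>" using cd by (intro \<delta>(2)) (simp add: dist_norm)
    then have "(y + c *\<^sub>R n, 0) \<in> frontier \<Omega>1" by (rule fr)
    moreover have "(y + c *\<^sub>R n, 0) = (y, 0) + w + (t0 + c) *\<^sub>R \<nu>"
      using ck by (simp add: w_def \<nu> algebra_simps)
    moreover have "\<bar>s\<bar> < h / 2" using s by (simp add: \<rho>_def)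
    then have "\<bar>t0 + c\<bar> < h" using t0 ch by linarith
    ultimately have A: "t0 + c = \<gamma> w" using wn w by (intro local_graph_frontier[OF U g L]) simp_all
    have "(y, 0) + w + t0 *\<^sub>R \<nu> = (y, s)" by (simp add: w_def)
    then have B: "(y, s) \<in> \<Omega>1 \<longleftrightarrow> t0 < \<gamma> w"
      using g wn w t0h unfolding local_graph_def by metis
    show ?thesis unfolding c_def[symmetric] B A[symmetric] by simp
  qed
  \<comment> \<open>The other sign would put points just above \<Gamma> into \<Omega>1, although
    they lie in the cylinder.\<close>
  have "k > 0"
  proof (rule ccontr)
    assume "\<not> k > 0"
    then have k: "k < 0" using k0 by simp
    define s where "s = min \<rho> 1 / 2"
    have s: "s > 0" "s < \<rho>" "s < 1" using \<rho> by (auto simp: s_def)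
    have "(y, s) \<in> \<Omega>1" using side[of s] s k by (simp add: divide_pos_neg)
    moreover have "(y, s) \<in> Omega2 \<Gamma>" using s y by (simp add: Omega2_def)
    ultimately show False using disj by blast
  qed
  then have "(y, t) \<in> \<Omega>1" if "- \<rho> < t" "t < 0" for t
    using side[of t] that by (simp add: divide_neg_pos)
  then show ?thesis using \<rho> by blast
qed

section \<open>The mixed problem for reduced fields\<close>

lemma semi_inner_plus:
  assumes "semi_inner S A" "semi_inner S B"
  shows "semi_inner S (\<lambda>x y. A x y + B x y)"
proof -
  interpret A: semi_inner S A by fact
  interpret B: semi_inner S B by fact
  show ?thesis
    by standard (simp_all add: A.subspace A.add_left B.add_left A.scale_left B.scale_left
        distrib_left A.nonneg B.nonneg, metis A.commute B.commute)
qed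

lemma semi_inner_cmult:
  assumes "semi_inner S A" "0 \<le> c"
  shows "semi_inner S (\<lambda>x y. c * A x y)"
proof -
  interpret A: semi_inner S A by fact
  show ?thesis
    by standard (simp_all add: A.subspace A.add_left A.scale_left distrib_left A.nonneg assms(2), metis A.commute)
qed

lemma semi_inner_sum:
  assumes "finite I" "subspace S" "\<And>i. i \<in> I \<Longrightarrow> semi_inner S (A i)"
  shows "semi_inner S (\<lambda>x y. \<Sum>i\<in>I. A i x y)"
  using assms(1,3)
proof (induction I rule: finite_induct)
  case empty
  then show ?case by (simp add: semi_inner_def assms(2))
next
  case (insert i I)
  then show ?case by (simp add: semi_inner_plus)
qed

lemma semi_inner_pullback:
  assumes "semi_inner S' A" "subspace S" "\<And>x. x \<in> S \<Longrightarrow> T x \<in> S'"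
    "\<And>x y. T (x + y) = T x + T y" "\<And>r x. T (r *\<^sub>R x) = r *\<^sub>R T x"
  shows "semi_inner S (\<lambda>x y. A (T x) (T y))"
proof -
  interpret A: semi_inner S' A by fact
  show ?thesis
    by standard (simp_all add: assms A.add_left A.scale_left A.nonneg, metis A.commute assms(3))
qed

text \<open>Multiplication by a pointwise symmetric and nonnegative coefficient, the common pattern
  of the terms with Q, \<alpha> and \<beta>.\<close>

lemma semi_inner_operator:
  fixes op :: "('e::euclidean_space \<Rightarrow> 'b::euclidean_space) \<Rightarrow> 'e \<Rightarrow> 'b"
  assumes "\<And>u. L2 U u \<Longrightarrow> L2 U (op u)"
    "\<And>u v. op (u + v) = op u + op v" "\<And>r u. op (r *\<^sub>R u) = r *\<^sub>R op u"
    "\<And>u v x. x \<in> U \<Longrightarrow> op u x \<bullet> v x = u x \<bullet> op v x" "\<And>u x. x \<in> U \<Longrightarrow> 0 \<le> op u x \<bullet> u x"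
  shows "semi_inner {u. L2 U u} (\<lambda>u v. l2ip U (op u) v)"
proof
  show "subspace {u::'e \<Rightarrow> 'b. L2 U u}" by (rule L2.subspace)
  fix x y z :: "'e \<Rightarrow> 'b" and r
  assume m: "x \<in> {u. L2 U u}"
  show "l2ip U (op (r *\<^sub>R x)) z = r * l2ip U (op x) z" if "z \<in> {u. L2 U u}"
    using m that assms(1,3) L2.scale_left[of "op x" U z r] by simp
  show "0 \<le> l2ip U (op x) x"
    unfolding l2ip_def by (rule integral_nonneg_AE, rule AE_I2) (use assms(5) in auto)
  assume m2: "y \<in> {u. L2 U u}"
  show "l2ip U (op (x + y)) z = l2ip U (op x) z + l2ip U (op y) z" if "z \<in> {u. L2 U u}"
    using m m2 that assms(1,2) L2.add_left[of "op x" U "op y" z] by simp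
  show "l2ip U (op x) y = l2ip U (op y) x"
    unfolding l2ip_def
    by (rule Bochner_Integration.integral_cong[OF refl]) (use assms(4) in \<open>auto simp: inner_commute\<close>)
qed

lemma l2ip_self: "l2ip U u u = (l2norm U u)\<^sup>2"
  by (simp add: l2ip_def l2norm_sq power2_norm_eq_inner)

lemma l2ip_cong_AE:
  assumes "u \<in> borel_measurable (lebesgue_on U)" "u' \<in> borel_measurable (lebesgue_on U)"
    "v \<in> borel_measurable (lebesgue_on U)" "v' \<in> borel_measurable (lebesgue_on U)"
    "AE x in lebesgue_on U. u x = u' x" "AE x in lebesgue_on U. v x = v' x"
  shows "l2ip U u v = l2ip U u' v'"
  unfolding l2ip_def
proof (rule integral_cong_AE)
  show "AE x in lebesgue_on U. u x \<bullet> v x = u' x \<bullet> v' x" using assms(5,6) by eventually_elim simp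
qed (intro borel_measurable_inner assms)+

lemma l2ip_tendsto:
  assumes "\<And>n. L2 U (s n)" "L2 U u" "(\<lambda>n. l2ip U (s n - u) (s n - u)) \<longlonglongrightarrow> 0" "L2 U k"
  shows "(\<lambda>n. l2ip U (s n) k) \<longlonglongrightarrow> l2ip U u k"
proof (rule L2.tendsto_B)
  show "(\<lambda>n. L2.nrm U (s n - u)) \<longlonglongrightarrow> 0"
    using tendsto_real_sqrt[OF assms(3)] by (simp add: L2.nrm_def)
qed (use assms in simp_all)

section \<open>Fields as tuples and their semi-Hilbert spaces\<close>

text \<open>Derivatives are carried as components of their own. The admissible fields thus form a
  subspace of a product of L2 spaces cut out by linear identities, and completeness can be checked
  component by component.\<close>

type_synonym 'a field = "('a \<times> real \<Rightarrow> 'a \<times> real) \<times> ('a \<times> real \<Rightarrow> real) \<times> ('a \<Rightarrow> 'a) \<times> ('a \<Rightarrow> 'a \<Rightarrow> 'a) \<times> ('a \<Rightarrow> real)"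

definition vel :: "'a::euclidean_space field \<Rightarrow> 'a \<times> real \<Rightarrow> 'a \<times> real" where "vel v = fst v"
definition dvg :: "'a::euclidean_space field \<Rightarrow> 'a \<times> real \<Rightarrow> real" where "dvg v = fst (snd v)"
definition tang :: "'a::euclidean_space field \<Rightarrow> 'a \<Rightarrow> 'a" where "tang v = fst (snd (snd v))"
definition tgrad :: "'a::euclidean_space field \<Rightarrow> 'a \<Rightarrow> 'a \<Rightarrow> 'a" where "tgrad v = fst (snd (snd (snd v)))"
definition slope :: "'a::euclidean_space field \<Rightarrow> 'a \<Rightarrow> real" where "slope v = snd (snd (snd (snd v)))"

lemmas sel_defs = vel_def dvg_def tang_def tgrad_def slope_def

lemma sel_linear:
  "vel (v + w) = vel v + vel w" "dvg (v + w) = dvg v + dvg w" "tang (v + w) = tang v + tang w"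
  "tgrad (v + w) b = tgrad v b + tgrad w b" "slope (v + w) = slope v + slope w"
  "vel (r *\<^sub>R v) = r *\<^sub>R vel v" "dvg (r *\<^sub>R v) = r *\<^sub>R dvg v" "tang (r *\<^sub>R v) = r *\<^sub>R tang v"
  "tgrad (r *\<^sub>R v) b = r *\<^sub>R tgrad v b" "slope (r *\<^sub>R v) = r *\<^sub>R slope v"
  "vel (v - w) = vel v - vel w" "dvg (v - w) = dvg v - dvg w" "tang (v - w) = tang v - tang w"
  "tgrad (v - w) b = tgrad v b - tgrad w b" "slope (v - w) = slope v - slope w"
  by (simp_all add: sel_defs)

lemma sel_tuple:
  "vel (w, d, \<tau>, g, f) = w" "dvg (w, d, \<tau>, g, f) = d" "tang (w, d, \<tau>, g, f) = \<tau>"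
  "tgrad (w, d, \<tau>, g, f) = g" "slope (w, d, \<tau>, g, f) = f"
  by (simp_all add: sel_defs)

text \<open>The two divergences of the constraint. The second, taken in the cylinder, does not
  depend on z and is kept as a function on \<Gamma>.\<close>

definition bdiv :: "'a::euclidean_space field \<Rightarrow> ('a \<times> real \<Rightarrow> real) \<times> ('a \<Rightarrow> real)" where
  "bdiv v = (dvg v, \<lambda>y. (\<Sum>b\<in>Basis. tgrad v b y \<bullet> b) + slope v y)"

lemma bdiv_linear: "bdiv (v + w) = bdiv v + bdiv w" "bdiv (r *\<^sub>R v) = r *\<^sub>R bdiv v"
  by (auto simp: bdiv_def sel_linear fun_eq_iff inner_add_left sum.distrib sum_distrib_left distrib_left)

context two_domains
begin

definition XX :: "'a field set" where
  "XX = {v. reduced (vel v) (dvg v) (tang v) (tgrad v) (slope v)}"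

definition YY :: "(('a \<times> real \<Rightarrow> real) \<times> ('a \<Rightarrow> real)) set" where
  "YY = {p. L2 \<Omega>1 (fst p) \<and> L2 \<Gamma> (snd p)}"

text \<open>The cylinder has height one, so integrals over \<Gamma> replace those over \<Omega>2.
  The norm of w_N has no term of its own, being at most that of \<open>slope\<close>.\<close>

definition ipX :: "'a field \<Rightarrow> 'a field \<Rightarrow> real" where
  "ipX v w = l2ip \<Omega>1 (vel v) (vel w) + l2ip \<Omega>1 (dvg v) (dvg w) + l2ip \<Gamma> (tang v) (tang w) +
     (\<Sum>b\<in>Basis. l2ip \<Gamma> (tgrad v b) (tgrad w b)) + l2ip \<Gamma> (slope v) (slope w)"

definition ipY :: "('a \<times> real \<Rightarrow> real) \<times> ('a \<Rightarrow> real) \<Rightarrow> ('a \<times> real \<Rightarrow> real) \<times> ('a \<Rightarrow> real) \<Rightarrow> real" where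
  "ipY p q = l2ip \<Omega>1 (fst p) (fst q) + l2ip \<Gamma> (snd p) (snd q)"

lemma XX_L2:
  assumes "v \<in> XX"
  shows "L2 \<Omega>1 (vel v)" "L2 \<Omega>1 (dvg v)" "L2 \<Gamma> (tang v)" "\<And>b. b \<in> Basis \<Longrightarrow> L2 \<Gamma> (tgrad v b)" "L2 \<Gamma> (slope v)"
  using assms by (simp_all add: XX_def reduced_def)

(* The constraints say that the field is orthogonal to a family of fixed L2 functions. *)
lemma reduced_iff:
  assumes L: "L2 \<Omega>1 w" "L2 \<Omega>1 d" "L2 \<Gamma> \<tau>" "\<And>b. b \<in> Basis \<Longrightarrow> L2 \<Gamma> (g b)" "L2 \<Gamma> f"
  shows "reduced w d \<tau> g f \<longleftrightarrow>
    (\<forall>\<phi>. test_fun free \<phi> \<longrightarrow> l2ip \<Omega>1 w (grad \<phi>) + l2ip \<Omega>1 d \<phi> + l2ip \<Gamma> f (\<lambda>y. \<phi> (y, 0)) = 0) \<and>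
    (\<forall>b\<in>Basis. \<forall>c\<in>Basis. \<forall>\<phi>. test_fun UNIV \<phi> \<longrightarrow>
      l2ip \<Gamma> \<tau> (\<lambda>y. pd b \<phi> y *\<^sub>R c) + l2ip \<Gamma> (g b) (\<lambda>y. \<phi> y *\<^sub>R c) = 0)"
proof -
  have 1: "(\<integral>x. w x \<bullet> grad \<phi> x + \<phi> x * d x \<partial>lebesgue_on \<Omega>1) = - (\<integral>y. f y * \<phi> (y, 0) \<partial>lebesgue_on \<Gamma>) \<longleftrightarrow>
      l2ip \<Omega>1 w (grad \<phi>) + l2ip \<Omega>1 d \<phi> + l2ip \<Gamma> f (\<lambda>y. \<phi> (y, 0)) = 0" if \<phi>: "test_fun free \<phi>" for \<phi>
    using L2_integrable_inner[OF L(1) L2_grad[OF \<phi> O1_leb]]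
      L2_real_integrable_mult[OF test_fun_L2[OF \<phi> O1_leb] L(2)]
    by (simp add: l2ip_def eq_neg_iff_add_eq_0 mult.commute[of "d _"])
  have 2: "(\<integral>y. pd b \<phi> y *\<^sub>R \<tau> y + \<phi> y *\<^sub>R g b y \<partial>lebesgue_on \<Gamma>) = 0 \<longleftrightarrow>
      (\<forall>c\<in>Basis. l2ip \<Gamma> \<tau> (\<lambda>y. pd b \<phi> y *\<^sub>R c) + l2ip \<Gamma> (g b) (\<lambda>y. \<phi> y *\<^sub>R c) = 0)"
    if b: "b \<in> Basis" and \<phi>: "test_fun UNIV \<phi>" for b \<phi>
  proof -
    note i1 = test_intG[OF test_fun_pd[OF \<phi> b] L(3)] and i2 = test_intG[OF \<phi> L(4)[OF b]]
    have "(\<integral>y. pd b \<phi> y *\<^sub>R \<tau> y + \<phi> y *\<^sub>R g b y \<partial>lebesgue_on \<Gamma>) \<bullet> c =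
        l2ip \<Gamma> \<tau> (\<lambda>y. pd b \<phi> y *\<^sub>R c) + l2ip \<Gamma> (g b) (\<lambda>y. \<phi> y *\<^sub>R c)" for c
    proof -
      have "(\<integral>y. (pd b \<phi> y *\<^sub>R \<tau> y) \<bullet> c \<partial>lebesgue_on \<Gamma>) = (\<integral>y. pd b \<phi> y *\<^sub>R \<tau> y \<partial>lebesgue_on \<Gamma>) \<bullet> c"
        by (rule integral_inner_left) (rule i1)
      moreover have "(\<integral>y. (\<phi> y *\<^sub>R g b y) \<bullet> c \<partial>lebesgue_on \<Gamma>) = (\<integral>y. \<phi> y *\<^sub>R g b y \<partial>lebesgue_on \<Gamma>) \<bullet> c"
        by (rule integral_inner_left) (rule i2)
      ultimately show ?thesis using i1 i2 by (simp add: l2ip_def inner_add_left)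
    qed
    then show ?thesis by (simp add: euclidean_eq_iff[of "integral\<^sup>L _ _" 0])
  qed
  have sw: "(\<forall>b\<in>Basis. \<forall>c\<in>Basis. \<forall>\<phi>. test_fun UNIV \<phi> \<longrightarrow> K b c \<phi>) \<longleftrightarrow>
      (\<forall>b\<in>Basis. \<forall>\<phi>. test_fun UNIV \<phi> \<longrightarrow> (\<forall>c\<in>Basis. K b c \<phi>))"
    for K :: "'a \<Rightarrow> 'a \<Rightarrow> ('a \<Rightarrow> real) \<Rightarrow> bool" by blast
  show ?thesis unfolding sw using L 1 2 by (simp add: reduced_def)
qed

lemma test_L2s:
  assumes "test_fun free \<phi>"
  shows "L2 \<Omega>1 (grad \<phi>)" "L2 \<Omega>1 \<phi>" "L2 \<Gamma> (\<lambda>y. \<phi> (y, 0))"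
  by (rule L2_grad[OF assms O1_leb] test_fun_L2[OF assms O1_leb] test_fun_L2[OF test_fun_slice[OF assms] G_leb])+

lemma test_L2s_UNIV:
  assumes "test_fun UNIV \<phi>" "b \<in> Basis"
  shows "L2 \<Gamma> (\<lambda>y. pd b \<phi> y *\<^sub>R c)" "L2 \<Gamma> (\<lambda>y. \<phi> y *\<^sub>R c)"
  by (intro L2_scaleR_const test_fun_L2[OF test_fun_pd[OF assms] G_leb] test_fun_L2[OF assms(1) G_leb])+

lemma XX_iff:
  "v \<in> XX \<longleftrightarrow> L2 \<Omega>1 (vel v) \<and> L2 \<Omega>1 (dvg v) \<and> L2 \<Gamma> (tang v) \<and> (\<forall>b\<in>Basis. L2 \<Gamma> (tgrad v b)) \<and> L2 \<Gamma> (slope v) \<and>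
    (\<forall>\<phi>. test_fun free \<phi> \<longrightarrow> l2ip \<Omega>1 (vel v) (grad \<phi>) + l2ip \<Omega>1 (dvg v) \<phi> + l2ip \<Gamma> (slope v) (\<lambda>y. \<phi> (y, 0)) = 0) \<and>
    (\<forall>b\<in>Basis. \<forall>c\<in>Basis. \<forall>\<phi>. test_fun UNIV \<phi> \<longrightarrow>
      l2ip \<Gamma> (tang v) (\<lambda>y. pd b \<phi> y *\<^sub>R c) + l2ip \<Gamma> (tgrad v b) (\<lambda>y. \<phi> y *\<^sub>R c) = 0)"
proof -
  define L where "L \<longleftrightarrow> L2 \<Omega>1 (vel v) \<and> L2 \<Omega>1 (dvg v) \<and> L2 \<Gamma> (tang v) \<and> (\<forall>b\<in>Basis. L2 \<Gamma> (tgrad v b)) \<and> L2 \<Gamma> (slope v)"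
  define C where "C \<longleftrightarrow>
    (\<forall>\<phi>. test_fun free \<phi> \<longrightarrow> l2ip \<Omega>1 (vel v) (grad \<phi>) + l2ip \<Omega>1 (dvg v) \<phi> + l2ip \<Gamma> (slope v) (\<lambda>y. \<phi> (y, 0)) = 0) \<and>
    (\<forall>b\<in>Basis. \<forall>c\<in>Basis. \<forall>\<phi>. test_fun UNIV \<phi> \<longrightarrow>
      l2ip \<Gamma> (tang v) (\<lambda>y. pd b \<phi> y *\<^sub>R c) + l2ip \<Gamma> (tgrad v b) (\<lambda>y. \<phi> y *\<^sub>R c) = 0)"
  have A: L if "v \<in> XX" unfolding L_def using XX_L2[OF that] by simp
  have B: "v \<in> XX \<longleftrightarrow> C" if L
    unfolding XX_def mem_Collect_eq C_def by (rule reduced_iff) (use that in \<open>simp_all add: L_def\<close>)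
  have "v \<in> XX \<longleftrightarrow> L \<and> C" using A B by blast
  then show ?thesis unfolding L_def C_def conj_assoc .
qed

lemma XX_subspace: "subspace XX"
proof (rule subspaceI)
  have z: "l2ip U (\<lambda>x. 0) k = 0" for U :: "'e::euclidean_space set" and k :: "'e \<Rightarrow> 'b::euclidean_space"
    by (simp add: l2ip_def)
  have "vel (0 :: 'a field) = (\<lambda>x. 0)" "dvg (0 :: 'a field) = (\<lambda>x. 0)" "tang (0 :: 'a field) = (\<lambda>x. 0)"
    "tgrad (0 :: 'a field) b = (\<lambda>x. 0)" "slope (0 :: 'a field) = (\<lambda>x. 0)" for b
    by (simp_all add: sel_defs zero_fun_def)
  then show "0 \<in> XX" by (simp add: XX_iff L2_zero z)
next
  fix v w assume vw: "v \<in> XX" "w \<in> XX"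
  note Lv = XX_L2[OF vw(1)] and Lw = XX_L2[OF vw(2)]
  have add: "L2 U (p + q)" if "L2 U p" "L2 U q" for U :: "'e::euclidean_space set" and p q :: "'e \<Rightarrow> 'b::euclidean_space"
    using L2_add[OF that] by (simp add: plus_fun_def)
  have ip: "l2ip U (p + q) k = l2ip U p k + l2ip U q k" if "L2 U p" "L2 U q" "L2 U k"
    for U :: "'e::euclidean_space set" and p q k :: "'e \<Rightarrow> 'b::euclidean_space"
    using L2.add_left[of p U q k] that by simp
  have c1: "l2ip \<Omega>1 (vel v + vel w) (grad \<phi>) + l2ip \<Omega>1 (dvg v + dvg w) \<phi> + l2ip \<Gamma> (slope v + slope w) (\<lambda>y. \<phi> (y, 0)) = 0"
    if \<phi>: "test_fun free \<phi>" for \<phi>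
  proof -
    have "l2ip \<Omega>1 (vel v) (grad \<phi>) + l2ip \<Omega>1 (dvg v) \<phi> + l2ip \<Gamma> (slope v) (\<lambda>y. \<phi> (y, 0)) = 0"
      "l2ip \<Omega>1 (vel w) (grad \<phi>) + l2ip \<Omega>1 (dvg w) \<phi> + l2ip \<Gamma> (slope w) (\<lambda>y. \<phi> (y, 0)) = 0"
      using vw \<phi> by (simp_all add: XX_iff)
    then show ?thesis
      unfolding ip[OF Lv(1) Lw(1) test_L2s(1)[OF \<phi>]] ip[OF Lv(2) Lw(2) test_L2s(2)[OF \<phi>]] ip[OF Lv(5) Lw(5) test_L2s(3)[OF \<phi>]]
      by linarith
  qed
  have c2: "l2ip \<Gamma> (tang v + tang w) (\<lambda>y. pd b \<phi> y *\<^sub>R c) + l2ip \<Gamma> (tgrad v b + tgrad w b) (\<lambda>y. \<phi> y *\<^sub>R c) = 0"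
    if b: "b \<in> Basis" and c: "c \<in> Basis" and \<phi>: "test_fun UNIV \<phi>" for b c \<phi>
  proof -
    have "l2ip \<Gamma> (tang v) (\<lambda>y. pd b \<phi> y *\<^sub>R c) + l2ip \<Gamma> (tgrad v b) (\<lambda>y. \<phi> y *\<^sub>R c) = 0"
      "l2ip \<Gamma> (tang w) (\<lambda>y. pd b \<phi> y *\<^sub>R c) + l2ip \<Gamma> (tgrad w b) (\<lambda>y. \<phi> y *\<^sub>R c) = 0"
      using vw b c \<phi> by (simp_all add: XX_iff)
    then show ?thesis
      unfolding ip[OF Lv(3) Lw(3) test_L2s_UNIV(1)[OF \<phi> b]] ip[OF Lv(4)[OF b] Lw(4)[OF b] test_L2s_UNIV(2)[OF \<phi> b]]
      by linarith
  qed
  show "v + w \<in> XX"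
    unfolding XX_iff sel_linear using Lv Lw c1 c2 by (simp add: add)
next
  fix r v assume v: "v \<in> XX"
  note Lv = XX_L2[OF v]
  have sc: "L2 U (r *\<^sub>R p)" if "L2 U p" for U :: "'e::euclidean_space set" and p :: "'e \<Rightarrow> 'b::euclidean_space"
    using L2_scaleR[OF that] by (simp add: scaleR_fun_def)
  have ip: "l2ip U (r *\<^sub>R p) k = r * l2ip U p k" for U :: "'e::euclidean_space set" and p k :: "'e \<Rightarrow> 'b::euclidean_space"
    by (simp add: l2ip_def)
  show "r *\<^sub>R v \<in> XX"
    using v unfolding XX_iff sel_linear ip by (simp add: sc distrib_left[symmetric])
qed

lemma L2_pull:
  assumes "\<And>v. v \<in> XX \<Longrightarrow> L2 U (T v)" "\<And>v w. T (v + w) = T v + T w" "\<And>r v. T (r *\<^sub>R v) = r *\<^sub>R T v"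
  shows "semi_inner XX (\<lambda>v w. l2ip U (T v) (T w))"
  by (rule semi_inner_pullback[OF L2_semi_inner XX_subspace]) (use assms in simp_all)

lemma ipX_semi_inner: "semi_inner XX ipX"
  unfolding ipX_def[abs_def]
  by (intro semi_inner_plus semi_inner_sum finite_Basis XX_subspace L2_pull sel_linear XX_L2)

lemma ipX_self:
  "ipX v v = (l2norm \<Omega>1 (vel v))\<^sup>2 + (l2norm \<Omega>1 (dvg v))\<^sup>2 + (l2norm \<Gamma> (tang v))\<^sup>2 +
     (\<Sum>b\<in>Basis. (l2norm \<Gamma> (tgrad v b))\<^sup>2) + (l2norm \<Gamma> (slope v))\<^sup>2"
  by (simp add: ipX_def l2ip_self)

lemma ipX_component_le:
  "l2ip \<Omega>1 (vel v) (vel v) \<le> ipX v v" "l2ip \<Omega>1 (dvg v) (dvg v) \<le> ipX v v" "l2ip \<Gamma> (tang v) (tang v) \<le> ipX v v"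
  "b \<in> Basis \<Longrightarrow> l2ip \<Gamma> (tgrad v b) (tgrad v b) \<le> ipX v v" "l2ip \<Gamma> (slope v) (slope v) \<le> ipX v v"
proof -
  have s: "0 \<le> (\<Sum>b\<in>Basis. (l2norm \<Gamma> (tgrad v b))\<^sup>2)" by (rule sum_nonneg) simp
  note nn = zero_le_power2[of "l2norm \<Omega>1 (vel v)"] zero_le_power2[of "l2norm \<Omega>1 (dvg v)"]
    zero_le_power2[of "l2norm \<Gamma> (tang v)"] zero_le_power2[of "l2norm \<Gamma> (slope v)"]
  show "l2ip \<Omega>1 (vel v) (vel v) \<le> ipX v v" "l2ip \<Omega>1 (dvg v) (dvg v) \<le> ipX v v" "l2ip \<Gamma> (tang v) (tang v) \<le> ipX v v"
    "l2ip \<Gamma> (slope v) (slope v) \<le> ipX v v"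
    unfolding ipX_self l2ip_self using s nn by linarith+
  assume b: "b \<in> Basis"
  have "(l2norm \<Gamma> (tgrad v b))\<^sup>2 \<le> (\<Sum>b\<in>Basis. (l2norm \<Gamma> (tgrad v b))\<^sup>2)"
    by (rule member_le_sum[OF b]) simp_all
  then show "l2ip \<Gamma> (tgrad v b) (tgrad v b) \<le> ipX v v"
    unfolding ipX_self l2ip_self using nn by linarith
qed

lemma component_limit:
  assumes s: "\<And>n. s n \<in> XX" and cau: "\<And>e. e > 0 \<Longrightarrow> \<exists>N. \<forall>m\<ge>N. \<forall>n\<ge>N. ipX (s m - s n) (s m - s n) < e"
    and T: "\<And>v. v \<in> XX \<Longrightarrow> L2 U (T v)" "\<And>v w. T (v - w) = T v - T w" "\<And>v. l2ip U (T v) (T v) \<le> ipX v v"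
  shows "\<exists>u. L2 U u \<and> (\<lambda>n. l2ip U (T (s n) - u) (T (s n) - u)) \<longlonglongrightarrow> 0"
proof (rule L2_complete)
  show "L2 U (T (s n))" for n by (rule T(1)[OF s])
  fix e :: real assume "e > 0"
  from cau[OF this] obtain N where N: "\<forall>m\<ge>N. \<forall>n\<ge>N. ipX (s m - s n) (s m - s n) < e" by (rule exE)
  have "l2ip U (T (s m) - T (s n)) (T (s m) - T (s n)) < e" if "m \<ge> N" "n \<ge> N" for m n
    using T(3)[of "s m - s n"] N[rule_format, OF that] by (simp add: T(2))
  then show "\<exists>N. \<forall>m\<ge>N. \<forall>n\<ge>N. l2ip U (T (s m) - T (s n)) (T (s m) - T (s n)) < e" by (intro exI[of _ N]) simp
qed

text \<open>Limits are taken componentwise. The constraints are pairings with fixed L2 functions,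
  hence persist in the limit.\<close>

lemma ipX_semi_hilbert: "semi_hilbert XX ipX"
proof (intro semi_hilbert.intro ipX_semi_inner semi_hilbert_axioms.intro)
  fix s :: "nat \<Rightarrow> 'a field" assume s: "\<And>n. s n \<in> XX" and cau: "\<And>e. e > 0 \<Longrightarrow> \<exists>N. \<forall>m\<ge>N. \<forall>n\<ge>N. ipX (s m - s n) (s m - s n) < e"
  note lim = component_limit[OF s cau]
  obtain w where w: "L2 \<Omega>1 w" "(\<lambda>n. l2ip \<Omega>1 (vel (s n) - w) (vel (s n) - w)) \<longlonglongrightarrow> 0"
    using lim[where T = vel, OF _ XX_L2(1) sel_linear(11) ipX_component_le(1)] by auto
  obtain d where d: "L2 \<Omega>1 d" "(\<lambda>n. l2ip \<Omega>1 (dvg (s n) - d) (dvg (s n) - d)) \<longlonglongrightarrow> 0"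
    using lim[where T = dvg, OF _ XX_L2(2) sel_linear(12) ipX_component_le(2)] by auto
  obtain \<tau> where \<tau>: "L2 \<Gamma> \<tau>" "(\<lambda>n. l2ip \<Gamma> (tang (s n) - \<tau>) (tang (s n) - \<tau>)) \<longlonglongrightarrow> 0"
    using lim[where T = tang, OF _ XX_L2(3) sel_linear(13) ipX_component_le(3)] by auto
  obtain f where f: "L2 \<Gamma> f" "(\<lambda>n. l2ip \<Gamma> (slope (s n) - f) (slope (s n) - f)) \<longlonglongrightarrow> 0"
    using lim[where T = slope, OF _ XX_L2(5) sel_linear(15) ipX_component_le(5)] by auto
  have "\<forall>b. \<exists>g. b \<in> Basis \<longrightarrow> L2 \<Gamma> g \<and> (\<lambda>n. l2ip \<Gamma> (tgrad (s n) b - g) (tgrad (s n) b - g)) \<longlonglongrightarrow> 0"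
  proof
    fix b :: 'a
    show "\<exists>g. b \<in> Basis \<longrightarrow> L2 \<Gamma> g \<and> (\<lambda>n. l2ip \<Gamma> (tgrad (s n) b - g) (tgrad (s n) b - g)) \<longlonglongrightarrow> 0"
  proof (cases "b \<in> Basis")
    case True
    then show ?thesis using lim[where T = "\<lambda>v. tgrad v b", OF _ XX_L2(4) sel_linear(14) ipX_component_le(4)] by simp
  qed simp
  qed
  from choice[OF this] obtain g where "\<forall>b. b \<in> Basis \<longrightarrow> L2 \<Gamma> (g b) \<and> (\<lambda>n. l2ip \<Gamma> (tgrad (s n) b - g b) (tgrad (s n) b - g b)) \<longlonglongrightarrow> 0"
    by (rule exE)
  then have g: "L2 \<Gamma> (g b)" "(\<lambda>n. l2ip \<Gamma> (tgrad (s n) b - g b) (tgrad (s n) b - g b)) \<longlonglongrightarrow> 0" if "b \<in> Basis" for b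
    using that by simp_all
  let ?u = "(w, d, \<tau>, g, f)"
  have "?u \<in> XX"
    unfolding XX_iff sel_tuple
  proof (intro conjI w d \<tau> f ballI allI impI g)
    fix \<phi> assume \<phi>: "test_fun free \<phi>"
    have "(\<lambda>n. l2ip \<Omega>1 (vel (s n)) (grad \<phi>) + l2ip \<Omega>1 (dvg (s n)) \<phi> + l2ip \<Gamma> (slope (s n)) (\<lambda>y. \<phi> (y, 0)))
        \<longlonglongrightarrow> l2ip \<Omega>1 w (grad \<phi>) + l2ip \<Omega>1 d \<phi> + l2ip \<Gamma> f (\<lambda>y. \<phi> (y, 0))"
      by (intro tendsto_add l2ip_tendsto XX_L2[OF s] w d f test_L2s[OF \<phi>])
    moreover have "l2ip \<Omega>1 (vel (s n)) (grad \<phi>) + l2ip \<Omega>1 (dvg (s n)) \<phi> + l2ip \<Gamma> (slope (s n)) (\<lambda>y. \<phi> (y, 0)) = 0" for n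
      using s[of n] \<phi> by (simp add: XX_iff)
    ultimately show "l2ip \<Omega>1 w (grad \<phi>) + l2ip \<Omega>1 d \<phi> + l2ip \<Gamma> f (\<lambda>y. \<phi> (y, 0)) = 0"
      by (simp add: LIMSEQ_const_iff)
  next
    fix b c :: 'a and \<phi> :: "'a \<Rightarrow> real" assume b: "b \<in> Basis" "c \<in> Basis" and \<phi>: "test_fun UNIV \<phi>"
    have "(\<lambda>n. l2ip \<Gamma> (tang (s n)) (\<lambda>y. pd b \<phi> y *\<^sub>R c) + l2ip \<Gamma> (tgrad (s n) b) (\<lambda>y. \<phi> y *\<^sub>R c))
        \<longlonglongrightarrow> l2ip \<Gamma> \<tau> (\<lambda>y. pd b \<phi> y *\<^sub>R c) + l2ip \<Gamma> (g b) (\<lambda>y. \<phi> y *\<^sub>R c)"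
      by (intro tendsto_add l2ip_tendsto XX_L2[OF s] \<tau> g b test_L2s_UNIV[OF \<phi> b(1)])
    moreover have "l2ip \<Gamma> (tang (s n)) (\<lambda>y. pd b \<phi> y *\<^sub>R c) + l2ip \<Gamma> (tgrad (s n) b) (\<lambda>y. \<phi> y *\<^sub>R c) = 0" for n
      using s[of n] b \<phi> by (simp add: XX_iff)
    ultimately show "l2ip \<Gamma> \<tau> (\<lambda>y. pd b \<phi> y *\<^sub>R c) + l2ip \<Gamma> (g b) (\<lambda>y. \<phi> y *\<^sub>R c) = 0"
      by (simp add: LIMSEQ_const_iff)
  qed
  moreover have "(\<lambda>n. ipX (s n - ?u) (s n - ?u)) \<longlonglongrightarrow> 0 + 0 + 0 + (\<Sum>b\<in>(Basis::'a set). 0) + 0"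
    unfolding ipX_def sel_linear sel_tuple by (intro tendsto_add tendsto_sum w d \<tau> g f)
  ultimately show "\<exists>u\<in>XX. (\<lambda>n. ipX (s n - u) (s n - u)) \<longlonglongrightarrow> 0" by (intro bexI[of _ ?u]) simp_all
qed

lemma L2_cmult: "L2 U u \<Longrightarrow> L2 U (\<lambda>x. c * u x :: real)"
  using L2_scaleR[of U u c] by simp

lemma YY_subspace: "subspace YY"
  by (rule subspaceI) (auto simp: YY_def plus_fun_def zero_fun_def scaleR_fun_def L2_zero L2_add L2_cmult)

lemma ipY_self: "ipY p p = (l2norm \<Omega>1 (fst p))\<^sup>2 + (l2norm \<Gamma> (snd p))\<^sup>2"
  by (simp add: ipY_def l2ip_self)

lemma ipY_semi_hilbert: "semi_hilbert YY ipY"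
proof (intro semi_hilbert.intro semi_hilbert_axioms.intro)
  show "semi_inner YY ipY"
    unfolding ipY_def[abs_def]
    by (intro semi_inner_plus semi_inner_pullback[OF L2_semi_inner YY_subspace]) (simp_all add: YY_def)
  fix s :: "nat \<Rightarrow> ('a \<times> real \<Rightarrow> real) \<times> ('a \<Rightarrow> real)" assume s: "\<And>n. s n \<in> YY" and cau: "\<And>e. e > 0 \<Longrightarrow> \<exists>N. \<forall>m\<ge>N. \<forall>n\<ge>N. ipY (s m - s n) (s m - s n) < e"
  have le: "l2ip \<Omega>1 (fst p) (fst p) \<le> ipY p p" "l2ip \<Gamma> (snd p) (snd p) \<le> ipY p p" for p
    by (simp_all add: ipY_def l2ip_self)
  have "\<exists>u. L2 \<Omega>1 u \<and> (\<lambda>n. l2ip \<Omega>1 (fst (s n) - u) (fst (s n) - u)) \<longlonglongrightarrow> 0"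
  proof (rule L2_complete)
    show "L2 \<Omega>1 (fst (s n))" for n using s by (simp add: YY_def)
    fix e :: real assume "e > 0"
    from cau[OF this] obtain N where N: "\<forall>m\<ge>N. \<forall>n\<ge>N. ipY (s m - s n) (s m - s n) < e" by (rule exE)
    then show "\<exists>N. \<forall>m\<ge>N. \<forall>n\<ge>N. l2ip \<Omega>1 (fst (s m) - fst (s n)) (fst (s m) - fst (s n)) < e"
    proof (intro exI[of _ N] allI impI)
      fix m n assume "m \<ge> N" "n \<ge> N"
      then show "l2ip \<Omega>1 (fst (s m) - fst (s n)) (fst (s m) - fst (s n)) < e"
        using le_less_trans[OF le(1)[of "s m - s n"] N[rule_format]] by (simp add: fst_diff)
    qed
  qed
  then obtain p where p: "L2 \<Omega>1 p" "(\<lambda>n. l2ip \<Omega>1 (fst (s n) - p) (fst (s n) - p)) \<longlonglongrightarrow> 0" by auto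
  have "\<exists>u. L2 \<Gamma> u \<and> (\<lambda>n. l2ip \<Gamma> (snd (s n) - u) (snd (s n) - u)) \<longlonglongrightarrow> 0"
  proof (rule L2_complete)
    show "L2 \<Gamma> (snd (s n))" for n using s by (simp add: YY_def)
    fix e :: real assume "e > 0"
    from cau[OF this] obtain N where N: "\<forall>m\<ge>N. \<forall>n\<ge>N. ipY (s m - s n) (s m - s n) < e" by (rule exE)
    then show "\<exists>N. \<forall>m\<ge>N. \<forall>n\<ge>N. l2ip \<Gamma> (snd (s m) - snd (s n)) (snd (s m) - snd (s n)) < e"
    proof (intro exI[of _ N] allI impI)
      fix m n assume "m \<ge> N" "n \<ge> N"
      then show "l2ip \<Gamma> (snd (s m) - snd (s n)) (snd (s m) - snd (s n)) < e"
        using le_less_trans[OF le(2)[of "s m - s n"] N[rule_format]] by (simp add: snd_diff)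
    qed
  qed
  then obtain q where q: "L2 \<Gamma> q" "(\<lambda>n. l2ip \<Gamma> (snd (s n) - q) (snd (s n) - q)) \<longlonglongrightarrow> 0" by auto
  have "(\<lambda>n. ipY (s n - (p, q)) (s n - (p, q))) \<longlonglongrightarrow> 0 + 0"
    unfolding ipY_def fst_diff snd_diff fst_conv snd_conv by (intro tendsto_add p q)
  then show "\<exists>u\<in>YY. (\<lambda>n. ipY (s n - u) (s n - u)) \<longlonglongrightarrow> 0"
    using p q by (intro bexI[of _ "(p, q)"]) (simp_all add: YY_def)
qed

lemma bdiv_mem: "v \<in> XX \<Longrightarrow> bdiv v \<in> YY"
  unfolding YY_def bdiv_def using XX_L2[of v] by (auto intro!: L2_add L2_sum L2_inner_const)

text \<open>With n the dimension of \<Gamma>, Cauchy-Schwarz over the n diagonal derivatives gives a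
  factor n, adding the slope raises it to n + 1, and the divergence on \<Omega>1 contributes the
  last 1.\<close>

lemma bdiv_bound:
  assumes v: "v \<in> XX"
  shows "ipY (bdiv v) (bdiv v) \<le> (real DIM('a) + 2) * ipX v v"
proof -
  note L = XX_L2[OF v]
  let ?n = "real DIM('a)"
  let ?G = "\<Sum>b\<in>Basis. (l2norm \<Gamma> (tgrad v b))\<^sup>2"
  have pw: "(norm ((\<Sum>b\<in>Basis. tgrad v b y \<bullet> b) + slope v y))\<^sup>2 \<le>
      (?n + 1) * ((\<Sum>b\<in>Basis. (norm (tgrad v b y))\<^sup>2) + (norm (slope v y))\<^sup>2)" for y
  proof -
    have a: "\<bar>\<Sum>b\<in>Basis. tgrad v b y \<bullet> b\<bar> \<le> (\<Sum>b\<in>Basis. norm (tgrad v b y) * 1)"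
      by (rule order_trans[OF sum_abs sum_mono])
        (use Cauchy_Schwarz_ineq2 norm_Basis in \<open>metis mult.right_neutral\<close>)
    have b: "(\<Sum>b\<in>(Basis::'a set). norm (tgrad v b y) * 1)\<^sup>2 \<le> (\<Sum>b\<in>(Basis::'a set). (norm (tgrad v b y))\<^sup>2) * (\<Sum>b\<in>(Basis::'a set). 1\<^sup>2)"
      by (rule Cauchy_Schwarz_ineq_sum)
    have c: "(\<Sum>b\<in>Basis. tgrad v b y \<bullet> b)\<^sup>2 \<le> (\<Sum>b\<in>Basis. norm (tgrad v b y) * 1)\<^sup>2"
      by (rule power2_le_iff_abs_le[THEN iffD2, OF _ a]) (simp add: sum_nonneg)
    define S where "S = (\<Sum>b\<in>Basis. tgrad v b y \<bullet> b)"
    define P where "P = (\<Sum>b\<in>Basis. (norm (tgrad v b y))\<^sup>2)"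
    have S: "S\<^sup>2 \<le> ?n * P" using b c by (simp add: S_def P_def mult.commute)
    have n: "?n \<ge> 1" using DIM_positive[where 'a = 'a] by simp
    have P0: "P \<ge> 0" by (simp add: P_def sum_nonneg)
    \<comment> \<open>Young's inequality weighted by n, so that the mixed term uses up exactly one
      more copy of \<open>P\<close>.\<close>
    have "2 * S * slope v y \<le> S\<^sup>2 / ?n + ?n * (slope v y)\<^sup>2"
    proof -
      have "0 \<le> (S - ?n * slope v y)\<^sup>2 / ?n" using n by simp
      also have "\<dots> = S\<^sup>2 / ?n + ?n * (slope v y)\<^sup>2 - 2 * S * slope v y"
        using n by (simp add: power2_diff power2_eq_square field_simps)
      finally show ?thesis by simp
    qed
    moreover have "S\<^sup>2 / ?n \<le> P" using S n by (simp add: field_simps)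
    ultimately have "(S + slope v y)\<^sup>2 \<le> (?n + 1) * (P + (slope v y)\<^sup>2)"
      using S by (simp add: power2_sum algebra_simps)
    then show ?thesis by (simp add: S_def P_def)
  qed
  have i1: "integrable (lebesgue_on \<Gamma>) (\<lambda>y. (norm (tgrad v b y))\<^sup>2)" if "b \<in> Basis" for b
    using L(4)[OF that] by (simp add: L2_def)
  have i2: "integrable (lebesgue_on \<Gamma>) (\<lambda>y. (norm (slope v y))\<^sup>2)" using L(5) by (simp add: L2_def)
  have "(l2norm \<Gamma> (snd (bdiv v)))\<^sup>2 \<le>
      (\<integral>y. (?n + 1) * ((\<Sum>b\<in>Basis. (norm (tgrad v b y))\<^sup>2) + (norm (slope v y))\<^sup>2) \<partial>lebesgue_on \<Gamma>)"
    unfolding l2norm_sq bdiv_def snd_conv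
  proof (rule integral_mono[OF _ _ pw])
    have "L2 \<Gamma> (snd (bdiv v))" using bdiv_mem[OF v] by (simp add: YY_def)
    then show "integrable (lebesgue_on \<Gamma>) (\<lambda>y. (norm ((\<Sum>b\<in>Basis. tgrad v b y \<bullet> b) + slope v y))\<^sup>2)"
      by (simp add: L2_def bdiv_def)
  qed (intro integrable_mult_right Bochner_Integration.integrable_add Bochner_Integration.integrable_sum i1 i2)
  also have "\<dots> = (?n + 1) * (?G + (l2norm \<Gamma> (slope v))\<^sup>2)"
    using i1 i2 by (simp add: l2norm_sq)
  finally have s: "(l2norm \<Gamma> (snd (bdiv v)))\<^sup>2 \<le> (?n + 1) * (?G + (l2norm \<Gamma> (slope v))\<^sup>2)" .
  have "?G + (l2norm \<Gamma> (slope v))\<^sup>2 \<le> ipX v v" by (simp add: ipX_self)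
  then have "(?n + 1) * (?G + (l2norm \<Gamma> (slope v))\<^sup>2) \<le> (?n + 1) * ipX v v" by (intro mult_left_mono) auto
  moreover have "(l2norm \<Omega>1 (fst (bdiv v)))\<^sup>2 \<le> ipX v v"
    using ipX_component_le(2)[of v] by (simp add: bdiv_def l2ip_self)
  ultimately show ?thesis using s by (simp add: ipY_self algebra_simps)
qed

lemma bdiv_surj:
  "\<exists>C\<ge>0. \<forall>y\<in>YY. \<exists>w\<in>XX. bdiv w = y \<and> ipX w w \<le> C * ipY y y"
proof -
  obtain C where C: "C \<ge> 0" and V: "\<forall>d f. L2 \<Omega>1 d \<longrightarrow> L2 \<Gamma> f \<longrightarrow> (\<exists>W. L2 \<Omega>1 W \<and> l2norm \<Omega>1 W \<le> C * (l2norm \<Omega>1 d + l2norm \<Gamma> f) \<and>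
    (\<forall>\<phi>. test_fun free \<phi> \<longrightarrow> (\<integral>x. W x * pd ez \<phi> x \<partial>lebesgue_on \<Omega>1) =
      - (\<integral>x. \<phi> x * d x \<partial>lebesgue_on \<Omega>1) - (\<integral>y. f y * \<phi> (y, 0) \<partial>lebesgue_on \<Gamma>)))"
    using exists_vertical_field by (elim exE conjE)
  \<comment> \<open>2 C^2 comes from squaring a sum of two norms in the bound for the vertical
    field; the extra 1 accounts for the divergence and slope components, which are the data
    themselves.\<close>
  have "\<exists>w\<in>XX. bdiv w = y \<and> ipX w w \<le> (2 * C\<^sup>2 + 1) * ipY y y" if y: "y \<in> YY" for y
  proof -
    obtain d f where df: "y = (d, f)" by (cases y)
    have d: "L2 \<Omega>1 d" and f: "L2 \<Gamma> f" using y by (simp_all add: df YY_def)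
    obtain W where W: "L2 \<Omega>1 W" and Wn: "l2norm \<Omega>1 W \<le> C * (l2norm \<Omega>1 d + l2norm \<Gamma> f)"
      and Weq: "\<forall>\<phi>. test_fun free \<phi> \<longrightarrow> (\<integral>x. W x * pd ez \<phi> x \<partial>lebesgue_on \<Omega>1) =
      - (\<integral>x. \<phi> x * d x \<partial>lebesgue_on \<Omega>1) - (\<integral>y. f y * \<phi> (y, 0) \<partial>lebesgue_on \<Gamma>)"
      using V[rule_format, OF d f] by (elim exE conjE)
    let ?W = "\<lambda>x. W x *\<^sub>R (ez :: 'a \<times> real)"
    let ?w = "(?W, d, 0, 0, f) :: 'a field"
    have LW: "L2 \<Omega>1 ?W" by (rule L2_scaleR_const[OF W])
    have nW: "l2norm \<Omega>1 ?W = l2norm \<Omega>1 W" by (simp add: l2norm_def ez_def norm_Pair)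
    have z: "L2 \<Gamma> (0 :: 'a \<Rightarrow> 'a)" by (simp add: zero_fun_def L2_zero)
    have "?w \<in> XX"
      unfolding XX_iff sel_tuple
    proof (intro conjI LW d f z ballI allI impI)
      show "L2 \<Gamma> ((0 :: 'a \<Rightarrow> 'a \<Rightarrow> 'a) b)" for b by (simp add: zero_fun_def L2_zero)
      fix \<phi> assume \<phi>: "test_fun free \<phi>"
      have "ez \<bullet> grad \<phi> x = pd ez \<phi> x" for x
      proof -
        have "ez \<bullet> grad \<phi> x = (\<Sum>b\<in>Basis. if b = ez then pd b \<phi> x else 0)"
          unfolding grad_def inner_sum_right
        proof (rule sum.cong[OF refl])
          fix b :: "'a \<times> real" assume b: "b \<in> Basis"
          show "ez \<bullet> pd b \<phi> x *\<^sub>R b = (if b = ez then pd b \<phi> x else 0)"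
            using inner_Basis[OF ez_Basis b] by (cases "b = ez") simp_all
        qed
        then show ?thesis by (simp add: ez_Basis)
      qed
      then have "l2ip \<Omega>1 ?W (grad \<phi>) = (\<integral>x. W x * pd ez \<phi> x \<partial>lebesgue_on \<Omega>1)" by (simp add: l2ip_def)
      then show "l2ip \<Omega>1 ?W (grad \<phi>) + l2ip \<Omega>1 d \<phi> + l2ip \<Gamma> f (\<lambda>y. \<phi> (y, 0)) = 0"
        using Weq \<phi> by (simp add: l2ip_def mult.commute[of "d _"])
    qed (simp add: l2ip_def zero_fun_def)
    moreover have "bdiv ?w = y" by (simp add: bdiv_def sel_tuple df)
    moreover have "ipX ?w ?w \<le> (2 * C\<^sup>2 + 1) * ipY y y"
    proof -
      let ?d = "l2norm \<Omega>1 d" and ?f = "l2norm \<Gamma> f"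
      have "(l2norm \<Omega>1 W)\<^sup>2 \<le> (C * (?d + ?f))\<^sup>2" by (rule power_mono[OF Wn]) simp
      also have "\<dots> = C\<^sup>2 * (?d + ?f)\<^sup>2" by (simp add: power_mult_distrib)
      also have "\<dots> \<le> C\<^sup>2 * (2 * (?d\<^sup>2 + ?f\<^sup>2))"
        using sum_squares_bound[of ?d ?f] by (intro mult_left_mono) (simp_all add: power2_sum)
      finally have "(l2norm \<Omega>1 W)\<^sup>2 \<le> 2 * C\<^sup>2 * (?d\<^sup>2 + ?f\<^sup>2)" by (simp add: algebra_simps)
      moreover have "ipX ?w ?w = (l2norm \<Omega>1 W)\<^sup>2 + ?d\<^sup>2 + ?f\<^sup>2"
        by (simp add: ipX_self sel_tuple nW zero_fun_def)
      ultimately show ?thesis by (simp add: ipY_self df algebra_simps)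
    qed
    ultimately show ?thesis by (intro bexI[of _ ?w]) simp_all
  qed
  then show ?thesis using C by (intro exI[of _ "2 * C\<^sup>2 + 1"]) simp
qed

end

section \<open>Coefficient operators, boundedness and coercivity\<close>

lemma l2ip_operator_bound:
  assumes "L2 U u" "L2 U v" "\<And>x. x \<in> U \<Longrightarrow> norm (v x) \<le> K * norm (u x)" "0 \<le> K"
  shows "l2ip U v u \<le> K * (l2norm U u)\<^sup>2"
proof -
  have "l2norm U v \<le> K * l2norm U u"
    by (rule l2norm_mono[OF assms(1,2) _ assms(4)], rule AE_I2) (use assms(3) in simp)
  then have "l2norm U v * l2norm U u \<le> K * l2norm U u * l2norm U u" by (intro mult_right_mono) simp_all
  then show ?thesis using l2ip_bound[OF assms(2,1)] by (simp add: l2ip_def power2_eq_square)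
qed

lemma inner_Pair_0: "p \<bullet> (v, 0::real) = fst p \<bullet> v" "(v, 0::real) \<bullet> p = v \<bullet> fst p"
  by (cases p, simp)+

lemma measurable_fst_euclidean:
  fixes u :: "'x \<Rightarrow> 'b::euclidean_space \<times> real"
  shows "u \<in> borel_measurable N \<Longrightarrow> (\<lambda>x. fst (u x)) \<in> borel_measurable N"
  by (rule measurable_compose[OF _ borel_measurable_continuous_onI[OF continuous_on_fst[OF continuous_on_id]]])

lemma measurable_Pair_0:
  fixes u :: "'x \<Rightarrow> 'b::euclidean_space"
  shows "u \<in> borel_measurable N \<Longrightarrow> (\<lambda>x. (u x, 0::real)) \<in> borel_measurable N"
  by (rule measurable_compose[OF _ borel_measurable_continuous_onI[of "\<lambda>v. (v, 0::real)"]])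
    (assumption, intro continuous_intros)

text \<open>The coefficient bounds are fixed parameters, nonnegative for \<alpha> and \<beta>. CQ
  \<le> BQ is the relation between the lower and upper bound under which the square root iteration
  contracts.\<close>

locale interface_flow = two_domains \<Gamma> \<Omega>1 for \<Gamma> :: "'a::euclidean_space set" and \<Omega>1 :: "('a \<times> real) set" +
  fixes \<mu> CQ BA BB BQ :: real and \<alpha> \<beta> :: "'a \<Rightarrow> real" and Q :: "'a \<times> real \<Rightarrow> ('a \<times> real) \<Rightarrow>\<^sub>L ('a \<times> real)"
  assumes mu_pos: "\<mu> > 0"
    and alpha_meas: "\<alpha> \<in> borel_measurable (lebesgue_on \<Gamma>)"
    and alpha: "\<And>y. y \<in> \<Gamma> \<Longrightarrow> 0 \<le> \<alpha> y" "\<And>y. y \<in> \<Gamma> \<Longrightarrow> \<alpha> y \<le> BA" "0 \<le> BA"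
    and beta_meas: "\<beta> \<in> borel_measurable (lebesgue_on \<Gamma>)"
    and beta: "\<And>y. y \<in> \<Gamma> \<Longrightarrow> 0 \<le> \<beta> y" "\<And>y. y \<in> \<Gamma> \<Longrightarrow> \<beta> y \<le> BB" "0 \<le> BB"
    and Q_meas1: "Q \<in> borel_measurable (lebesgue_on \<Omega>1)"
    and Q_measG: "(\<lambda>y. Q (y, 0)) \<in> borel_measurable (lebesgue_on \<Gamma>)"
    and Q_bd: "\<And>x. x \<in> \<Omega>1 \<union> \<Gamma> \<times> {0} \<Longrightarrow> norm (Q x) \<le> BQ"
    and Q_sym: "\<And>x. x \<in> \<Omega>1 \<union> \<Gamma> \<times> {0} \<Longrightarrow> sym_op (Q x)"
    and Q_coercive: "\<And>x y. x \<in> \<Omega>1 \<union> \<Gamma> \<times> {0} \<Longrightarrow> CQ * (norm y)\<^sup>2 \<le> Q x y \<bullet> y"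
    and CQ: "0 < CQ" "CQ \<le> BQ"
begin

definition "opQ u = (\<lambda>x. Q x (u x))"
definition "opA f = (\<lambda>y. \<alpha> y * f y :: real)"
text \<open>The tangential block of the root of Q: the vector is embedded with zero normal component
  and the result is projected back.\<close>

definition "opB \<tau> = (\<lambda>y. \<beta> y *\<^sub>R fst (psqrt (Q (y, 0)) (\<tau> y, 0)))"

lemma sqrt_props:
  assumes "y \<in> \<Gamma>"
  shows "sym_op (psqrt (Q (y, 0)))" "0 \<le> psqrt (Q (y, 0)) v \<bullet> v" "norm (psqrt (Q (y, 0))) \<le> 2 * sqrt BQ"
  by (rule exists_square_root(1-3)[OF Q_sym Q_coercive CQ Q_bd]; use assms in simp)+

lemma sqrt_meas: "(\<lambda>y. psqrt (Q (y, 0))) \<in> borel_measurable (lebesgue_on \<Gamma>)"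
  by (rule measurable_psqrt[OF Q_measG CQ]) (simp_all add: Q_sym Q_coercive Q_bd)

lemma BQ_pos: "BQ > 0" using CQ by simp

lemma opQ_L2: "L2 \<Omega>1 u \<Longrightarrow> L2 \<Omega>1 (opQ u)"
  unfolding opQ_def by (rule L2_blinfun_apply[OF Q_meas1 _ Q_bd]) simp_all

lemma opA_norm: "y \<in> \<Gamma> \<Longrightarrow> norm (opA f y) \<le> BA * norm (f y)"
  unfolding opA_def using alpha(1,2)[of y] by (simp add: abs_mult mult_right_mono)

lemma opA_L2:
  assumes f: "L2 \<Gamma> f"
  shows "L2 \<Gamma> (opA f)"
proof (rule L2_bounded[OF f])
  show "opA f \<in> borel_measurable (lebesgue_on \<Gamma>)"
    unfolding opA_def by (intro borel_measurable_times alpha_meas L2_measurable[OF f])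
  show "AE y in lebesgue_on \<Gamma>. norm (opA f y) \<le> BA * norm (f y)"
    by (rule AE_I2) (use opA_norm in simp)
qed

lemma opB_norm:
  assumes y: "y \<in> \<Gamma>"
  shows "norm (opB \<tau> y) \<le> (BB * (2 * sqrt BQ)) * norm (\<tau> y)"
proof -
  have "norm (fst (psqrt (Q (y, 0)) (\<tau> y, 0))) \<le> norm (psqrt (Q (y, 0)) (\<tau> y, 0))"
    by (metis norm_fst_le prod.collapse)
  also have "\<dots> \<le> norm (psqrt (Q (y, 0))) * norm (\<tau> y, 0::real)" by (rule norm_blinfun)
  also have "\<dots> \<le> (2 * sqrt BQ) * norm (\<tau> y)"
    using sqrt_props(3)[OF y] by (simp add: norm_Pair mult_right_mono)
  finally have a: "norm (fst (psqrt (Q (y, 0)) (\<tau> y, 0))) \<le> (2 * sqrt BQ) * norm (\<tau> y)" .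
  have "norm (opB \<tau> y) = \<beta> y * norm (fst (psqrt (Q (y, 0)) (\<tau> y, 0)))"
    using beta(1)[OF y] by (simp add: opB_def)
  also have "\<dots> \<le> BB * ((2 * sqrt BQ) * norm (\<tau> y))"
    by (intro mult_mono a) (use beta y in auto)
  finally show ?thesis by (simp only: mult.assoc)
qed

lemma opB_L2:
  assumes \<tau>: "L2 \<Gamma> \<tau>"
  shows "L2 \<Gamma> (opB \<tau>)"
proof (rule L2_bounded[OF \<tau>])
  show "opB \<tau> \<in> borel_measurable (lebesgue_on \<Gamma>)"
    unfolding opB_def
    by (intro borel_measurable_scaleR beta_meas measurable_fst_euclidean measurable_blinfun_apply_euclidean sqrt_meas
        measurable_Pair_0 L2_measurable[OF \<tau>])
  show "AE y in lebesgue_on \<Gamma>. norm (opB \<tau> y) \<le> (BB * (2 * sqrt BQ)) * norm (\<tau> y)"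
    by (rule AE_I2) (use opB_norm in simp)
qed

lemma opQ_semi: "semi_inner {u. L2 \<Omega>1 u} (\<lambda>u v. l2ip \<Omega>1 (opQ u) v)"
proof (rule semi_inner_operator)
  show "opQ u x \<bullet> v x = u x \<bullet> opQ v x" if "x \<in> \<Omega>1" for u v x
    using Q_sym[of x] that unfolding opQ_def sym_op_def by blast
  show "0 \<le> opQ u x \<bullet> u x" if "x \<in> \<Omega>1" for u x
    using order_trans[OF _ Q_coercive[of x "u x"]] that CQ by (simp add: opQ_def)
qed (simp_all add: opQ_L2, simp_all add: opQ_def fun_eq_iff blinfun.add_right blinfun.scaleR_right)

lemma opA_semi: "semi_inner {u. L2 \<Gamma> u} (\<lambda>u v. l2ip \<Gamma> (opA u) v)"
proof (rule semi_inner_operator)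
  show "0 \<le> opA u x \<bullet> u x" if "x \<in> \<Gamma>" for u x
    using alpha(1)[OF that] by (simp add: opA_def mult.assoc)
qed (simp_all add: opA_L2, simp_all add: opA_def fun_eq_iff distrib_left)

lemma opB_semi: "semi_inner {u. L2 \<Gamma> u} (\<lambda>u v. l2ip \<Gamma> (opB u) v)"
proof (rule semi_inner_operator)
  show "opB (u + v) = opB u + opB v" for u v
  proof (rule ext)
    fix y
    have "(u y + v y, 0::real) = (u y, 0) + (v y, 0)" by simp
    then show "opB (u + v) y = (opB u + opB v) y"
      by (simp only: opB_def plus_fun_apply blinfun.add_right fst_add scaleR_add_right)
  qed
  show "opB (r *\<^sub>R u) = r *\<^sub>R opB u" for r u
  proof (rule ext)
    fix y
    have "(r *\<^sub>R u y, 0::real) = r *\<^sub>R (u y, 0)" by simp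
    then show "opB (r *\<^sub>R u) y = (r *\<^sub>R opB u) y"
      by (simp only: opB_def scaleR_fun_apply blinfun.scaleR_right fst_scaleR scaleR_scaleR mult.commute)
  qed
  show "opB u y \<bullet> v y = u y \<bullet> opB v y" if "y \<in> \<Gamma>" for u v y
    using sqrt_props(1)[OF that] unfolding sym_op_def opB_def inner_scaleR_left inner_scaleR_right
      inner_Pair_0[symmetric] by simp
  show "0 \<le> opB u y \<bullet> u y" if "y \<in> \<Gamma>" for u y
    using sqrt_props(2)[OF that, of "(u y, 0)"] beta(1)[OF that] unfolding opB_def inner_scaleR_left inner_Pair_0
    by simp
qed (simp add: opB_L2)

text \<open>The interface term with \<alpha> contains two traces - f, whose signs cancel, so
  \<open>slope\<close> itself can stand in it.\<close>

definition aa :: "'a field \<Rightarrow> 'a field \<Rightarrow> real" where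
  "aa v w = l2ip \<Omega>1 (opQ (vel v)) (vel w) + \<mu> * (\<Sum>b\<in>Basis. l2ip \<Gamma> (tgrad v b) (tgrad w b)) +
     \<mu> * l2ip \<Gamma> (slope v) (slope w) + l2ip \<Gamma> (opA (slope v)) (slope w) + l2ip \<Gamma> (opB (tang v)) (tang w)"

lemma aa_semi_inner: "semi_inner XX aa"
  unfolding aa_def[abs_def]
proof (intro semi_inner_plus semi_inner_cmult semi_inner_sum finite_Basis XX_subspace L2_pull)
  show "semi_inner XX (\<lambda>v w. l2ip \<Omega>1 (opQ (vel v)) (vel w))"
    by (rule semi_inner_pullback[OF opQ_semi XX_subspace]) (simp_all add: sel_linear XX_L2)
  show "semi_inner XX (\<lambda>v w. l2ip \<Gamma> (opA (slope v)) (slope w))"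
    by (rule semi_inner_pullback[OF opA_semi XX_subspace]) (simp_all add: sel_linear XX_L2)
  show "semi_inner XX (\<lambda>v w. l2ip \<Gamma> (opB (tang v)) (tang w))"
    by (rule semi_inner_pullback[OF opB_semi XX_subspace]) (simp_all add: sel_linear XX_L2)
qed (use mu_pos in \<open>simp_all add: sel_linear XX_L2\<close>)

lemma aa_self:
  "aa v v = l2ip \<Omega>1 (opQ (vel v)) (vel v) + \<mu> * (\<Sum>b\<in>Basis. (l2norm \<Gamma> (tgrad v b))\<^sup>2) +
     \<mu> * (l2norm \<Gamma> (slope v))\<^sup>2 + l2ip \<Gamma> (opA (slope v)) (slope v) + l2ip \<Gamma> (opB (tang v)) (tang v)"
  by (simp add: aa_def l2ip_self)

lemma mixed: "\<exists>k M C. mixed_problem XX ipX YY ipY aa bdiv k M C"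
proof -
  obtain T where T: "T \<ge> 0" and P: "\<forall>\<tau> g b. b \<in> Basis \<longrightarrow> L2 \<Gamma> \<tau> \<longrightarrow> L2 \<Gamma> g \<longrightarrow>
    (\<forall>\<phi>. test_fun UNIV \<phi> \<longrightarrow> (\<integral>y. pd b \<phi> y *\<^sub>R \<tau> y + \<phi> y *\<^sub>R g y \<partial>lebesgue_on \<Gamma>) = 0) \<longrightarrow>
    l2norm \<Gamma> (\<tau> :: 'a \<Rightarrow> 'a) \<le> T * l2norm \<Gamma> g"
    using poincare by (elim exE conjE)
  obtain C where C: "C \<ge> 0" and S: "\<forall>y\<in>YY. \<exists>w\<in>XX. bdiv w = y \<and> ipX w w \<le> C * ipY y y"
    using bdiv_surj by (elim exE conjE)
  \<comment> \<open>CQ serves the velocity, 1 the divergence through the augmented term, and \<mu> /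
    (T^2 + 1) both \<tau> and its gradient, since the gradient has to pay for \<tau> by the Poincare
    inequality.\<close>
  define k where "k = min CQ (min 1 (\<mu> / (T\<^sup>2 + 1)))"
  \<comment> \<open>One constant above the bounds of all terms of \<open>aa\<close> and above that
    of \<open>bdiv\<close>.\<close>
  define K where "K = BQ + \<mu> + BA + BB * (2 * sqrt BQ) + (real DIM('a) + 2)"
  have T1: "T\<^sup>2 + 1 > 0" by (simp add: add_nonneg_pos)
  have k: "k > 0" "k \<le> CQ" "k \<le> 1" "k * (T\<^sup>2 + 1) \<le> \<mu>"
  proof -
    show "k > 0" "k \<le> CQ" "k \<le> 1" using CQ mu_pos T1 by (simp_all add: k_def)
    have "k \<le> \<mu> / (T\<^sup>2 + 1)" by (simp add: k_def)
    then show "k * (T\<^sup>2 + 1) \<le> \<mu>" using T1 by (simp add: field_simps)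
  qed
  have BB0: "0 \<le> BB * (2 * sqrt BQ)" using beta(3) BQ_pos by simp
  have ipX0: "0 \<le> ipX v v" for v unfolding ipX_self by (intro add_nonneg_nonneg sum_nonneg) simp_all
  interpret Y: semi_hilbert YY ipY by (rule ipY_semi_hilbert)
  interpret X: semi_hilbert XX ipX by (rule ipX_semi_hilbert)
  \<comment> \<open>The preimage bound is for squared norms, whence the root of
    \<open>C\<close>.\<close>
  have "mixed_problem XX ipX YY ipY aa bdiv k K (sqrt C)"
  proof (intro mixed_problem.intro mixed_problem_axioms.intro ipX_semi_hilbert ipY_semi_hilbert aa_semi_inner
      bdiv_mem bdiv_linear k(1))
    fix v assume v: "v \<in> XX"
    note L = XX_L2[OF v]
    let ?V = "(l2norm \<Omega>1 (vel v))\<^sup>2" and ?D = "(l2norm \<Omega>1 (dvg v))\<^sup>2" and ?T = "(l2norm \<Gamma> (tang v))\<^sup>2"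
      and ?G = "\<Sum>b\<in>Basis. (l2norm \<Gamma> (tgrad v b))\<^sup>2" and ?S = "(l2norm \<Gamma> (slope v))\<^sup>2"
    have G0: "?G \<ge> 0" by (rule sum_nonneg) simp
    have ipX: "ipX v v = ?V + ?D + ?T + ?G + ?S" by (rule ipX_self)
    have le: "?V \<le> ipX v v" "?T \<le> ipX v v" "?G \<le> ipX v v" "?S \<le> ipX v v"
      using G0 unfolding ipX by simp_all
    have q: "l2ip \<Omega>1 (opQ (vel v)) (vel v) \<le> BQ * ?V"
    proof (rule l2ip_operator_bound[OF L(1) opQ_L2[OF L(1)]])
      fix x assume "x \<in> \<Omega>1"
      then have "norm (Q x) * norm (vel v x) \<le> BQ * norm (vel v x)" by (intro mult_right_mono Q_bd) auto
      then show "norm (opQ (vel v) x) \<le> BQ * norm (vel v x)"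
        using norm_blinfun[of "Q x" "vel v x"] by (simp add: opQ_def)
    qed (use BQ_pos in simp)
    have aS: "l2ip \<Gamma> (opA (slope v)) (slope v) \<le> BA * ?S"
      by (rule l2ip_operator_bound[OF L(5) opA_L2[OF L(5)] opA_norm alpha(3)])
    have bT: "l2ip \<Gamma> (opB (tang v)) (tang v) \<le> (BB * (2 * sqrt BQ)) * ?T"
      by (rule l2ip_operator_bound[OF L(3) opB_L2[OF L(3)] opB_norm BB0])
    have m: "c * r \<le> c * ipX v v" if "r \<le> ipX v v" "0 \<le> c" for c r using that by (rule mult_left_mono)
    have mus: "\<mu> * ?G + \<mu> * ?S \<le> \<mu> * ipX v v"
      unfolding distrib_left[symmetric] by (rule m) (use mu_pos in \<open>simp_all add: ipX\<close>)
    have n0: "0 \<le> (real DIM('a) + 2) * ipX v v" using ipX0 by simp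
    show "aa v v \<le> K * ipX v v"
      using q aS bT mus n0 m[OF le(1), of BQ] m[OF le(4), of BA] m[OF le(2), of "BB * (2 * sqrt BQ)"] BQ_pos alpha(3) BB0
      unfolding aa_self K_def distrib_right by linarith
    have "0 \<le> (BQ + \<mu> + BA + BB * (2 * sqrt BQ)) * ipX v v"
      using BQ_pos mu_pos alpha(3) BB0 ipX0 by simp
    then show "ipY (bdiv v) (bdiv v) \<le> K * ipX v v"
      using bdiv_bound[OF v] unfolding K_def distrib_right by linarith
    have lowQ: "CQ * ?V \<le> l2ip \<Omega>1 (opQ (vel v)) (vel v)"
    proof -
      have "CQ * ?V = (\<integral>x. CQ * (norm (vel v x))\<^sup>2 \<partial>lebesgue_on \<Omega>1)" by (simp add: l2norm_sq)
      also have "\<dots> \<le> l2ip \<Omega>1 (opQ (vel v)) (vel v)"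
        unfolding l2ip_def
      proof (rule integral_mono)
        show "integrable (lebesgue_on \<Omega>1) (\<lambda>x. CQ * (norm (vel v x))\<^sup>2)" using L(1) by (simp add: L2_def)
        show "integrable (lebesgue_on \<Omega>1) (\<lambda>x. opQ (vel v) x \<bullet> vel v x)"
          by (rule L2_integrable_inner[OF opQ_L2[OF L(1)] L(1)])
        show "CQ * (norm (vel v x))\<^sup>2 \<le> opQ (vel v) x \<bullet> vel v x" if "x \<in> space (lebesgue_on \<Omega>1)" for x
          using Q_coercive[of x "vel v x"] that by (simp add: opQ_def)
      qed
      finally show ?thesis .
    qed
    have A0: "0 \<le> l2ip \<Gamma> (opA (slope v)) (slope v)" using semi_inner.nonneg[OF opA_semi] L(5) by simp
    have B0: "0 \<le> l2ip \<Gamma> (opB (tang v)) (tang v)" using semi_inner.nonneg[OF opB_semi] L(3) by simp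
    have D: "?D \<le> ipY (bdiv v) (bdiv v)" by (simp add: ipY_self bdiv_def)
    have poinc: "?T \<le> T\<^sup>2 * ?G"
    proof -
      \<comment> \<open>The Poincare inequality bounds \<tau> by the derivative in one direction, so
        a single basis vector is enough.\<close>
      obtain b :: 'a where b: "b \<in> Basis" using nonempty_Basis[where 'a = 'a] by blast
      have "l2norm \<Gamma> (tang v) \<le> T * l2norm \<Gamma> (tgrad v b)"
        using P b L(3) L(4)[OF b] v by (simp add: XX_def reduced_def)
      then have "?T \<le> (T * l2norm \<Gamma> (tgrad v b))\<^sup>2" by (intro power_mono) simp_all
      also have "\<dots> = T\<^sup>2 * (l2norm \<Gamma> (tgrad v b))\<^sup>2" by (simp add: power_mult_distrib)
      also have "\<dots> \<le> T\<^sup>2 * ?G" by (intro mult_left_mono member_le_sum[OF b]) simp_all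
      finally show ?thesis .
    qed
    have 1: "k * ?V \<le> CQ * ?V" by (intro mult_right_mono k) simp
    have 2: "k * ?D \<le> 1 * ?D" by (intro mult_right_mono k) simp
    have 3: "k * (?T + ?G) \<le> k * ((T\<^sup>2 + 1) * ?G)" using poinc k(1) by (intro mult_left_mono) (simp_all add: distrib_right)
    have 4: "k * ((T\<^sup>2 + 1) * ?G) \<le> \<mu> * ?G"
      unfolding mult.assoc[symmetric] by (intro mult_right_mono k(4) G0)
    have "k * 1 \<le> k * (T\<^sup>2 + 1)" using k(1) by (intro mult_left_mono) simp_all
    then have "k \<le> \<mu>" using k(4) by simp
    then have 5: "k * ?S \<le> \<mu> * ?S" by (intro mult_right_mono) simp_all
    have "k * ipX v v = k * ?V + k * ?D + k * (?T + ?G) + k * ?S" unfolding ipX by (simp only: distrib_left)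
    then show "k * ipX v v \<le> aa v v + ipY (bdiv v) (bdiv v)"
      using 1 2 3 4 5 lowQ A0 B0 D unfolding aa_self by linarith
  next
    fix y assume y: "y \<in> YY"
    obtain w where w: "w \<in> XX" "bdiv w = y" "ipX w w \<le> C * ipY y y" using S y by auto
    have "Y.nrm (bdiv w - y) = 0" using Y.nrm_scale[OF Y.memI(4), of 0] by (simp add: w(2))
    moreover have "X.nrm w \<le> sqrt C * Y.nrm y"
      using real_sqrt_le_mono[OF w(3)] by (simp add: X.nrm_def Y.nrm_def real_sqrt_mult)
    ultimately show "\<exists>w\<in>XX. Y.nrm (bdiv w - y) = 0 \<and> X.nrm w \<le> sqrt C * Y.nrm y" using w(1) by auto
  qed (use C BQ_pos mu_pos alpha(3) BB0 in \<open>simp_all add: K_def\<close>)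
  then show ?thesis by blast
qed

section \<open>Translating the variational problem\<close>

definition rep :: "'a field \<Rightarrow> ('a \<times> real \<Rightarrow> 'a) \<Rightarrow> ('a \<times> real \<Rightarrow> real) \<Rightarrow> bool" where
  "rep v wT wN \<longleftrightarrow> represents (vel v) wT wN (dvg v) (tang v) (tgrad v) (slope v)"

lemma rep_XX: "rep v wT wN \<Longrightarrow> v \<in> XX"
  by (simp add: rep_def represents_def XX_def)

lemma rep_lift:
  assumes v: "v \<in> XX"
  shows "rep v (\<lambda>x. tang v (fst x)) (\<lambda>x. (snd x - 1) * slope v (fst x))"
  using v L2_measurable[OF L2_lift(1)[OF open_G XX_L2(3)[OF v]]] L2_measurable[OF L2_linear_lift(1)[OF XX_L2(5)[OF v]]]
  by (simp add: rep_def represents_def XX_def)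

lemma rep_X0: "rep v wT wN \<Longrightarrow> X0 \<Omega>1 \<Gamma> (vel v) wT wN"
  unfolding rep_def by (rule represents_X0)

lemma X0_rep:
  assumes "X0 \<Omega>1 \<Gamma> w1 wT wN"
  shows "\<exists>v. rep v wT wN \<and> vel v = w1"
proof -
  obtain \<tau> g f where "represents w1 wT wN (wdiv \<Omega>1 w1) \<tau> g f" using X0_represents[OF assms] by auto
  then show ?thesis by (intro exI[of _ "(w1, wdiv \<Omega>1 w1, \<tau>, g, f)"]) (simp add: rep_def sel_tuple)
qed

text \<open>The derivatives and traces in the original formulation are arbitrary choices. Up to null
  sets they are the components of the reduced field, which is all that the integrals notice.\<close>

lemma rep_AE:
  assumes R: "rep v wT wN"
  shows "AE x in lebesgue_on \<Omega>1. wdiv \<Omega>1 (vel v) x = dvg v x" "wdiv \<Omega>1 (vel v) \<in> borel_measurable (lebesgue_on \<Omega>1)"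
    "\<And>b. b \<in> Basis \<Longrightarrow> AE x in lebesgue_on \<Omega>. wpd \<Omega> wT (b, 0) x = tgrad v b (fst x)"
    "\<And>b. b \<in> Basis \<Longrightarrow> wpd \<Omega> wT (b, 0) \<in> borel_measurable (lebesgue_on \<Omega>)"
    "AE x in lebesgue_on \<Omega>. wpd \<Omega> wT ez x = 0" "wpd \<Omega> wT ez \<in> borel_measurable (lebesgue_on \<Omega>)"
    "AE x in lebesgue_on \<Omega>. dz \<Gamma> wN x = slope v (fst x)" "dz \<Gamma> wN \<in> borel_measurable (lebesgue_on \<Omega>)"
    "AE y in lebesgue_on \<Gamma>. tr0 \<Gamma> wT y = tang v y" "tr0 \<Gamma> wT \<in> borel_measurable (lebesgue_on \<Gamma>)"
    "AE y in lebesgue_on \<Gamma>. tr0 \<Gamma> wN y = - slope v y" "tr0 \<Gamma> wN \<in> borel_measurable (lebesgue_on \<Gamma>)"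
    "AE x in lebesgue_on \<Omega>. wT x = tang v (fst x)" "wT \<in> borel_measurable (lebesgue_on \<Omega>)"
    "AE x in lebesgue_on \<Omega>. wN x = (snd x - 1) * slope v (fst x)" "wN \<in> borel_measurable (lebesgue_on \<Omega>)"
proof -
  note F = represents_facts[OF R[unfolded rep_def]]
  have red: "reduced (vel v) (dvg v) (tang v) (tgrad v) (slope v)" using rep_XX[OF R] by (simp add: XX_def)
  note wd = reduced_has_wdiv[OF red]
  show "AE x in lebesgue_on \<Omega>1. wdiv \<Omega>1 (vel v) x = dvg v x" by (rule wdiv_AE[OF open_1 wd])
  show "wdiv \<Omega>1 (vel v) \<in> borel_measurable (lebesgue_on \<Omega>1)"
    using has_wdiv_wdiv[OF wd] by (simp add: has_wdiv_def L2_def)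
  show "AE x in lebesgue_on \<Omega>. wpd \<Omega> wT (b, 0) x = tgrad v b (fst x)" if "b \<in> Basis" for b
    by (rule wpd_AE[OF open_O F(1)[OF that]])
  show "wpd \<Omega> wT (b, 0) \<in> borel_measurable (lebesgue_on \<Omega>)" if "b \<in> Basis" for b
    by (rule L2_measurable[OF has_wpd_L2(1)[OF has_wpd_wpd[OF F(1)[OF that]]]])
  show "AE x in lebesgue_on \<Omega>. wpd \<Omega> wT ez x = 0" by (rule wpd_AE[OF open_O F(2)])
  show "wpd \<Omega> wT ez \<in> borel_measurable (lebesgue_on \<Omega>)"
    by (rule L2_measurable[OF has_wpd_L2(1)[OF has_wpd_wpd[OF F(2)]]])
  show "AE x in lebesgue_on \<Omega>. dz \<Gamma> wN x = slope v (fst x)" unfolding dz_def by (rule wpd_AE[OF open_O F(3)])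
  show "dz \<Gamma> wN \<in> borel_measurable (lebesgue_on \<Omega>)"
    unfolding dz_def by (rule L2_measurable[OF has_wpd_L2(1)[OF has_wpd_wpd[OF F(3)]]])
  show "AE y in lebesgue_on \<Gamma>. tr0 \<Gamma> wT y = tang v y" by (rule tr0_AE(2)[OF F(4)])
  show "tr0 \<Gamma> wT \<in> borel_measurable (lebesgue_on \<Gamma>)" using tr0_AE(1)[OF F(4)] by (simp add: ztrace0_def L2_def)
  show "AE y in lebesgue_on \<Gamma>. tr0 \<Gamma> wN y = - slope v y" by (rule tr0_AE(2)[OF F(5)])
  show "tr0 \<Gamma> wN \<in> borel_measurable (lebesgue_on \<Gamma>)" using tr0_AE(1)[OF F(5)] by (simp add: ztrace0_def L2_def)
  have ae: "AE x in lebesgue_on \<Omega>. tang v (fst x) = wT x" "AE x in lebesgue_on \<Omega>. (snd x - 1) * slope v (fst x) = wN x"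
    using R by (simp_all add: rep_def represents_def)
  show "AE x in lebesgue_on \<Omega>. wT x = tang v (fst x)" using ae(1) by eventually_elim simp
  show "AE x in lebesgue_on \<Omega>. wN x = (snd x - 1) * slope v (fst x)" using ae(2) by eventually_elim simp
  show "wT \<in> borel_measurable (lebesgue_on \<Omega>)" by (rule L2_measurable[OF F(7)])
  show "wN \<in> borel_measurable (lebesgue_on \<Omega>)" by (rule L2_measurable[OF F(8)])
qed

lemma integral_Omega_AE:
  fixes h :: "'a \<times> real \<Rightarrow> real"
  assumes "h \<in> borel_measurable (lebesgue_on \<Omega>)" "integrable (lebesgue_on \<Gamma>) H"
    "AE x in lebesgue_on \<Omega>. h x = H (fst x)"
  shows "(\<integral>x. h x \<partial>lebesgue_on \<Omega>) = (\<integral>y. H y \<partial>lebesgue_on \<Gamma>)"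
proof -
  note I = integral_lift[OF open_G assms(2)]
  have "(\<integral>x. h x \<partial>lebesgue_on \<Omega>) = (\<integral>x. H (fst x) \<partial>lebesgue_on \<Omega>)"
    by (rule integral_cong_AE[OF assms(1) borel_measurable_integrable[OF I(1)] assms(3)])
  then show ?thesis by (simp add: I(2))
qed

lemma divT_dz_rep:
  assumes R: "rep w wT wN"
  shows "AE x in lebesgue_on \<Omega>. divT \<Gamma> wT x + dz \<Gamma> wN x = snd (bdiv w) (fst x)"
    "(\<lambda>x. divT \<Gamma> wT x + dz \<Gamma> wN x) \<in> borel_measurable (lebesgue_on \<Omega>)"
proof -
  note A = rep_AE[OF R]
  have "AE x in lebesgue_on \<Omega>. \<forall>b\<in>Basis. wpd \<Omega> wT (b, 0) x = tgrad w b (fst x)"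
    by (rule AE_finite_allI[OF finite_Basis A(3)])
  then show "AE x in lebesgue_on \<Omega>. divT \<Gamma> wT x + dz \<Gamma> wN x = snd (bdiv w) (fst x)"
    using A(7) by eventually_elim (simp add: divT_def bdiv_def)
  show "(\<lambda>x. divT \<Gamma> wT x + dz \<Gamma> wN x) \<in> borel_measurable (lebesgue_on \<Omega>)"
    unfolding divT_def by (intro borel_measurable_add borel_measurable_sum borel_measurable_inner A borel_measurable_const)
qed

lemma pressure_terms:
  assumes R: "rep w wT wN" and p: "L2 \<Omega>1 p1" "L2 \<Omega> p2" "L2 \<Gamma> \<pi>" "AE x in lebesgue_on \<Omega>. p2 x = \<pi> (fst x)"
  shows "(\<integral>x. p1 x * wdiv \<Omega>1 (vel w) x \<partial>lebesgue_on \<Omega>1) = l2ip \<Omega>1 p1 (dvg w)"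
    "(\<integral>x. p2 x * (divT \<Gamma> wT x + dz \<Gamma> wN x) \<partial>lebesgue_on \<Omega>) = l2ip \<Gamma> \<pi> (snd (bdiv w))"
proof -
  note A = rep_AE[OF R] and L = XX_L2[OF rep_XX[OF R]]
  have "l2ip \<Omega>1 p1 (wdiv \<Omega>1 (vel w)) = l2ip \<Omega>1 p1 (dvg w)"
    by (rule l2ip_cong_AE) (use A L2_measurable[OF p(1)] L2_measurable[OF L(2)] in simp_all)
  then show "(\<integral>x. p1 x * wdiv \<Omega>1 (vel w) x \<partial>lebesgue_on \<Omega>1) = l2ip \<Omega>1 p1 (dvg w)" by (simp add: l2ip_def)
  have Lb: "L2 \<Gamma> (snd (bdiv w))" using bdiv_mem[OF rep_XX[OF R]] by (simp add: YY_def)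
  have "(\<integral>x. p2 x * (divT \<Gamma> wT x + dz \<Gamma> wN x) \<partial>lebesgue_on \<Omega>) = (\<integral>y. \<pi> y * snd (bdiv w) y \<partial>lebesgue_on \<Gamma>)"
  proof (rule integral_Omega_AE)
    show "(\<lambda>x. p2 x * (divT \<Gamma> wT x + dz \<Gamma> wN x)) \<in> borel_measurable (lebesgue_on \<Omega>)"
      by (rule borel_measurable_times[OF L2_measurable[OF p(2)] divT_dz_rep(2)[OF R]])
    show "integrable (lebesgue_on \<Gamma>) (\<lambda>y. \<pi> y * snd (bdiv w) y)" by (rule L2_real_integrable_mult[OF p(3) Lb])
    show "AE x in lebesgue_on \<Omega>. p2 x * (divT \<Gamma> wT x + dz \<Gamma> wN x) = \<pi> (fst x) * snd (bdiv w) (fst x)"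
      using p(4) divT_dz_rep(1)[OF R] by eventually_elim simp
  qed
  then show "(\<integral>x. p2 x * (divT \<Gamma> wT x + dz \<Gamma> wN x) \<partial>lebesgue_on \<Omega>) = l2ip \<Gamma> \<pi> (snd (bdiv w))"
    by (simp add: l2ip_def)
qed

lemma velocity_terms:
  assumes V: "rep v vT vN" and W: "rep w wT wN"
  shows "(\<integral>x. Q x (vel v x) \<bullet> vel w x \<partial>lebesgue_on \<Omega>1)
        + (\<integral>x. \<mu> * gradT_inner \<Gamma> vT wT x \<partial>lebesgue_on \<Omega>)
        + (\<integral>x. \<mu> * dz \<Gamma> vN x * dz \<Gamma> wN x \<partial>lebesgue_on \<Omega>)
        + (\<integral>y. \<alpha> y * tr0 \<Gamma> vN y * tr0 \<Gamma> wN y \<partial>lebesgue_on \<Gamma>)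
        + (\<integral>y. \<beta> y * (psqrt (Q (y, 0)) (tr0 \<Gamma> vT y, 0) \<bullet> (tr0 \<Gamma> wT y, 0)) \<partial>lebesgue_on \<Gamma>) = aa v w"
proof -
  note A = rep_AE[OF V] and LA = XX_L2[OF rep_XX[OF V]]
  note B = rep_AE[OF W] and LB = XX_L2[OF rep_XX[OF W]]
  have t1: "(\<integral>x. Q x (vel v x) \<bullet> vel w x \<partial>lebesgue_on \<Omega>1) = l2ip \<Omega>1 (opQ (vel v)) (vel w)"
    by (simp add: l2ip_def opQ_def)
  have "(\<integral>x. \<mu> * gradT_inner \<Gamma> vT wT x \<partial>lebesgue_on \<Omega>) = (\<integral>y. \<mu> * (\<Sum>b\<in>Basis. tgrad v b y \<bullet> tgrad w b y) \<partial>lebesgue_on \<Gamma>)"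
  proof (rule integral_Omega_AE)
    show "(\<lambda>x. \<mu> * gradT_inner \<Gamma> vT wT x) \<in> borel_measurable (lebesgue_on \<Omega>)"
      unfolding gradT_inner_def
      by (intro borel_measurable_times borel_measurable_const borel_measurable_sum borel_measurable_inner A(4) B(4))
    show "integrable (lebesgue_on \<Gamma>) (\<lambda>y. \<mu> * (\<Sum>b\<in>Basis. tgrad v b y \<bullet> tgrad w b y))"
      by (intro integrable_mult_right Bochner_Integration.integrable_sum L2_integrable_inner LA(4) LB(4))
    have "AE x in lebesgue_on \<Omega>. \<forall>b\<in>Basis. wpd \<Omega> vT (b, 0) x = tgrad v b (fst x)"
      by (rule AE_finite_allI[OF finite_Basis A(3)])
    moreover have "AE x in lebesgue_on \<Omega>. \<forall>b\<in>Basis. wpd \<Omega> wT (b, 0) x = tgrad w b (fst x)"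
      by (rule AE_finite_allI[OF finite_Basis B(3)])
    ultimately show "AE x in lebesgue_on \<Omega>. \<mu> * gradT_inner \<Gamma> vT wT x = \<mu> * (\<Sum>b\<in>Basis. tgrad v b (fst x) \<bullet> tgrad w b (fst x))"
      by eventually_elim (simp add: gradT_inner_def)
  qed
  also have "\<dots> = \<mu> * (\<Sum>b\<in>Basis. l2ip \<Gamma> (tgrad v b) (tgrad w b))"
    using LA(4) LB(4) by (simp add: l2ip_def L2_integrable_inner)
  finally have t2: "(\<integral>x. \<mu> * gradT_inner \<Gamma> vT wT x \<partial>lebesgue_on \<Omega>) = \<mu> * (\<Sum>b\<in>Basis. l2ip \<Gamma> (tgrad v b) (tgrad w b))" .
  have "(\<integral>x. \<mu> * dz \<Gamma> vN x * dz \<Gamma> wN x \<partial>lebesgue_on \<Omega>) = (\<integral>y. \<mu> * (slope v y * slope w y) \<partial>lebesgue_on \<Gamma>)"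
  proof (rule integral_Omega_AE)
    show "(\<lambda>x. \<mu> * dz \<Gamma> vN x * dz \<Gamma> wN x) \<in> borel_measurable (lebesgue_on \<Omega>)"
      by (intro borel_measurable_times borel_measurable_const A(8) B(8))
    show "integrable (lebesgue_on \<Gamma>) (\<lambda>y. \<mu> * (slope v y * slope w y))"
      by (intro integrable_mult_right L2_real_integrable_mult LA(5) LB(5))
    show "AE x in lebesgue_on \<Omega>. \<mu> * dz \<Gamma> vN x * dz \<Gamma> wN x = \<mu> * (slope v (fst x) * slope w (fst x))"
      using A(7) B(7) by eventually_elim simp
  qed
  then have t3: "(\<integral>x. \<mu> * dz \<Gamma> vN x * dz \<Gamma> wN x \<partial>lebesgue_on \<Omega>) = \<mu> * l2ip \<Gamma> (slope v) (slope w)" by (simp add: l2ip_def)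
  have t4: "(\<integral>y. \<alpha> y * tr0 \<Gamma> vN y * tr0 \<Gamma> wN y \<partial>lebesgue_on \<Gamma>) = l2ip \<Gamma> (opA (slope v)) (slope w)"
    unfolding l2ip_def
  proof (rule integral_cong_AE)
    show "(\<lambda>y. \<alpha> y * tr0 \<Gamma> vN y * tr0 \<Gamma> wN y) \<in> borel_measurable (lebesgue_on \<Gamma>)"
      by (intro borel_measurable_times alpha_meas A(12) B(12))
    show "(\<lambda>y. opA (slope v) y \<bullet> slope w y) \<in> borel_measurable (lebesgue_on \<Gamma>)"
      by (intro borel_measurable_inner L2_measurable[OF opA_L2[OF LA(5)]] L2_measurable[OF LB(5)])
    show "AE y in lebesgue_on \<Gamma>. \<alpha> y * tr0 \<Gamma> vN y * tr0 \<Gamma> wN y = opA (slope v) y \<bullet> slope w y"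
      using A(11) B(11) by eventually_elim (simp add: opA_def)
  qed
  have t5: "(\<integral>y. \<beta> y * (psqrt (Q (y, 0)) (tr0 \<Gamma> vT y, 0) \<bullet> (tr0 \<Gamma> wT y, 0)) \<partial>lebesgue_on \<Gamma>) = l2ip \<Gamma> (opB (tang v)) (tang w)"
    unfolding l2ip_def
  proof (rule integral_cong_AE)
    show "(\<lambda>y. \<beta> y * (psqrt (Q (y, 0)) (tr0 \<Gamma> vT y, 0) \<bullet> (tr0 \<Gamma> wT y, 0))) \<in> borel_measurable (lebesgue_on \<Gamma>)"
      by (intro borel_measurable_times beta_meas borel_measurable_inner measurable_blinfun_apply_euclidean sqrt_meas
          measurable_Pair_0 A(10) B(10))
    show "(\<lambda>y. opB (tang v) y \<bullet> tang w y) \<in> borel_measurable (lebesgue_on \<Gamma>)"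
      by (intro borel_measurable_inner L2_measurable[OF opB_L2[OF LA(3)]] L2_measurable[OF LB(3)])
    show "AE y in lebesgue_on \<Gamma>. \<beta> y * (psqrt (Q (y, 0)) (tr0 \<Gamma> vT y, 0) \<bullet> (tr0 \<Gamma> wT y, 0)) = opB (tang v) y \<bullet> tang w y"
      using A(9) B(9) by eventually_elim (simp add: opB_def inner_Pair_0)
  qed
  show ?thesis unfolding t1 t2 t3 t4 t5 aa_def by simp
qed

definition load :: "('a \<times> real \<Rightarrow> 'a \<times> real) \<Rightarrow> 'a field \<Rightarrow> real" where
  "load f2 w = l2ip \<Omega> (\<lambda>x. fst (f2 x)) (\<lambda>x. tang w (fst x))"

lemma L2_fst_load:
  assumes "L2 \<Omega> f2"
  shows "L2 \<Omega> (\<lambda>x. fst (f2 x) :: 'a)" "l2norm \<Omega> (\<lambda>x. fst (f2 x)) \<le> l2norm \<Omega> (f2 :: 'a \<times> real \<Rightarrow> 'a \<times> real)"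
proof -
  have ae: "AE x in lebesgue_on \<Omega>. norm (fst (f2 x)) \<le> 1 * norm (f2 x)"
    by (rule AE_I2) (metis mult_1 norm_fst_le prod.collapse)
  show l: "L2 \<Omega> (\<lambda>x. fst (f2 x) :: 'a)"
    by (rule L2_bounded[OF assms measurable_fst_euclidean[OF L2_measurable[OF assms]] ae])
  show "l2norm \<Omega> (\<lambda>x. fst (f2 x)) \<le> l2norm \<Omega> f2" using l2norm_mono[OF assms l ae] by simp
qed

lemma load_props:
  assumes f2: "L2 \<Omega> f2"
  shows "v \<in> XX \<Longrightarrow> w \<in> XX \<Longrightarrow> load f2 (v + w) = load f2 v + load f2 w"
    "v \<in> XX \<Longrightarrow> load f2 (r *\<^sub>R v) = r * load f2 v"
    "v \<in> XX \<Longrightarrow> \<bar>load f2 v\<bar> \<le> l2norm \<Omega> f2 * sqrt (ipX v v)"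
proof -
  note F = L2_fst_load[OF f2]
  have T: "L2 \<Omega> (\<lambda>x. tang v (fst x))" if "v \<in> XX" for v by (rule L2_lift(1)[OF open_G XX_L2(3)[OF that]])
  show "load f2 (v + w) = load f2 v + load f2 w" if "v \<in> XX" "w \<in> XX"
    using L2_integrable_inner[OF F(1) T[OF that(1)]] L2_integrable_inner[OF F(1) T[OF that(2)]]
    by (simp add: load_def l2ip_def sel_linear inner_add_right)
  show "load f2 (r *\<^sub>R v) = r * load f2 v" by (simp add: load_def l2ip_def sel_linear)
  assume v: "v \<in> XX"
  have "\<bar>load f2 v\<bar> \<le> l2norm \<Omega> (\<lambda>x. fst (f2 x)) * l2norm \<Omega> (\<lambda>x. tang v (fst x))"
    unfolding load_def l2ip_def by (rule l2ip_bound[OF F(1) T[OF v]])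
  also have "\<dots> \<le> l2norm \<Omega> f2 * sqrt (ipX v v)"
  proof (intro mult_mono F(2))
    show "l2norm \<Omega> (\<lambda>x. tang v (fst x)) \<le> sqrt (ipX v v)"
      using real_sqrt_le_mono[OF ipX_component_le(3)[of v]] by (simp add: L2_lift(2)[OF open_G XX_L2(3)[OF v]] l2ip_self)
  qed simp_all
  finally show "\<bar>load f2 v\<bar> \<le> l2norm \<Omega> f2 * sqrt (ipX v v)" .
qed

lemma load_rep:
  assumes R: "rep w wT wN" and f2: "L2 \<Omega> f2"
  shows "(\<integral>x. fst (f2 x) \<bullet> wT x \<partial>lebesgue_on \<Omega>) = load f2 w"
proof -
  have "l2ip \<Omega> (\<lambda>x. fst (f2 x)) wT = load f2 w"
    unfolding load_def
    by (rule l2ip_cong_AE)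
      (use rep_AE(13,14)[OF R] L2_measurable[OF L2_fst_load(1)[OF f2]]
        lift_measurable[OF open_G L2_measurable[OF XX_L2(3)[OF rep_XX[OF R]]]] in simp_all)
  then show ?thesis by (simp add: l2ip_def)
qed

text \<open>The abstract notion of solution with datum (h1, 0), the zero being the cylinder's part
  of the constraint. It is spelled out here because the abstract one lives under constants that are
  obtained only existentially.\<close>

definition reduced_solution where
  "reduced_solution f2 h1 v p \<longleftrightarrow> v \<in> XX \<and> p \<in> YY \<and> (\<forall>w\<in>XX. aa v w - ipY p (bdiv w) = load f2 w) \<and>
     (\<forall>y\<in>YY. ipY (bdiv v) y = ipY (h1, \<lambda>y. 0) y)"

lemma P0_equations:
  assumes V: "rep v vT vN" and W: "rep w wT wN" and f2: "L2 \<Omega> f2"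
    and p: "L2 \<Omega>1 p1" "L2 \<Omega> p2" "L2 \<Gamma> \<pi>" "AE x in lebesgue_on \<Omega>. p2 x = \<pi> (fst x)"
  shows "(\<integral>x. Q x (vel v x) \<bullet> vel w x \<partial>lebesgue_on \<Omega>1)
        - (\<integral>x. p1 x * wdiv \<Omega>1 (vel w) x \<partial>lebesgue_on \<Omega>1)
        - (\<integral>x. p2 x * (divT \<Gamma> wT x + dz \<Gamma> wN x) \<partial>lebesgue_on \<Omega>)
        + (\<integral>x. \<mu> * gradT_inner \<Gamma> vT wT x \<partial>lebesgue_on \<Omega>)
        + (\<integral>x. \<mu> * dz \<Gamma> vN x * dz \<Gamma> wN x \<partial>lebesgue_on \<Omega>)
        + (\<integral>y. \<alpha> y * tr0 \<Gamma> vN y * tr0 \<Gamma> wN y \<partial>lebesgue_on \<Gamma>)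
        + (\<integral>y. \<beta> y * (psqrt (Q (y, 0)) (tr0 \<Gamma> vT y, 0) \<bullet> (tr0 \<Gamma> wT y, 0)) \<partial>lebesgue_on \<Gamma>)
        = (\<integral>x. fst (f2 x) \<bullet> wT x \<partial>lebesgue_on \<Omega>) \<longleftrightarrow> aa v w - ipY (p1, \<pi>) (bdiv w) = load f2 w"
proof -
  have "ipY (p1, \<pi>) (bdiv w) = l2ip \<Omega>1 p1 (dvg w) + l2ip \<Gamma> \<pi> (snd (bdiv w))" by (simp add: ipY_def bdiv_def)
  then show ?thesis
    unfolding load_rep[OF W f2] pressure_terms[OF W p] velocity_terms[OF V W, symmetric]
    by (simp only: ) linarith
qed

lemma P0_constraint:
  assumes V: "rep v vT vN" and h: "L2 \<Omega>1 h1"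
    and p: "L2 \<Omega>1 p1" "L2 \<Omega> p2" "L2 \<Gamma> \<pi>" "AE x in lebesgue_on \<Omega>. p2 x = \<pi> (fst x)"
  shows "(\<integral>x. wdiv \<Omega>1 (vel v) x * p1 x \<partial>lebesgue_on \<Omega>1) + (\<integral>x. (divT \<Gamma> vT x + dz \<Gamma> vN x) * p2 x \<partial>lebesgue_on \<Omega>)
        = (\<integral>x. h1 x * p1 x \<partial>lebesgue_on \<Omega>1) \<longleftrightarrow> ipY (bdiv v) (p1, \<pi>) = ipY (h1, \<lambda>y. 0) (p1, \<pi>)"
proof -
  have "(\<integral>x. wdiv \<Omega>1 (vel v) x * p1 x \<partial>lebesgue_on \<Omega>1) + (\<integral>x. (divT \<Gamma> vT x + dz \<Gamma> vN x) * p2 x \<partial>lebesgue_on \<Omega>) = ipY (bdiv v) (p1, \<pi>)"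
    using pressure_terms[OF V p] by (simp add: ipY_def bdiv_def l2ip_def mult.commute)
  moreover have "(\<integral>x. h1 x * p1 x \<partial>lebesgue_on \<Omega>1) = ipY (h1, \<lambda>y. 0) (p1, \<pi>)" by (simp add: ipY_def l2ip_def)
  ultimately show ?thesis by simp
qed

lemma Y0_reduced:
  assumes "Y0 \<Omega>1 \<Gamma> p1 p2"
  shows "\<exists>\<pi>. L2 \<Omega>1 p1 \<and> L2 \<Omega> p2 \<and> L2 \<Gamma> \<pi> \<and> (AE x in lebesgue_on \<Omega>. p2 x = \<pi> (fst x))"
proof -
  obtain \<pi> where ae: "AE x in lebesgue_on \<Omega>. p2 x = \<pi> (fst x)" using assms by (auto simp: Y0_def zindep_def)
  have L: "L2 \<Omega>1 p1" "L2 \<Omega> p2" using assms by (simp_all add: Y0_def)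
  show ?thesis using L ae zindep_L2[OF open_G L(2) ae] by (intro exI[of _ \<pi>]) simp
qed

lemma Y0_lift:
  assumes "L2 \<Omega>1 p1" "L2 \<Gamma> \<pi>"
  shows "Y0 \<Omega>1 \<Gamma> p1 (\<lambda>x. \<pi> (fst x))"
  using assms L2_lift(1)[OF open_G assms(2)] by (auto simp: Y0_def zindep_def)

lemma P0_solution_reduced:
  assumes f2: "L2 \<Omega> f2" and h: "L2 \<Omega>1 h1" and sol: "P0_solution \<Omega>1 \<Gamma> \<mu> \<alpha> \<beta> Q f2 h1 v1 vT vN p1 p2"
  shows "\<exists>v \<pi>. rep v vT vN \<and> vel v = v1 \<and> L2 \<Omega>1 p1 \<and> L2 \<Omega> p2 \<and> L2 \<Gamma> \<pi> \<and> (AE x in lebesgue_on \<Omega>. p2 x = \<pi> (fst x)) \<and>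
    reduced_solution f2 h1 v (p1, \<pi>)"
proof -
  have X: "X0 \<Omega>1 \<Gamma> v1 vT vN" and Y: "Y0 \<Omega>1 \<Gamma> p1 p2" using sol by (simp_all add: P0_solution_def)
  obtain v where v: "rep v vT vN" "vel v = v1" using X0_rep[OF X] by (elim exE conjE)
  obtain \<pi> where p: "L2 \<Omega>1 p1" "L2 \<Omega> p2" "L2 \<Gamma> \<pi>" "AE x in lebesgue_on \<Omega>. p2 x = \<pi> (fst x)"
    using Y0_reduced[OF Y] by (elim exE conjE)
  note eq = sol[unfolded P0_solution_def, THEN conjunct2, THEN conjunct2, rule_format]
  have z: "v \<in> XX" "(p1, \<pi>) \<in> YY" using rep_XX[OF v(1)] p by (simp_all add: YY_def)
  \<comment> \<open>The momentum equation does not contain the pressure test function, so the zero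
    pair completes the test data.\<close>
  have Y00: "Y0 \<Omega>1 \<Gamma> (\<lambda>x. 0) (\<lambda>x. 0)" using Y0_lift[OF L2_zero L2_zero] by simp
  have "aa v w - ipY (p1, \<pi>) (bdiv w) = load f2 w" if w: "w \<in> XX" for w
    using eq[OF conjI[OF rep_X0[OF rep_lift[OF w]] Y00], THEN conjunct1]
    unfolding v(2)[symmetric] P0_equations[OF v(1) rep_lift[OF w] f2 p] .
  moreover have "ipY (bdiv v) y = ipY (h1, \<lambda>y. 0) y" if y: "y \<in> YY" for y
  proof -
    obtain q1 q where q: "y = (q1, q)" "L2 \<Omega>1 q1" "L2 \<Gamma> q" using y by (cases y) (simp add: YY_def)
    note Lq = L2_lift(1)[OF open_G q(3)]
    \<comment> \<open>The constraint does not contain the velocity test field; the solution's own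
      velocity fills that place.\<close>
    show ?thesis
      using eq[OF conjI[OF X Y0_lift[OF q(2,3)]], THEN conjunct2]
      unfolding v(2)[symmetric] P0_constraint[OF v(1) h q(2) Lq q(3) AE_I2[OF refl]] q(1) .
  qed
  ultimately have "reduced_solution f2 h1 v (p1, \<pi>)" using z by (simp add: reduced_solution_def)
  then show ?thesis using v p by (intro exI[of _ v] exI[of _ \<pi>]) simp
qed

lemma reduced_solution_P0:
  assumes f2: "L2 \<Omega> f2" and h: "L2 \<Omega>1 h1" and sol: "reduced_solution f2 h1 v (p1, \<pi>)"
  shows "P0_solution \<Omega>1 \<Gamma> \<mu> \<alpha> \<beta> Q f2 h1 (vel v) (\<lambda>x. tang v (fst x)) (\<lambda>x. (snd x - 1) * slope v (fst x)) p1 (\<lambda>x. \<pi> (fst x))"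
proof -
  have v: "v \<in> XX" and p: "L2 \<Omega>1 p1" "L2 \<Gamma> \<pi>" using sol by (simp_all add: reduced_solution_def YY_def)
  note V = rep_lift[OF v]
  note Lp = L2_lift(1)[OF open_G p(2)]
  show ?thesis
    unfolding P0_solution_def
  proof (intro conjI allI impI rep_X0[OF V] Y0_lift p)
    fix w1 wT wN \<phi>1 \<phi>2 assume A: "X0 \<Omega>1 \<Gamma> w1 wT wN \<and> Y0 \<Omega>1 \<Gamma> \<phi>1 \<phi>2"
    obtain w where w: "rep w wT wN" "vel w = w1" using X0_rep[OF conjunct1[OF A]] by (elim exE conjE)
    obtain q where q: "L2 \<Omega>1 \<phi>1" "L2 \<Omega> \<phi>2" "L2 \<Gamma> q" "AE x in lebesgue_on \<Omega>. \<phi>2 x = q (fst x)"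
      using Y0_reduced[OF conjunct2[OF A]] by (elim exE conjE)
    note E = P0_equations[OF V w(1) f2 p(1) Lp p(2) AE_I2[OF refl], unfolded w(2)]
    note F = P0_constraint[OF V h q]
    show "(\<integral>x. Q x (vel v x) \<bullet> w1 x \<partial>lebesgue_on \<Omega>1)
        - (\<integral>x. p1 x * wdiv \<Omega>1 w1 x \<partial>lebesgue_on \<Omega>1)
        - (\<integral>x. \<pi> (fst x) * (divT \<Gamma> wT x + dz \<Gamma> wN x) \<partial>lebesgue_on \<Omega>)
        + (\<integral>x. \<mu> * gradT_inner \<Gamma> (\<lambda>x. tang v (fst x)) wT x \<partial>lebesgue_on \<Omega>)
        + (\<integral>x. \<mu> * dz \<Gamma> (\<lambda>x. (snd x - 1) * slope v (fst x)) x * dz \<Gamma> wN x \<partial>lebesgue_on \<Omega>)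
        + (\<integral>y. \<alpha> y * tr0 \<Gamma> (\<lambda>x. (snd x - 1) * slope v (fst x)) y * tr0 \<Gamma> wN y \<partial>lebesgue_on \<Gamma>)
        + (\<integral>y. \<beta> y * (psqrt (Q (y, 0)) (tr0 \<Gamma> (\<lambda>x. tang v (fst x)) y, 0) \<bullet> (tr0 \<Gamma> wT y, 0)) \<partial>lebesgue_on \<Gamma>)
        = (\<integral>x. fst (f2 x) \<bullet> wT x \<partial>lebesgue_on \<Omega>)"
      by (rule E[THEN iffD2]) (use sol rep_XX[OF w(1)] in \<open>simp add: reduced_solution_def\<close>)
    show "(\<integral>x. wdiv \<Omega>1 (vel v) x * \<phi>1 x \<partial>lebesgue_on \<Omega>1)
        + (\<integral>x. (divT \<Gamma> (\<lambda>x. tang v (fst x)) x + dz \<Gamma> (\<lambda>x. (snd x - 1) * slope v (fst x)) x) * \<phi>2 x \<partial>lebesgue_on \<Omega>)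
        = (\<integral>x. h1 x * \<phi>1 x \<partial>lebesgue_on \<Omega>1)"
      by (rule F[THEN iffD2]) (use sol q in \<open>simp add: reduced_solution_def YY_def\<close>)
  qed
qed

text \<open>Every component of the X^0 norm is one of the reduced norms, except that of v_N, which
  is at most the slope. The slope is therefore counted at most twice.\<close>

lemma X0_norm_le:
  assumes R: "rep v vT vN"
  shows "X0_norm \<Omega>1 \<Gamma> (vel v) vT vN \<le> 2 * sqrt (ipX v v)"
proof -
  note A = rep_AE[OF R] and L = XX_L2[OF rep_XX[OF R]]
  have m: "(\<lambda>x. h (fst x)) \<in> borel_measurable (lebesgue_on \<Omega>)" if "L2 \<Gamma> h" for h :: "'a \<Rightarrow> 'b::euclidean_space"
    by (rule L2_measurable[OF L2_lift(1)[OF open_G that]])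
  have 1: "l2norm \<Omega>1 (wdiv \<Omega>1 (vel v)) = l2norm \<Omega>1 (dvg v)"
    by (rule l2norm_cong_AE[OF A(2) L2_measurable[OF L(2)] A(1)])
  have 2: "l2norm \<Omega> vT = l2norm \<Gamma> (tang v)"
    using l2norm_cong_AE[OF A(14) m[OF L(3)] A(13)] by (simp add: L2_lift(2)[OF open_G L(3)])
  have 3: "l2norm \<Omega> (wpd \<Omega> vT (b, 0)) = l2norm \<Gamma> (tgrad v b)" if b: "b \<in> Basis" for b
    using l2norm_cong_AE[OF A(4)[OF b] m[OF L(4)[OF b]] A(3)[OF b]] by (simp add: L2_lift(2)[OF open_G L(4)[OF b]])
  have 4: "l2norm \<Omega> (wpd \<Omega> vT ez) = 0"
    using l2norm_cong_AE[OF A(6) _ A(5)] by simp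
  have 5: "l2norm \<Omega> vN \<le> l2norm \<Gamma> (slope v)"
    using l2norm_cong_AE[OF A(16) L2_measurable[OF L2_linear_lift(1)[OF L(5)]] A(15)] L2_linear_lift(2)[OF L(5)] by simp
  have 6: "l2norm \<Omega> (wpd \<Omega> vN ez) = l2norm \<Gamma> (slope v)"
    using l2norm_cong_AE[OF A(8) m[OF L(5)] A(7)] by (simp add: L2_lift(2)[OF open_G L(5)] dz_def)
  have ezn: "ez \<notin> (\<lambda>b::'a. (b, 0::real)) ` Basis" by (auto simp: ez_def)
  have inj: "inj_on (\<lambda>b::'a. (b, 0::real)) Basis" by (auto simp: inj_on_def)
  have 7: "(\<Sum>e\<in>Basis. (l2norm \<Omega> (wpd \<Omega> vT e))\<^sup>2) = (\<Sum>b\<in>Basis. (l2norm \<Gamma> (tgrad v b))\<^sup>2)"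
    unfolding Basis_prod_real using ezn by (simp add: 4 3 sum.reindex[OF inj])
  have sq: "(sqrt (x\<^sup>2 + s))\<^sup>2 = x\<^sup>2 + s" if "0 \<le> s" for x s :: real using that by simp
  have G0: "0 \<le> (\<Sum>b\<in>Basis. (l2norm \<Gamma> (tgrad v b))\<^sup>2)" by (rule sum_nonneg) simp
  have "(X0_norm \<Omega>1 \<Gamma> (vel v) vT vN)\<^sup>2 = (l2norm \<Omega>1 (vel v))\<^sup>2 + (l2norm \<Omega>1 (dvg v))\<^sup>2 + (l2norm \<Gamma> (tang v))\<^sup>2 +
      (\<Sum>b\<in>Basis. (l2norm \<Gamma> (tgrad v b))\<^sup>2) + ((l2norm \<Omega> vN)\<^sup>2 + (l2norm \<Gamma> (slope v))\<^sup>2)"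
    unfolding X0_norm_def hdiv_norm_def X20_norm_def h1_norm_def hz_norm_def 1 2 6 7
    by (simp add: sq G0)
  also have "\<dots> \<le> 4 * ipX v v"
  proof -
    have gen: "a + b + t + g + (n + s) \<le> 4 * (a + b + t + g + s)"
      if "n \<le> s" "0 \<le> a" "0 \<le> b" "0 \<le> t" "0 \<le> g" "0 \<le> s" for a b t g n s :: real
      using that unfolding distrib_left by simp
    show ?thesis unfolding ipX_self by (rule gen) (use 5 G0 in \<open>simp_all add: power_mono\<close>)
  qed
  finally have "(X0_norm \<Omega>1 \<Gamma> (vel v) vT vN)\<^sup>2 \<le> 4 * ipX v v" .
  then have "\<bar>X0_norm \<Omega>1 \<Gamma> (vel v) vT vN\<bar> \<le> sqrt (4 * ipX v v)" using real_sqrt_le_mono by fastforce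
  then show ?thesis by (simp add: real_sqrt_mult)
qed

section \<open>Existence, uniqueness and the a priori estimate\<close>

text \<open>All three claims are pulled back to the abstract problem. The bound there holds for
  every solution, so applied to a difference of two solutions it gives null components, and equality
  on \<Gamma> lifts to equality almost everywhere in the cylinder.\<close>

lemma well_posed:
  "\<exists>c>0. \<forall>f2 h1. L2 \<Omega> f2 \<and> L2 \<Omega>1 h1 \<longrightarrow>
     (\<exists>v1 vT vN p1 p2. P0_solution \<Omega>1 \<Gamma> \<mu> \<alpha> \<beta> Q f2 h1 v1 vT vN p1 p2)
   \<and> (\<forall>v1 vT vN p1 p2 v1' vT' vN' p1' p2'.
        P0_solution \<Omega>1 \<Gamma> \<mu> \<alpha> \<beta> Q f2 h1 v1 vT vN p1 p2 \<and>
        P0_solution \<Omega>1 \<Gamma> \<mu> \<alpha> \<beta> Q f2 h1 v1' vT' vN' p1' p2' \<longrightarrow>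
          (AE x in lebesgue_on \<Omega>1. v1 x = v1' x \<and> p1 x = p1' x) \<and>
          (AE x in lebesgue_on \<Omega>. vT x = vT' x \<and> vN x = vN' x \<and> p2 x = p2' x))
   \<and> (\<forall>v1 vT vN p1 p2. P0_solution \<Omega>1 \<Gamma> \<mu> \<alpha> \<beta> Q f2 h1 v1 vT vN p1 p2 \<longrightarrow>
        X0_norm \<Omega>1 \<Gamma> v1 vT vN + Y0_norm \<Omega>1 \<Gamma> p1 p2 \<le> c * (l2norm \<Omega> f2 + l2norm \<Omega>1 h1))"
  (is "\<exists>c>0. \<forall>f2 h1. _ f2 h1 \<longrightarrow> ?P f2 h1 \<and> ?U f2 h1 \<and> ?B c f2 h1")
proof -
  obtain k M C where mp: "mixed_problem XX ipX YY ipY aa bdiv k M C" using mixed by auto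
  interpret mp: mixed_problem XX ipX YY ipY aa bdiv k M C by (rule mp)
  have nX: "mp.X.nrm v = sqrt (ipX v v)" for v by (rule mp.X.nrm_def)
  have nY: "mp.Y.nrm p = sqrt (ipY p p)" for p by (rule mp.Y.nrm_def)
  have rs: "reduced_solution f2 h1 v p \<longleftrightarrow> mp.solves (load f2) (h1, \<lambda>y. 0) v p" for f2 h1 v p
    unfolding reduced_solution_def mp.solves_def by simp
  have hY: "(h1, \<lambda>y. 0) \<in> YY" if "L2 \<Omega>1 h1" for h1 using that by (simp add: YY_def L2_zero)
  have nh: "mp.Y.nrm (h1, \<lambda>y. 0) = l2norm \<Omega>1 h1" for h1 by (simp add: nY ipY_self)
  \<comment> \<open>The abstract velocity bound with both data replaced by their sum.\<close>
  define c1 where "c1 = (1 + (M + k) * C) / k"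
  \<comment> \<open>The 2 is the loss between the X^0 norm and the reduced norm, the second summand
    is the pressure bound, and the final 1 makes the constant strictly positive.\<close>
  define c where "c = 2 * c1 + C * (M * c1 + 1) + 1"
  have c1: "c1 \<ge> 0" using mp.pos mp.k_pos by (simp add: c1_def)
  have c: "c > 0" unfolding c_def using c1 mp.pos by (intro add_nonneg_pos add_nonneg_nonneg mult_nonneg_nonneg) simp_all
  have bound: "mp.X.nrm v \<le> c1 * (l2norm \<Omega> f2 + l2norm \<Omega>1 h1) \<and>
      mp.Y.nrm p \<le> (C * (M * c1 + 1)) * (l2norm \<Omega> f2 + l2norm \<Omega>1 h1)"
    if f2: "L2 \<Omega> f2" and h: "L2 \<Omega>1 h1" and sol: "reduced_solution f2 h1 v p" for f2 h1 v p
  proof -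
    let ?n = "l2norm \<Omega> f2 + l2norm \<Omega>1 h1"
    note B = mp.solves_bound[OF sol[unfolded rs], of "l2norm \<Omega> f2", unfolded nX nh, OF load_props(3)[OF f2] l2norm_nonneg hY[OF h], folded nX]
    have MC: "0 \<le> (M + k) * C" using mp.pos mp.k_pos by simp
    have "l2norm \<Omega> f2 + (M + k) * C * l2norm \<Omega>1 h1 \<le> (1 + (M + k) * C) * ?n"
    proof -
      have "a + m * b \<le> (1 + m) * (a + b)" if "0 \<le> m" "0 \<le> a" "0 \<le> b" for a b m :: real
        using mult_nonneg_nonneg[OF that(1,2)] that(3) unfolding distrib_left distrib_right by simp
      from this[OF MC] show ?thesis by simp
    qed
    then have 1: "mp.X.nrm v \<le> c1 * ?n"
      using order_trans[OF B(1) divide_right_mono] mp.k_pos by (simp add: c1_def)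
    have "M * mp.X.nrm v \<le> M * (c1 * ?n)" using mp.pos by (intro mult_left_mono 1)
    then have "M * mp.X.nrm v + l2norm \<Omega> f2 \<le> (M * c1 + 1) * ?n"
      by (simp add: distrib_right mult.assoc) (use l2norm_nonneg in \<open>smt (verit)\<close>)
    then have "C * (M * mp.X.nrm v + l2norm \<Omega> f2) \<le> C * ((M * c1 + 1) * ?n)" using mp.pos by (intro mult_left_mono)
    then have "mp.Y.nrm p \<le> (C * (M * c1 + 1)) * ?n" using order_trans[OF B(2)] by (simp add: mult.assoc)
    with 1 show ?thesis by blast
  qed
  have ex: "(\<exists>v1 vT vN p1 p2. P0_solution \<Omega>1 \<Gamma> \<mu> \<alpha> \<beta> Q f2 h1 v1 vT vN p1 p2)" if f2: "L2 \<Omega> f2" and h: "L2 \<Omega>1 h1" for f2 h1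
  proof -
    have "\<exists>v p. mp.solves (load f2) (h1, \<lambda>y. 0) v p"
      by (rule mp.solves_exists[OF load_props(1,2)[OF f2] _ l2norm_nonneg hY[OF h], of "\<Omega>" f2])
        (simp_all add: nX load_props(3)[OF f2])
    then obtain v p1 \<pi> where "reduced_solution f2 h1 v (p1, \<pi>)" unfolding rs[symmetric] by auto
    from reduced_solution_P0[OF f2 h this] show ?thesis by (intro exI)
  qed
  have un: "(AE x in lebesgue_on \<Omega>1. v1 x = v1' x \<and> p1 x = p1' x) \<and>
          (AE x in lebesgue_on \<Omega>. vT x = vT' x \<and> vN x = vN' x \<and> p2 x = p2' x)"
    if f2: "L2 \<Omega> f2" and h: "L2 \<Omega>1 h1" and S: "P0_solution \<Omega>1 \<Gamma> \<mu> \<alpha> \<beta> Q f2 h1 v1 vT vN p1 p2"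
      and S': "P0_solution \<Omega>1 \<Gamma> \<mu> \<alpha> \<beta> Q f2 h1 v1' vT' vN' p1' p2'"
    for f2 h1 v1 vT vN p1 p2 v1' vT' vN' p1' p2'
  proof -
    obtain v \<pi> where v: "rep v vT vN" "vel v = v1" "L2 \<Omega>1 p1" "L2 \<Omega> p2" "L2 \<Gamma> \<pi>" "AE x in lebesgue_on \<Omega>. p2 x = \<pi> (fst x)"
      "reduced_solution f2 h1 v (p1, \<pi>)" using P0_solution_reduced[OF f2 h S] by (elim exE conjE)
    obtain v' \<pi>' where v': "rep v' vT' vN'" "vel v' = v1'" "L2 \<Omega>1 p1'" "L2 \<Omega> p2'" "L2 \<Gamma> \<pi>'" "AE x in lebesgue_on \<Omega>. p2' x = \<pi>' (fst x)"
      "reduced_solution f2 h1 v' (p1', \<pi>')" using P0_solution_reduced[OF f2 h S'] by (elim exE conjE)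
    let ?u = "v - v'" and ?q = "(p1, \<pi>) - (p1', \<pi>')"
    have XX: "v \<in> XX" "v' \<in> XX" and YY: "(p1, \<pi>) \<in> YY" "(p1', \<pi>') \<in> YY"
      and e1: "\<And>w. w \<in> XX \<Longrightarrow> aa v w - ipY (p1, \<pi>) (bdiv w) = load f2 w" "\<And>w. w \<in> XX \<Longrightarrow> aa v' w - ipY (p1', \<pi>') (bdiv w) = load f2 w"
      and e2: "\<And>y. y \<in> YY \<Longrightarrow> ipY (bdiv v) y = ipY (h1, \<lambda>y. 0) y" "\<And>y. y \<in> YY \<Longrightarrow> ipY (bdiv v') y = ipY (h1, \<lambda>y. 0) y"
      using v(7) v'(7) by (simp_all add: reduced_solution_def)
    have zY: "ipY 0 y = 0" for y by (simp add: ipY_def l2ip_def)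
    have u: "?u \<in> XX" and q: "?q \<in> YY" by (intro mp.X.memI XX, intro mp.Y.memI YY)
    \<comment> \<open>By linearity the difference of two solutions solves the problem with zero
      data.\<close>
    have "mp.solves (\<lambda>_. 0) 0 ?u ?q"
      unfolding mp.solves_def
    proof (intro conjI ballI u q)
      fix w assume w: "w \<in> XX"
      show "aa ?u w - ipY ?q (bdiv w) = 0"
        using e1(1)[OF w] e1(2)[OF w] mp.a.diff_left[OF XX w] mp.Y.diff_left[OF YY bdiv_mem[OF w]] by linarith
    next
      fix y assume y: "y \<in> YY"
      show "ipY (bdiv ?u) y = ipY 0 y"
        using e2(1)[OF y] e2(2)[OF y] mp.Y.diff_left[OF bdiv_mem[OF XX(1)] bdiv_mem[OF XX(2)] y] mp.b_diff[OF XX]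
        by (simp add: zY)
    qed
    note B = mp.solves_bound[OF this, of 0, OF _ order_refl mp.Y.memI(4)]
    have n0: "mp.Y.nrm 0 = 0" by (simp add: nY zY)
    have "mp.X.nrm ?u \<le> 0" using B(1) by (simp add: n0)
    then have u0: "mp.X.nrm ?u = 0" using mp.X.nrm_nonneg[OF u] by linarith
    have "mp.Y.nrm ?q \<le> 0" using B(2) by (simp add: u0)
    then have q0: "ipY ?q ?q \<le> 0" by (simp add: nY)
    have u0': "ipX ?u ?u \<le> 0" using u0 by (simp add: nX)
    have zero: "AE x in lebesgue_on U. a x = b x" if "L2 U a" "L2 U b" "l2ip U (a - b) (a - b) \<le> 0"
      for U :: "'e::euclidean_space set" and a b :: "'e \<Rightarrow> 'f::euclidean_space"
    proof -
      have "L2 U (a - b)" using L2_diff[OF that(1,2)] by (simp add: fun_diff_def)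
      moreover have "l2norm U (a - b) = 0" using that(3) by (simp add: l2ip_self)
      ultimately have "AE x in lebesgue_on U. (a - b) x = 0" by (rule l2norm_eq_0_AE)
      then show ?thesis by eventually_elim simp
    qed
    note c = ipX_component_le(1,3,5)[where v = ?u, unfolded sel_linear, THEN order_trans, OF u0']
    note L = XX_L2[OF XX(1)] and L' = XX_L2[OF XX(2)]
    have 1: "AE x in lebesgue_on \<Omega>1. v1 x = v1' x" using zero[OF L(1) L'(1) c(1)] v(2) v'(2) by simp
    have 2: "AE y in lebesgue_on \<Gamma>. tang v y = tang v' y" by (rule zero[OF L(3) L'(3) c(2)])
    have 3: "AE y in lebesgue_on \<Gamma>. slope v y = slope v' y" by (rule zero[OF L(5) L'(5) c(3)])
    have qs: "l2ip \<Omega>1 (p1 - p1') (p1 - p1') \<le> 0" "l2ip \<Gamma> (\<pi> - \<pi>') (\<pi> - \<pi>') \<le> 0"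
      using q0 unfolding ipY_self l2ip_self by (simp_all add: add_nonneg_eq_0_iff order_antisym_conv)
    have 4: "AE x in lebesgue_on \<Omega>1. p1 x = p1' x" by (rule zero[OF v(3) v'(3) qs(1)])
    have 5: "AE y in lebesgue_on \<Gamma>. \<pi> y = \<pi>' y" by (rule zero[OF v(5) v'(5) qs(2)])
    have A: "AE x in lebesgue_on \<Omega>1. v1 x = v1' x \<and> p1 x = p1' x" using 1 4 by eventually_elim simp
    have "AE x in lebesgue_on \<Omega>. vT x = vT' x \<and> vN x = vN' x \<and> p2 x = p2' x"
      using lift_AE[OF open_G 2] lift_AE[OF open_G 3] lift_AE[OF open_G 5] rep_AE(13,15)[OF v(1)] rep_AE(13,15)[OF v'(1)] v(6) v'(6)
      by eventually_elim simp
    with A show ?thesis by blast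
  qed
  have bd: "X0_norm \<Omega>1 \<Gamma> v1 vT vN + Y0_norm \<Omega>1 \<Gamma> p1 p2 \<le> c * (l2norm \<Omega> f2 + l2norm \<Omega>1 h1)"
    if f2: "L2 \<Omega> f2" and h: "L2 \<Omega>1 h1" and S: "P0_solution \<Omega>1 \<Gamma> \<mu> \<alpha> \<beta> Q f2 h1 v1 vT vN p1 p2"
    for f2 h1 v1 vT vN p1 p2
  proof -
    let ?n = "l2norm \<Omega> f2 + l2norm \<Omega>1 h1"
    obtain v \<pi> where v: "rep v vT vN" "vel v = v1" "L2 \<Omega>1 p1" "L2 \<Omega> p2" "L2 \<Gamma> \<pi>" "AE x in lebesgue_on \<Omega>. p2 x = \<pi> (fst x)"
      "reduced_solution f2 h1 v (p1, \<pi>)" using P0_solution_reduced[OF f2 h S] by (elim exE conjE)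
    note B = bound[OF f2 h v(7)]
    have "l2norm \<Omega> p2 = l2norm \<Gamma> \<pi>"
      using l2norm_cong_AE[OF L2_measurable[OF v(4)] L2_measurable[OF L2_lift(1)[OF open_G v(5)]] v(6)]
      by (simp add: L2_lift(2)[OF open_G v(5)])
    then have "Y0_norm \<Omega>1 \<Gamma> p1 p2 = mp.Y.nrm (p1, \<pi>)" by (simp add: Y0_norm_def nY ipY_self)
    moreover have "X0_norm \<Omega>1 \<Gamma> v1 vT vN \<le> 2 * mp.X.nrm v" using X0_norm_le[OF v(1)] v(2) by (simp add: nX)
    moreover have "0 \<le> ?n" by simp
    moreover have "x + y \<le> (2 * r + D + 1) * n" if "y = q" "x \<le> 2 * z" "0 \<le> n" "z \<le> r * n" "q \<le> D * n"
      for x y z q n r D :: real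
    proof -
      have "(2 * r + D + 1) * n = 2 * (r * n) + D * n + n" by (simp add: distrib_right)
      then show ?thesis using that by linarith
    qed
    ultimately show ?thesis using B unfolding c_def by blast
  qed
  show ?thesis
  proof (rule exI[of _ c], rule conjI[OF c], intro allI impI, elim conjE)
    fix f2 :: "'a \<times> real \<Rightarrow> 'a \<times> real" and h1 :: "'a \<times> real \<Rightarrow> real"
    assume f2: "L2 \<Omega> f2" and h: "L2 \<Omega>1 h1"
    show "?P f2 h1 \<and> ?U f2 h1 \<and> ?B c f2 h1"
      by (rule conjI[OF ex[OF f2 h] conjI]; intro allI impI; (elim conjE)?; (rule un[OF f2 h] | rule bd[OF f2 h]); assumption)
  qed
qed

end

theorem theorem6:
  fixes \<Gamma> :: "'a::euclidean_space set"
    and \<Omega>1 :: "('a \<times> real) set"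
    and \<mu> CQ :: real
    and \<alpha> \<beta> :: "'a \<Rightarrow> real"
    and Q :: "'a \<times> real \<Rightarrow> ('a \<times> real) \<Rightarrow>\<^sub>L ('a \<times> real)"
  assumes Gamma_lip: "lipschitz_domain \<Gamma>" and Gamma_bdd: "bounded \<Gamma>"
    and Omega1_lip: "lipschitz_domain \<Omega>1" and Omega1_bdd: "bounded \<Omega>1"
    and disj: "\<Omega>1 \<inter> Omega2 \<Gamma> = {}"
    and interface: "frontier \<Omega>1 \<inter> frontier (Omega2 \<Gamma>) = closure \<Gamma> \<times> {0}"
    and rest_smooth: "smooth_boundary_part \<Omega>1 (frontier \<Omega>1 - \<Gamma> \<times> {0})"
    and rest_pos: "hausdorff_measure (real DIM('a)) (frontier \<Omega>1 - \<Gamma> \<times> {0}) > 0"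
    and mu_pos: "\<mu> > 0"
    and alpha_meas: "\<alpha> \<in> borel_measurable (lebesgue_on \<Gamma>)"
    and alpha_nonneg: "\<forall>y\<in>\<Gamma>. 0 \<le> \<alpha> y" and alpha_bdd: "\<exists>B. \<forall>y\<in>\<Gamma>. \<alpha> y \<le> B"
    and beta_meas: "\<beta> \<in> borel_measurable (lebesgue_on \<Gamma>)"
    and beta_nonneg: "\<forall>y\<in>\<Gamma>. 0 \<le> \<beta> y" and beta_bdd: "\<exists>B. \<forall>y\<in>\<Gamma>. \<beta> y \<le> B"
    and Q_meas1: "Q \<in> borel_measurable (lebesgue_on \<Omega>1)"
    and Q_measG: "(\<lambda>y. Q (y, 0)) \<in> borel_measurable (lebesgue_on \<Gamma>)"
    and Q_bdd: "\<exists>B. \<forall>x\<in>\<Omega>1 \<union> \<Gamma> \<times> {0}. norm (Q x) \<le> B"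
    and Q_sym: "\<forall>x\<in>\<Omega>1 \<union> \<Gamma> \<times> {0}. sym_op (Q x)"
    and CQ_pos: "CQ > 0"
    and Q_coercive: "\<forall>x\<in>\<Omega>1 \<union> \<Gamma> \<times> {0}. \<forall>y. Q x y \<bullet> y \<ge> CQ * (norm y)\<^sup>2"
  shows "\<exists>c>0. \<forall>(f2 :: 'a \<times> real \<Rightarrow> 'a \<times> real) (h1 :: 'a \<times> real \<Rightarrow> real).
           L2 (Omega2 \<Gamma>) f2 \<and> L2 \<Omega>1 h1 \<longrightarrow>
             (\<exists>v1 vT vN p1 p2. P0_solution \<Omega>1 \<Gamma> \<mu> \<alpha> \<beta> Q f2 h1 v1 vT vN p1 p2)
           \<and> (\<forall>v1 vT vN p1 p2 v1' vT' vN' p1' p2'.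
                P0_solution \<Omega>1 \<Gamma> \<mu> \<alpha> \<beta> Q f2 h1 v1 vT vN p1 p2 \<and>
                P0_solution \<Omega>1 \<Gamma> \<mu> \<alpha> \<beta> Q f2 h1 v1' vT' vN' p1' p2' \<longrightarrow>
                  (AE x in lebesgue_on \<Omega>1. v1 x = v1' x \<and> p1 x = p1' x) \<and>
                  (AE x in lebesgue_on (Omega2 \<Gamma>). vT x = vT' x \<and> vN x = vN' x \<and> p2 x = p2' x))
           \<and> (\<forall>v1 vT vN p1 p2. P0_solution \<Omega>1 \<Gamma> \<mu> \<alpha> \<beta> Q f2 h1 v1 vT vN p1 p2 \<longrightarrow>
                X0_norm \<Omega>1 \<Gamma> v1 vT vN + Y0_norm \<Omega>1 \<Gamma> p1 p2
                  \<le> c * (l2norm (Omega2 \<Gamma>) f2 + l2norm \<Omega>1 h1))"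
proof -
  obtain B where B: "\<And>y. y \<in> \<Gamma> \<Longrightarrow> \<alpha> y \<le> B" using alpha_bdd by blast
  obtain B' where B': "\<And>y. y \<in> \<Gamma> \<Longrightarrow> \<beta> y \<le> B'" using beta_bdd by blast
  obtain B'' where B'': "\<And>x. x \<in> \<Omega>1 \<union> \<Gamma> \<times> {0} \<Longrightarrow> norm (Q x) \<le> B''" using Q_bdd by blast
  have open_G: "open \<Gamma>" and open_1: "open \<Omega>1" using Gamma_lip Omega1_lip by (simp_all add: lipschitz_domain_def)
  \<comment> \<open>The interface hypothesis names the closure of \<Gamma>, in particular \<Gamma>
    itself, as part of the boundary of \<Omega>1.\<close>
  have fr: "(y, 0) \<in> frontier \<Omega>1" if "y \<in> \<Gamma>" for y
  proof -
    have "(y, 0) \<in> closure \<Gamma> \<times> {0}" using that closure_subset by auto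
    then show ?thesis using interface by blast
  qed
  \<comment> \<open>The given upper bounds are enlarged so that those of \<alpha> and \<beta> are
    nonnegative and that of Q is at least CQ.\<close>
  interpret interface_flow \<Gamma> \<Omega>1 \<mu> CQ "max 0 B" "max 0 B'" "max CQ B''" \<alpha> \<beta> Q
  proof
    show "\<exists>\<rho>>0. \<forall>t. - \<rho> < t \<and> t < 0 \<longrightarrow> (y, t) \<in> \<Omega>1" if "y \<in> \<Gamma>" for y
      by (rule interface_below[OF open_G Omega1_lip disj fr that])
    show "sym_op (Q x)" if "x \<in> \<Omega>1 \<union> \<Gamma> \<times> {0}" for x using Q_sym that by (rule bspec)
    show "CQ * (norm y)\<^sup>2 \<le> Q x y \<bullet> y" if "x \<in> \<Omega>1 \<union> \<Gamma> \<times> {0}" for x y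
      using bspec[OF Q_coercive that] by (rule spec)
    show "norm (Q x) \<le> max CQ B''" if "x \<in> \<Omega>1 \<union> \<Gamma> \<times> {0}" for x
      using B''[OF that] by (rule max.coboundedI2)
    show "\<alpha> y \<le> max 0 B" if "y \<in> \<Gamma>" for y using B[OF that] by (rule max.coboundedI2)
    show "\<beta> y \<le> max 0 B'" if "y \<in> \<Gamma>" for y using B'[OF that] by (rule max.coboundedI2)
    show "0 \<le> \<alpha> y" if "y \<in> \<Gamma>" for y using alpha_nonneg that by (rule bspec)
    show "0 \<le> \<beta> y" if "y \<in> \<Gamma>" for y using beta_nonneg that by (rule bspec)
  qed (fact open_G Gamma_bdd open_1 Omega1_bdd fr mu_pos alpha_meas beta_meas Q_meas1 Q_measG CQ_pos | simp)+
  show ?thesis by (rule well_posed)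
qed

end
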